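(* Let $P$ be a unital subsemigroup of a discrete group $G$ and let $X$ be a product system over $P$. If $\Psi$ is an equivariant $*$-representation of $\mathcal{T}_\lambda(X)$ that is injective on $A$, then there exists a completely isometric homomorphism $$\mathcal{T}_\lambda(X)^+\longrightarrow \mathrm{C}^*(\Psi)\otimes \mathrm{C}^*_\lambda(P);\quad \lambda(\xi_p)\mapsto\Psi\lambda(\xi_p)\otimes V_p .$$ In particular, $\mathrm{C}^*(\Psi)$ is a C*-cover of the cosystem $(\mathcal{T}_\lambda(X)^+,G,\delta)$.
   Context: **Product systems.** $P$ is a unital discrete left-cancellative semigroup with unit $e$. A product system $X$ over $P$ is a family $\{X_p\}_{p\in P}$ of closed subspaces of some $\mathcal{B}(H)$ such that $A := X_e$ is a C*-algebra, $X_p\cdot X_q\subseteq X_{pq}$ and $X_p^*\cdot X_{pq}\subseteq X_q$ for all $p,q\in P$. Each $X_p$ is a right Hilbert $A$-module with $\langle\xi,\eta\rangle=\xi^*\eta$. **Fock algebras.** $\mathcal{F}X=\bigoplus_{r\in P}X_r$ (right Hilbert $A$-module), and for $\xi_p\in X_p$ the adjointable operator $\lambda(\xi_p)$ is given by $\lambda(\xi_p)\eta_r=\xi_p\eta_r$, $\eta_r\in X_r$. $\lambda$ is injective on each $X_p$. $\mathcal{T}_\lambda(X)$ is the C*-algebra generated by all $\lambda(\xi_p)$, and $\mathcal{T}_\lambda(X)^+$ is the norm-closed subalgebra generated by all $\lambda(\xi_p)$. "Injective on $A$" means injective on $\lambda(A)$. $\mathrm{C}^*(\Psi)=\Psi(\mathcal{T}_\lambda(X))$.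 **Semigroup C*-algebra.** $V_p\delta_s=\delta_{ps}$ on $\ell^2(P)$, and $\mathrm{C}^*_\lambda(P)=\mathrm{C}^*(V_p\mid p\in P)$. **Coactions, cosystems.** $u_g$ are the generators of $\mathrm{C}^*_{\max}(G)$ and $\otimes$ is the spatial tensor product. A coaction of $G$ on an operator algebra $\mathfrak{A}$ is a completely isometric homomorphism $\delta\colon\mathfrak{A}\to\mathfrak{A}\otimes \mathrm{C}^*_{\max}(G)$ (a faithful $*$-homomorphism if $\mathfrak{A}$ is a C*-algebra) such that the spaces $\{a\mid\delta(a)=a\otimes u_g\}$, $g\in G$, together densely span $\mathfrak{A}$; $(\mathfrak{A},G,\delta)$ is called a cosystem. On $\mathcal{T}_\lambda(X)$ and $\mathcal{T}_\lambda(X)^+$, $\delta$ is the coaction $\lambda(\xi_p)\mapsto\lambda(\xi_p)\otimes u_p$. $\Psi$ is equivariant if $\mathrm{C}^*(\Psi)$ admits a coaction $\delta_\Psi$ of $G$ with $\Psi\lambda(\xi_p)\mapsto\Psi\lambda(\xi_p)\otimes u_p$. **C*-cover.** A C*-cover of a cosystem $(\mathfrak{A},G,\delta)$ is a triple $(C,\iota,\delta_C)$ where $\iota\colon\mathfrak{A}\to C$ is a completely isometric homomorphism with $C=\mathrm{C}^*(\iota(\mathfrak{A}))$ and $\delta_C$ is a coaction of $G$ on $C$ with $\delta_C\iota=(\iota\otimes\mathrm{id})\delta$. Here the cover is understood with $\iota=\Psi|_{\mathcal{T}_\lambda(X)^+}$ and $\delta_C=\delta_\Psi$. *)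

theory Defs
  imports "HOL-Analysis.Analysis" "HOL-Algebra.Module"
begin

section \<open>Complex Hilbert spaces\<close>

text \<open>Inner products are linear in the second variable.  The underlying real Hilbert space
  carries the real part of the complex inner product.\<close>

class complex_hilbert = real_inner + banach +
  fixes scaleC :: "complex \<Rightarrow> 'a \<Rightarrow> 'a" (infixr \<open>*\<^sub>C\<close> 75)
    and cinner :: "'a \<Rightarrow> 'a \<Rightarrow> complex"
  assumes scaleC_add_right: "c *\<^sub>C (x + y) = c *\<^sub>C x + c *\<^sub>C y"
    and scaleC_add_left: "(c + d) *\<^sub>C x = c *\<^sub>C x + d *\<^sub>C x"
    and scaleC_scaleC: "c *\<^sub>C (d *\<^sub>C x) = (c * d) *\<^sub>C x"
    and scaleR_scaleC: "r *\<^sub>R x = complex_of_real r *\<^sub>C x"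
    and cinner_add_right: "cinner x (y + z) = cinner x y + cinner x z"
    and cinner_scaleC_right: "cinner x (c *\<^sub>C y) = c * cinner x y"
    and cinner_commute: "cinner x y = cnj (cinner y x)"
    and inner_Re_cinner: "inner x y = Re (cinner x y)"
begin

lemma cinner_add_left: "cinner (x + y) z = cinner x z + cinner y z"
  by (metis cinner_commute cinner_add_right complex_cnj_add)

lemma cinner_scaleC_left: "cinner (c *\<^sub>C x) y = cnj c * cinner x y"
  by (metis cinner_commute cinner_scaleC_right complex_cnj_mult complex_cnj_cnj)

lemma cinner_self: "cinner x x = complex_of_real ((norm x)\<^sup>2)"
proof -
  have "Im (cinner x x) = 0"
    by (metis Reals_cnj_iff cinner_commute complex_is_Real_iff)
  moreover have "Re (cinner x x) = (norm x)\<^sup>2"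
    by (simp add: inner_Re_cinner [symmetric] power2_norm_eq_inner)
  ultimately show ?thesis
    by (simp add: complex_eq_iff)
qed

lemma norm_scaleC: "norm (c *\<^sub>C x) = cmod c * norm x"
proof -
  have "complex_of_real ((norm (c *\<^sub>C x))\<^sup>2) = (c * cnj c) * complex_of_real ((norm x)\<^sup>2)"
    unfolding cinner_self [symmetric] cinner_scaleC_left cinner_scaleC_right
    by (simp only: mult.assoc)
  then have "complex_of_real ((norm (c *\<^sub>C x))\<^sup>2) = complex_of_real ((cmod c * norm x)\<^sup>2)"
    by (simp only: complex_norm_square [symmetric] of_real_mult of_real_power power_mult_distrib)
  then have "(norm (c *\<^sub>C x))\<^sup>2 = (cmod c * norm x)\<^sup>2"
    using of_real_eq_iff by blast
  then show ?thesis
    by (simp add: power2_eq_iff_nonneg)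
qed

lemma scaleC_one: "1 *\<^sub>C x = x"
  by (metis of_real_1 scaleR_one scaleR_scaleC)

lemma Im_cinner: "Im (cinner x y) = inner (\<i> *\<^sub>C x) y"
  by (simp add: inner_Re_cinner cinner_scaleC_left)

end

instantiation complex :: complex_hilbert
begin
definition scaleC_complex :: "complex \<Rightarrow> complex \<Rightarrow> complex" where "scaleC_complex c x = c * x"
definition cinner_complex :: "complex \<Rightarrow> complex \<Rightarrow> complex" where "cinner_complex x y = cnj x * y"
instance
  by standard (auto simp: scaleC_complex_def cinner_complex_def algebra_simps scaleR_conv_of_real
      inner_complex_def)
end

text \<open>The Hilbert space tensor product of \<open>K\<close> with \<open>l\<^sup>2(J)\<close> is realised
  as the space \<open>l\<^sup>2(J; K)\<close> of square summable \<open>K\<close>-valued families.\<close>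

typedef (overloaded) ('j, 'k::complex_hilbert) ell2 =
  "{f :: 'j \<Rightarrow> 'k. (\<lambda>j. (norm (f j))\<^sup>2) summable_on UNIV}"
  morphisms coord Abs_ell2
  by (rule exI [of _ "\<lambda>_. 0"]) simp

type_synonym 'j l2 = "('j, complex) ell2"

lemma coord_summable: "(\<lambda>j. (norm (coord x j))\<^sup>2) summable_on UNIV"
  using coord [of x] by simp

lemma sq_summable_bound:
  fixes f g :: "'j \<Rightarrow> 'k::complex_hilbert" and h :: "'j \<Rightarrow> real"
  assumes "(\<lambda>j. (norm (f j))\<^sup>2) summable_on UNIV" "(\<lambda>j. (norm (g j))\<^sup>2) summable_on UNIV"
    and "\<And>j. \<bar>h j\<bar> \<le> c * ((norm (f j))\<^sup>2 + (norm (g j))\<^sup>2)"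
  shows "h summable_on UNIV"
proof -
  have "(\<lambda>j. c * ((norm (f j))\<^sup>2 + (norm (g j))\<^sup>2)) summable_on UNIV"
    by (intro summable_on_cmult_right summable_on_add assms)
  then have "(\<lambda>j. norm (h j)) summable_on UNIV"
    by (rule summable_on_comparison_test) (use assms(3) in auto)
  then show ?thesis
    by (rule abs_summable_summable)
qed

lemma norm_add_sq: "(norm (x + y))\<^sup>2 \<le> 2 * ((norm x)\<^sup>2 + (norm y)\<^sup>2)" for x y :: "'a::real_inner"
proof -
  have "(norm (x + y))\<^sup>2 + (norm (x - y))\<^sup>2 = 2 * ((norm x)\<^sup>2 + (norm y)\<^sup>2)"
    by (simp add: power2_norm_eq_inner algebra_simps inner_commute)
  then show ?thesis
    by (metis add.commute le_add_same_cancel2 zero_le_power2)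
qed

lemma abs_inner_sq: "\<bar>inner x y\<bar> \<le> 1 * ((norm x)\<^sup>2 + (norm y)\<^sup>2)" for x y :: "'a::real_inner"
proof -
  have "\<bar>inner x y\<bar> \<le> norm x * norm y" by (rule Cauchy_Schwarz_ineq2)
  moreover have "0 \<le> (norm x - norm y)\<^sup>2" by simp
  ultimately show ?thesis
    using mult_nonneg_nonneg [of "norm x" "norm y"] by (simp add: power2_diff)
qed

lemma ell2_inner_summable: "(\<lambda>j. inner (coord x j) (coord y j)) summable_on UNIV"
  by (rule sq_summable_bound [OF coord_summable coord_summable abs_inner_sq])

lemma ell2_cinner_summable: "(\<lambda>j. cinner (coord x j) (coord y j)) summable_on UNIV"
proof -
  have re: "(\<lambda>j. Re (cinner (coord x j) (coord y j))) summable_on UNIV"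
    using ell2_inner_summable [of x y] by (simp add: inner_Re_cinner)
  have bd: "\<bar>Im (cinner a b)\<bar> \<le> 1 * ((norm a)\<^sup>2 + (norm b)\<^sup>2)" for a b :: 'b
    using abs_inner_sq [of "\<i> *\<^sub>C a" b] by (simp add: Im_cinner norm_scaleC)
  have im: "(\<lambda>j. Im (cinner (coord x j) (coord y j))) summable_on UNIV"
    by (rule sq_summable_bound [OF coord_summable coord_summable bd])
  have "(\<lambda>j. complex_of_real (Re (cinner (coord x j) (coord y j)))
      + \<i> * complex_of_real (Im (cinner (coord x j) (coord y j)))) summable_on UNIV"
    by (intro summable_on_add summable_on_cmult_right summable_on_of_real re im)
  then show ?thesis by (simp add: complex_eq [symmetric])
qed

lemma coord_inject_ext: "x = y \<longleftrightarrow> (\<forall>j. coord x j = coord y j)"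
  by (metis coord_inject ext)

instantiation ell2 :: (type, complex_hilbert) real_inner
begin

definition "0 = Abs_ell2 (\<lambda>_. 0)"
definition "x + y = Abs_ell2 (\<lambda>j. coord x j + coord y j)"
definition "x - y = Abs_ell2 (\<lambda>j. coord x j - coord y j)"
definition "- x = Abs_ell2 (\<lambda>j. - coord x j)"
definition "r *\<^sub>R x = Abs_ell2 (\<lambda>j. r *\<^sub>R coord x j)"
definition "inner x y = (\<Sum>\<^sub>\<infinity>j. inner (coord x j) (coord y j))"
definition "norm x = sqrt (inner x x)" for x :: "('a, 'b) ell2"
definition "dist x y = norm (x - y)" for x :: "('a, 'b) ell2"
definition "sgn x = inverse (norm x) *\<^sub>R x" for x :: "('a, 'b) ell2"
definition "uniformity =
  (INF e\<in>{0<..}. principal {(x :: ('a, 'b) ell2, y). dist x y < e})"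
definition "open U \<longleftrightarrow> (\<forall>x\<in>U. eventually (\<lambda>(x', y). x' = x \<longrightarrow> y \<in> U) uniformity)"
  for U :: "('a, 'b) ell2 set"

lemma coord_zero: "coord 0 j = 0"
  by (simp add: zero_ell2_def Abs_ell2_inverse)

lemma coord_add: "coord (x + y) j = coord x j + coord y j"
proof -
  have "(\<lambda>j. (norm (coord x j + coord y j))\<^sup>2) summable_on UNIV"
    by (rule sq_summable_bound [OF coord_summable [of x] coord_summable [of y]])
      (unfold abs_of_nonneg [OF zero_le_power2], rule norm_add_sq)
  then show ?thesis by (simp add: plus_ell2_def Abs_ell2_inverse)
qed

lemma coord_scaleR: "coord (r *\<^sub>R x) j = r *\<^sub>R coord x j"
proof -
  have "(\<lambda>j. (norm (r *\<^sub>R coord x j))\<^sup>2) summable_on UNIV"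
    by (simp add: power_mult_distrib summable_on_cmult_right coord_summable)
  then show ?thesis by (simp add: scaleR_ell2_def Abs_ell2_inverse)
qed

lemma coord_uminus: "coord (- x) j = - coord x j"
  by (simp add: uminus_ell2_def Abs_ell2_inverse coord_summable)

lemma coord_minus: "coord (x - y) j = coord x j - coord y j"
proof -
  have "x - y = x + (- y)"
    unfolding minus_ell2_def plus_ell2_def by (simp add: coord_uminus)
  then show ?thesis by (simp add: coord_add coord_uminus)
qed

lemma norm_ell2_sq: "(norm x)\<^sup>2 = (\<Sum>\<^sub>\<infinity>j. (norm (coord x j))\<^sup>2)" for x :: "('a, 'b) ell2"
  unfolding norm_ell2_def inner_ell2_def
  by (simp add: power2_norm_eq_inner infsum_nonneg)

lemma finite_sum_le_norm_sq: "finite F \<Longrightarrow> (\<Sum>j\<in>F. (norm (coord x j))\<^sup>2) \<le> (norm x)\<^sup>2"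
  for x :: "('a, 'b) ell2"
  unfolding norm_ell2_sq by (rule finite_sum_le_infsum [OF coord_summable]) auto

lemma norm_coord_le: "norm (coord x j) \<le> norm x" for x :: "('a, 'b) ell2"
proof (rule power2_le_imp_le)
  show "(norm (coord x j))\<^sup>2 \<le> (norm x)\<^sup>2"
    using finite_sum_le_norm_sq [of "{j}" x] by simp
  show "0 \<le> norm x"
    by (simp add: norm_ell2_def inner_ell2_def infsum_nonneg)
qed

instance
proof
  fix x y z :: "('a, 'b) ell2" and r s :: real
  show "x + y + z = x + (y + z)" "x + y = y + x" "0 + x = x" "- x + x = 0" "x - y = x + (- y)"
    by (simp_all add: coord_inject_ext coord_zero coord_add coord_uminus coord_minus)
  show "r *\<^sub>R (x + y) = r *\<^sub>R x + r *\<^sub>R y" "(r + s) *\<^sub>R x = r *\<^sub>R x + s *\<^sub>R x"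
    "r *\<^sub>R s *\<^sub>R x = (r * s) *\<^sub>R x" "1 *\<^sub>R x = x"
    by (simp_all add: coord_inject_ext coord_add coord_scaleR algebra_simps)
  show "dist x y = norm (x - y)" by (rule dist_ell2_def)
  show "sgn x = inverse (norm x) *\<^sub>R x" by (rule sgn_ell2_def)
  show "uniformity = (INF e\<in>{0<..}. principal {(x :: ('a, 'b) ell2, y). dist x y < e})"
    by (rule uniformity_ell2_def)
  show "open U \<longleftrightarrow> (\<forall>x\<in>U. eventually (\<lambda>(x', y). x' = x \<longrightarrow> y \<in> U) uniformity)"
    for U :: "('a, 'b) ell2 set"
    by (rule open_ell2_def)
  show "inner x y = inner y x"
    unfolding inner_ell2_def by (subst inner_commute) (rule refl)
  show "inner (x + y) z = inner x z + inner y z"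
    by (simp add: inner_ell2_def coord_add inner_add_left infsum_add ell2_inner_summable)
  show "inner (r *\<^sub>R x) y = r * inner x y"
    by (simp add: inner_ell2_def coord_scaleR infsum_cmult_right')
  show "0 \<le> inner x x"
    by (simp add: inner_ell2_def infsum_nonneg)
  show "inner x x = 0 \<longleftrightarrow> x = 0"
  proof
    assume "inner x x = 0"
    then have "norm (coord x j) \<le> 0" for j
      using norm_coord_le [of x j] by (simp add: norm_ell2_def)
    then show "x = 0" by (simp add: coord_inject_ext coord_zero)
  qed (simp add: inner_ell2_def coord_zero)
  show "norm x = sqrt (inner x x)" by (rule norm_ell2_def)
qed

end

instance ell2 :: (type, complex_hilbert) banach
proof
  fix X :: "nat \<Rightarrow> ('a, 'b) ell2"
  assume "Cauchy X"
  have small: "\<exists>M. \<forall>m\<ge>M. \<forall>n\<ge>M. norm (X m - X n) < e" if "0 < e" for e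
    using \<open>Cauchy X\<close> that unfolding Cauchy_def dist_ell2_def by blast
  have "Cauchy (\<lambda>n. coord (X n) j)" for j
  proof (rule CauchyI)
    fix e :: real assume "0 < e"
    then obtain M where "\<forall>m\<ge>M. \<forall>n\<ge>M. norm (X m - X n) < e" using small by blast
    then show "\<exists>M. \<forall>m\<ge>M. \<forall>n\<ge>M. norm (coord (X m) j - coord (X n) j) < e"
      unfolding coord_minus [symmetric] by (auto intro: le_less_trans [OF norm_coord_le])
  qed
  then have conv: "convergent (\<lambda>n. coord (X n) j)" for j
    by (simp add: Cauchy_convergent_iff)
  define l where "l = (\<lambda>j. lim (\<lambda>n. coord (X n) j))"
  have l: "(\<lambda>n. coord (X n) j) \<longlonglongrightarrow> l j" for j
    using conv [of j] by (simp add: l_def convergent_LIMSEQ_iff)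
  have fin: "(\<Sum>j\<in>F. (norm (coord (X m) j - l j))\<^sup>2) \<le> e\<^sup>2"
    if "finite F" "\<forall>n\<ge>M. norm (X m - X n) < e" for F M m e
  proof (rule tendsto_upperbound)
    show "(\<lambda>n. \<Sum>j\<in>F. (norm (coord (X m) j - coord (X n) j))\<^sup>2)
      \<longlonglongrightarrow> (\<Sum>j\<in>F. (norm (coord (X m) j - l j))\<^sup>2)"
      by (intro tendsto_intros l)
    have "(\<Sum>j\<in>F. (norm (coord (X m) j - coord (X n) j))\<^sup>2) \<le> e\<^sup>2" if "n \<ge> M" for n
    proof -
      have "(\<Sum>j\<in>F. (norm (coord (X m) j - coord (X n) j))\<^sup>2) \<le> (norm (X m - X n))\<^sup>2"
        using finite_sum_le_norm_sq [OF \<open>finite F\<close>, of "X m - X n"] by (simp add: coord_minus)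
      also have "\<dots> \<le> e\<^sup>2"
        using that \<open>\<forall>n\<ge>M. norm (X m - X n) < e\<close>
        by (intro power_mono norm_ge_zero less_imp_le) simp
      finally show ?thesis .
    qed
    then show "\<forall>\<^sub>F n in sequentially. (\<Sum>j\<in>F. (norm (coord (X m) j - coord (X n) j))\<^sup>2) \<le> e\<^sup>2"
      by (auto simp: eventually_sequentially)
  qed simp
  have summ: "(\<lambda>j. (norm (coord (X m) j - l j))\<^sup>2) summable_on UNIV"
    if "\<forall>n\<ge>M. norm (X m - X n) < e" for M m e
  proof (rule nonneg_bdd_above_summable_on)
    show "bdd_above (sum (\<lambda>j. (norm (coord (X m) j - l j))\<^sup>2) ` {F. F \<subseteq> UNIV \<and> finite F})"
      by (rule bdd_aboveI2 [where M = "e\<^sup>2"]) (rule fin [OF _ that], simp)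
  qed simp
  obtain M1 where M1: "\<forall>m\<ge>M1. \<forall>n\<ge>M1. norm (X m - X n) < 1"
    using small [of 1] by auto
  have "(\<lambda>j. (norm (l j))\<^sup>2) summable_on UNIV"
  proof (rule sq_summable_bound)
    show "(\<lambda>j. (norm (coord (X M1) j - l j))\<^sup>2) summable_on UNIV"
      by (rule summ [of M1 _ 1]) (use M1 in auto)
    show "(\<lambda>j. (norm (coord (X M1) j))\<^sup>2) summable_on UNIV"
      by (rule coord_summable)
    show "\<bar>(norm (l j))\<^sup>2\<bar> \<le> 2 * ((norm (coord (X M1) j - l j))\<^sup>2 + (norm (coord (X M1) j))\<^sup>2)" for j
      using norm_add_sq [of "l j - coord (X M1) j" "coord (X M1) j"] by (simp add: norm_minus_commute)
  qed
  then have cl: "coord (Abs_ell2 l) j = l j" for j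
    by (simp add: Abs_ell2_inverse)
  have "X \<longlonglongrightarrow> Abs_ell2 l"
    unfolding tendsto_iff eventually_sequentially
  proof (intro allI impI)
    fix e :: real assume "0 < e"
    then obtain M where M: "\<forall>m\<ge>M. \<forall>n\<ge>M. norm (X m - X n) < e / 2"
      using small [of "e / 2"] by auto
    have "dist (X m) (Abs_ell2 l) < e" if "m \<ge> M" for m
    proof -
      have Mm: "\<forall>n\<ge>M. norm (X m - X n) < e / 2"
        using M that by simp
      have "(norm (X m - Abs_ell2 l))\<^sup>2 \<le> (e / 2)\<^sup>2"
        unfolding norm_ell2_sq
      proof (rule infsum_le_finite_sums [OF coord_summable])
        fix F :: "'a set" assume "finite F"
        show "(\<Sum>j\<in>F. (norm (coord (X m - Abs_ell2 l) j))\<^sup>2) \<le> (e / 2)\<^sup>2"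
          unfolding coord_minus cl by (rule fin [OF \<open>finite F\<close> Mm])
      qed
      then have "norm (X m - Abs_ell2 l) \<le> e / 2"
        by (rule power2_le_imp_le) (use \<open>0 < e\<close> in simp)
      then show ?thesis using \<open>0 < e\<close> by (simp add: dist_ell2_def)
    qed
    then show "\<exists>M. \<forall>m\<ge>M. dist (X m) (Abs_ell2 l) < e" by (intro exI [of _ M]) simp
  qed
  then show "convergent X" by (auto simp: convergent_def)
qed

instantiation ell2 :: (type, complex_hilbert) complex_hilbert
begin

definition "c *\<^sub>C x = Abs_ell2 (\<lambda>j. c *\<^sub>C coord x j)"
definition "cinner x y = (\<Sum>\<^sub>\<infinity>j. cinner (coord x j) (coord y j))"

lemma coord_scaleC: "coord (c *\<^sub>C x) j = c *\<^sub>C coord x j"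
proof -
  have "(\<lambda>j. (norm (c *\<^sub>C coord x j))\<^sup>2) summable_on UNIV"
    by (simp add: norm_scaleC power_mult_distrib summable_on_cmult_right coord_summable)
  then show ?thesis by (simp add: scaleC_ell2_def Abs_ell2_inverse)
qed

instance
proof
  fix x y z :: "('a, 'b) ell2" and r :: real and c d :: complex
  show "c *\<^sub>C (x + y) = c *\<^sub>C x + c *\<^sub>C y" "(c + d) *\<^sub>C x = c *\<^sub>C x + d *\<^sub>C x"
    "c *\<^sub>C d *\<^sub>C x = (c * d) *\<^sub>C x" "r *\<^sub>R x = complex_of_real r *\<^sub>C x"
    by (simp_all add: coord_inject_ext coord_add coord_scaleR coord_scaleC
        scaleC_add_right scaleC_add_left scaleC_scaleC scaleR_scaleC)
  show "cinner x (y + z) = cinner x y + cinner x z"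
    by (simp add: cinner_ell2_def coord_add cinner_add_right infsum_add ell2_cinner_summable)
  show "cinner x (c *\<^sub>C y) = c * cinner x y"
    by (simp add: cinner_ell2_def coord_scaleC cinner_scaleC_right infsum_cmult_right')
  show "cinner x y = cnj (cinner y x)"
    unfolding cinner_ell2_def infsum_cnj [symmetric] by (simp only: cinner_commute [symmetric])
  show "inner x y = Re (cinner x y)"
    unfolding cinner_ell2_def inner_ell2_def infsum_Re [OF ell2_cinner_summable, symmetric]
    by (simp only: inner_Re_cinner)
qed

end


section \<open>Bounded operators\<close>

type_synonym 'h bop = "'h \<Rightarrow>\<^sub>L 'h"

text \<open>The type \<open>'h bop\<close> contains all real linear bounded maps; \<open>B(H)\<close> is the
  following subset.\<close>

definition clinear_ops :: "'h::complex_hilbert bop set" where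
  "clinear_ops = {T. \<forall>c x. blinfun_apply T (c *\<^sub>C x) = c *\<^sub>C T x}"

definition adj :: "'h::complex_hilbert bop \<Rightarrow> 'h bop" where
  "adj T = (THE S. \<forall>x y. cinner (blinfun_apply T x) y = cinner x (blinfun_apply S y))"

definition scale_op :: "complex \<Rightarrow> 'h::complex_hilbert bop \<Rightarrow> 'h bop" where
  "scale_op c T = Blinfun (\<lambda>x. c *\<^sub>C T x)"

definition tensor_vec :: "'k::complex_hilbert \<Rightarrow> 'j l2 \<Rightarrow> ('j, 'k) ell2" where
  "tensor_vec k x = Abs_ell2 (\<lambda>j. coord x j *\<^sub>C k)"

definition op_tensor :: "'k::complex_hilbert bop \<Rightarrow> 'j l2 bop \<Rightarrow> ('j, 'k) ell2 bop" where
  "op_tensor a b =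
    (THE T. T \<in> clinear_ops \<and> (\<forall>k x. T (tensor_vec k x) = tensor_vec (a k) (b x)))"


section \<open>Operator algebras\<close>

text \<open>An ambient *-algebra together with its norms on \<open>n\<close> by \<open>n\<close> matrices
  (only the entries with indices below \<open>n\<close> matter).\<close>

record 'a op_alg = "(complex, 'a) module" +
  star :: "'a \<Rightarrow> 'a"
  mat_norm :: "nat \<Rightarrow> (nat \<Rightarrow> nat \<Rightarrow> 'a) \<Rightarrow> real"

definition op_dist :: "'a op_alg \<Rightarrow> 'a \<Rightarrow> 'a \<Rightarrow> real" where
  "op_dist R a b = mat_norm R 1 (\<lambda>_ _. a \<oplus>\<^bsub>R\<^esub> ((- 1) \<odot>\<^bsub>R\<^esub> b))"

definition norm_closure :: "'a op_alg \<Rightarrow> 'a set \<Rightarrow> 'a set" where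
  "norm_closure R B = {a \<in> carrier R. \<forall>e>0. \<exists>b\<in>B. op_dist R a b < e}"

definition linear_subspace :: "'a op_alg \<Rightarrow> 'a set \<Rightarrow> bool" where
  "linear_subspace R B \<longleftrightarrow> B \<subseteq> carrier R \<and> \<zero>\<^bsub>R\<^esub> \<in> B \<and>
    (\<forall>a\<in>B. \<forall>b\<in>B. a \<oplus>\<^bsub>R\<^esub> b \<in> B) \<and> (\<forall>c. \<forall>a\<in>B. c \<odot>\<^bsub>R\<^esub> a \<in> B)"

definition closed_subalgebra :: "'a op_alg \<Rightarrow> 'a set \<Rightarrow> bool" where
  "closed_subalgebra R B \<longleftrightarrow> linear_subspace R B \<and>
    (\<forall>a\<in>B. \<forall>b\<in>B. a \<otimes>\<^bsub>R\<^esub> b \<in> B) \<and> norm_closure R B = B"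

definition cstar_subalgebra :: "'a op_alg \<Rightarrow> 'a set \<Rightarrow> bool" where
  "cstar_subalgebra R B \<longleftrightarrow> closed_subalgebra R B \<and> (\<forall>a\<in>B. star R a \<in> B)"

definition closed_span :: "'a op_alg \<Rightarrow> 'a set \<Rightarrow> 'a set" where
  "closed_span R F = norm_closure R (\<Inter>{B. linear_subspace R B \<and> F \<subseteq> B})"

definition alg_gen :: "'a op_alg \<Rightarrow> 'a set \<Rightarrow> 'a set" where
  "alg_gen R F = \<Inter>{B. closed_subalgebra R B \<and> F \<subseteq> B}"

definition cstar_gen :: "'a op_alg \<Rightarrow> 'a set \<Rightarrow> 'a set" where
  "cstar_gen R F = \<Inter>{B. cstar_subalgebra R B \<and> F \<subseteq> B}"

definition alg_hom :: "'a op_alg \<Rightarrow> 'b op_alg \<Rightarrow> 'a set \<Rightarrow> ('a \<Rightarrow> 'b) \<Rightarrow> bool" where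
  "alg_hom R R' B f \<longleftrightarrow> f ` B \<subseteq> carrier R' \<and>
    (\<forall>a\<in>B. \<forall>b\<in>B. f (a \<oplus>\<^bsub>R\<^esub> b) = f a \<oplus>\<^bsub>R'\<^esub> f b \<and>
      f (a \<otimes>\<^bsub>R\<^esub> b) = f a \<otimes>\<^bsub>R'\<^esub> f b) \<and>
    (\<forall>c. \<forall>a\<in>B. f (c \<odot>\<^bsub>R\<^esub> a) = c \<odot>\<^bsub>R'\<^esub> f a)"

definition star_hom :: "'a op_alg \<Rightarrow> 'b op_alg \<Rightarrow> 'a set \<Rightarrow> ('a \<Rightarrow> 'b) \<Rightarrow> bool" where
  "star_hom R R' B f \<longleftrightarrow> alg_hom R R' B f \<and> (\<forall>a\<in>B. f (star R a) = star R' (f a))"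

definition completely_isometric ::
  "'a op_alg \<Rightarrow> 'b op_alg \<Rightarrow> 'a set \<Rightarrow> ('a \<Rightarrow> 'b) \<Rightarrow> bool" where
  "completely_isometric R R' B f \<longleftrightarrow>
    (\<forall>n M. (\<forall>i<n. \<forall>j<n. M i j \<in> B) \<longrightarrow>
      mat_norm R' n (\<lambda>i j. f (M i j)) = mat_norm R n M)"

text \<open>\<open>B(H)\<close>, with the norm of \<open>M\<^sub>n(B(H)) = B(H\<^sup>n)\<close>.\<close>

definition bounded_ops :: "'h::complex_hilbert bop op_alg" where
  "bounded_ops = \<lparr>carrier = clinear_ops, mult = (o\<^sub>L), one = id_blinfun, zero = 0,
    add = (+), smult = scale_op, star = adj,
    mat_norm = (\<lambda>n M. Sup {sqrt (\<Sum>i<n. (norm (\<Sum>j<n. M i j (x j)))\<^sup>2) | x.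
      (\<Sum>j<n. (norm (x j))\<^sup>2) \<le> 1})\<rparr>"


section \<open>Direct sums of Hilbert modules\<close>

text \<open>Each \<open>Y i\<close> is a closed subspace of \<open>B(H)\<close> which is a right Hilbert module over a
  C*-algebra \<open>A\<close> contained in \<open>B(H)\<close>, with \<open>A\<close>-valued inner product
  \<open>(\<xi>, \<eta>) \<mapsto> \<xi>\<^sup>*\<eta>\<close>.  Elements of the direct sum are extended by zero outside
  the index set.\<close>

definition dsum :: "'i set \<Rightarrow> ('i \<Rightarrow> 'h::complex_hilbert bop set) \<Rightarrow> ('i \<Rightarrow> 'h bop) set" where
  "dsum I Y = {\<eta>. (\<forall>i\<in>I. \<eta> i \<in> Y i) \<and> (\<forall>i. i \<notin> I \<longrightarrow> \<eta> i = 0) \<and>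
    (\<lambda>i. adj (\<eta> i) o\<^sub>L \<eta> i) summable_on I}"

definition mod_inner ::
  "'i set \<Rightarrow> ('i \<Rightarrow> 'h::complex_hilbert bop) \<Rightarrow> ('i \<Rightarrow> 'h bop) \<Rightarrow> 'h bop" where
  "mod_inner I \<xi> \<eta> = (\<Sum>\<^sub>\<infinity>i\<in>I. adj (\<xi> i) o\<^sub>L \<eta> i)"

type_synonym ('i, 'h) mod_op = "('i \<Rightarrow> 'h bop) \<Rightarrow> ('i \<Rightarrow> 'h bop)"

definition is_mod_adjoint ::
  "'i set \<Rightarrow> ('i \<Rightarrow> 'h::complex_hilbert bop set) \<Rightarrow> ('i, 'h) mod_op \<Rightarrow> ('i, 'h) mod_op \<Rightarrow> bool"
where
  "is_mod_adjoint I Y T S \<longleftrightarrow>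
    T \<in> dsum I Y \<rightarrow>\<^sub>E dsum I Y \<and> S \<in> dsum I Y \<rightarrow>\<^sub>E dsum I Y \<and>
    (\<forall>\<xi>\<in>dsum I Y. \<forall>\<eta>\<in>dsum I Y. mod_inner I (T \<xi>) \<eta> = mod_inner I \<xi> (S \<eta>))"

text \<open>The C*-algebra of adjointable operators on the direct sum \<open>E\<close>, with the norm of
  \<open>M\<^sub>n(L(E)) = L(E\<^sup>n)\<close>.\<close>

definition adjointable_ops ::
  "'i set \<Rightarrow> ('i \<Rightarrow> 'h::complex_hilbert bop set) \<Rightarrow> ('i, 'h) mod_op op_alg" where
  "adjointable_ops I Y = \<lparr>carrier = {T. \<exists>S. is_mod_adjoint I Y T S},
    mult = compose (dsum I Y), one = (\<lambda>\<xi>\<in>dsum I Y. \<xi>), zero = (\<lambda>\<xi>\<in>dsum I Y. \<lambda>_. 0),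
    add = (\<lambda>T S. \<lambda>\<xi>\<in>dsum I Y. \<lambda>i. T \<xi> i + S \<xi> i),
    smult = (\<lambda>c T. \<lambda>\<xi>\<in>dsum I Y. \<lambda>i. scale_op c (T \<xi> i)),
    star = (\<lambda>T. THE S. is_mod_adjoint I Y T S),
    mat_norm = (\<lambda>n M. Sup {sqrt (norm (\<Sum>i<n. mod_inner I
        (\<lambda>s. \<Sum>j<n. M i j (\<xi> j) s) (\<lambda>s. \<Sum>j<n. M i j (\<xi> j) s))) | \<xi>.
      (\<forall>j<n. \<xi> j \<in> dsum I Y) \<and> norm (\<Sum>j<n. mod_inner I (\<xi> j) (\<xi> j)) \<le> 1})\<rparr>"

text \<open>The exterior tensor product of \<open>dsum I Y\<close> with the Hilbert space \<open>l\<^sup>2(J)\<close> is the direct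
  sum of copies of the modules \<open>Y i\<close> indexed by \<open>I \<times> J\<close>.\<close>

definition mod_tensor_vec ::
  "('i \<Rightarrow> 'h::complex_hilbert bop) \<Rightarrow> 'j l2 \<Rightarrow> ('i \<times> 'j \<Rightarrow> 'h bop)" where
  "mod_tensor_vec \<xi> x = (\<lambda>(i, j). scale_op (coord x j) (\<xi> i))"

definition mod_op_tensor ::
  "'i set \<Rightarrow> ('i \<Rightarrow> 'h::complex_hilbert bop set) \<Rightarrow> ('i, 'h) mod_op \<Rightarrow> 'j l2 bop
    \<Rightarrow> ('i \<times> 'j, 'h) mod_op" where
  "mod_op_tensor I Y T b = (THE S.
    S \<in> carrier (adjointable_ops (I \<times> UNIV) (Y \<circ> fst)) \<and>
    (\<forall>\<xi>\<in>dsum I Y. \<forall>x. S (mod_tensor_vec \<xi> x) = mod_tensor_vec (T \<xi>) (b x)))"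


section \<open>Spatial tensor products\<close>

text \<open>The data needed to form spatial tensor products of subalgebras of \<open>alg\<close> with algebras of
  operators on \<open>l\<^sup>2(J)\<close>: the elementary tensors, and the algebra in which closures are taken.
  For subalgebras of \<open>B(K)\<close> this is \<open>B(K \<otimes> l\<^sup>2(J))\<close>; for algebras of adjointable
  operators on a Hilbert module \<open>E\<close> it is the algebra of adjointable operators on the exterior
  tensor product \<open>E \<otimes> l\<^sup>2(J)\<close>, on which the spatial tensor product of the algebra of
  adjointable operators on \<open>E\<close> with \<open>B(l\<^sup>2(J))\<close> is represented faithfully.\<close>

record ('a, 't, 'j) tensor_ctx =
  alg :: "'a op_alg"
  tens :: "'t op_alg"
  elem :: "'a \<Rightarrow> 'j l2 bop \<Rightarrow> 't"

definition hilbert_ctx :: "('k::complex_hilbert bop, ('j, 'k) ell2 bop, 'j) tensor_ctx" where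
  "hilbert_ctx = \<lparr>alg = bounded_ops, tens = bounded_ops, elem = op_tensor\<rparr>"

definition module_ctx ::
  "'i set \<Rightarrow> ('i \<Rightarrow> 'h::complex_hilbert bop set)
    \<Rightarrow> (('i, 'h) mod_op, ('i \<times> 'j, 'h) mod_op, 'j) tensor_ctx" where
  "module_ctx I Y = \<lparr>alg = adjointable_ops I Y,
    tens = adjointable_ops (I \<times> UNIV) (Y \<circ> fst), elem = mod_op_tensor I Y\<rparr>"

definition spatial_tensor ::
  "('a, 't, 'j) tensor_ctx \<Rightarrow> 'a set \<Rightarrow> 'j l2 bop set \<Rightarrow> 't set" where
  "spatial_tensor D B E = closed_span (tens D) {elem D a b | a b. a \<in> B \<and> b \<in> E}"


section \<open>The full group C*-algebra\<close>

definition unitary_op :: "'h::complex_hilbert bop \<Rightarrow> bool" where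
  "unitary_op T \<longleftrightarrow> T \<in> clinear_ops \<and> adj T o\<^sub>L T = id_blinfun \<and> T o\<^sub>L adj T = id_blinfun"

definition unitary_reps :: "('g, 'z) monoid_scheme \<Rightarrow> ('g \<Rightarrow> ('g \<times> nat) l2 bop) set" where
  "unitary_reps G = {\<pi>. (\<forall>g\<in>carrier G. unitary_op (\<pi> g)) \<and>
    (\<forall>g\<in>carrier G. \<forall>h\<in>carrier G. \<pi> (g \<otimes>\<^bsub>G\<^esub> h) = \<pi> g o\<^sub>L \<pi> h)}"

text \<open>The universal representation is the direct sum of all unitary representations of \<open>G\<close> on
  \<open>l\<^sup>2(G \<times> \<nat>)\<close>.  This is large enough to give the full group C*-algebra: every cyclic
  representation of \<open>G\<close> has dimension at most the cardinality of \<open>G \<times> \<nat>\<close>, and so becomes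
  one of these after adding a multiple of the trivial representation.  Index components \<open>\<pi>\<close>
  that are not representations carry the trivial representation.\<close>

type_synonym 'g univ_index = "('g \<Rightarrow> ('g \<times> nat) l2 bop) \<times> ('g \<times> nat)"

definition slice :: "('g \<Rightarrow> ('g \<times> nat) l2 bop) \<Rightarrow> 'g univ_index l2 \<Rightarrow> ('g \<times> nat) l2" where
  "slice \<pi> x = Abs_ell2 (\<lambda>i. coord x (\<pi>, i))"

definition univ_unitary :: "('g, 'z) monoid_scheme \<Rightarrow> 'g \<Rightarrow> 'g univ_index l2 bop" where
  "univ_unitary G g = (THE U. U \<in> clinear_ops \<and>
    (\<forall>x \<pi>. slice \<pi> (U x) = (if \<pi> \<in> unitary_reps G then \<pi> g (slice \<pi> x) else slice \<pi> x)))"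

definition full_group_cstar :: "('g, 'z) monoid_scheme \<Rightarrow> 'g univ_index l2 bop set" where
  "full_group_cstar G = cstar_gen bounded_ops (univ_unitary G ` carrier G)"


section \<open>Coactions, cosystems and C*-covers\<close>

definition coaction_axioms ::
  "('g, 'z) monoid_scheme \<Rightarrow> ('a, 't, 'g univ_index) tensor_ctx \<Rightarrow> 'a set \<Rightarrow> ('a \<Rightarrow> 't) \<Rightarrow> bool"
where
  "coaction_axioms G D B \<delta> \<longleftrightarrow>
    \<delta> ` B \<subseteq> spatial_tensor D B (full_group_cstar G) \<and>
    closed_span (alg D) (\<Union>g\<in>carrier G. {a \<in> B. \<delta> a = elem D a (univ_unitary G g)}) = B"

definition cosystem ::
  "('g, 'z) monoid_scheme \<Rightarrow> ('a, 't, 'g univ_index) tensor_ctx \<Rightarrow> 'a set \<Rightarrow> ('a \<Rightarrow> 't) \<Rightarrow> bool"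
where
  "cosystem G D B \<delta> \<longleftrightarrow> closed_subalgebra (alg D) B \<and> alg_hom (alg D) (tens D) B \<delta> \<and>
    completely_isometric (alg D) (tens D) B \<delta> \<and> coaction_axioms G D B \<delta>"

definition cstar_cosystem ::
  "('g, 'z) monoid_scheme \<Rightarrow> ('a, 't, 'g univ_index) tensor_ctx \<Rightarrow> 'a set \<Rightarrow> ('a \<Rightarrow> 't) \<Rightarrow> bool"
where
  "cstar_cosystem G D B \<delta> \<longleftrightarrow> cstar_subalgebra (alg D) B \<and> star_hom (alg D) (tens D) B \<delta> \<and>
    inj_on \<delta> B \<and> coaction_axioms G D B \<delta>"

text \<open>\<open>\<Theta>\<close> is the continuous linear extension of \<open>a \<otimes> b \<mapsto> \<iota> a \<otimes> b\<close> to the spatial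
  tensor product; it is determined there by \<open>\<iota>\<close>.\<close>

definition is_tensor_id ::
  "('a, 't, 'j) tensor_ctx \<Rightarrow> ('b, 's, 'j) tensor_ctx \<Rightarrow> 'a set \<Rightarrow> 'j l2 bop set
    \<Rightarrow> ('a \<Rightarrow> 'b) \<Rightarrow> ('t \<Rightarrow> 's) \<Rightarrow> bool" where
  "is_tensor_id D D' B E \<iota> \<Theta> \<longleftrightarrow> alg_hom (tens D) (tens D') (spatial_tensor D B E) \<Theta> \<and>
    (\<exists>K. \<forall>t\<in>spatial_tensor D B E.
      mat_norm (tens D') 1 (\<lambda>_ _. \<Theta> t) \<le> K * mat_norm (tens D) 1 (\<lambda>_ _. t)) \<and>
    (\<forall>a\<in>B. \<forall>b\<in>E. \<Theta> (elem D a b) = elem D' (\<iota> a) b)"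

definition cstar_cover ::
  "('g, 'z) monoid_scheme \<Rightarrow> ('a, 't, 'g univ_index) tensor_ctx \<Rightarrow> 'a set \<Rightarrow> ('a \<Rightarrow> 't)
    \<Rightarrow> ('b, 's, 'g univ_index) tensor_ctx \<Rightarrow> 'b set \<Rightarrow> ('a \<Rightarrow> 'b) \<Rightarrow> ('b \<Rightarrow> 's) \<Rightarrow> bool" where
  "cstar_cover G D B \<delta> D' C \<iota> \<delta>\<^sub>C \<longleftrightarrow> cosystem G D B \<delta> \<and>
    alg_hom (alg D) (alg D') B \<iota> \<and> completely_isometric (alg D) (alg D') B \<iota> \<and>
    C = cstar_gen (alg D') (\<iota> ` B) \<and> cstar_cosystem G D' C \<delta>\<^sub>C \<and>
    (\<exists>\<Theta>. is_tensor_id D D' B (full_group_cstar G) \<iota> \<Theta> \<and> (\<forall>a\<in>B. \<delta>\<^sub>C (\<iota> a) = \<Theta> (\<delta> a)))"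


section \<open>Product systems and Fock algebras\<close>

locale product_system = monoid P for P :: "('p, 'z) monoid_scheme" (structure) +
  fixes X :: "'p \<Rightarrow> 'h::complex_hilbert bop set"
  assumes left_cancel: "\<And>p r s. p \<in> carrier P \<Longrightarrow> r \<in> carrier P \<Longrightarrow> s \<in> carrier P \<Longrightarrow>
      p \<otimes> r = p \<otimes> s \<Longrightarrow> r = s"
    and closed_subspace: "\<And>p. p \<in> carrier P \<Longrightarrow> linear_subspace bounded_ops (X p) \<and> closed (X p)"
    and unit_fibre: "cstar_subalgebra bounded_ops (X \<one>)"
    and mult_fibre: "\<And>p q \<xi> \<eta>. p \<in> carrier P \<Longrightarrow> q \<in> carrier P \<Longrightarrow>
      \<xi> \<in> X p \<Longrightarrow> \<eta> \<in> X q \<Longrightarrow> \<xi> o\<^sub>L \<eta> \<in> X (p \<otimes> q)"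
    and adj_mult_fibre: "\<And>p q \<xi> \<eta>. p \<in> carrier P \<Longrightarrow> q \<in> carrier P \<Longrightarrow>
      \<xi> \<in> X p \<Longrightarrow> \<eta> \<in> X (p \<otimes> q) \<Longrightarrow> adj \<xi> o\<^sub>L \<eta> \<in> X q"

definition fock_ctx ::
  "('p, 'z) monoid_scheme \<Rightarrow> ('p \<Rightarrow> 'h::complex_hilbert bop set)
    \<Rightarrow> (('p, 'h) mod_op, ('p \<times> 'j, 'h) mod_op, 'j) tensor_ctx" where
  "fock_ctx P X = module_ctx (carrier P) X"

definition fock_ops ::
  "('p, 'z) monoid_scheme \<Rightarrow> ('p \<Rightarrow> 'h::complex_hilbert bop set) \<Rightarrow> ('p, 'h) mod_op op_alg" where
  "fock_ops P X = adjointable_ops (carrier P) X"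

text \<open>\<open>creation P X p \<xi>\<close> is \<open>\<lambda>(\<xi>)\<close> for \<open>\<xi> \<in> X\<^sub>p\<close>; the fibres need not be disjoint as sets of
  operators, so the index is an argument.\<close>

definition creation ::
  "('p, 'z) monoid_scheme \<Rightarrow> ('p \<Rightarrow> 'h::complex_hilbert bop set) \<Rightarrow> 'p \<Rightarrow> 'h bop \<Rightarrow> ('p, 'h) mod_op"
where
  "creation P X p \<xi> = (\<lambda>\<eta>\<in>dsum (carrier P) X. \<lambda>s.
    if \<exists>r\<in>carrier P. s = p \<otimes>\<^bsub>P\<^esub> r
    then \<xi> o\<^sub>L \<eta> (THE r. r \<in> carrier P \<and> s = p \<otimes>\<^bsub>P\<^esub> r) else 0)"

definition toeplitz ::
  "('p, 'z) monoid_scheme \<Rightarrow> ('p \<Rightarrow> 'h::complex_hilbert bop set) \<Rightarrow> ('p, 'h) mod_op set" where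
  "toeplitz P X = cstar_gen (fock_ops P X) {creation P X p \<xi> | p \<xi>. p \<in> carrier P \<and> \<xi> \<in> X p}"

definition toeplitz_plus ::
  "('p, 'z) monoid_scheme \<Rightarrow> ('p \<Rightarrow> 'h::complex_hilbert bop set) \<Rightarrow> ('p, 'h) mod_op set" where
  "toeplitz_plus P X = alg_gen (fock_ops P X) {creation P X p \<xi> | p \<xi>. p \<in> carrier P \<and> \<xi> \<in> X p}"

text \<open>\<open>\<delta>\<^sub>\<Psi>\<close> witnesses that \<open>\<Psi>\<close> is equivariant.\<close>

definition equivariant ::
  "('g, 'y) monoid_scheme \<Rightarrow> ('g, 'z) monoid_scheme \<Rightarrow> ('g \<Rightarrow> 'h::complex_hilbert bop set)
    \<Rightarrow> (('g, 'h) mod_op \<Rightarrow> 'k::complex_hilbert bop) \<Rightarrow> ('k bop \<Rightarrow> ('g univ_index, 'k) ell2 bop) \<Rightarrow> bool"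
where
  "equivariant G P X \<Psi> \<delta>\<^sub>\<Psi> \<longleftrightarrow> cstar_cosystem G hilbert_ctx (\<Psi> ` toeplitz P X) \<delta>\<^sub>\<Psi> \<and>
    (\<forall>p\<in>carrier P. \<forall>\<xi>\<in>X p.
      \<delta>\<^sub>\<Psi> (\<Psi> (creation P X p \<xi>)) = op_tensor (\<Psi> (creation P X p \<xi>)) (univ_unitary G p))"


section \<open>The semigroup C*-algebra\<close>

definition delta :: "'j \<Rightarrow> 'j l2" where
  "delta s = Abs_ell2 (\<lambda>i. if i = s then 1 else 0)"

text \<open>\<open>l\<^sup>2(P)\<close> is identified with the subspace of \<open>l\<^sup>2\<close> of the ambient type spanned by
  the \<open>\<delta>\<^sub>s\<close> with \<open>s \<in> P\<close>, and operators on it are extended by zero.\<close>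

definition semigroup_isometry :: "('p, 'z) monoid_scheme \<Rightarrow> 'p \<Rightarrow> 'p l2 bop" where
  "semigroup_isometry P p = (THE V. V \<in> clinear_ops \<and>
    (\<forall>s\<in>carrier P. V (delta s) = delta (p \<otimes>\<^bsub>P\<^esub> s)) \<and> (\<forall>s. s \<notin> carrier P \<longrightarrow> V (delta s) = 0))"

definition semigroup_cstar :: "('p, 'z) monoid_scheme \<Rightarrow> 'p l2 bop set" where
  "semigroup_cstar P = cstar_gen bounded_ops (semigroup_isometry P ` carrier P)"

end

theory Submission
  imports Defs
begin

text \<open>
  The idea is to let the norm of the Fock algebra be computed on a Hilbert space on which the
  tensor product representation acts.  Write \<open>c p \<xi>\<close> for \<open>\<Psi>\<close> applied to the creation operator of
  \<open>\<xi> \<in> X p\<close>.  Since \<open>(c p \<xi>)\<^sup>* (c p \<eta>) = c \<one> (\<xi>\<^sup>* \<eta>)\<close> and \<open>c \<one>\<close> is an injective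
  *-representation of \<open>A = X \<one>\<close>, hence isometric, the map sending a family \<open>Z\<close> in the Fock module to
  \<open>U Z : k \<mapsto> (c r (Z r) k)\<^sub>r\<close> from \<open>K\<close> to \<open>K \<otimes> l\<^sup>2(P)\<close> preserves the module inner product
  (lemma \<open>U_gram\<close>), so it preserves the norms of columns of such families (\<open>norm_col_U\<close>).  It intertwines
  the Fock creation operator with \<open>c p \<xi> \<otimes> V p\<close> (\<open>cre_U\<close>).  Norms of matrices of adjointable
  operators are computed on columns, so the matrix norm on the tensor algebra is at most that of
  \<open>c p \<xi> \<otimes> V p\<close> (\<open>norm_le_Phi\<close>).

  For the opposite estimate the coaction enters.  The regular representation is a component of the
  universal representation of the group, and \<open>l\<^sup>2(P)\<close> sits in it as a subspace that is invariant
  under the translations by elements of \<open>P\<close>, with restriction \<open>V p\<close>.  Compressing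
  \<open>\<delta>\<^sub>\<Psi> \<circ> \<Psi>\<close> to this subspace gives the homomorphism \<open>Phi\<close>: it is multiplicative on the tensor algebra
  because of the invariance (\<open>D_zk\<close>), and it is completely contractive because *-homomorphisms and
  compressions are.  Hence, for matrices over the tensor algebra, the norms of \<open>M\<close>, \<open>Phi M\<close>,
  \<open>\<delta>\<^sub>\<Psi> (\<Psi> M)\<close> and \<open>\<Psi> M\<close> are all equal (\<open>completely_isometric\<close>), which gives both the embedding and
  the complete isometry required of a C*-cover.

  The coaction on the tensor algebra is implemented by a unitary: on the Fock module tensored with the
  universal representation let \<open>W\<close> act on the fibre at \<open>p\<close> as the universal unitary of \<open>p\<close>.  Then
  \<open>T \<mapsto> W (T \<otimes> 1) W\<^sup>*\<close> sends a creation operator of degree \<open>p\<close> to its tensor product with that unitary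
  (\<open>twist_creation\<close>) and is visibly completely isometric.

  To make the algebra of adjointable operators accessible, an element of the module over \<open>B(H)\<close> is viewed as
  an operator from \<open>H\<close> to \<open>l\<^sup>2(I; H)\<close>, and each adjointable operator as a bounded operator on
  \<open>l\<^sup>2(I; H)\<close> that vanishes on the vectors orthogonal to all these ranges.  This is a faithful
  *-representation that computes the matrix norms (\<open>mat_norm_adjointable\<close>), and everything reduces to
  concrete C*-algebras of operators.
\<close>

section \<open>Complex Hilbert spaces: projections and adjoints\<close>

lemma scaleC_zero_left [simp]: "0 *\<^sub>C x = (0 :: 'a::complex_hilbert)"
  using scaleR_scaleC [of 0 x] by simp

lemma scaleC_zero_right [simp]: "c *\<^sub>C 0 = (0 :: 'a::complex_hilbert)"
  by (metis norm_eq_zero norm_scaleC mult_zero_right)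

lemma scaleC_of_real: "complex_of_real r *\<^sub>C x = r *\<^sub>R x"
  by (simp add: scaleR_scaleC)

lemma scaleC_minus_right: "c *\<^sub>C (- x) = - (c *\<^sub>C (x :: 'a::complex_hilbert))"
  by (metis add.right_inverse add_eq_0_iff scaleC_add_right scaleC_zero_right)

lemma scaleC_diff_right: "c *\<^sub>C (x - y) = c *\<^sub>C x - c *\<^sub>C (y :: 'a::complex_hilbert)"
  by (metis add_uminus_conv_diff scaleC_add_right scaleC_minus_right)

lemma scaleC_sum_right: "c *\<^sub>C sum f S = (\<Sum>i\<in>S. c *\<^sub>C (f i :: 'a::complex_hilbert))"
  by (induction S rule: infinite_finite_induct) (auto simp: scaleC_add_right)

lemma cinner_eq: "cinner x y = Complex (inner x y) (inner (\<i> *\<^sub>C x) y)"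
  by (simp add: complex_eq_iff inner_Re_cinner cinner_scaleC_left)

lemma bounded_bilinear_cinner: "bounded_bilinear (cinner :: 'a::complex_hilbert \<Rightarrow> 'a \<Rightarrow> complex)"
proof
  fix x y z :: 'a and r :: real
  show "cinner (x + y) z = cinner x z + cinner y z" by (rule cinner_add_left)
  show "cinner x (y + z) = cinner x y + cinner x z" by (rule cinner_add_right)
  show "cinner (r *\<^sub>R x) z = r *\<^sub>R cinner x z"
    by (simp add: scaleR_scaleC cinner_scaleC_left scaleR_conv_of_real scaleC_complex_def)
  show "cinner x (r *\<^sub>R z) = r *\<^sub>R cinner x z"
    by (simp add: scaleR_scaleC cinner_scaleC_right scaleC_complex_def)
  show "\<exists>K. \<forall>a b :: 'a. norm (cinner a b) \<le> norm a * norm b * K"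
  proof (intro exI allI)
    fix a b :: 'a
    have "norm (cinner a b) \<le> \<bar>inner a b\<bar> + \<bar>inner (\<i> *\<^sub>C a) b\<bar>"
      by (metis cinner_eq cmod_le complex.sel)
    also have "\<dots> \<le> norm a * norm b * 2"
      using Cauchy_Schwarz_ineq2 [of a b] Cauchy_Schwarz_ineq2 [of "\<i> *\<^sub>C a" b]
      by (simp add: norm_scaleC)
    finally show "norm (cinner a b) \<le> norm a * norm b * 2" .
  qed
qed

interpretation cinner: bounded_bilinear cinner
  by (rule bounded_bilinear_cinner)

lemma cinner_ext: "x = y" if "\<And>z. cinner x z = cinner y (z :: 'a::complex_hilbert)"
proof -
  have "cinner (x - y) (x - y) = 0"
    by (simp add: cinner.diff_left that)
  then show ?thesis by (simp add: cinner_self)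
qed

lemma cinner_ext': "x = y" if "\<And>z. cinner z x = cinner z (y :: 'a::complex_hilbert)"
  by (rule cinner_ext) (metis cinner_commute that)

lemma norm_eq_if_cinner_eq:
  "norm x = norm y" if "cinner x x = cinner y y" for x :: "'a::complex_hilbert" and y :: "'b::complex_hilbert"
  using that unfolding cinner_self of_real_eq_iff by (simp add: power2_eq_iff_nonneg)

text \<open>A minimising sequence for the distance is Cauchy by the parallelogram law.\<close>

lemma orthogonal_projection_exists:
  fixes V :: "'a::{real_inner,banach} set"
  assumes V: "subspace V" and cl: "closed V"
  obtains p where "p \<in> V" "\<And>v. v \<in> V \<Longrightarrow> inner (x - p) v = 0"
proof -
  define D where "D = (\<lambda>v. (norm (x - v))\<^sup>2) ` V"
  have ne: "D \<noteq> {}" and bdd: "bdd_below D"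
    using subspace_0 [OF V] by (auto simp: D_def intro!: bdd_belowI2 [where m = 0])
  define d where "d = Inf D"
  have dle: "d \<le> (norm (x - v))\<^sup>2" if "v \<in> V" for v
    unfolding d_def by (rule cInf_lower [OF _ bdd]) (use that D_def in auto)
  have "\<exists>v\<in>V. (norm (x - v))\<^sup>2 < d + 1 / real (Suc n)" for n
    using cInf_lessD [OF ne, of "d + 1 / real (Suc n)"] by (auto simp: d_def D_def)
  then obtain v where vV: "v n \<in> V" and vd: "(norm (x - v n))\<^sup>2 < d + 1 / real (Suc n)" for n
    by metis
  have gap: "(norm (v n - v m))\<^sup>2 \<le> 2 / real (Suc n) + 2 / real (Suc m)" for m n
  proof -
    have "(1/2) *\<^sub>R (v n + v m) \<in> V"
      by (intro subspace_scale subspace_add V vV)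
    then have "d \<le> (norm (x - (1/2) *\<^sub>R (v n + v m)))\<^sup>2" by (rule dle)
    moreover have "(norm (v n - v m))\<^sup>2 = 2 * (norm (x - v n))\<^sup>2 + 2 * (norm (x - v m))\<^sup>2
      - 4 * (norm (x - (1/2) *\<^sub>R (v n + v m)))\<^sup>2"
      by (simp add: power2_norm_eq_inner inner_diff_left inner_diff_right inner_add_left
          inner_add_right inner_commute algebra_simps)
    ultimately show ?thesis using vd [of n] vd [of m] by simp
  qed
  have "Cauchy v"
  proof (rule CauchyI)
    fix e :: real assume e: "0 < e"
    then obtain N :: nat where N: "inverse (real (Suc N)) < e\<^sup>2 / 4"
      using reals_Archimedean [of "e\<^sup>2 / 4"] by auto
    have "norm (v m - v n) < e" if "m \<ge> N" "n \<ge> N" for m n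
    proof (rule power2_less_imp_less)
      have "1 / real (Suc k) < e\<^sup>2 / 4" if "k \<ge> N" for k
      proof -
        have "1 / real (Suc k) \<le> inverse (real (Suc N))"
          using that by (simp add: inverse_eq_divide frac_le)
        with N show ?thesis by linarith
      qed
      from this [OF that(1)] this [OF that(2)]
      show "(norm (v m - v n))\<^sup>2 < e\<^sup>2" using gap [of m n] by simp
    qed (use e in simp)
    then show "\<exists>M. \<forall>m\<ge>M. \<forall>n\<ge>M. norm (v m - v n) < e" by blast
  qed
  then obtain p where p: "v \<longlonglongrightarrow> p" using Cauchy_convergent convergent_def by blast
  have pV: "p \<in> V" using closed_sequentially [OF cl] vV p by blast
  have "(norm (x - p))\<^sup>2 \<le> d"
  proof (rule LIMSEQ_le)
    show "(\<lambda>n. (norm (x - v n))\<^sup>2) \<longlonglongrightarrow> (norm (x - p))\<^sup>2" by (intro tendsto_intros p)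
    show "(\<lambda>n. d + 1 / real (Suc n)) \<longlonglongrightarrow> d"
      using tendsto_add [OF tendsto_const [of d] LIMSEQ_inverse_real_of_nat]
      by (simp add: inverse_eq_divide)
    show "\<exists>N. \<forall>n\<ge>N. (norm (x - v n))\<^sup>2 \<le> d + 1 / real (Suc n)"
      using vd less_imp_le by blast
  qed
  then have min: "(norm (x - p))\<^sup>2 \<le> (norm (x - w))\<^sup>2" if "w \<in> V" for w
    using dle [OF that] by (rule order_trans)
  have "inner (x - p) u = 0" if u: "u \<in> V" for u
  proof (cases "u = 0")
    case False
    define t where "t = inner (x - p) u / (norm u)\<^sup>2"
    have "(norm (x - p))\<^sup>2 \<le> (norm (x - (p + t *\<^sub>R u)))\<^sup>2"
      by (intro min subspace_add subspace_scale V pV u)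
    also have "\<dots> = (norm (x - p))\<^sup>2 - 2 * t * inner (x - p) u + t\<^sup>2 * (norm u)\<^sup>2"
      by (simp add: power2_norm_eq_inner inner_diff_left inner_diff_right inner_add_left
          inner_add_right inner_commute algebra_simps) (simp add: power2_eq_square)
    also have "\<dots> = (norm (x - p))\<^sup>2 - (inner (x - p) u)\<^sup>2 / (norm u)\<^sup>2"
    proof -
      have "t * inner (x - p) u = (inner (x - p) u)\<^sup>2 / (norm u)\<^sup>2"
        by (simp add: t_def power2_eq_square)
      moreover have "t\<^sup>2 * (norm u)\<^sup>2 = (inner (x - p) u)\<^sup>2 / (norm u)\<^sup>2"
        using False by (simp add: t_def power2_eq_square)
      ultimately show ?thesis by simp
    qed
    finally have "(inner (x - p) u)\<^sup>2 / (norm u)\<^sup>2 \<le> 0" by simp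
    then show ?thesis using False
      by (simp add: divide_le_0_iff power2_less_0 not_le)
  qed simp
  with pV that show thesis by blast
qed

lemma riesz_representation:
  fixes f :: "'a::{real_inner,banach} \<Rightarrow> real"
  assumes "bounded_linear f"
  obtains y where "\<And>x. f x = inner x y"
proof (cases "\<forall>x. f x = 0")
  case True
  then show ?thesis using that [of 0] by simp
next
  case False
  then obtain x0 where x0: "f x0 \<noteq> 0" by blast
  interpret f: bounded_linear f by fact
  have V: "subspace {x. f x = 0}" by (auto simp: subspace_def f.add f.scaleR)
  have cl: "closed {x. f x = 0}"
    by (intro closed_Collect_eq linear_continuous_on assms continuous_on_const)
  obtain p where p: "f p = 0" and orth: "\<And>v. f v = 0 \<Longrightarrow> inner (x0 - p) v = 0"
    using orthogonal_projection_exists [OF V cl, of x0] by auto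
  define z where "z = x0 - p"
  have fz: "f z = f x0" by (simp add: z_def f.diff p)
  then have z0: "z \<noteq> 0" using x0 by (metis f.zero)
  have "f x = inner x ((f z / (norm z)\<^sup>2) *\<^sub>R z)" for x
  proof -
    have "f (x - (f x / f z) *\<^sub>R z) = 0"
      using fz x0 by (simp add: f.diff f.scaleR)
    then have "inner z (x - (f x / f z) *\<^sub>R z) = 0" using orth z_def by simp
    then have eq: "inner x z = f x / f z * (norm z)\<^sup>2"
      by (simp add: inner_diff_right power2_norm_eq_inner inner_commute)
    have "(f z / (norm z)\<^sup>2) * (f x / f z * (norm z)\<^sup>2) = f x"
      using fz x0 z0 by simp
    then show ?thesis by (simp only: inner_scaleR_right eq)
  qed
  then show ?thesis by (rule that)
qed

definition adjoint_pair ::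
  "('a::complex_hilbert \<Rightarrow>\<^sub>L 'b::complex_hilbert) \<Rightarrow> ('b \<Rightarrow>\<^sub>L 'a) \<Rightarrow> bool" where
  "adjoint_pair A B \<longleftrightarrow> (\<forall>x y. cinner (A x) y = cinner x (B y))"

definition clin :: "('a::complex_hilbert \<Rightarrow>\<^sub>L 'b::complex_hilbert) \<Rightarrow> bool" where
  "clin A \<longleftrightarrow> (\<forall>c x. A (c *\<^sub>C x) = c *\<^sub>C A x)"

lemma clinear_ops_iff_clin: "A \<in> clinear_ops \<longleftrightarrow> clin A"
  by (simp add: clinear_ops_def clin_def)

lemma adjoint_pairD: "adjoint_pair A B \<Longrightarrow> cinner (A x) y = cinner x (B y)"
  by (simp add: adjoint_pair_def)

lemma adjoint_pairI:
  "(\<And>x y. cinner (blinfun_apply A x) y = cinner x (blinfun_apply B y)) \<Longrightarrow> adjoint_pair A B"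
  by (simp add: adjoint_pair_def)

lemma adjoint_pair_sym: "adjoint_pair A B \<Longrightarrow> adjoint_pair B A"
  unfolding adjoint_pair_def by (metis cinner_commute)

lemma adjoint_pair_clin: "adjoint_pair A B \<Longrightarrow> clin A"
  unfolding clin_def
  by (intro allI, rule cinner_ext) (simp add: adjoint_pairD cinner_scaleC_left)

lemma adjoint_pair_clin2: "adjoint_pair A B \<Longrightarrow> clin B"
  by (rule adjoint_pair_clin [OF adjoint_pair_sym])

lemma adjoint_pair_unique: "adjoint_pair A B \<Longrightarrow> adjoint_pair A C \<Longrightarrow> B = C"
  by (rule blinfun_eqI, rule cinner_ext') (metis adjoint_pairD)

lemma adjoint_pair_comp:
  "adjoint_pair A B \<Longrightarrow> adjoint_pair C D \<Longrightarrow> adjoint_pair (A o\<^sub>L C) (D o\<^sub>L B)"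
  by (simp add: adjoint_pair_def)

lemma adjoint_pair_add:
  "adjoint_pair A B \<Longrightarrow> adjoint_pair C D \<Longrightarrow> adjoint_pair (A + C) (B + D)"
  by (simp add: adjoint_pair_def blinfun.add_left cinner_add_left cinner_add_right)

lemma adjoint_pair_diff:
  "adjoint_pair A B \<Longrightarrow> adjoint_pair C D \<Longrightarrow> adjoint_pair (A - C) (B - D)"
  by (simp add: adjoint_pair_def blinfun.diff_left cinner.diff_left cinner.diff_right)

lemma adjoint_pair_scaleR: "adjoint_pair A B \<Longrightarrow> adjoint_pair (r *\<^sub>R A) (r *\<^sub>R B)"
  by (simp add: adjoint_pair_def blinfun.scaleR_left cinner.scaleR_left cinner.scaleR_right)

lemma adjoint_pair_zero: "adjoint_pair 0 0"
  by (simp add: adjoint_pair_def cinner.zero_left cinner.zero_right)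

lemma adjoint_pair_id: "adjoint_pair id_blinfun id_blinfun"
  by (simp add: adjoint_pair_def)

lemma adjoint_pair_sum:
  "(\<And>i. i \<in> S \<Longrightarrow> adjoint_pair (A i) (B i)) \<Longrightarrow> adjoint_pair (sum A S) (sum B S)"
  by (induction S rule: infinite_finite_induct) (auto intro: adjoint_pair_zero adjoint_pair_add)

lemma adjoint_pair_exists:
  assumes "clin A"
  obtains B where "adjoint_pair A B"
proof -
  have "\<exists>z. \<forall>x. inner (A x) y = inner x z" for y
  proof -
    have "bounded_linear (\<lambda>x. inner (A x) y)"
      by (rule bounded_linear_compose [OF bounded_linear_inner_left blinfun.bounded_linear_right])
    from riesz_representation [OF this] show ?thesis by metis
  qed
  then obtain b where b: "\<And>x y. inner (A x) y = inner x (b y)" by metis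
  have ext: "u = v" if "\<And>x. inner x u = inner x v" for u v :: 'a
    using that [of "u - v"] by (metis inner_diff_right inner_eq_zero_iff right_minus_eq)
  have "bounded_linear b"
  proof (rule bounded_linear_intro [where K = "norm A"])
    show "b (y + z) = b y + b z" for y z
      by (rule ext) (simp add: b [symmetric] inner_add_right)
    show "b (r *\<^sub>R y) = r *\<^sub>R b y" for r y
      by (rule ext) (simp add: b [symmetric])
    show "norm (b y) \<le> norm y * norm A" for y
    proof (cases "b y = 0")
      case False
      have "norm (b y) * norm (b y) = inner (A (b y)) y"
        by (simp add: b power2_norm_eq_inner [symmetric] power2_eq_square)
      also have "\<dots> \<le> norm (A (b y)) * norm y" by (rule norm_cauchy_schwarz)
      also have "\<dots> \<le> (norm A * norm (b y)) * norm y"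
        by (intro mult_right_mono norm_blinfun) simp
      finally show ?thesis using False by (simp add: algebra_simps)
    qed simp
  qed
  then have B: "blinfun_apply (Blinfun b) = b" by (rule bounded_linear_Blinfun_apply)
  have "adjoint_pair A (Blinfun b)"
  proof (rule adjoint_pairI)
    show "cinner (A x) y = cinner x (Blinfun b y)" for x y
      using assms unfolding cinner_eq B clin_def by (simp flip: b)
  qed
  then show thesis by (rule that)
qed

definition hadj :: "('a::complex_hilbert \<Rightarrow>\<^sub>L 'b::complex_hilbert) \<Rightarrow> ('b \<Rightarrow>\<^sub>L 'a)" where
  "hadj A = (THE B. adjoint_pair A B)"

lemma hadj_eqI: "adjoint_pair A B \<Longrightarrow> hadj A = B"
  unfolding hadj_def by (blast intro: the_equality adjoint_pair_unique)

lemma adjoint_pair_hadj: "clin A \<Longrightarrow> adjoint_pair A (hadj A)"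
  by (metis adjoint_pair_exists hadj_eqI)

lemma adj_eq_hadj: "adj = hadj"
  by (simp add: fun_eq_iff adj_def hadj_def adjoint_pair_def)

lemma adj_eqI: "adjoint_pair A B \<Longrightarrow> adj A = B"
  by (simp add: adj_eq_hadj hadj_eqI)

lemma adjoint_pair_adj: "clin A \<Longrightarrow> adjoint_pair A (adj A)"
  by (simp add: adj_eq_hadj adjoint_pair_hadj)

lemma adj_adj: "clin A \<Longrightarrow> adj (adj A) = A"
  by (rule adj_eqI [OF adjoint_pair_sym [OF adjoint_pair_adj]])

lemma adj_comp: "clin A \<Longrightarrow> clin B \<Longrightarrow> adj (A o\<^sub>L B) = adj B o\<^sub>L adj A"
  by (intro adj_eqI adjoint_pair_comp adjoint_pair_adj)

lemma adj_add: "clin A \<Longrightarrow> clin B \<Longrightarrow> adj (A + B) = adj A + adj B"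
  by (intro adj_eqI adjoint_pair_add adjoint_pair_adj)

lemma adj_diff: "clin A \<Longrightarrow> clin B \<Longrightarrow> adj (A - B) = adj A - adj B"
  by (intro adj_eqI adjoint_pair_diff adjoint_pair_adj)

lemma adj_scaleR: "clin A \<Longrightarrow> adj (r *\<^sub>R A) = r *\<^sub>R adj A"
  by (intro adj_eqI adjoint_pair_scaleR adjoint_pair_adj)

lemma adj_id [simp]: "adj id_blinfun = id_blinfun"
  by (intro adj_eqI adjoint_pair_id)

lemma adj_zero [simp]: "adj 0 = 0"
  by (intro adj_eqI adjoint_pair_zero)

lemma clin_zero [simp, intro]: "clin 0" and clin_id [simp, intro]: "clin id_blinfun"
  by (simp_all add: clin_def)

lemma clin_comp [intro]: "clin A \<Longrightarrow> clin B \<Longrightarrow> clin (A o\<^sub>L B)"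
  and clin_add [intro]: "clin A \<Longrightarrow> clin C \<Longrightarrow> clin (A + C)"
  and clin_diff [intro]: "clin A \<Longrightarrow> clin C \<Longrightarrow> clin (A - C)"
  and clin_scaleR [intro]: "clin A \<Longrightarrow> clin (r *\<^sub>R A)"
  by (simp_all add: clin_def blinfun.add_left blinfun.diff_left blinfun.scaleR_left
      scaleC_add_right scaleC_diff_right scaleR_scaleC scaleC_scaleC mult.commute)

lemma clin_sum [intro]: "(\<And>i. i \<in> S \<Longrightarrow> clin (A i)) \<Longrightarrow> clin (sum A S)"
  by (induction S rule: infinite_finite_induct) auto

lemma clin_adj [intro]: "clin A \<Longrightarrow> clin (adj A)"
  by (metis adjoint_pair_adj adjoint_pair_clin2)

lemma norm_adjoint_pair_le: "adjoint_pair A B \<Longrightarrow> norm B \<le> norm A"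
proof (rule norm_blinfun_bound)
  fix y assume AB: "adjoint_pair A B"
  show "norm (B y) \<le> norm A * norm y"
  proof (cases "B y = 0")
    case False
    have "norm (B y) * norm (B y) = inner (A (B y)) y"
      by (simp add: inner_Re_cinner adjoint_pairD [OF AB] cinner_self power2_eq_square)
    also have "\<dots> \<le> norm (A (B y)) * norm y" by (rule norm_cauchy_schwarz)
    also have "\<dots> \<le> (norm A * norm (B y)) * norm y"
      by (intro mult_right_mono norm_blinfun) simp
    finally show ?thesis using False by (simp add: algebra_simps)
  qed simp
qed simp

lemma norm_adjoint_pair: "adjoint_pair A B \<Longrightarrow> norm B = norm A"
  by (meson adjoint_pair_sym norm_adjoint_pair_le order_antisym)

lemma norm_adj: "clin A \<Longrightarrow> norm (adj A) = norm A"
  by (intro norm_adjoint_pair adjoint_pair_adj)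

text \<open>An operator with \<open>A = Z\<^sup>* Z\<close> satisfies the C*-identity; the adjoint
  of \<open>Z\<close> is avoided by using the form only.\<close>

lemma norm_gram:
  fixes Z :: "'a::complex_hilbert \<Rightarrow>\<^sub>L 'b::complex_hilbert" and A :: "'a bop"
  assumes "\<And>h k. cinner h (A k) = cinner (Z h) (Z k)"
  shows "norm A = (norm Z)\<^sup>2"
proof (rule order_antisym)
  show "norm A \<le> (norm Z)\<^sup>2"
  proof (rule norm_blinfun_bound)
    fix x
    show "norm (A x) \<le> (norm Z)\<^sup>2 * norm x"
    proof (cases "A x = 0")
      case False
      have "norm (A x) * norm (A x) = Re (cinner (A x) (A x))"
        by (simp add: cinner_self power2_eq_square)
      also have "\<dots> = inner (Z (A x)) (Z x)" by (simp add: assms inner_Re_cinner)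
      also have "\<dots> \<le> norm (Z (A x)) * norm (Z x)" by (rule norm_cauchy_schwarz)
      also have "\<dots> \<le> (norm Z * norm (A x)) * (norm Z * norm x)"
        by (intro mult_mono norm_blinfun) auto
      finally show ?thesis using False by (simp add: power2_eq_square algebra_simps)
    qed simp
  qed simp
  have "norm Z \<le> sqrt (norm A)"
  proof (rule norm_blinfun_bound)
    fix x
    have "(norm (Z x))\<^sup>2 = inner x (A x)"
      by (simp add: inner_Re_cinner assms cinner_self)
    also have "\<dots> \<le> norm x * norm (A x)" by (rule norm_cauchy_schwarz)
    also have "\<dots> \<le> norm x * (norm A * norm x)" by (intro mult_left_mono norm_blinfun) simp
    also have "\<dots> = (sqrt (norm A) * norm x)\<^sup>2" by (simp add: power2_eq_square algebra_simps)
    finally show "norm (Z x) \<le> sqrt (norm A) * norm x" by (rule power2_le_imp_le) simp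
  qed simp
  then have "(norm Z)\<^sup>2 \<le> (sqrt (norm A))\<^sup>2" by (intro power_mono) auto
  then show "(norm Z)\<^sup>2 \<le> norm A" by simp
qed

lemma norm_adjoint_pair_comp: "adjoint_pair A B \<Longrightarrow> norm (B o\<^sub>L A) = (norm A)\<^sup>2"
  by (rule norm_gram) (simp add: adjoint_pairD)

lemma bounded_linear_scaleC: "bounded_linear (\<lambda>x :: 'a::complex_hilbert. c *\<^sub>C x)"
  by (rule bounded_linear_intro [where K = "cmod c"])
    (simp_all add: scaleC_add_right scaleR_scaleC scaleC_scaleC mult.commute norm_scaleC)

definition cscale :: "complex \<Rightarrow> 'a::complex_hilbert bop" where
  "cscale c = Blinfun (\<lambda>x. c *\<^sub>C x)"

lemma cscale_apply [simp]: "cscale c x = c *\<^sub>C x"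
  by (simp add: cscale_def bounded_linear_Blinfun_apply bounded_linear_scaleC)

lemma scale_op_eq: "scale_op c T = cscale c o\<^sub>L T"
proof -
  have "bounded_linear (\<lambda>x. c *\<^sub>C T x)"
    by (rule bounded_linear_compose [OF bounded_linear_scaleC blinfun.bounded_linear_right])
  then show ?thesis
    by (intro blinfun_eqI) (simp add: scale_op_def bounded_linear_Blinfun_apply)
qed

lemma scale_op_apply: "scale_op c T x = c *\<^sub>C T x"
  by (simp add: scale_op_eq)

lemma adjoint_pair_cscale: "adjoint_pair (cscale c) (cscale (cnj c))"
  by (simp add: adjoint_pair_def cinner_scaleC_left cinner_scaleC_right)

lemma clin_cscale [simp, intro]: "clin (cscale c)"
  by (rule adjoint_pair_clin [OF adjoint_pair_cscale])

lemma cscale_commute: "clin T \<Longrightarrow> T o\<^sub>L cscale c = cscale c o\<^sub>L T"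
  by (rule blinfun_eqI) (simp add: clin_def)

lemma cscale_of_real: "cscale (complex_of_real r) o\<^sub>L T = r *\<^sub>R T"
  by (rule blinfun_eqI) (simp add: scaleC_of_real blinfun.scaleR_left)

lemma clin_scale_op [intro]: "clin T \<Longrightarrow> clin (scale_op c T)"
  unfolding scale_op_eq by auto

lemma closed_clin: "closed {T. clin T}"
proof -
  have "{T :: 'a \<Rightarrow>\<^sub>L 'b. clin T} =
      (\<Inter>c. \<Inter>x. {T. blinfun_apply T (c *\<^sub>C x) = c *\<^sub>C blinfun_apply T x})"
    by (auto simp: clin_def)
  moreover have "closed {T :: 'a \<Rightarrow>\<^sub>L 'b. blinfun_apply T (c *\<^sub>C x) = c *\<^sub>C blinfun_apply T x}" for c x
    by (intro closed_Collect_eq bounded_linear.continuous_on [OF bounded_linear_scaleC]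
        bounded_linear.continuous_on [OF blinfun.bounded_linear_left] continuous_on_id)
  ultimately show ?thesis by (simp only:) (intro closed_INT ballI)
qed

text \<open>Only real parts of the quadratic form are needed, so this holds for real adjointness.\<close>

lemma norm_selfadjoint_le:
  fixes T :: "'a::complex_hilbert bop"
  assumes T: "adjoint_pair T T" and M: "\<And>x. \<bar>inner (T x) x\<bar> \<le> M * (norm x)\<^sup>2" and "0 \<le> M"
  shows "norm T \<le> M"
proof (rule norm_blinfun_bound [OF \<open>0 \<le> M\<close>])
  fix x
  show "norm (T x) \<le> M * norm x"
  proof (cases "T x = 0")
    case False
    then have x0: "x \<noteq> 0" by auto
    define y where "y = (norm x / norm (T x)) *\<^sub>R T x"
    have ny: "norm y = norm x" using False by (simp add: y_def)
    have sym: "inner (T u) v = inner u (T v)" for u v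
      by (simp add: inner_Re_cinner adjoint_pairD [OF T])
    have "4 * inner (T x) y = inner (T (x + y)) (x + y) - inner (T (x - y)) (x - y)"
      using sym [of y x]
      by (simp add: blinfun.add_right blinfun.diff_right inner_add_left inner_add_right
          inner_diff_left inner_diff_right inner_commute)
    also have "\<dots> \<le> M * (norm (x + y))\<^sup>2 + M * (norm (x - y))\<^sup>2"
      using M [of "x + y"] M [of "x - y"] by linarith
    also have "\<dots> = M * (2 * (norm x)\<^sup>2 + 2 * (norm y)\<^sup>2)"
      by (simp add: power2_norm_eq_inner algebra_simps inner_commute)
    also have "\<dots> = 4 * (M * (norm x)\<^sup>2)" using ny by simp
    finally have "inner (T x) y \<le> M * (norm x)\<^sup>2" by simp
    moreover have "inner (T x) y = norm x * norm (T x)"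
      using False by (simp add: y_def power2_norm_eq_inner [symmetric] power2_eq_square)
    ultimately show ?thesis using x0 by (simp add: power2_eq_square algebra_simps)
  qed (simp add: \<open>0 \<le> M\<close>)
qed

section \<open>Operator C*-algebras without spectral theory\<close>

lemmas blf_simps = blinfun.add_left blinfun.add_right blinfun.diff_left blinfun.diff_right
  blinfun.scaleR_left blinfun.scaleR_right blinfun.zero_left blinfun.zero_right
  blinfun.minus_left blinfun.minus_right

lemmas cinner_simps = cinner.add_left cinner.add_right cinner.diff_left cinner.diff_right
  cinner.scaleR_left cinner.scaleR_right cinner.zero_left cinner.zero_right

locale concrete_cstar =
  fixes B :: "'h::complex_hilbert bop set"
  assumes closed_B: "closed B"
    and clin_B: "a \<in> B \<Longrightarrow> clin a"
    and zero_B: "0 \<in> B"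
    and add_B: "a \<in> B \<Longrightarrow> b \<in> B \<Longrightarrow> a + b \<in> B"
    and scale_B: "a \<in> B \<Longrightarrow> scale_op c a \<in> B"
    and mult_B: "a \<in> B \<Longrightarrow> b \<in> B \<Longrightarrow> a o\<^sub>L b \<in> B"
    and adj_B: "a \<in> B \<Longrightarrow> adj a \<in> B"
begin

lemma scaleR_B: "a \<in> B \<Longrightarrow> r *\<^sub>R a \<in> B"
  using scale_B [of a "complex_of_real r"] by (simp add: scale_op_eq cscale_of_real)

lemma diff_B: "a \<in> B \<Longrightarrow> b \<in> B \<Longrightarrow> a - b \<in> B"
  using add_B [of a "- 1 *\<^sub>R b"] scaleR_B [of b "- 1"] by simp

text \<open>The element \<open>w\<close> is \<open>1 - sqrt (1 - c)\<close>.  The iteration for it converges because it is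
  dominated by the same iteration for the number \<open>1\<close>; since \<open>w\<close> has no constant term in \<open>c\<close>,
  no unit is needed in the algebra.\<close>

lemma one_minus_sqrt_exists:
  assumes c: "c \<in> B" and sa: "adj c = c" and nc: "norm c \<le> 1"
  obtains w where "w \<in> B" "adj w = w" "norm w \<le> 1" "2 *\<^sub>R w - (w o\<^sub>L w) = c"
    "\<And>T. T o\<^sub>L c = c o\<^sub>L T \<Longrightarrow> T o\<^sub>L w = w o\<^sub>L T"
proof -
  define v where "v = rec_nat 0 (\<lambda>_ w. (1/2) *\<^sub>R (c + (w o\<^sub>L w)))"
  define r where "r = rec_nat (0::real) (\<lambda>_ t. (1 + t * t) / 2)"
  have v0: "v 0 = 0" and vS: "v (Suc n) = (1/2) *\<^sub>R (c + (v n o\<^sub>L v n))" for n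
    by (simp_all add: v_def)
  have r0: "r 0 = 0" and rS: "r (Suc n) = (1 + r n * r n) / 2" for n
    by (simp_all add: r_def)
  have rpos: "0 \<le> r n" and r1: "r n \<le> 1" for n
  proof (induction n)
    case (Suc n)
    { case 1 then show ?case using Suc by (simp add: rS) }
    { case 2 then show ?case using Suc mult_le_one [of "r n" "r n"] by (simp add: rS) }
  qed (simp_all add: r0)
  have vr: "norm (v n) \<le> r n" for n
  proof (induction n)
    case (Suc n)
    have "norm (c + (v n o\<^sub>L v n)) \<le> norm c + norm (v n o\<^sub>L v n)" by (rule norm_triangle_ineq)
    also have "\<dots> \<le> 1 + r n * r n"
      by (intro add_mono nc order_trans [OF norm_blinfun_compose] mult_mono Suc norm_ge_zero rpos)
    finally show ?case by (simp add: vS rS)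
  qed (simp add: v0 r0)
  have step: "norm (v (Suc n) - v n) \<le> r (Suc n) - r n" for n
  proof (induction n)
    case 0
    then show ?case using nc by (simp add: vS rS v0 r0)
  next
    case (Suc n)
    let ?d = "v (Suc n) - v n"
    have eq: "v (Suc (Suc n)) - v (Suc n) = (1/2) *\<^sub>R ((v (Suc n) o\<^sub>L ?d) + (?d o\<^sub>L v n))"
      unfolding vS [of "Suc n"]
      by (subst (2) vS) (rule blinfun_eqI, simp add: blf_simps algebra_simps)
    have "norm ((v (Suc n) o\<^sub>L ?d) + (?d o\<^sub>L v n))
        \<le> norm (v (Suc n) o\<^sub>L ?d) + norm (?d o\<^sub>L v n)"
      by (rule norm_triangle_ineq)
    also have "\<dots> \<le> r (Suc n) * (r (Suc n) - r n) + (r (Suc n) - r n) * r n"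
      by (intro add_mono order_trans [OF norm_blinfun_compose] mult_mono vr Suc norm_ge_zero rpos
          order_trans [OF norm_ge_zero Suc])
    also have "\<dots> = 2 * (r (Suc (Suc n)) - r (Suc n))"
      by (simp add: rS [of "Suc n"]) (simp add: rS [of n] algebra_simps)
    finally show ?case unfolding eq by simp
  qed
  have mono: "incseq r"
    by (intro incseq_SucI) (metis step norm_ge_zero diff_ge_0_iff_ge order_trans)
  then have "convergent r"
    using r1 rpos by (intro Bseq_mono_convergent BseqI' [where K = 1]) (auto simp: incseq_def)
  then have "Cauchy r" by (rule convergent_Cauchy)
  have vdist: "norm (v (n + k) - v n) \<le> r (n + k) - r n" for n k
  proof (induction k)
    case (Suc k)
    have "norm (v (Suc (n + k)) - v n) \<le> norm (v (Suc (n + k)) - v (n + k)) + norm (v (n + k) - v n)"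
      using norm_triangle_ineq [of "v (Suc (n + k)) - v (n + k)" "v (n + k) - v n"] by simp
    then show ?case using step [of "n + k"] Suc by simp
  qed simp
  have "Cauchy v"
  proof (rule CauchyI)
    fix e :: real assume "0 < e"
    then obtain M where M: "\<And>m n. m \<ge> M \<Longrightarrow> n \<ge> M \<Longrightarrow> norm (r m - r n) < e"
      using \<open>Cauchy r\<close> CauchyD by metis
    have "norm (v m - v n) < e" if "m \<ge> n" "n \<ge> M" for m n
      using vdist [of n "m - n"] M [of m n] that by (simp add: abs_if split: if_splits)
    then have "norm (v m - v n) < e" if "m \<ge> M" "n \<ge> M" for m n
      using that by (metis linorder_le_cases norm_minus_commute)
    then show "\<exists>M. \<forall>m\<ge>M. \<forall>n\<ge>M. norm (v m - v n) < e" by blast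
  qed
  then obtain w where w: "v \<longlonglongrightarrow> w" using Cauchy_convergent convergent_def by blast
  have vB: "v n \<in> B" for n
    by (induction n) (simp_all add: v0 vS zero_B scaleR_B add_B mult_B c)
  have vsa: "adj (v n) = v n" for n
    by (induction n) (simp_all add: v0 vS adj_scaleR adj_add adj_comp clin_B vB c sa clin_add clin_comp)
  have vcomm: "T o\<^sub>L v n = v n o\<^sub>L T" if "T o\<^sub>L c = c o\<^sub>L T" for T n
  proof (induction n)
    case (Suc n)
    have "blinfun_apply T (c x) = c (T x)" "blinfun_apply T (v n x) = v n (T x)" for x
      using that Suc by (metis blinfun_apply_blinfun_compose)+
    then show ?case by (intro blinfun_eqI) (simp add: vS blf_simps)
  qed (simp add: v0)
  show thesis
  proof (rule that)
    show "w \<in> B" using closed_sequentially [OF closed_B] vB w by blast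
    have lim: "(\<lambda>n. (1/2) *\<^sub>R (c + (v n o\<^sub>L v n))) \<longlonglongrightarrow> (1/2) *\<^sub>R (c + (w o\<^sub>L w))"
      by (intro tendsto_intros w)
    have "(\<lambda>n. v (Suc n)) \<longlonglongrightarrow> w" using w by (rule LIMSEQ_Suc)
    then have "w = (1/2) *\<^sub>R (c + (w o\<^sub>L w))" using lim unfolding vS by (rule LIMSEQ_unique)
    from arg_cong [OF this, of "\<lambda>T. 2 *\<^sub>R T"]
    have "2 *\<^sub>R w = c + (w o\<^sub>L w)" by simp
    then show "2 *\<^sub>R w - (w o\<^sub>L w) = c" by simp
    show "norm w \<le> 1"
      by (rule LIMSEQ_le_const2 [OF tendsto_norm [OF w]]) (meson vr r1 order_trans)
    show "adj w = w"
    proof (rule adj_eqI, rule adjoint_pairI)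
      fix x y
      have "(\<lambda>n. cinner (v n x) y) \<longlonglongrightarrow> cinner (w x) y" "(\<lambda>n. cinner x (v n y)) \<longlonglongrightarrow> cinner x (w y)"
        by (intro cinner.tendsto tendsto_intros w)+
      moreover have "cinner (v n x) y = cinner x (v n y)" for n
        using adjoint_pair_adj [OF clin_B [OF vB [of n]]] by (simp add: vsa adjoint_pairD)
      ultimately show "cinner (w x) y = cinner x (w y)" using LIMSEQ_unique by auto
    qed
    show "T o\<^sub>L w = w o\<^sub>L T" if "T o\<^sub>L c = c o\<^sub>L T" for T
    proof (rule LIMSEQ_unique)
      show "(\<lambda>n. T o\<^sub>L v n) \<longlonglongrightarrow> (T o\<^sub>L w)" by (intro tendsto_intros w)
      show "(\<lambda>n. T o\<^sub>L v n) \<longlonglongrightarrow> (w o\<^sub>L T)"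
        unfolding vcomm [OF that] by (intro tendsto_intros w)
    qed
  qed
qed

end

text \<open>Uniqueness of positive square roots, for commuting operators.\<close>

lemma positive_sqrt_unique:
  assumes p: "adjoint_pair p p" and q: "adjoint_pair q q"
    and pos: "\<And>x. 0 \<le> inner (blinfun_apply p x) x" "\<And>x. 0 \<le> inner (blinfun_apply q x) x"
    and comm: "p o\<^sub>L q = q o\<^sub>L p" and sq: "p o\<^sub>L p = q o\<^sub>L q"
  shows "p = q"
proof -
  define r where "r = p - q"
  have r: "adjoint_pair r r" unfolding r_def by (intro adjoint_pair_diff p q)
  have sym: "inner (r x) y = inner x (r y)" for x y
    by (simp add: inner_Re_cinner adjoint_pairD [OF r])
  have "inner (r (r x)) (r x) = 0" for x
  proof -
    have "blinfun_apply p (q x) = q (p x)" "blinfun_apply p (p x) = q (q x)"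
      using comm sq by (metis blinfun_apply_blinfun_compose)+
    then have "p (r x) + q (r x) = 0"
      by (simp add: r_def blinfun.diff_left blinfun.diff_right)
    then have "inner (p (r x)) (r x) + inner (q (r x)) (r x) = 0"
      by (metis inner_add_left inner_zero_left)
    then have "inner (p (r x)) (r x) = 0" "inner (q (r x)) (r x) = 0"
      using pos [of "r x"] by linarith+
    then show ?thesis by (simp add: r_def [of] blinfun.diff_left inner_diff_left)
  qed
  then have "\<bar>inner ((r o\<^sub>L r o\<^sub>L r) x) x\<bar> \<le> 0 * (norm x)\<^sup>2" for x
    by (simp add: sym)
  then have "norm (r o\<^sub>L r o\<^sub>L r) \<le> 0"
    by (intro norm_selfadjoint_le) (use r in \<open>auto simp: adjoint_pair_def\<close>)
  then have r3: "blinfun_apply r (r (r x)) = 0" for x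
    by (metis blinfun_apply_blinfun_compose norm_le_zero_iff zero_blinfun.rep_eq)
  have "r (r x) = 0" for x
    using sym [of "r x" "r (r x)"] r3 [of x] r3 [of "r x"] by (metis inner_eq_zero_iff inner_zero_right sym)
  then have "r x = 0" for x
    using sym [of x "r x"] by (metis inner_eq_zero_iff inner_zero_right)
  then show ?thesis unfolding r_def by (intro blinfun_eqI) (simp add: blinfun.diff_left)
qed

locale star_rep = concrete_cstar B for B :: "'h::complex_hilbert bop set" +
  fixes \<pi> :: "'h bop \<Rightarrow> 'k::complex_hilbert bop"
  assumes rep_clin: "a \<in> B \<Longrightarrow> clin (\<pi> a)"
    and rep_add: "a \<in> B \<Longrightarrow> b \<in> B \<Longrightarrow> \<pi> (a + b) = \<pi> a + \<pi> b"
    and rep_scale: "a \<in> B \<Longrightarrow> \<pi> (scale_op c a) = scale_op c (\<pi> a)"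
    and rep_mult: "a \<in> B \<Longrightarrow> b \<in> B \<Longrightarrow> \<pi> (a o\<^sub>L b) = \<pi> a o\<^sub>L \<pi> b"
    and rep_adj: "a \<in> B \<Longrightarrow> \<pi> (adj a) = adj (\<pi> a)"
begin

lemma rep_scaleR: "a \<in> B \<Longrightarrow> \<pi> (r *\<^sub>R a) = r *\<^sub>R \<pi> a"
  using rep_scale [of a "complex_of_real r"] by (simp add: scale_op_eq cscale_of_real)

lemma rep_diff: "a \<in> B \<Longrightarrow> b \<in> B \<Longrightarrow> \<pi> (a - b) = \<pi> a - \<pi> b"
  using rep_add [of a "- 1 *\<^sub>R b"] rep_scaleR [of b "- 1"] scaleR_B [of b "- 1"] by simp

lemma rep_zero: "\<pi> 0 = 0"
  using rep_scaleR [OF zero_B, of 0] by simp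

text \<open>If \<open>\<parallel>a\<parallel> = 1\<close> and \<open>1 - a\<^sup>*a = (1 - w)\<^sup>2\<close>, then \<open>1 - \<pi>(a)\<^sup>*\<pi>(a) = (1 - \<pi>(w))\<^sup>2 \<ge> 0\<close>.\<close>

lemma rep_contractive: "a \<in> B \<Longrightarrow> norm (\<pi> a) \<le> norm a"
proof (cases "a = 0")
  case False
  assume a: "a \<in> B"
  define b where "b = inverse (norm a) *\<^sub>R a"
  have b: "b \<in> B" "norm b = 1" using a False by (auto simp: b_def scaleR_B)
  note ab = adjoint_pair_adj [OF clin_B [OF b(1)]]
  have c: "adj b o\<^sub>L b \<in> B" "adj (adj b o\<^sub>L b) = adj b o\<^sub>L b" "norm (adj b o\<^sub>L b) \<le> 1"
    using b norm_adjoint_pair_comp [OF ab]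
    by (auto simp: mult_B adj_B adj_comp clin_B clin_adj adj_adj)
  obtain w where w: "w \<in> B" "adj w = w" and wc: "2 *\<^sub>R w - (w o\<^sub>L w) = adj b o\<^sub>L b"
    using one_minus_sqrt_exists [OF c] by metis
  have "\<pi> (2 *\<^sub>R w - (w o\<^sub>L w)) = 2 *\<^sub>R \<pi> w - (\<pi> w o\<^sub>L \<pi> w)"
    using w by (simp add: rep_diff rep_scaleR rep_mult scaleR_B mult_B)
  moreover have "\<pi> (adj b o\<^sub>L b) = adj (\<pi> b) o\<^sub>L \<pi> b"
    using b by (simp add: rep_mult rep_adj adj_B)
  ultimately have eq: "adj (\<pi> b) o\<^sub>L \<pi> b = 2 *\<^sub>R \<pi> w - (\<pi> w o\<^sub>L \<pi> w)"
    using wc by simp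
  have pw: "adjoint_pair (\<pi> w) (\<pi> w)"
    by (metis adjoint_pair_adj rep_adj rep_clin w)
  have "norm (\<pi> b) \<le> 1"
  proof (rule norm_blinfun_bound)
    fix x
    have "(norm (\<pi> b x))\<^sup>2 = inner x ((adj (\<pi> b) o\<^sub>L \<pi> b) x)"
      using adjoint_pairD [OF adjoint_pair_adj [OF rep_clin [OF b(1)]]]
      by (simp add: power2_norm_eq_inner inner_Re_cinner)
    also have "\<dots> = 2 * inner x (\<pi> w x) - inner (\<pi> w x) (\<pi> w x)"
      unfolding eq using adjoint_pairD [OF pw]
      by (simp add: blf_simps cinner_simps inner_Re_cinner)
    also have "\<dots> = (norm x)\<^sup>2 - (norm (x - \<pi> w x))\<^sup>2"
      by (simp add: power2_norm_eq_inner inner_diff_left inner_diff_right inner_commute)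
    finally have "(norm (\<pi> b x))\<^sup>2 \<le> (norm x)\<^sup>2" by simp
    then show "norm (\<pi> b x) \<le> 1 * norm x" by simp
  qed simp
  moreover have "a = norm a *\<^sub>R b" using False by (simp add: b_def)
  ultimately show ?thesis
    using b rep_scaleR [of b "norm a"] mult_left_mono [of "norm (\<pi> b)" 1 "norm a"] by simp
qed (simp add: rep_zero)

text \<open>Suppose \<open>\<parallel>\<pi>(a)\<parallel> < \<parallel>a\<parallel>\<close>, and let \<open>e\<close> be the multiple of \<open>a\<^sup>*a\<close> with \<open>1 < \<parallel>e\<parallel> \<le> 2\<close> and
  \<open>\<parallel>\<pi>(e)\<parallel> \<le> 1\<close>.  With \<open>w = 1 - \<bar>1 - e\<bar>\<close>, the element \<open>e - w\<close> vanishes on the part of the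
  spectrum where \<open>e \<le> 1\<close>, so \<open>\<pi>(e - w) = 0\<close>; but \<open>e - w \<noteq> 0\<close>, because \<open>\<parallel>w\<parallel> \<le> 1\<close>.\<close>

lemma rep_isometric:
  assumes inj: "\<And>a. a \<in> B \<Longrightarrow> \<pi> a = 0 \<Longrightarrow> a = 0" and a: "a \<in> B"
  shows "norm (\<pi> a) = norm a"
proof (rule ccontr)
  assume "norm (\<pi> a) \<noteq> norm a"
  then have less: "norm (\<pi> a) < norm a" using rep_contractive [OF a] by simp
  then have na: "norm a > 0" by (meson norm_ge_zero le_less_trans)
  define b where "b = inverse (norm a) *\<^sub>R a"
  have b: "b \<in> B" "norm b = 1" using a na by (auto simp: b_def scaleR_B)
  have "norm (\<pi> b) < 1"
    using less na a by (simp add: b_def rep_scaleR field_simps)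
  then have nb: "(norm (\<pi> b))\<^sup>2 < 1" by (simp add: power_less_one_iff abs_square_less_1)
  define s where "s = (norm (\<pi> b))\<^sup>2"
  define t where "t = (if s \<le> 1/2 then 2 else 1 / s)"
  have s: "0 \<le> s" "s < 1" using nb by (auto simp: s_def)
  have t: "1 < t" "t \<le> 2" "t * s \<le> 1" using s by (auto simp: t_def field_simps)
  note ab = adjoint_pair_adj [OF clin_B [OF b(1)]]
  define d where "d = adj b o\<^sub>L b"
  have dB: "d \<in> B" using b by (simp add: d_def mult_B adj_B)
  have dp: "adjoint_pair d d" unfolding d_def by (intro adjoint_pair_comp adjoint_pair_sym [OF ab] ab)
  have nd: "norm d = 1" unfolding d_def using norm_adjoint_pair_comp [OF ab] b by simp
  have dform: "inner (d x) x = (norm (b x))\<^sup>2" for x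
    by (simp add: d_def inner_Re_cinner power2_norm_eq_inner adjoint_pairD [OF adjoint_pair_sym [OF ab]])
  have dle: "(norm (d x))\<^sup>2 \<le> inner (d x) x" for x
  proof -
    have "norm (d x) \<le> norm (adj b) * norm (b x)" by (simp add: d_def norm_blinfun)
    also have "norm (adj b) = 1" using b norm_adj clin_B by metis
    finally show ?thesis unfolding dform by (simp add: power_mono)
  qed
  define e where "e = t *\<^sub>R d"
  have eB: "e \<in> B" using dB by (simp add: e_def scaleR_B)
  have ep: "adjoint_pair e e" unfolding e_def by (rule adjoint_pair_scaleR [OF dp])
  have ne: "norm e = t" using nd t by (simp add: e_def)
  define c where "c = 2 *\<^sub>R e - (e o\<^sub>L e)"
  have cB: "c \<in> B" using eB by (simp add: c_def diff_B scaleR_B mult_B)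
  have cp: "adjoint_pair c c"
    unfolding c_def by (intro adjoint_pair_diff adjoint_pair_scaleR adjoint_pair_comp ep)
  have "norm c \<le> 1"
  proof (rule norm_selfadjoint_le [OF cp])
    fix x
    have cx: "inner (c x) x = 2 * inner (e x) x - (norm (e x))\<^sup>2"
      using adjoint_pairD [OF ep]
      by (simp add: c_def blf_simps cinner_simps inner_Re_cinner power2_norm_eq_inner)
    have "(norm (e x))\<^sup>2 \<le> t\<^sup>2 * inner (d x) x"
      using dle [of x] by (simp add: e_def blinfun.scaleR_left power_mult_distrib mult_left_mono)
    also have "\<dots> \<le> (2 * t) * inner (d x) x"
      using t dform by (intro mult_right_mono) (auto simp: power2_eq_square)
    also have "\<dots> = 2 * inner (e x) x" by (simp add: e_def blinfun.scaleR_left)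
    finally have "0 \<le> inner (c x) x" by (simp add: cx)
    moreover have "inner (c x) x = (norm x)\<^sup>2 - (norm (x - e x))\<^sup>2"
      unfolding cx by (simp add: power2_norm_eq_inner inner_diff_left inner_diff_right inner_commute)
    ultimately show "\<bar>inner (c x) x\<bar> \<le> 1 * (norm x)\<^sup>2" by simp
  qed simp
  then obtain w where w: "w \<in> B" "adj w = w" "norm w \<le> 1" and wc: "2 *\<^sub>R w - (w o\<^sub>L w) = c"
    and comm: "\<And>T. T o\<^sub>L c = c o\<^sub>L T \<Longrightarrow> T o\<^sub>L w = w o\<^sub>L T"
    using one_minus_sqrt_exists [OF cB adj_eqI [OF cp]] by metis
  have ew: "e o\<^sub>L w = w o\<^sub>L e"
    by (rule comm, rule blinfun_eqI) (simp add: c_def blf_simps)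
  define p where "p = id_blinfun - \<pi> w"
  define q where "q = id_blinfun - \<pi> e"
  have sap: "adjoint_pair (\<pi> f) (\<pi> f)" if "f \<in> B" "adj f = f" for f
    by (metis adjoint_pair_adj rep_adj rep_clin that)
  have pos: "0 \<le> inner ((id_blinfun - T) x) x" if "norm T \<le> 1" for T :: "'k bop" and x
  proof -
    have "inner (T x) x \<le> norm (T x) * norm x" by (rule norm_cauchy_schwarz)
    also have "\<dots> \<le> (1 * norm x) * norm x"
      by (intro mult_right_mono order_trans [OF norm_blinfun] that) auto
    finally show ?thesis by (simp add: blinfun.diff_left inner_diff_left power2_norm_eq_inner
        [symmetric] power2_eq_square)
  qed
  have "norm (\<pi> d) = s"
    using norm_adjoint_pair_comp [OF adjoint_pair_adj [OF rep_clin [OF b(1)]]] b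
    by (simp add: d_def rep_mult rep_adj adj_B s_def)
  then have "norm (\<pi> e) \<le> 1" using t dB by (simp add: e_def rep_scaleR)
  have sq: "2 *\<^sub>R \<pi> w - (\<pi> w o\<^sub>L \<pi> w) = 2 *\<^sub>R \<pi> e - (\<pi> e o\<^sub>L \<pi> e)"
  proof -
    have "\<pi> (2 *\<^sub>R f - (f o\<^sub>L f)) = 2 *\<^sub>R \<pi> f - (\<pi> f o\<^sub>L \<pi> f)" if "f \<in> B" for f
      using that by (simp add: rep_diff rep_scaleR rep_mult scaleR_B mult_B)
    from this [OF w(1)] this [OF eB] show ?thesis unfolding wc by (simp add: c_def)
  qed
  have "p = q"
  proof (rule positive_sqrt_unique)
    show "adjoint_pair p p" "adjoint_pair q q" unfolding p_def q_def
      by (intro adjoint_pair_diff adjoint_pair_id sap w eB adj_eqI [OF ep])+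
    show "0 \<le> inner (p x) x" "0 \<le> inner (q x) x" for x
      unfolding p_def q_def
      using pos \<open>norm (\<pi> e) \<le> 1\<close> rep_contractive [OF w(1)] w(3) order_trans by blast+
    have "\<pi> e o\<^sub>L \<pi> w = \<pi> w o\<^sub>L \<pi> e" using ew w eB by (metis rep_mult)
    then have "\<pi> e (\<pi> w x) = \<pi> w (\<pi> e x)" for x by (metis blinfun_apply_blinfun_compose)
    then show "p o\<^sub>L q = q o\<^sub>L p"
      by (intro blinfun_eqI) (simp add: p_def q_def blf_simps)
    show "p o\<^sub>L p = q o\<^sub>L q"
    proof (rule blinfun_eqI)
      fix x
      have "2 *\<^sub>R \<pi> w x - \<pi> w (\<pi> w x) = 2 *\<^sub>R \<pi> e x - \<pi> e (\<pi> e x)"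
        using arg_cong [OF sq, of "\<lambda>T. blinfun_apply T x"]
        by (simp add: blinfun.diff_left blinfun.scaleR_left)
      then show "(p o\<^sub>L p) x = (q o\<^sub>L q) x"
        by (simp add: p_def q_def blf_simps scaleR_2 algebra_simps)
    qed
  qed
  then have "\<pi> (e - w) = 0" using w eB by (simp add: p_def q_def rep_diff)
  then have "e = w" using inj [OF diff_B [OF eB w(1)]] by simp
  then show False using ne w t by simp
qed

end

section \<open>Square summable families and matrices of operators\<close>

lemma coord_Abs_ell2:
  "(\<lambda>j. (norm (f j))\<^sup>2) summable_on UNIV \<Longrightarrow> coord (Abs_ell2 f) j = f j"
  by (simp add: Abs_ell2_inverse)

lemma ell2_eqI: "(\<And>j. coord x j = coord y j) \<Longrightarrow> x = y"
  by (simp add: coord_inject_ext)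

lemma coord_sum: "coord (sum f S) j = (\<Sum>i\<in>S. coord (f i) j)"
  by (induction S rule: infinite_finite_induct) (auto simp: coord_add coord_zero)

lemma bounded_linear_coord: "bounded_linear (\<lambda>x :: ('j, 'k::complex_hilbert) ell2. coord x j)"
  by (rule bounded_linear_intro [where K = 1])
    (simp_all add: coord_add coord_scaleR norm_coord_le)

lemma blinfun_compose_assoc: "(a o\<^sub>L b) o\<^sub>L c = a o\<^sub>L (b o\<^sub>L c)"
  by (rule blinfun_eqI) simp

definition of_coords ::
  "('a::complex_hilbert \<Rightarrow> 'j \<Rightarrow> 'k::complex_hilbert) \<Rightarrow> 'a \<Rightarrow>\<^sub>L ('j, 'k) ell2" where
  "of_coords f = Blinfun (\<lambda>x. Abs_ell2 (f x))"

lemma of_coords: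
  fixes f :: "('a::complex_hilbert) \<Rightarrow> 'j \<Rightarrow> 'k::complex_hilbert"
  assumes lin: "\<And>x y j. f (x + y) j = f x j + f y j" "\<And>c x j. f (c *\<^sub>C x) j = c *\<^sub>C f x j"
    and bd: "\<And>x F. finite F \<Longrightarrow> (\<Sum>j\<in>F. (norm (f x j))\<^sup>2) \<le> (C * norm x)\<^sup>2" and C: "0 \<le> C"
  shows "coord (of_coords f x) j = f x j" and "clin (of_coords f)" and "norm (of_coords f) \<le> C"
proof -
  have summ: "(\<lambda>j. (norm (f x j))\<^sup>2) summable_on UNIV" for x
    by (rule nonneg_bdd_above_summable_on) (auto intro!: bdd_aboveI2 [where M = "(C * norm x)\<^sup>2"] bd)
  have co: "coord (Abs_ell2 (f x)) j = f x j" for x j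
    by (rule coord_Abs_ell2 [OF summ])
  have nb: "norm (Abs_ell2 (f x)) \<le> C * norm x" for x
  proof (rule power2_le_imp_le)
    show "(norm (Abs_ell2 (f x)))\<^sup>2 \<le> (C * norm x)\<^sup>2"
      unfolding norm_ell2_sq co by (rule infsum_le_finite_sums [OF summ]) (auto intro: bd)
  qed (simp add: C)
  have "bounded_linear (\<lambda>x. Abs_ell2 (f x))"
  proof (rule bounded_linear_intro [where K = C])
    show "Abs_ell2 (f (x + y)) = Abs_ell2 (f x) + Abs_ell2 (f y)" for x y
      by (rule ell2_eqI) (simp add: co coord_add lin)
    show "Abs_ell2 (f (r *\<^sub>R x)) = r *\<^sub>R Abs_ell2 (f x)" for r x
      unfolding scaleR_scaleC by (rule ell2_eqI) (simp add: co coord_scaleC lin)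
    show "norm (Abs_ell2 (f x)) \<le> norm x * C" for x
      using nb [of x] by (simp add: mult.commute)
  qed
  then have T: "blinfun_apply (of_coords f) x = Abs_ell2 (f x)" for x
    by (simp add: of_coords_def bounded_linear_Blinfun_apply)
  show "coord (of_coords f x) j = f x j"
    by (simp add: T co)
  show "clin (of_coords f)"
    unfolding clin_def by (auto intro!: ell2_eqI simp: T co coord_scaleC lin)
  show "norm (of_coords f) \<le> C"
    by (rule norm_blinfun_bound [OF C]) (simp add: T nb)
qed

text \<open>The coordinate embeddings and projections.\<close>

definition eps :: "'j \<Rightarrow> 'k::complex_hilbert \<Rightarrow>\<^sub>L ('j, 'k) ell2" where
  "eps i = of_coords (\<lambda>k j. if j = i then k else 0)"

definition prj :: "'j \<Rightarrow> ('j, 'k::complex_hilbert) ell2 \<Rightarrow>\<^sub>L 'k" where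
  "prj j = Blinfun (\<lambda>x. coord x j)"

lemma prj_apply [simp]: "prj j x = coord x j"
  by (simp add: prj_def bounded_linear_Blinfun_apply bounded_linear_coord)

lemma coord_eps [simp]:
  fixes k :: "'k::complex_hilbert"
  shows "coord (eps i k) j = (if j = i then k else 0)"
proof -
  have "(\<Sum>j\<in>F. (norm (if j = i then k else 0))\<^sup>2) \<le> (1 * norm k)\<^sup>2" if "finite F" for F and k :: 'k
  proof -
    have "(\<Sum>j\<in>F. (norm (if j = i then k else 0))\<^sup>2) = (\<Sum>j\<in>F. if j = i then (norm k)\<^sup>2 else 0)"
      by (intro sum.cong) auto
    then show ?thesis using that by (simp add: sum.delta)
  qed
  then show ?thesis unfolding eps_def by (intro of_coords [where C = 1]) auto
qed

lemma cinner_eps: "cinner (eps i k) x = cinner k (coord x i)"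
proof -
  have "cinner (eps i k) x = (\<Sum>\<^sub>\<infinity>j. if j = i then cinner k (coord x i) else 0)"
    unfolding cinner_ell2_def by (intro infsum_cong) (auto simp: cinner_simps)
  also have "\<dots> = (\<Sum>\<^sub>\<infinity>j\<in>{i}. cinner k (coord x i))"
    by (rule infsum_cong_neutral) auto
  finally show ?thesis by simp
qed

lemma adjoint_pair_eps: "adjoint_pair (eps i) (prj i)"
  by (rule adjoint_pairI) (simp add: cinner_eps)

lemma adjoint_pair_prj: "adjoint_pair (prj i) (eps i)"
  by (rule adjoint_pair_sym [OF adjoint_pair_eps])

lemma clin_eps [simp, intro]: "clin (eps i)" and clin_prj [simp, intro]: "clin (prj i)"
  by (rule adjoint_pair_clin [OF adjoint_pair_eps], rule adjoint_pair_clin [OF adjoint_pair_prj])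

lemma norm_eps [simp]: "norm (eps i k) = norm k"
  by (rule norm_eq_if_cinner_eq) (simp add: cinner_eps)

lemma norm_eps_le: "norm (eps i) \<le> 1"
  by (rule norm_blinfun_bound) auto

lemma norm_prj_le: "norm (prj i) \<le> 1"
  by (rule norm_blinfun_bound) (auto simp: norm_coord_le)

lemma prj_eps: "prj i o\<^sub>L eps j = (if i = j then id_blinfun else 0)"
  by (rule blinfun_eqI) auto

definition trunc :: "'j set \<Rightarrow> ('j, 'k::complex_hilbert) ell2 \<Rightarrow>\<^sub>L ('j, 'k) ell2" where
  "trunc F = (\<Sum>j\<in>F. eps j o\<^sub>L prj j)"

lemma blinfun_apply_sum: "blinfun_apply (sum f S) x = (\<Sum>i\<in>S. blinfun_apply (f i) x)"
  by (induction S rule: infinite_finite_induct) (auto simp: blf_simps)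

lemma coord_trunc: "finite F \<Longrightarrow> coord (trunc F x) j = (if j \<in> F then coord x j else 0)"
  by (simp add: trunc_def blinfun_apply_sum coord_sum sum.delta')

lemma adjoint_pair_trunc: "adjoint_pair (trunc F) (trunc F)"
  unfolding trunc_def
  by (rule adjoint_pair_sum) (rule adjoint_pair_comp [OF adjoint_pair_eps adjoint_pair_prj])

lemma ell2_norm_le_if_coord_le:
  "(\<And>j. norm (coord x j) \<le> norm (coord y j)) \<Longrightarrow> norm x \<le> norm y"
  unfolding norm_ell2_def inner_ell2_def
  by (intro real_sqrt_le_mono infsum_mono ell2_inner_summable)
    (simp add: power_mono flip: power2_norm_eq_inner)

lemma norm_trunc_apply_le: "finite F \<Longrightarrow> norm (trunc F x) \<le> norm x"
  by (rule ell2_norm_le_if_coord_le) (simp add: coord_trunc)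

lemma norm_trunc_le: "finite F \<Longrightarrow> norm (trunc F) \<le> 1"
  by (rule norm_blinfun_bound) (auto simp: norm_trunc_apply_le)

lemma norm_diff_trunc_sq:
  assumes "finite F"
  shows "(norm (x - trunc F x))\<^sup>2 = (norm x)\<^sup>2 - (\<Sum>j\<in>F. (norm (coord x j))\<^sup>2)"
proof -
  have idem: "trunc F (trunc F x) = trunc F x"
    by (rule ell2_eqI) (simp add: coord_trunc assms)
  have "cinner (trunc F x) x = cinner (trunc F x) (trunc F x)"
    using adjoint_pairD [OF adjoint_pair_trunc, of F "trunc F x" x] idem by simp
  then have ip: "inner (trunc F x) x = inner (trunc F x) (trunc F x)"
    by (simp add: inner_Re_cinner)
  have "cinner (trunc F x) x = (\<Sum>j\<in>F. cinner (coord x j) (coord x j))"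
    by (simp add: trunc_def blinfun_apply_sum cinner.sum_left cinner_eps)
  then have "inner (trunc F x) x = (\<Sum>j\<in>F. (norm (coord x j))\<^sup>2)"
    by (simp add: inner_Re_cinner cinner_self)
  then show ?thesis using ip
    by (simp add: power2_norm_eq_inner inner_diff_left inner_diff_right inner_commute)
qed

lemma ell2_has_sum: "((\<lambda>j. eps j (coord x j)) has_sum x) UNIV"
proof -
  have "((\<lambda>j. (norm (coord x j))\<^sup>2) has_sum (norm x)\<^sup>2) UNIV"
    unfolding norm_ell2_sq using coord_summable by (rule has_sum_infsum)
  then have lim: "((\<lambda>F. (norm x)\<^sup>2 - (\<Sum>j\<in>F. (norm (coord x j))\<^sup>2)) \<longlongrightarrow> 0) (finite_subsets_at_top UNIV)"
    using tendsto_diff [OF tendsto_const [of "(norm x)\<^sup>2"], of _ "(norm x)\<^sup>2"]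
    unfolding has_sum_def by fastforce
  have "((\<lambda>F. (norm (x - trunc F x))\<^sup>2) \<longlongrightarrow> 0) (finite_subsets_at_top UNIV)"
    by (rule Lim_transform_eventually [OF lim])
      (auto simp: norm_diff_trunc_sq intro: eventually_finite_subsets_at_top_weakI)
  then have "((\<lambda>F. norm (x - trunc F x)) \<longlongrightarrow> 0) (finite_subsets_at_top UNIV)"
    using tendsto_real_sqrt by fastforce
  then have "((\<lambda>F. x - trunc F x) \<longlongrightarrow> 0) (finite_subsets_at_top UNIV)"
    by (rule tendsto_norm_zero_cancel)
  from tendsto_diff [OF tendsto_const [of x] this]
  have "((\<lambda>F. trunc F x) \<longlongrightarrow> x) (finite_subsets_at_top UNIV)"
    by simp
  then show ?thesis
    unfolding has_sum_def by (simp add: trunc_def blinfun_apply_sum)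
qed

lemma closed_subspace_ell2_UNIV:
  fixes V :: "('j, 'k::complex_hilbert) ell2 set"
  assumes V: "subspace V" and cl: "closed V" and eps: "\<And>j k. eps j k \<in> V"
  shows "x \<in> V"
proof -
  have "((\<lambda>F. \<Sum>j\<in>F. eps j (coord x j)) \<longlongrightarrow> x) (finite_subsets_at_top UNIV)"
    using ell2_has_sum [of x] by (simp add: has_sum_def)
  from Lim_in_closed_set [OF cl _ finite_subsets_at_top_neq_bot this]
  show ?thesis by (auto intro!: subspace_sum V eps)
qed

lemma ell2_blinfun_eqI:
  assumes "\<And>j k. blinfun_apply S (eps j k) = blinfun_apply T (eps j k)"
  shows "S = T"
proof (rule blinfun_eqI)
  fix x
  have V: "subspace {x. S x = T x}" by (auto simp: subspace_def blf_simps)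
  have "closed {x. S x = T x}"
    by (intro closed_Collect_eq linear_continuous_on blinfun.bounded_linear_right)
  from closed_subspace_ell2_UNIV [OF V this] show "S x = T x" using assms by simp
qed

lemma norm_le_if_truncated_le:
  fixes T :: "('j, 'k::complex_hilbert) ell2 bop"
  assumes "\<And>F. finite F \<Longrightarrow> norm (trunc F o\<^sub>L T o\<^sub>L trunc F) \<le> C" and C: "0 \<le> C"
  shows "norm T \<le> C"
proof (rule norm_blinfun_bound [OF C])
  fix x
  have tr: "((\<lambda>F. trunc F y) \<longlongrightarrow> y) (finite_subsets_at_top UNIV)" for y :: "('j, 'k) ell2"
    using ell2_has_sum [of y] by (simp add: has_sum_def trunc_def blinfun_apply_sum)
  have bd: "norm (trunc F (T (trunc F x))) \<le> C * norm x" if "finite F" for F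
  proof -
    have "norm ((trunc F o\<^sub>L T o\<^sub>L trunc F) x) \<le> norm (trunc F o\<^sub>L T o\<^sub>L trunc F) * norm x"
      by (rule norm_blinfun)
    also have "\<dots> \<le> C * norm x" by (intro mult_right_mono assms that) simp
    finally show ?thesis by simp
  qed
  have "((\<lambda>F. trunc F (T (trunc F x))) \<longlongrightarrow> T x) (finite_subsets_at_top UNIV)"
  proof -
    have "((\<lambda>F. T (trunc F x) - T x) \<longlongrightarrow> 0) (finite_subsets_at_top UNIV)"
      using tendsto_diff [OF blinfun.tendsto [OF tendsto_const [of T] tr [of x]] tendsto_const [of "T x"]]
      by simp
    then have "((\<lambda>F. trunc F (T (trunc F x) - T x)) \<longlongrightarrow> 0) (finite_subsets_at_top UNIV)"
      by (rule Lim_null_comparison [rotated, OF tendsto_norm_zero])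
        (auto intro!: eventually_finite_subsets_at_top_weakI norm_trunc_apply_le)
    from tendsto_add [OF this tr [of "T x"]] show ?thesis by (simp add: blf_simps)
  qed
  then have "((\<lambda>F. norm (trunc F (T (trunc F x)))) \<longlongrightarrow> norm (T x)) (finite_subsets_at_top UNIV)"
    by (rule tendsto_norm)
  then show "norm (T x) \<le> C * norm x"
    by (rule tendsto_upperbound)
      (auto intro!: eventually_finite_subsets_at_top_weakI bd)
qed

text \<open>A matrix of operators, acting on the direct sum.\<close>

definition matop :: "'j set \<Rightarrow> ('j \<Rightarrow> 'j \<Rightarrow> 'k::complex_hilbert bop) \<Rightarrow> ('j, 'k) ell2 bop" where
  "matop F M = (\<Sum>i\<in>F. \<Sum>j\<in>F. eps i o\<^sub>L M i j o\<^sub>L prj j)"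

lemma coord_matop:
  "finite F \<Longrightarrow> coord (matop F M x) i = (if i \<in> F then \<Sum>j\<in>F. M i j (coord x j) else 0)"
proof -
  assume F: "finite F"
  have "coord (matop F M x) i = (\<Sum>i'\<in>F. if i = i' then \<Sum>j\<in>F. M i' j (coord x j) else 0)"
    unfolding matop_def blinfun_apply_sum coord_sum by (intro sum.cong) (auto simp: coord_zero)
  then show ?thesis using F by (simp add: sum.delta)
qed

lemma matop_entry: "finite F \<Longrightarrow> i \<in> F \<Longrightarrow> j \<in> F \<Longrightarrow> prj i o\<^sub>L matop F M o\<^sub>L eps j = M i j"
proof (rule blinfun_eqI)
  fix x assume *: "finite F" "i \<in> F" "j \<in> F"
  have "(\<Sum>l\<in>F. M i l (if l = j then x else 0)) = (\<Sum>l\<in>F. if l = j then M i l x else 0)"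
    by (intro sum.cong) (auto simp: blf_simps)
  then show "(prj i o\<^sub>L matop F M o\<^sub>L eps j) x = M i j x"
    using * by (simp add: coord_matop sum.delta)
qed

lemma matop_cong: "(\<And>i j. i \<in> F \<Longrightarrow> j \<in> F \<Longrightarrow> M i j = N i j) \<Longrightarrow> matop F M = matop F N"
  unfolding matop_def by (intro sum.cong) auto

lemma trunc_matop: "trunc F o\<^sub>L T o\<^sub>L trunc F = matop F (\<lambda>i j. prj i o\<^sub>L T o\<^sub>L eps j)"
  unfolding trunc_def matop_def
  by (rule blinfun_eqI, simp add: blinfun_apply_sum blinfun.sum_right coord_sum, rule sum.swap)

lemma adjoint_pair_matop:
  assumes "\<And>i j. i \<in> F \<Longrightarrow> j \<in> F \<Longrightarrow> adjoint_pair (M i j) (N j i)"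
  shows "adjoint_pair (matop F M) (matop F N)"
proof -
  have "adjoint_pair (eps i o\<^sub>L M i j o\<^sub>L prj j) (eps j o\<^sub>L N j i o\<^sub>L prj i)"
    if "i \<in> F" "j \<in> F" for i j
    using adjoint_pair_comp [OF adjoint_pair_eps
        adjoint_pair_comp [OF assms [OF that] adjoint_pair_prj [of j]], of i]
    by (simp add: blinfun_compose_assoc)
  then have "adjoint_pair (matop F M) (\<Sum>i\<in>F. \<Sum>j\<in>F. eps j o\<^sub>L N j i o\<^sub>L prj i)"
    unfolding matop_def by (intro adjoint_pair_sum)
  then show ?thesis unfolding matop_def by (subst (asm) sum.swap)
qed

lemma matop_add: "finite F \<Longrightarrow> matop F (\<lambda>i j. M i j + N i j) = matop F M + matop F N"
  by (intro blinfun_eqI ell2_eqI) (simp add: coord_matop coord_add blf_simps sum.distrib)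

lemma matop_scale: "finite F \<Longrightarrow> matop F (\<lambda>i j. scale_op c (M i j)) = scale_op c (matop F M)"
  by (intro blinfun_eqI ell2_eqI)
    (simp add: coord_matop coord_scaleC scale_op_apply scaleC_sum_right)

lemma matop_mult:
  "finite F \<Longrightarrow> matop F (\<lambda>i j. \<Sum>l\<in>F. M i l o\<^sub>L N l j) = matop F M o\<^sub>L matop F N"
  by (intro blinfun_eqI ell2_eqI)
    (simp add: coord_matop blinfun_apply_sum blinfun.sum_right, rule impI, rule sum.swap)

text \<open>Diagonal operators between direct sums.\<close>

definition diagop ::
  "('j \<Rightarrow> ('a::complex_hilbert \<Rightarrow>\<^sub>L 'b::complex_hilbert)) \<Rightarrow> ('j, 'a) ell2 \<Rightarrow>\<^sub>L ('j, 'b) ell2" where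
  "diagop D = of_coords (\<lambda>x j. D j (coord x j))"

lemma diagop:
  assumes "\<And>j. clin (D j)" "\<And>j. norm (D j) \<le> C"
  shows coord_diagop: "coord (diagop D x) j = D j (coord x j)"
    and clin_diagop: "clin (diagop D)" and norm_diagop_le: "norm (diagop D) \<le> C"
proof -
  have "(\<Sum>j\<in>F. (norm (D j (coord x j)))\<^sup>2) \<le> (C * norm x)\<^sup>2" if "finite F" for F x
  proof -
    have "norm (D j (coord x j)) \<le> C * norm (coord x j)" for j
      by (rule order_trans [OF norm_blinfun]) (intro mult_right_mono assms norm_ge_zero)
    then have "(\<Sum>j\<in>F. (norm (D j (coord x j)))\<^sup>2) \<le> (\<Sum>j\<in>F. (C * norm (coord x j))\<^sup>2)"
      by (intro sum_mono power_mono) auto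
    also have "\<dots> = C\<^sup>2 * (\<Sum>j\<in>F. (norm (coord x j))\<^sup>2)"
      by (simp add: power_mult_distrib sum_distrib_left)
    also have "\<dots> \<le> C\<^sup>2 * (norm x)\<^sup>2"
      by (intro mult_left_mono finite_sum_le_norm_sq that) simp
    finally show ?thesis by (simp add: power_mult_distrib)
  qed
  moreover have "0 \<le> C" using assms(2) norm_ge_zero order_trans by blast
  moreover have "D j (c *\<^sub>C x) = c *\<^sub>C D j x" for j c x using assms(1) by (simp add: clin_def)
  ultimately show "coord (diagop D x) j = D j (coord x j)" "clin (diagop D)" "norm (diagop D) \<le> C"
    unfolding diagop_def
    by (intro of_coords [where C = C]; simp add: coord_add coord_scaleC blf_simps)+
qed

text \<open>Compressing every entry by fixed contractions is the compression of the whole matrix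
  by diagonal contractions.\<close>

lemma matop_sandwich_le:
  fixes U :: "'a::complex_hilbert \<Rightarrow>\<^sub>L 'b::complex_hilbert" and V :: "'b \<Rightarrow>\<^sub>L 'a"
  assumes F: "finite F" and U: "clin U" "norm U \<le> 1" and V: "clin V" "norm V \<le> 1"
  shows "norm (matop F (\<lambda>i j. U o\<^sub>L M i j o\<^sub>L V)) \<le> norm (matop F M)"
proof -
  have cU: "coord (diagop (\<lambda>_. U) x) j = U (coord x j)" for x :: "('c, 'a) ell2" and j
    using coord_diagop [of "\<lambda>_. U" 1] U by simp
  have cV: "coord (diagop (\<lambda>_. V) x) j = V (coord x j)" for x :: "('c, 'b) ell2" and j
    using coord_diagop [of "\<lambda>_. V" 1] V by simp
  have "matop F (\<lambda>i j. U o\<^sub>L M i j o\<^sub>L V) = diagop (\<lambda>_. U) o\<^sub>L matop F M o\<^sub>L diagop (\<lambda>_. V)"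
    by (intro blinfun_eqI ell2_eqI) (simp add: coord_matop F cU cV blinfun.sum_right blf_simps)
  also have "norm \<dots> \<le> (norm (diagop (\<lambda>_ :: 'c. U)) * norm (matop F M)) * norm (diagop (\<lambda>_ :: 'c. V))"
    by (intro order_trans [OF norm_blinfun_compose] mult_right_mono norm_blinfun_compose norm_ge_zero)
  also have "\<dots> \<le> (1 * norm (matop F M)) * 1"
    by (intro mult_mono norm_diagop_le U V) auto
  finally show ?thesis by simp
qed

lemma finite_support_ell2:
  fixes x :: "'j \<Rightarrow> 'k::complex_hilbert"
  assumes "finite F"
  defines "y \<equiv> (\<Sum>i\<in>F. eps i (x i))"
  shows "coord y i = (if i \<in> F then x i else 0)" "(norm y)\<^sup>2 = (\<Sum>i\<in>F. (norm (x i))\<^sup>2)"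
proof -
  show co: "coord y i = (if i \<in> F then x i else 0)" for i
    using assms by (simp add: coord_sum sum.delta)
  have "(norm y)\<^sup>2 = (\<Sum>\<^sub>\<infinity>i\<in>F. (norm (x i))\<^sup>2)"
    unfolding norm_ell2_sq by (rule infsum_cong_neutral) (auto simp: co)
  then show "(norm y)\<^sup>2 = (\<Sum>i\<in>F. (norm (x i))\<^sup>2)" using assms by simp
qed

lemma norm_matop_apply_sq:
  "finite F \<Longrightarrow> (norm (matop F M x))\<^sup>2 = (\<Sum>i\<in>F. (norm (\<Sum>j\<in>F. M i j (coord x j)))\<^sup>2)"
proof -
  assume F: "finite F"
  have "matop F M x = (\<Sum>i\<in>F. eps i (\<Sum>j\<in>F. M i j (coord x j)))"
    by (rule ell2_eqI) (simp add: finite_support_ell2 coord_matop F)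
  then show ?thesis using finite_support_ell2(2) [OF F] by simp
qed

text \<open>The matrix norm of \<open>B(H)\<close> is an operator norm.\<close>

lemma mat_norm_bounded_ops: "mat_norm bounded_ops n M = norm (matop {..<n} M)"
proof -
  let ?T = "matop {..<n} M"
  let ?S = "{sqrt (\<Sum>i<n. (norm (\<Sum>j<n. M i j (x j)))\<^sup>2) | x. (\<Sum>j<n. (norm (x j))\<^sup>2) \<le> 1}"
  have val: "sqrt (\<Sum>i<n. (norm (\<Sum>j<n. M i j (x j)))\<^sup>2) = norm (?T (\<Sum>j<n. eps j (x j)))" for x
  proof -
    have "(norm (?T (\<Sum>j<n. eps j (x j))))\<^sup>2 = (\<Sum>i<n. (norm (\<Sum>j<n. M i j (x j)))\<^sup>2)"
      unfolding norm_matop_apply_sq [OF finite_lessThan]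
      by (intro sum.cong arg_cong [where f = "\<lambda>z. (norm z)\<^sup>2"]) (auto simp: finite_support_ell2)
    from real_sqrt_unique [OF this norm_ge_zero] show ?thesis .
  qed
  have nx: "norm (\<Sum>j<n. eps j (x j)) \<le> 1 \<longleftrightarrow> (\<Sum>j<n. (norm (x j))\<^sup>2) \<le> 1" for x :: "nat \<Rightarrow> 'a"
    unfolding finite_support_ell2(2) [OF finite_lessThan, symmetric] by (simp add: abs_square_le_1)
  have le: "s \<le> norm ?T" if "s \<in> ?S" for s
  proof -
    from that obtain x where x: "s = norm (?T (\<Sum>j<n. eps j (x j)))" "norm (\<Sum>j<n. eps j (x j)) \<le> 1"
      unfolding val nx by blast
    have "s \<le> norm ?T * norm (\<Sum>j<n. eps j (x j))" unfolding x(1) by (rule norm_blinfun)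
    also have "\<dots> \<le> norm ?T * 1" by (intro mult_left_mono x norm_ge_zero)
    finally show ?thesis by simp
  qed
  have zero: "0 \<in> ?S" by (intro CollectI exI [of _ "\<lambda>_. 0"]) simp
  have "Sup ?S = norm ?T"
  proof (rule order_antisym)
    show "Sup ?S \<le> norm ?T" using zero le by (intro cSup_least) auto
    have bdd: "bdd_above ?S" using le by (rule bdd_aboveI)
    have S0: "0 \<le> Sup ?S" using zero bdd by (rule cSup_upper)
    show "norm ?T \<le> Sup ?S"
    proof (rule norm_blinfun_bound [OF S0])
      fix y
      show "norm (?T y) \<le> Sup ?S * norm y"
      proof (cases "y = 0")
        case False
        define u where "u = inverse (norm y) *\<^sub>R y"
        have "norm u = 1" using False by (simp add: u_def)
        have "(\<Sum>j<n. (norm (coord u j))\<^sup>2) \<le> (norm u)\<^sup>2" by (rule finite_sum_le_norm_sq) simp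
        moreover have "sqrt (\<Sum>i<n. (norm (\<Sum>j<n. M i j (coord u j)))\<^sup>2) = norm (?T u)"
          by (rule real_sqrt_unique [OF norm_matop_apply_sq [OF finite_lessThan] norm_ge_zero])
        ultimately have "norm (?T u) \<in> ?S"
          using \<open>norm u = 1\<close> by (intro CollectI exI [of _ "coord u"]) simp
        then have "norm (?T u) \<le> Sup ?S" using bdd by (rule cSup_upper)
        then show ?thesis using False by (simp add: u_def blf_simps field_simps)
      qed simp
    qed
  qed
  then show ?thesis by (simp add: bounded_ops_def)
qed

section \<open>Complete contractivity of representations\<close>

lemma closed_vimage_blinfun:
  "closed S \<Longrightarrow> bounded_linear f \<Longrightarrow> closed {x. f x \<in> S}"
  using closed_vimage [of S f] by (simp add: vimage_def linear_continuous_on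
      continuous_on_eq_continuous_at)

lemma (in concrete_cstar) subspace_B: "subspace B"
  by (simp add: subspace_def zero_B add_B scaleR_B)

lemma (in concrete_cstar) sum_B: "(\<And>i. i \<in> S \<Longrightarrow> f i \<in> B) \<Longrightarrow> sum f S \<in> B"
  by (rule subspace_sum [OF subspace_B])

lemma (in star_rep) rep_sum: "(\<And>i. i \<in> S \<Longrightarrow> f i \<in> B) \<Longrightarrow> \<pi> (sum f S) = (\<Sum>i\<in>S. \<pi> (f i))"
  by (induction S rule: infinite_finite_induct) (auto simp: rep_zero rep_add sum_B)

interpretation comp: bounded_bilinear "(o\<^sub>L)"
  by (rule bounded_bilinear_blinfun_compose)

lemma bounded_linear_sandwich:
  "bounded_linear (\<lambda>R. P o\<^sub>L R o\<^sub>L Q)"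
  by (intro bounded_linear_compose [OF comp.bounded_linear_left]
      comp.bounded_linear_right)

definition matrices_over :: "'j set \<Rightarrow> 'h::complex_hilbert bop set \<Rightarrow> ('j, 'h) ell2 bop set" where
  "matrices_over F B = {R. trunc F o\<^sub>L R o\<^sub>L trunc F = R \<and>
    (\<forall>i\<in>F. \<forall>j\<in>F. prj i o\<^sub>L R o\<^sub>L eps j \<in> B)}"

lemma trunc_matop_trunc: "finite F \<Longrightarrow> trunc F o\<^sub>L matop F M o\<^sub>L trunc F = matop F M"
  unfolding trunc_matop by (rule matop_cong) (rule matop_entry)

lemma matop_in_matrices_over:
  "finite F \<Longrightarrow> (\<And>i j. i \<in> F \<Longrightarrow> j \<in> F \<Longrightarrow> M i j \<in> B) \<Longrightarrow> matop F M \<in> matrices_over F B"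
  by (simp add: matrices_over_def trunc_matop_trunc matop_entry)

lemma matrices_overE:
  assumes "R \<in> matrices_over F B"
  obtains M where "R = matop F M" "\<And>i j. i \<in> F \<Longrightarrow> j \<in> F \<Longrightarrow> M i j \<in> B"
proof (rule that [of "\<lambda>i j. prj i o\<^sub>L R o\<^sub>L eps j"])
  show "R = matop F (\<lambda>i j. prj i o\<^sub>L R o\<^sub>L eps j)"
    using assms trunc_matop [of F R] by (simp add: matrices_over_def)
qed (use assms in \<open>auto simp: matrices_over_def\<close>)

lemma (in concrete_cstar) matrices_over_cstar:
  assumes F: "finite F"
  shows "concrete_cstar (matrices_over F B)"
proof
  note mI = matop_in_matrices_over [OF F, where B = B]
  have "matrices_over F B = {R. trunc F o\<^sub>L R o\<^sub>L trunc F = R} \<inter>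
      (\<Inter>i\<in>F. \<Inter>j\<in>F. {R. prj i o\<^sub>L R o\<^sub>L eps j \<in> B})"
    by (auto simp: matrices_over_def)
  moreover have "closed {R. trunc F o\<^sub>L R o\<^sub>L trunc F = R}"
    by (intro closed_Collect_eq linear_continuous_on bounded_linear_sandwich continuous_on_id)
  moreover have "closed {R. prj i o\<^sub>L R o\<^sub>L eps j \<in> B}" for i j
    by (intro closed_vimage_blinfun closed_B bounded_linear_sandwich)
  ultimately show "closed (matrices_over F B)"
    by (simp only:) (intro closed_Int closed_INT ballI)
  show "0 \<in> matrices_over F B" by (simp add: matrices_over_def comp.zero_left
        comp.zero_right zero_B)
  fix a b assume a: "a \<in> matrices_over F B"
  obtain M where M: "a = matop F M" "\<And>i j. i \<in> F \<Longrightarrow> j \<in> F \<Longrightarrow> M i j \<in> B"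
    using matrices_overE [OF a] by metis
  have ap: "adjoint_pair a (matop F (\<lambda>i j. adj (M j i)))"
    unfolding M(1) by (rule adjoint_pair_matop) (simp add: adjoint_pair_adj clin_B M)
  show "clin a" by (rule adjoint_pair_clin [OF ap])
  show "adj a \<in> matrices_over F B"
    unfolding adj_eqI [OF ap] by (rule mI) (simp add: adj_B M)
  show "scale_op c a \<in> matrices_over F B" for c
    unfolding M(1) matop_scale [OF F, symmetric] by (rule mI) (simp add: scale_B M)
  assume b: "b \<in> matrices_over F B"
  obtain N where N: "b = matop F N" "\<And>i j. i \<in> F \<Longrightarrow> j \<in> F \<Longrightarrow> N i j \<in> B"
    using matrices_overE [OF b] by metis
  show "a + b \<in> matrices_over F B"
    unfolding M(1) N(1) matop_add [OF F, symmetric] by (rule mI) (simp add: add_B M N)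
  show "a o\<^sub>L b \<in> matrices_over F B"
    unfolding M(1) N(1) matop_mult [OF F, symmetric] by (rule mI) (simp add: sum_B mult_B M N)
qed

text \<open>Matrices over a concrete C*-algebra form a concrete C*-algebra again, on which the
  entrywise representation is a *-representation.\<close>

lemma (in star_rep) rep_completely_contractive:
  assumes F: "finite F" and M: "\<And>i j. i \<in> F \<Longrightarrow> j \<in> F \<Longrightarrow> M i j \<in> B"
  shows "norm (matop F (\<lambda>i j. \<pi> (M i j))) \<le> norm (matop F M)"
proof -
  define \<sigma> where "\<sigma> = (\<lambda>R. matop F (\<lambda>i j. \<pi> (prj i o\<^sub>L R o\<^sub>L eps j)))"
  have \<sigma>: "\<sigma> (matop F N) = matop F (\<lambda>i j. \<pi> (N i j))" for N
    unfolding \<sigma>_def by (rule matop_cong) (simp add: matop_entry F)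
  interpret m: concrete_cstar "matrices_over F B" by (rule matrices_over_cstar [OF F])
  interpret m: star_rep "matrices_over F B" \<sigma>
  proof
    fix a b assume a: "a \<in> matrices_over F B"
    obtain M where M: "a = matop F M" "\<And>i j. i \<in> F \<Longrightarrow> j \<in> F \<Longrightarrow> M i j \<in> B"
      using matrices_overE [OF a] by metis
    have ap: "adjoint_pair a (matop F (\<lambda>i j. adj (M j i)))"
      unfolding M(1) by (rule adjoint_pair_matop) (simp add: adjoint_pair_adj clin_B M)
    have sp: "adjoint_pair (\<sigma> a) (matop F (\<lambda>i j. adj (\<pi> (M j i))))"
      unfolding M(1) \<sigma> by (rule adjoint_pair_matop) (simp add: adjoint_pair_adj rep_clin M)
    show "clin (\<sigma> a)" by (rule adjoint_pair_clin [OF sp])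
    show "\<sigma> (adj a) = adj (\<sigma> a)"
      unfolding adj_eqI [OF ap] adj_eqI [OF sp] \<sigma> by (rule matop_cong) (simp add: rep_adj M)
    show "\<sigma> (scale_op c a) = scale_op c (\<sigma> a)" for c
      unfolding M(1) matop_scale [OF F, symmetric] \<sigma> by (rule matop_cong) (simp add: rep_scale M)
    assume b: "b \<in> matrices_over F B"
    obtain N where N: "b = matop F N" "\<And>i j. i \<in> F \<Longrightarrow> j \<in> F \<Longrightarrow> N i j \<in> B"
      using matrices_overE [OF b] by metis
    show "\<sigma> (a + b) = \<sigma> a + \<sigma> b"
      unfolding M(1) N(1) matop_add [OF F, symmetric] \<sigma> by (rule matop_cong) (simp add: rep_add M N)
    show "\<sigma> (a o\<^sub>L b) = \<sigma> a o\<^sub>L \<sigma> b"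
      unfolding M(1) N(1) matop_mult [OF F, symmetric] \<sigma>
      by (rule matop_cong) (simp add: rep_sum rep_mult mult_B M N)
  qed
  show ?thesis
    using m.rep_contractive [of "matop F M"] matop_in_matrices_over [OF F M] by (simp add: \<sigma>)
qed

section \<open>Extension by continuity\<close>

lemma subspace_closure_normed:
  fixes S :: "'a::real_normed_vector set"
  assumes "subspace S"
  shows "subspace (closure S)"
  unfolding subspace_def
proof (intro conjI ballI allI)
  show "0 \<in> closure S" using closure_subset subspace_0 [OF assms] by blast
  fix x y assume "x \<in> closure S" "y \<in> closure S"
  then obtain f g where "\<And>n::nat. f n \<in> S" "f \<longlonglongrightarrow> x" "\<And>n::nat. g n \<in> S" "g \<longlonglongrightarrow> y"
    by (auto simp: closure_sequential)
  then show "x + y \<in> closure S"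
    unfolding closure_sequential
    by (intro exI [of _ "\<lambda>n. f n + g n"]) (auto intro: tendsto_intros subspace_add [OF assms])
next
  fix c :: real and x assume "x \<in> closure S"
  then obtain f where "\<And>n::nat. f n \<in> S" "f \<longlonglongrightarrow> x" by (auto simp: closure_sequential)
  then show "c *\<^sub>R x \<in> closure S"
    unfolding closure_sequential
    by (intro exI [of _ "\<lambda>n. c *\<^sub>R f n"]) (auto intro: tendsto_intros subspace_scale [OF assms])
qed

text \<open>The closure of a bounded linear relation is the graph of a map.\<close>

lemma bounded_relation_extension:
  fixes D :: "('a::banach \<times> 'b::banach) set"
  assumes D: "subspace D" and bd: "\<And>x y. (x, y) \<in> D \<Longrightarrow> norm y \<le> C * norm x"
  obtains f where "\<And>x. x \<in> closure (fst ` D) \<Longrightarrow> (x, f x) \<in> closure D"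
    "\<And>x y. (x, y) \<in> closure D \<Longrightarrow> y = f x" "\<And>x y. (x, y) \<in> closure D \<Longrightarrow> norm y \<le> C * norm x"
proof -
  have "closed {p :: 'a \<times> 'b. norm (snd p) \<le> C * norm (fst p)}"
    by (intro closed_Collect_le continuous_intros)
  then have "closure D \<subseteq> {p. norm (snd p) \<le> C * norm (fst p)}"
    using bd by (intro closure_minimal) auto
  then have bd': "norm y \<le> C * norm x" if "(x, y) \<in> closure D" for x y
    using that by auto
  have sub: "subspace (closure D)" by (rule subspace_closure_normed [OF D])
  have uniq: "y = z" if "(x, y) \<in> closure D" "(x, z) \<in> closure D" for x y z
    using bd' [of "x - x" "y - z"] subspace_diff [OF sub that] by simp
  have ex: "\<exists>y. (x, y) \<in> closure D" if x: "x \<in> closure (fst ` D)" for x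
  proof -
    obtain u where u: "\<And>n::nat. u n \<in> fst ` D" "u \<longlonglongrightarrow> x"
      using x unfolding closure_sequential by metis
    then have "\<forall>n. \<exists>y. (u n, y) \<in> D" by force
    then obtain v where v: "\<And>n. (u n, v n) \<in> D" by metis
    have diff: "norm (v m - v n) \<le> C * norm (u m - u n)" for m n
      using bd [of "u m - u n" "v m - v n"] subspace_diff [OF D v [of m] v [of n]] by simp
    have "Cauchy v"
    proof (rule CauchyI)
      fix e :: real assume e: "0 < e"
      have "Cauchy u" using u by (blast intro: LIMSEQ_imp_Cauchy)
      moreover have "0 < e / (\<bar>C\<bar> + 1)" using e by simp
      ultimately obtain M where M: "\<And>m n. m \<ge> M \<Longrightarrow> n \<ge> M \<Longrightarrow> norm (u m - u n) < e / (\<bar>C\<bar> + 1)"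
        using CauchyD by metis
      have "norm (v m - v n) < e" if "m \<ge> M" "n \<ge> M" for m n
      proof -
        have "norm (v m - v n) \<le> (\<bar>C\<bar> + 1) * norm (u m - u n)"
          by (rule order_trans [OF diff]) (intro mult_right_mono, auto)
        also have "\<dots> < e" using M [OF that] by (simp add: field_simps)
        finally show ?thesis .
      qed
      then show "\<exists>M. \<forall>m\<ge>M. \<forall>n\<ge>M. norm (v m - v n) < e" by blast
    qed
    then obtain y where "v \<longlonglongrightarrow> y" using Cauchy_convergent convergent_def by blast
    then have "(\<lambda>n. (u n, v n)) \<longlonglongrightarrow> (x, y)" using u by (intro tendsto_Pair)
    then have "(x, y) \<in> closure D"
      using v unfolding closure_sequential by (intro exI [of _ "\<lambda>n. (u n, v n)"]) simp
    then show ?thesis by blast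
  qed
  show thesis
  proof (rule that [of "\<lambda>x. SOME y. (x, y) \<in> closure D"])
    show "(x, SOME y. (x, y) \<in> closure D) \<in> closure D" if "x \<in> closure (fst ` D)" for x
      using ex [OF that] by (rule someI_ex)
    show "y = (SOME y. (x, y) \<in> closure D)" if "(x, y) \<in> closure D" for x y
      using that uniq someI [of "\<lambda>y. (x, y) \<in> closure D" y] by blast
  qed (rule bd')
qed

lemma bounded_relation_extension_blinfun:
  fixes D :: "('a::banach \<times> 'b::banach) set"
  assumes D: "subspace D" and bd: "\<And>x y. (x, y) \<in> D \<Longrightarrow> norm y \<le> C * norm x" and C: "0 \<le> C"
    and dense: "closure (fst ` D) = UNIV"
  obtains T :: "'a \<Rightarrow>\<^sub>L 'b" where "\<And>x y. (x, y) \<in> D \<Longrightarrow> T x = y" "norm T \<le> C"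
proof -
  obtain f where f: "\<And>x. x \<in> closure (fst ` D) \<Longrightarrow> (x, f x) \<in> closure D"
    "\<And>x y. (x, y) \<in> closure D \<Longrightarrow> y = f x" "\<And>x y. (x, y) \<in> closure D \<Longrightarrow> norm y \<le> C * norm x"
    using bounded_relation_extension [OF D bd] by metis
  have g: "(x, f x) \<in> closure D" for x using f(1) dense by simp
  have sub: "subspace (closure D)" by (rule subspace_closure_normed [OF D])
  have "bounded_linear f"
  proof (rule bounded_linear_intro [where K = C])
    show "f (x + y) = f x + f y" for x y
      using f(2) [of "x + y" "f x + f y"] subspace_add [OF sub g g, of x y] by simp
    show "f (r *\<^sub>R x) = r *\<^sub>R f x" for r x
      using f(2) [of "r *\<^sub>R x" "r *\<^sub>R f x"] subspace_scale [OF sub g, of r x] by simp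
    show "norm (f x) \<le> norm x * C" for x
      using f(3) [OF g [of x]] by (simp add: mult.commute)
  qed
  then have T: "blinfun_apply (Blinfun f) = f" by (rule bounded_linear_Blinfun_apply)
  show thesis
  proof (rule that [of "Blinfun f"])
    show "Blinfun f x = y" if "(x, y) \<in> D" for x y
      using f(2) [of x y] that closure_subset T by fastforce
    show "norm (Blinfun f) \<le> C"
      by (rule norm_blinfun_bound [OF C]) (use f(3) [OF g] in \<open>simp add: T\<close>)
  qed
qed

lemma blinfun_eq_on_dense:
  fixes S T :: "'a::real_normed_vector \<Rightarrow>\<^sub>L 'b::real_normed_vector"
  assumes dense: "closure (span G) = UNIV" and eq: "\<And>x. x \<in> G \<Longrightarrow> S x = T x"
  shows "S = T"
proof (rule blinfun_eqI)
  fix x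
  have "subspace {x. S x = T x}" by (auto simp: subspace_def blf_simps)
  then have "span G \<subseteq> {x. S x = T x}" using eq by (intro span_minimal) auto
  moreover have "closed {x. S x = T x}"
    by (intro closed_Collect_eq linear_continuous_on blinfun.bounded_linear_right)
  ultimately have "closure (span G) \<subseteq> {x. S x = T x}" by (rule closure_minimal)
  then show "S x = T x" using dense by auto
qed

lemma clin_if_clin_on_dense:
  fixes T :: "'a::complex_hilbert \<Rightarrow>\<^sub>L 'b::complex_hilbert"
  assumes dense: "closure (span G) = UNIV" and eq: "\<And>x c. x \<in> G \<Longrightarrow> T (c *\<^sub>C x) = c *\<^sub>C T x"
  shows "clin T"
proof -
  have "T o\<^sub>L cscale c = cscale c o\<^sub>L T" for c
    by (rule blinfun_eq_on_dense [OF dense]) (simp add: eq)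
  then show ?thesis unfolding clin_def by (metis blinfun_apply_blinfun_compose cscale_apply)
qed

text \<open>If the Gram matrices of \<open>y\<close> and \<open>z\<close> add up to that of \<open>x\<close>, then \<open>x \<mapsto> y\<close> is a contraction.\<close>

lemma gram_extension:
  fixes S :: "('a::{real_inner,banach} \<times> 'b::{real_inner,banach} \<times> 'c::real_inner) set"
  assumes gram: "\<And>x y z x' y' z'. (x, y, z) \<in> S \<Longrightarrow> (x', y', z') \<in> S \<Longrightarrow>
      inner y y' + inner z z' = inner x x'"
    and dense: "closure (span (fst ` S)) = UNIV"
  obtains T :: "'a \<Rightarrow>\<^sub>L 'b" where "\<And>x y z. (x, y, z) \<in> S \<Longrightarrow> T x = y" "norm T \<le> 1"
proof -
  define q :: "'a \<times> 'b \<times> 'c \<Rightarrow> 'a \<times> 'b \<times> 'c \<Rightarrow> real"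
    where "q = (\<lambda>u v. inner (fst (snd u)) (fst (snd v)) + inner (snd (snd u)) (snd (snd v))
      - inner (fst u) (fst v))"
  have lin: "subspace {v. q u v = 0}" "subspace {u. q u v = 0}" for u v
    by (auto simp: subspace_def q_def inner_add_left inner_add_right algebra_simps
        simp flip: distrib_left)
  have "q u v = 0" if "u \<in> S" "v \<in> span S" for u v
    using span_minimal [OF _ lin(1) [of u], of S] gram that by (force simp: q_def)
  then have q0: "q u v = 0" if "u \<in> span S" "v \<in> span S" for u v
  proof -
    have "S \<subseteq> {u. q u v = 0}" using \<open>\<And>v u. u \<in> S \<Longrightarrow> v \<in> span S \<Longrightarrow> q u v = 0\<close> that by blast
    then show ?thesis using span_minimal [OF _ lin(2) [of v]] that by blast
  qed
  define D where "D = (\<lambda>(x, y, z). (x, y)) ` span S"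
  have l1: "linear (\<lambda>(x :: 'a, y :: 'b, z :: 'c). (x, y))" by (auto intro!: linearI)
  have l2: "linear (fst :: 'a \<times> 'b \<times> 'c \<Rightarrow> 'a)" by (rule linear_fst)
  have sD: "subspace D" unfolding D_def by (rule linear_subspace_image [OF l1]) simp
  have bD: "norm y \<le> 1 * norm x" if xy: "(x, y) \<in> D" for x y
  proof -
    obtain z where "(x, y, z) \<in> span S" using xy by (auto simp: D_def)
    then have "(norm y)\<^sup>2 + (norm z)\<^sup>2 = (norm x)\<^sup>2"
      using q0 by (force simp: q_def power2_norm_eq_inner)
    then have "(norm y)\<^sup>2 \<le> (norm x)\<^sup>2" using zero_le_power2 [of "norm z"] by linarith
    then show ?thesis by simp
  qed
  have "fst ` D = span (fst ` S)"
  proof -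
    have "fst ` D = fst ` span S" by (force simp: D_def image_iff)
    then show ?thesis by (simp add: linear_span_image [OF l2])
  qed
  then have dD: "closure (fst ` D) = UNIV" using dense by simp
  obtain T :: "'a \<Rightarrow>\<^sub>L 'b" where T: "\<And>x y. (x, y) \<in> D \<Longrightarrow> T x = y" "norm T \<le> 1"
    by (rule bounded_relation_extension_blinfun [OF sD bD _ dD]) auto
  have "T x = y" if "(x, y, z) \<in> S" for x y z
    using that span_base [of _ S] by (intro T) (force simp: D_def)
  then show thesis using T(2) that by blast
qed

section \<open>Tensor products of operators\<close>

lemma coord_tensor_vec [simp]: "coord (tensor_vec k x) j = coord x j *\<^sub>C k"
proof -
  have "(\<lambda>j. (norm (coord x j *\<^sub>C k))\<^sup>2) summable_on UNIV"
    using summable_on_cmult_left [OF coord_summable [of x], of "(norm k)\<^sup>2"]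
    by (simp add: norm_scaleC power_mult_distrib)
  then show ?thesis unfolding tensor_vec_def by (rule coord_Abs_ell2)
qed

lemma tensor_vec_linear:
  "tensor_vec (k + l) x = tensor_vec k x + tensor_vec l x"
  "tensor_vec k (x + y) = tensor_vec k x + tensor_vec k y"
  "tensor_vec (c *\<^sub>C k) x = c *\<^sub>C tensor_vec k x"
  "tensor_vec k (c *\<^sub>C x) = c *\<^sub>C tensor_vec k x"
  "tensor_vec (r *\<^sub>R k) x = r *\<^sub>R tensor_vec k x"
  "tensor_vec k (r *\<^sub>R x) = r *\<^sub>R tensor_vec k x"
  by (rule ell2_eqI; simp add: coord_add coord_scaleC coord_scaleR scaleC_add_left scaleC_add_right
      scaleC_scaleC scaleC_complex_def scaleR_scaleC mult.commute)+

lemma cinner_tensor_vec: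
  "cinner (tensor_vec k x) (tensor_vec l y) = cinner k l * cinner x y"
proof -
  have "cinner (tensor_vec k x) (tensor_vec l y) = (\<Sum>\<^sub>\<infinity>j. cinner k l * (cnj (coord x j) * coord y j))"
    unfolding cinner_ell2_def by (simp add: cinner_scaleC_left cinner_scaleC_right ac_simps)
  also have "\<dots> = cinner k l * (\<Sum>\<^sub>\<infinity>j. cnj (coord x j) * coord y j)"
    by (rule infsum_cmult_right')
  finally show ?thesis by (simp add: cinner_ell2_def cinner_complex_def)
qed

lemma norm_tensor_vec: "norm (tensor_vec k x) = norm k * norm x"
proof -
  have "complex_of_real ((norm (tensor_vec k x))\<^sup>2) = complex_of_real ((norm k * norm x)\<^sup>2)"
    unfolding cinner_self [symmetric] cinner_tensor_vec by (simp add: cinner_self power_mult_distrib)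
  then show ?thesis unfolding of_real_eq_iff by (simp add: power2_eq_iff_nonneg)
qed

definition tvec :: "'j l2 \<Rightarrow> 'k::complex_hilbert \<Rightarrow>\<^sub>L ('j, 'k) ell2" where
  "tvec x = Blinfun (\<lambda>k. tensor_vec k x)"

lemma tvec_apply [simp]: "tvec x k = tensor_vec k x" for k :: "'k::complex_hilbert"
proof -
  have "bounded_linear (\<lambda>k :: 'k. tensor_vec k x)"
    by (rule bounded_linear_intro [where K = "norm x"]) (simp_all add: tensor_vec_linear norm_tensor_vec)
  then show ?thesis by (simp add: tvec_def bounded_linear_Blinfun_apply)
qed

lemma clin_tvec [simp, intro]: "clin (tvec x)"
  by (simp add: clin_def tensor_vec_linear)

lemma coord_delta: "coord (delta s) i = (if i = s then 1 else 0)"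
proof -
  have "coord (eps s (1 :: complex)) = (\<lambda>i. if i = s then 1 else 0)"
    by (rule ext) simp
  then have "delta s = eps s 1"
    unfolding delta_def by (metis coord_inverse)
  then show ?thesis by simp
qed

lemma eps_one: "eps s 1 = delta s"
  by (rule ell2_eqI) (simp add: coord_delta)

lemma tensor_vec_delta [simp]: "tensor_vec k (delta j) = eps j k"
  by (rule ell2_eqI) (simp add: coord_delta scaleC_one)

lemma norm_delta [simp]: "norm (delta j) = 1"
  unfolding eps_one [symmetric] by simp

abbreviation tensor_vecs :: "('j, 'k::complex_hilbert) ell2 set" where
  "tensor_vecs \<equiv> {tensor_vec k x | k x. True}"

lemma tensor_vecs_dense:
  "closure (span (tensor_vecs :: ('j, 'k::complex_hilbert) ell2 set)) = UNIV"
proof -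
  have "x \<in> closure (span tensor_vecs)" for x :: "('j, 'k) ell2"
  proof (rule closed_subspace_ell2_UNIV)
    show "eps j k \<in> closure (span tensor_vecs)" for j :: 'j and k :: 'k
    proof -
      have "tensor_vec k (delta j) \<in> span tensor_vecs" by (rule span_base) blast
      then show ?thesis using closure_subset [of "span tensor_vecs"] by auto
    qed
  qed (auto intro: subspace_closure_normed)
  then show ?thesis by blast
qed

lemma tensor_blinfun_eqI:
  "(\<And>k x. blinfun_apply S (tensor_vec k x) = blinfun_apply T (tensor_vec k x)) \<Longrightarrow> S = T"
  by (rule blinfun_eq_on_dense [OF tensor_vecs_dense]) auto

lemma concrete_cstar_clin: "concrete_cstar {T. clin T}"
  by unfold_locales (auto simp: closed_clin)

text \<open>For a contraction \<open>b\<close>, the operator \<open>1 \<otimes> b\<close> is a contraction because \<open>1 - b\<^sup>*b = d\<^sup>*d\<close>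
  for some \<open>d\<close>, so that the Gram matrices of \<open>k\<^sub>i \<otimes> b x\<^sub>i\<close> and \<open>k\<^sub>i \<otimes> d x\<^sub>i\<close> add up to that
  of \<open>k\<^sub>i \<otimes> x\<^sub>i\<close>.\<close>

lemma amplification_contraction_exists:
  fixes b :: "'j l2 bop"
  assumes b: "clin b" "norm b \<le> 1"
  obtains T :: "('j, 'k::complex_hilbert) ell2 bop"
  where "\<And>k x. T (tensor_vec k x) = tensor_vec k (b x)" "norm T \<le> 1"
proof -
  interpret concrete_cstar "{T :: 'j l2 bop. clin T}" by (rule concrete_cstar_clin)
  note ab = adjoint_pair_adj [OF b(1)]
  define c where "c = adj b o\<^sub>L b"
  have c: "adjoint_pair c c" unfolding c_def by (intro adjoint_pair_comp adjoint_pair_sym [OF ab] ab)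
  have "norm c \<le> 1" unfolding c_def norm_adjoint_pair_comp [OF ab] using b by (simp add: power_le_one)
  then obtain w where w: "clin w" "adj w = w" "2 *\<^sub>R w - (w o\<^sub>L w) = c"
    using one_minus_sqrt_exists [OF _ adj_eqI [OF c]] adjoint_pair_clin [OF c] by blast
  define d where "d = id_blinfun - w"
  have dd: "adjoint_pair d d"
    unfolding d_def by (intro adjoint_pair_diff adjoint_pair_id) (metis adjoint_pair_adj w(1,2))
  have "cinner (d x) (d y) = cinner x (d (d y))" for x y by (rule adjoint_pairD [OF dd])
  moreover have "d (d y) = y - c y" for y
    unfolding w(3) [symmetric] d_def by (simp add: blf_simps scaleR_2)
  moreover have "cinner (b x) (b y) = cinner x (c y)" for x y
    by (simp add: adjoint_pairD [OF ab] c_def)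
  ultimately have gram: "cinner (b x) (b y) + cinner (d x) (d y) = cinner x y" for x y
    by (simp add: cinner_simps)
  define S :: "(('j, 'k) ell2 \<times> ('j, 'k) ell2 \<times> ('j, 'k) ell2) set"
    where "S = {(tensor_vec k x, tensor_vec k (b x), tensor_vec k (d x)) | k x. True}"
  have SG: "inner y y' + inner z z' = inner x x'" if "(x, y, z) \<in> S" "(x', y', z') \<in> S" for x y z x' y' z'
  proof -
    have "cinner y y' + cinner z z' = cinner x x'"
      using that by (auto simp: S_def cinner_tensor_vec) (metis distrib_left gram)
    then show ?thesis by (metis inner_Re_cinner plus_complex.sel(1))
  qed
  have "fst ` S = tensor_vecs" by (force simp: S_def image_iff)
  then have SD: "closure (span (fst ` S)) = UNIV" by (simp only: tensor_vecs_dense)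
  obtain T :: "('j, 'k) ell2 bop" where T: "\<And>x y z. (x, y, z) \<in> S \<Longrightarrow> T x = y" "norm T \<le> 1"
    by (rule gram_extension [OF SG SD]) blast+
  show thesis
  proof (rule that [of T])
    show "T (tensor_vec k x) = tensor_vec k (b x)" for k x
      by (rule T(1) [of _ _ "tensor_vec k (d x)"]) (auto simp: S_def)
  qed (rule T)
qed

lemma op_tensor_exists:
  fixes a :: "'k::complex_hilbert bop" and b :: "'j l2 bop"
  assumes a: "clin a" and b: "clin b"
  obtains T where "clin T" "\<And>k x. T (tensor_vec k x) = tensor_vec (a k) (b x)"
    "norm T \<le> norm a * norm b"
proof -
  obtain T0 :: "('j, 'k) ell2 bop" where
    T0: "\<And>k x. T0 (tensor_vec k x) = tensor_vec k ((inverse (norm b) *\<^sub>R b) x)" "norm T0 \<le> 1"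
    by (rule amplification_contraction_exists [of "inverse (norm b) *\<^sub>R b"])
      (use b in \<open>auto simp: divide_simps\<close>)
  have ca: "coord (diagop (\<lambda>_. a) x) j = a (coord x j)" for x and j :: 'j
    using coord_diagop [of "\<lambda>_. a" "norm a"] a by simp
  define T where "T = diagop (\<lambda>_. a) o\<^sub>L (norm b *\<^sub>R T0)"
  have T: "T (tensor_vec k x) = tensor_vec (a k) (b x)" for k x
  proof -
    have "norm b *\<^sub>R (inverse (norm b) *\<^sub>R b) = b" by (cases "b = 0") auto
    then have "(norm b *\<^sub>R T0) (tensor_vec k x) = tensor_vec k (b x)"
      by (metis T0(1) scaleR_blinfun.rep_eq tensor_vec_linear(6))
    then show ?thesis using a
      by (intro ell2_eqI) (simp add: T_def ca clin_def)
  qed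
  have "norm T \<le> norm (diagop (\<lambda>_ :: 'j. a)) * norm (norm b *\<^sub>R T0)"
    unfolding T_def by (rule norm_blinfun_compose)
  also have "\<dots> \<le> norm a * norm b"
    using T0(2) mult_left_mono [OF T0(2), of "norm b"] a by (intro mult_mono norm_diagop_le) auto
  finally have n: "norm T \<le> norm a * norm b" .
  have "T (c *\<^sub>C tensor_vec k x) = c *\<^sub>C T (tensor_vec k x)" for c k x
    using T [of "c *\<^sub>C k" x] a by (simp add: T clin_def tensor_vec_linear(3))
  then have "clin T" by (intro clin_if_clin_on_dense [OF tensor_vecs_dense]) auto
  then show thesis using T n by (rule that)
qed

lemma op_tensor_eqI:
  assumes T: "\<And>k x. blinfun_apply T (tensor_vec k x) = tensor_vec (blinfun_apply a k) (blinfun_apply b x)"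
    and a: "clin a" and b: "clin b"
  shows "op_tensor a b = T"
proof -
  obtain T' where T': "clin T'" "\<And>k x. T' (tensor_vec k x) = tensor_vec (a k) (b x)"
    using op_tensor_exists [OF a b] by metis
  have "T = T'" by (rule tensor_blinfun_eqI) (simp add: T T'(2))
  then show ?thesis unfolding op_tensor_def
    using T T'(1) by (intro the_equality) (auto simp: clinear_ops_iff_clin intro: tensor_blinfun_eqI)
qed

lemma op_tensor:
  assumes "clin a" "clin b"
  shows op_tensor_apply: "op_tensor a b (tensor_vec k x) = tensor_vec (a k) (b x)"
    and clin_op_tensor: "clin (op_tensor a b)"
    and norm_op_tensor_le: "norm (op_tensor a b) \<le> norm a * norm b"
proof -
  obtain T where T: "clin T" "\<And>k x. T (tensor_vec k x) = tensor_vec (a k) (b x)"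
    "norm T \<le> norm a * norm b"
    using op_tensor_exists [OF assms] by metis
  have "op_tensor a b = T" by (rule op_tensor_eqI [OF T(2) assms])
  with T show "op_tensor a b (tensor_vec k x) = tensor_vec (a k) (b x)" "clin (op_tensor a b)"
    "norm (op_tensor a b) \<le> norm a * norm b" by simp_all
qed

lemma op_tensor_mult:
  "clin a \<Longrightarrow> clin b \<Longrightarrow> clin a' \<Longrightarrow> clin b' \<Longrightarrow>
    op_tensor a b o\<^sub>L op_tensor a' b' = op_tensor (a o\<^sub>L a') (b o\<^sub>L b')"
  by (rule op_tensor_eqI [symmetric]) (auto simp: op_tensor_apply)

lemma op_tensor_add_left:
  "clin a \<Longrightarrow> clin a' \<Longrightarrow> clin b \<Longrightarrow> op_tensor (a + a') b = op_tensor a b + op_tensor a' b"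
  by (rule op_tensor_eqI) (auto simp: op_tensor_apply blf_simps tensor_vec_linear)

lemma op_tensor_scale_left:
  "clin a \<Longrightarrow> clin b \<Longrightarrow> op_tensor (scale_op c a) b = scale_op c (op_tensor a b)"
  by (rule op_tensor_eqI) (auto simp: op_tensor_apply scale_op_apply tensor_vec_linear)

lemma op_tensor_id: "op_tensor id_blinfun id_blinfun = id_blinfun"
  by (rule op_tensor_eqI) auto

lemma adjoint_pair_if_on_dense:
  fixes S :: "'a::complex_hilbert \<Rightarrow>\<^sub>L 'b::complex_hilbert"
  assumes G: "closure (span G) = UNIV" and H: "closure (span H) = UNIV"
    and eq: "\<And>x y. x \<in> G \<Longrightarrow> y \<in> H \<Longrightarrow> cinner (S x) y = cinner x (blinfun_apply T y)"
  shows "adjoint_pair S T"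
proof -
  have cl: "closed {x. cinner (S x) y = cinner x (T y)}" "closed {y. cinner (S x) y = cinner x (T y)}" for x y
    by (intro closed_Collect_eq continuous_on_id cinner.continuous_on continuous_on_const
      linear_continuous_on blinfun.bounded_linear_right)+
  have sub: "subspace {x. cinner (S x) y = cinner x (T y)}" "subspace {y. cinner (S x) y = cinner x (T y)}" for x y
    by (auto simp: subspace_def blf_simps cinner_simps)
  have "closure (span G) \<subseteq> {x. cinner (S x) y = cinner x (T y)}" if "y \<in> H" for y
    using eq that by (intro closure_minimal cl span_minimal sub) auto
  then have "cinner (S x) y = cinner x (T y)" if "y \<in> H" for x y using G that by auto
  then have "closure (span H) \<subseteq> {y. cinner (S x) y = cinner x (T y)}" for x
    by (intro closure_minimal cl span_minimal sub) auto
  then show ?thesis using H by (intro adjoint_pairI) auto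
qed

lemma adjoint_pair_op_tensor:
  assumes "adjoint_pair a a'" "adjoint_pair b b'"
  shows "adjoint_pair (op_tensor a b) (op_tensor a' b')"
  using adjoint_pair_clin [OF assms(1)] adjoint_pair_clin [OF assms(2)]
    adjoint_pair_clin2 [OF assms(1)] adjoint_pair_clin2 [OF assms(2)]
  by (intro adjoint_pair_if_on_dense [OF tensor_vecs_dense tensor_vecs_dense])
    (auto simp: op_tensor_apply cinner_tensor_vec adjoint_pairD [OF assms(1)] adjoint_pairD [OF assms(2)])

lemma op_tensor_entry:
  assumes "clin a" "clin b"
  shows "prj i o\<^sub>L op_tensor a b o\<^sub>L eps j = scale_op (coord (b (delta j)) i) a"
proof (rule blinfun_eqI)
  fix k
  have "op_tensor a b (eps j k) = tensor_vec (a k) (b (delta j))"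
    using op_tensor_apply [OF assms, of k "delta j"] by simp
  then show "(prj i o\<^sub>L op_tensor a b o\<^sub>L eps j) k = scale_op (coord (b (delta j)) i) a k"
    by (simp add: scale_op_apply)
qed

text \<open>For a representation \<open>\<pi>\<close>, the map \<open>\<pi> \<otimes> id\<close> on the closed span of the tensors
  \<open>a \<otimes> b\<close>.  Applied to compressions to finitely many coordinates it is an amplification of
  \<open>\<pi>\<close> to matrices, hence it is contractive.\<close>

definition (in concrete_cstar) tensors :: "('j, 'h) ell2 bop set" where
  "tensors = {op_tensor a b | a b. a \<in> B \<and> clin b}"

lemma closure_comp_closed:
  fixes S :: "('a::complex_hilbert bop \<times> 'b::complex_hilbert bop) set"
  assumes S: "\<And>u v. u \<in> S \<Longrightarrow> v \<in> S \<Longrightarrow> (fst u o\<^sub>L fst v, snd u o\<^sub>L snd v) \<in> S"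
    and uv: "u \<in> closure (span S)" "v \<in> closure (span S)"
  shows "(fst u o\<^sub>L fst v, snd u o\<^sub>L snd v) \<in> closure (span S)"
proof -
  let ?m = "\<lambda>u v. (fst u o\<^sub>L fst v, snd u o\<^sub>L snd v) :: 'a bop \<times> 'b bop"
  have b1: "bounded_linear (\<lambda>u. ?m u v)" and b2: "bounded_linear (\<lambda>v. ?m u v)" for u v
    by (intro bounded_linear_Pair bounded_linear_compose [OF comp.bounded_linear_left]
        bounded_linear_compose [OF comp.bounded_linear_right] bounded_linear_fst bounded_linear_snd)+
  let ?C = "closure (span S)"
  have sub: "subspace {u. ?m u v \<in> ?C}" "subspace {v. ?m u v \<in> ?C}" for u v
  proof -
    have C: "subspace ?C" by (intro subspace_closure_normed) simp
    show "subspace {u. ?m u v \<in> ?C}" "subspace {v. ?m u v \<in> ?C}"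
      using linear_subspace_vimage [OF bounded_linear.linear [OF b1] C]
        linear_subspace_vimage [OF bounded_linear.linear [OF b2] C]
      by (simp_all add: vimage_def)
  qed
  have cl: "closed {u. ?m u v \<in> ?C}" "closed {v. ?m u v \<in> ?C}" for u v
    by (intro closed_vimage_blinfun b1 b2 closed_closure)+
  have "?m u v \<in> ?C" if "u \<in> S" "v \<in> S" for u v
    using S [OF that] closure_subset span_superset by blast
  then have "?C \<subseteq> {v. ?m u v \<in> ?C}" if "u \<in> S" for u
    using that by (intro closure_minimal span_minimal sub cl) auto
  then have "?C \<subseteq> {u. ?m u v \<in> ?C}" if "v \<in> ?C" for v
    using that by (intro closure_minimal span_minimal sub cl) auto
  then show ?thesis using uv by blast
qed

lemma (in star_rep) rep_tensor_identity_exists: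
  defines "C \<equiv> closure (span (tensors :: ('j, 'h) ell2 bop set))"
  obtains \<Theta> :: "('j, 'h) ell2 bop \<Rightarrow> ('j, 'k) ell2 bop" where
    "\<And>a b. a \<in> B \<Longrightarrow> clin b \<Longrightarrow> \<Theta> (op_tensor a b) = op_tensor (\<pi> a) b"
    "\<And>t. t \<in> C \<Longrightarrow> norm (\<Theta> t) \<le> norm t" "\<And>t. t \<in> C \<Longrightarrow> clin (\<Theta> t)"
    "\<And>s t. s \<in> C \<Longrightarrow> t \<in> C \<Longrightarrow> \<Theta> (s + t) = \<Theta> s + \<Theta> t"
    "\<And>s t. s \<in> C \<Longrightarrow> t \<in> C \<Longrightarrow> \<Theta> (s o\<^sub>L t) = \<Theta> s o\<^sub>L \<Theta> t"
    "\<And>c t. t \<in> C \<Longrightarrow> \<Theta> (scale_op c t) = scale_op c (\<Theta> t)"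
proof -
  define S :: "(('j, 'h) ell2 bop \<times> ('j, 'k) ell2 bop) set"
    where "S = {(op_tensor a b, op_tensor (\<pi> a) b) | a b. a \<in> B \<and> clin b}"
  let ?D = "closure (span S)"
  have sub: "subspace ?D" by (intro subspace_closure_normed) simp
  have SC: "fst ` S = tensors" by (force simp: S_def tensors_def)
  have fspan: "fst ` span S = span (tensors :: ('j, 'h) ell2 bop set)"
    by (simp add: linear_span_image [OF linear_fst, symmetric] SC)
  have entry: "prj i o\<^sub>L x o\<^sub>L eps j \<in> B \<and> prj i o\<^sub>L y o\<^sub>L eps j = \<pi> (prj i o\<^sub>L x o\<^sub>L eps j)"
    if "(x, y) \<in> span S" for x y i j
  proof -
    let ?e = "\<lambda>x. prj i o\<^sub>L x o\<^sub>L eps j"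
    define V where "V = {u :: ('j, 'h) ell2 bop \<times> ('j, 'k) ell2 bop.
        prj i o\<^sub>L fst u o\<^sub>L eps j \<in> B \<and> prj i o\<^sub>L snd u o\<^sub>L eps j = \<pi> (prj i o\<^sub>L fst u o\<^sub>L eps j)}"
    have "subspace V"
      by (auto simp: V_def subspace_def comp.zero_left comp.zero_right comp.add_left comp.add_right
          comp.scaleR_left comp.scaleR_right zero_B add_B scaleR_B rep_zero rep_add rep_scaleR)
    moreover have "S \<subseteq> V"
      by (auto simp: V_def S_def op_tensor_entry clin_B rep_clin scale_B rep_scale)
    ultimately show ?thesis using span_minimal [of S V] that by (auto simp: V_def)
  qed
  have bd: "norm y \<le> 1 * norm x" if xy: "(x, y) \<in> span S" for x y
  proof -
    have "norm (trunc F o\<^sub>L y o\<^sub>L trunc F) \<le> norm x" if F: "finite F" for F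
    proof -
      have "trunc F o\<^sub>L y o\<^sub>L trunc F = matop F (\<lambda>i j. \<pi> (prj i o\<^sub>L x o\<^sub>L eps j))"
        unfolding trunc_matop by (rule matop_cong) (simp add: entry [OF xy])
      also have "norm \<dots> \<le> norm (matop F (\<lambda>i j. prj i o\<^sub>L x o\<^sub>L eps j))"
        by (rule rep_completely_contractive [OF F]) (simp add: entry [OF xy])
      also have "\<dots> = norm (trunc F o\<^sub>L x o\<^sub>L trunc F)" by (simp add: trunc_matop)
      also have "\<dots> \<le> (norm (trunc F :: ('j, 'h) ell2 bop) * norm x) * norm (trunc F :: ('j, 'h) ell2 bop)"
        by (intro order_trans [OF norm_blinfun_compose] mult_right_mono norm_blinfun_compose norm_ge_zero)
      also have "\<dots> \<le> (1 * norm x) * 1" by (intro mult_mono norm_trunc_le F) auto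
      finally show ?thesis by simp
    qed
    then show ?thesis by (simp add: norm_le_if_truncated_le)
  qed
  have fC: "closure (fst ` span S) = C" by (simp only: fspan C_def)
  obtain \<Theta> where "\<And>x. x \<in> closure (fst ` span S) \<Longrightarrow> (x, \<Theta> x) \<in> ?D"
    and \<Theta>': "\<And>x y. (x, y) \<in> ?D \<Longrightarrow> y = \<Theta> x" "\<And>x y. (x, y) \<in> ?D \<Longrightarrow> norm y \<le> 1 * norm x"
    by (rule bounded_relation_extension [OF subspace_span bd]) blast+
  then have "\<And>x. x \<in> C \<Longrightarrow> (x, \<Theta> x) \<in> ?D" by (simp only: fC)
  note \<Theta> = this \<Theta>'
  have "closed {u :: ('j, 'h) ell2 bop \<times> ('j, 'k) ell2 bop. clin (snd u)}"
    using closed_vimage_blinfun [OF closed_clin bounded_linear_snd] by simp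
  moreover have "subspace {u :: ('j, 'h) ell2 bop \<times> ('j, 'k) ell2 bop. clin (snd u)}"
    by (auto simp: subspace_def)
  ultimately have Dclin: "?D \<subseteq> {u. clin (snd u)}"
    by (intro closure_minimal span_minimal) (auto simp: S_def clin_op_tensor rep_clin)
  have mult: "(fst u o\<^sub>L fst v, snd u o\<^sub>L snd v) \<in> ?D" if "u \<in> ?D" "v \<in> ?D" for u v
  proof (rule closure_comp_closed [OF _ that])
    fix u v assume "u \<in> S" "v \<in> S"
    then obtain a b a' b' where u: "u = (op_tensor a b, op_tensor (\<pi> a) b)" "a \<in> B" "clin b"
      and v: "v = (op_tensor a' b', op_tensor (\<pi> a') b')" "a' \<in> B" "clin b'"
      by (auto simp: S_def)
    show "(fst u o\<^sub>L fst v, snd u o\<^sub>L snd v) \<in> S"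
      unfolding S_def using u v
      by (intro CollectI exI [of _ "a o\<^sub>L a'"] exI [of _ "b o\<^sub>L b'"])
        (auto simp: op_tensor_mult clin_B rep_clin rep_mult mult_B)
  qed
  have scale: "(scale_op c (fst u), scale_op c (snd u)) \<in> ?D" if "u \<in> ?D" for c u
  proof -
    let ?f = "\<lambda>u. (scale_op c (fst u), scale_op c (snd u)) :: ('j, 'h) ell2 bop \<times> ('j, 'k) ell2 bop"
    have bl: "bounded_linear ?f" unfolding scale_op_eq
      by (intro bounded_linear_Pair bounded_linear_compose [OF comp.bounded_linear_right]
          bounded_linear_fst bounded_linear_snd)
    have "S \<subseteq> {u. ?f u \<in> ?D}"
    proof
      fix u assume "u \<in> S"
      then obtain a b where u: "u = (op_tensor a b, op_tensor (\<pi> a) b)" "a \<in> B" "clin b"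
        by (auto simp: S_def)
      then have "?f u \<in> S" unfolding S_def
        by (intro CollectI exI [of _ "scale_op c a"] exI [of _ b])
          (auto simp: op_tensor_scale_left clin_B rep_clin rep_scale scale_B)
      then show "u \<in> {u. ?f u \<in> ?D}" using closure_subset span_superset by blast
    qed
    moreover have "subspace {u. ?f u \<in> ?D}"
      using linear_subspace_vimage [OF bounded_linear.linear [OF bl] sub] by (simp add: vimage_def)
    moreover have "closed {u. ?f u \<in> ?D}" by (intro closed_vimage_blinfun bl closed_closure)
    ultimately have "?D \<subseteq> {u. ?f u \<in> ?D}" by (intro closure_minimal span_minimal)
    then show ?thesis using that by blast
  qed
  show thesis
  proof (rule that)
    show "\<Theta> (op_tensor a b) = op_tensor (\<pi> a) b" if "a \<in> B" "clin b" for a b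
    proof (rule \<Theta>(2) [symmetric])
      have "(op_tensor a b, op_tensor (\<pi> a) b) \<in> S" using that by (auto simp: S_def)
      then show "(op_tensor a b, op_tensor (\<pi> a) b) \<in> ?D" using closure_subset span_superset by blast
    qed
    show "norm (\<Theta> t) \<le> norm t" if "t \<in> C" for t using \<Theta>(3) [OF \<Theta>(1) [OF that]] by simp
    show "clin (\<Theta> t)" if "t \<in> C" for t using Dclin \<Theta>(1) [OF that] by auto
    show "\<Theta> (s + t) = \<Theta> s + \<Theta> t" if "s \<in> C" "t \<in> C" for s t
      using subspace_add [OF sub \<Theta>(1) [OF that(1)] \<Theta>(1) [OF that(2)]] by (auto dest: \<Theta>(2))
    show "\<Theta> (s o\<^sub>L t) = \<Theta> s o\<^sub>L \<Theta> t" if "s \<in> C" "t \<in> C" for s t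
      using mult [OF \<Theta>(1) [OF that(1)] \<Theta>(1) [OF that(2)]] by (auto dest: \<Theta>(2))
    show "\<Theta> (scale_op c t) = scale_op c (\<Theta> t)" if "t \<in> C" for c t
      using scale [OF \<Theta>(1) [OF that], of c] by (auto dest: \<Theta>(2))
  qed
qed

section \<open>Uniform boundedness\<close>

lemma uniform_boundedness:
  fixes \<phi> :: "'i \<Rightarrow> 'a::banach \<Rightarrow>\<^sub>L 'b::real_normed_vector"
  assumes V: "subspace V" and cl: "closed V"
    and pw: "\<And>x. x \<in> V \<Longrightarrow> \<exists>C. \<forall>i\<in>J. norm (\<phi> i x) \<le> C"
  obtains C where "0 \<le> C" "\<And>i x. i \<in> J \<Longrightarrow> x \<in> V \<Longrightarrow> norm (\<phi> i x) \<le> C * norm x"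
proof -
  define N where "N = (\<lambda>i. Sup ((\<lambda>x. norm (\<phi> i x)) ` {x \<in> V. norm x \<le> 1}))"
  have bdd: "bdd_above ((\<lambda>x. norm (\<phi> i x)) ` {x \<in> V. norm x \<le> 1})" for i
  proof (rule bdd_aboveI2 [where M = "norm (\<phi> i)"])
    fix x assume "x \<in> {x \<in> V. norm x \<le> 1}"
    then show "norm (\<phi> i x) \<le> norm (\<phi> i)"
      using norm_blinfun [of "\<phi> i" x] mult_left_mono [of "norm x" 1 "norm (\<phi> i)"] by simp
  qed
  have Nup: "norm (\<phi> i x) \<le> N i" if "x \<in> V" "norm x \<le> 1" for i x
    unfolding N_def by (rule cSup_upper [OF _ bdd]) (use that in auto)
  have N0: "0 \<le> N i" for i using Nup [of 0 i] subspace_0 [OF V] by (simp add: blf_simps)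
  have Nbd: "norm (\<phi> i x) \<le> N i * norm x" if "x \<in> V" for i x
  proof (cases "x = 0")
    case False
    have "norm (\<phi> i (inverse (norm x) *\<^sub>R x)) \<le> N i"
      by (rule Nup) (use False subspace_scale [OF V that] in auto)
    then show ?thesis using False by (simp add: blf_simps field_simps)
  qed (simp add: blf_simps)
  have near: "\<exists>x\<in>V. norm x \<le> 1 \<and> norm (\<phi> i x) \<ge> 2/3 * N i" for i
  proof (cases "N i = 0")
    case False
    then have lt: "2/3 * N i < N i" using N0 [of i] by simp
    have "(\<lambda>x. norm (\<phi> i x)) ` {x \<in> V. norm x \<le> 1} \<noteq> {}"
      using subspace_0 [OF V] by auto
    from less_cSupD [OF this, of "2/3 * N i"] lt
    have "\<exists>r\<in>(\<lambda>x. norm (\<phi> i x)) ` {x \<in> V. norm x \<le> 1}. 2/3 * N i < r" by (simp only: N_def)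
    then show ?thesis by (auto intro!: less_imp_le)
  qed (use subspace_0 [OF V] in \<open>auto intro!: bexI [of _ 0]\<close>)
  show thesis
  proof (cases "\<exists>C. \<forall>i\<in>J. N i \<le> C")
    case True
    then obtain C where C: "\<And>i. i \<in> J \<Longrightarrow> N i \<le> C" by blast
    show thesis
    proof (rule that [of "\<bar>C\<bar>"])
      show "norm (\<phi> i x) \<le> \<bar>C\<bar> * norm x" if "i \<in> J" "x \<in> V" for i x
        using Nbd [OF that(2), of i] C [OF that(1)] mult_right_mono [of "N i" "\<bar>C\<bar>" "norm x"]
        by fastforce
    qed simp
  next
    case False
    then have "\<forall>n::nat. \<exists>i\<in>J. 4 ^ n < N i" by (meson not_le)
    then obtain i where iJ: "\<And>n. i n \<in> J" and i: "\<And>n::nat. 4 ^ n < N (i n)" by metis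
    obtain x where xV: "\<And>n. x n \<in> V" and x1: "\<And>n. norm (x n) \<le> 1"
      and xN: "\<And>n. norm (\<phi> (i n) (x n)) \<ge> 2/3 * N (i n)"
    proof -
      have "\<forall>n. \<exists>x. x \<in> V \<and> norm x \<le> 1 \<and> 2/3 * N (i n) \<le> norm (\<phi> (i n) x)" using near by blast
      from choice [OF this] show thesis using that by blast
    qed
    \<comment> \<open>Of the two points \<open>a \<plusminus> x\<close>, one has an image at least as long as that of \<open>x\<close>.\<close>
    have pick: "\<exists>s\<in>{1, - 1 :: real}. norm (\<phi> (i n) (a + (s / 3 ^ n) *\<^sub>R x n)) \<ge> 2/3 * N (i n) / 3 ^ n" for a n
    proof -
      define u where "u = (1 / 3 ^ n) *\<^sub>R x n"
      have "2 * norm (\<phi> (i n) u) = norm (\<phi> (i n) (a + u) - \<phi> (i n) (a - u))"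
        by (simp add: blf_simps flip: scaleR_2)
      also have "\<dots> \<le> norm (\<phi> (i n) (a + u)) + norm (\<phi> (i n) (a - u))" by (rule norm_triangle_ineq4)
      finally have "norm (\<phi> (i n) u) \<le> norm (\<phi> (i n) (a + u)) \<or> norm (\<phi> (i n) u) \<le> norm (\<phi> (i n) (a - u))"
        by linarith
      moreover have "norm (\<phi> (i n) u) \<ge> 2/3 * N (i n) / 3 ^ n"
        using divide_right_mono [OF xN [of n], of "3 ^ n"] by (simp add: u_def blf_simps)
      ultimately have "norm (\<phi> (i n) (a + u)) \<ge> 2/3 * N (i n) / 3 ^ n
          \<or> norm (\<phi> (i n) (a - u)) \<ge> 2/3 * N (i n) / 3 ^ n" by linarith
      then show ?thesis by (auto simp: u_def)
    qed
    then obtain s where s: "\<And>n a. s n a \<in> {1, - 1 :: real}"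
      and big: "\<And>n a. norm (\<phi> (i n) (a + (s n a / 3 ^ n) *\<^sub>R x n)) \<ge> 2/3 * N (i n) / 3 ^ n"
      by metis
    define a where "a = rec_nat 0 (\<lambda>n b. b + (s n b / 3 ^ n) *\<^sub>R x n)"
    have aS: "a (Suc n) = a n + (s n (a n) / 3 ^ n) *\<^sub>R x n" for n by (simp add: a_def)
    have aV: "a n \<in> V" for n
      by (induction n) (simp_all add: aS subspace_add [OF V] subspace_scale [OF V] xV,
          simp add: a_def subspace_0 [OF V])
    have step: "norm (a (Suc n) - a n) \<le> (1/3) ^ n" for n
    proof -
      have "\<bar>s n (a n)\<bar> = 1" using s [of n "a n"] by auto
      then show ?thesis using x1 [of n] by (simp add: aS power_divide divide_right_mono)
    qed
    have tail: "norm (a (n + k) - a n) \<le> (\<Sum>l<k. (1/3) ^ (n + l))" for n k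
    proof (induction k)
      case (Suc k)
      have "norm (a (n + Suc k) - a n) \<le> norm (a (Suc (n + k)) - a (n + k)) + norm (a (n + k) - a n)"
        using norm_triangle_ineq [of "a (Suc (n + k)) - a (n + k)" "a (n + k) - a n"] by simp
      then show ?case using Suc step [of "n + k"] by simp
    qed simp
    have geo: "(\<Sum>l<k. (1/3 :: real) ^ (n + l)) \<le> 3/2 * (1/3) ^ n" for n k
    proof -
      have "(\<Sum>l<k. (1/3 :: real) ^ (n + l)) = (1/3) ^ n * (\<Sum>l<k. (1/3) ^ l)"
        by (simp add: power_add sum_distrib_left)
      also have "(\<Sum>l<k. (1/3 :: real) ^ l) = 3/2 * (1 - (1/3) ^ k)" by (simp add: sum_gp_strict)
      also have "(1/3) ^ n * (3/2 * (1 - (1/3 :: real) ^ k)) \<le> (1/3) ^ n * (3/2)"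
        by (intro mult_left_mono) auto
      finally show ?thesis by simp
    qed
    have close: "norm (a m - a n) \<le> 3/2 * (1/3) ^ n" if "m \<ge> n" for m n
      using order_trans [OF tail [of n "m - n"] geo [of n "m - n"]] that by simp
    have "Cauchy a"
    proof (rule CauchyI)
      fix e :: real assume "0 < e"
      then obtain M where M: "(1/3 :: real) ^ M < e / 3"
        using real_arch_pow_inv [of "e / 3" "1/3"] by auto
      have "norm (a m - a n) < e" if "m \<ge> M" "n \<ge> M" for m n
      proof -
        have "norm (a m - a n) \<le> norm (a m - a M) + norm (a n - a M)"
          using norm_triangle_ineq4 [of "a m - a M" "a n - a M"] by simp
        also have "\<dots> \<le> 3/2 * (1/3) ^ M + 3/2 * (1/3) ^ M"
          by (intro add_mono close that)
        also have "\<dots> < e" using M by simp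
        finally show ?thesis .
      qed
      then show "\<exists>M. \<forall>m\<ge>M. \<forall>n\<ge>M. norm (a m - a n) < e" by blast
    qed
    then obtain b where b: "a \<longlonglongrightarrow> b" using Cauchy_convergent convergent_def by blast
    have bV: "b \<in> V" using closed_sequentially [OF cl] aV b by blast
    have far: "norm (\<phi> (i n) b) \<ge> 1/6 * (4/3) ^ n" for n
    proof -
      have "norm (b - a (Suc n)) \<le> 3/2 * (1/3) ^ Suc n"
        by (rule LIMSEQ_le_const2 [OF tendsto_norm [OF tendsto_diff [OF b tendsto_const]]])
          (use close in blast)
      then have "norm (\<phi> (i n) (b - a (Suc n))) \<le> N (i n) * (1/2 * (1/3) ^ n)"
        using Nbd [OF subspace_diff [OF V bV aV [of "Suc n"]], of "i n"]
          mult_left_mono [OF _ N0 [of "i n"], of "norm (b - a (Suc n))" "1/2 * (1/3) ^ n"]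
        by simp
      moreover have "norm (\<phi> (i n) (a (Suc n))) \<ge> 2/3 * N (i n) * (1/3) ^ n"
        using big [where n = n and a = "a n"] by (simp add: aS power_divide)
      moreover have "norm (\<phi> (i n) (a (Suc n))) \<le> norm (\<phi> (i n) b) + norm (\<phi> (i n) (b - a (Suc n)))"
        using norm_triangle_ineq4 [of "\<phi> (i n) b" "\<phi> (i n) (b - a (Suc n))"] by (simp add: blf_simps)
      ultimately have "norm (\<phi> (i n) b) \<ge> 1/6 * (N (i n) * (1/3) ^ n)" by (simp add: algebra_simps)
      moreover have "4 ^ n * (1/3) ^ n \<le> N (i n) * (1/3 :: real) ^ n"
        by (intro mult_right_mono less_imp_le i) simp
      moreover have "(4 :: real) ^ n * (1/3) ^ n = (4/3) ^ n" by (simp add: power_divide)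
      ultimately show ?thesis by linarith
    qed
    obtain C where C: "\<And>n. norm (\<phi> (i n) b) \<le> C" using pw [OF bV] iJ by blast
    obtain n where "6 * C < (4/3 :: real) ^ n" using real_arch_pow [of "4/3" "6 * C"] by auto
    then show thesis using far [of n] C [of n] by simp
  qed
qed

section \<open>Adjointable operators on direct sums as Hilbert space operators\<close>

text \<open>If \<open>a\<^sub>k\<close> is the length of \<open>(T\<^sup>*T)\<^sup>k z\<close>, the hypothesis is the Cauchy--Schwarz inequality.\<close>

lemma growth_bound:
  fixes a :: "nat \<Rightarrow> real"
  assumes pos: "\<And>k. 0 \<le> a k" and cs: "\<And>k. (a k)\<^sup>2 \<le> a 0 * a (2 * k)"
    and gr: "\<And>k. a k \<le> C * d ^ k" and d: "0 \<le> d"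
  shows "a 1 \<le> d * a 0"
proof (rule ccontr)
  assume "\<not> a 1 \<le> d * a 0"
  then have less: "d * a 0 < a 1" by simp
  have a0: "0 < a 0"
  proof (rule ccontr)
    assume "\<not> 0 < a 0"
    then have "a 0 = 0" using pos [of 0] by simp
    then show False using cs [of 1] less by simp
  qed
  have pow: "(a 1 / a 0) ^ (2 ^ m) \<le> a (2 ^ m) / a 0" for m
  proof (induction m)
    case (Suc m)
    have "(a 1 / a 0) ^ (2 ^ Suc m) = ((a 1 / a 0) ^ (2 ^ m))\<^sup>2"
      by (simp add: mult.commute flip: power_mult)
    also have "\<dots> \<le> (a (2 ^ m) / a 0)\<^sup>2" by (intro power_mono Suc) (use pos in simp)
    also have "\<dots> \<le> a (2 * 2 ^ m) / a 0"
      using cs [of "2 ^ m"] a0 by (simp add: power_divide power2_eq_square field_simps)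
    finally show ?case by simp
  qed simp
  show False
  proof (cases "d = 0")
    case True
    then have "a 2 = 0" using gr [of 2] pos [of 2] by simp
    moreover have "(a 1)\<^sup>2 \<le> a 0 * a 2" using cs [of 1] by simp
    ultimately show False using less True by simp
  next
    case False
    then have dp: "0 < d" using d by simp
    define q where "q = a 1 / a 0 / d"
    have "1 < q" using less a0 dp by (simp add: q_def field_simps)
    then obtain n where n: "C / a 0 < q ^ n" using real_arch_pow by blast
    have "n \<le> 2 ^ n" by (simp add: less_imp_le)
    then have "q ^ n \<le> q ^ (2 ^ n)" using \<open>1 < q\<close> by (intro power_increasing) auto
    also have "\<dots> = (a 1 / a 0) ^ (2 ^ n) / d ^ (2 ^ n)" by (simp only: q_def power_divide)
    also have "\<dots> \<le> (a (2 ^ n) / a 0) / d ^ (2 ^ n)" using dp by (intro divide_right_mono pow) simp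
    also have "\<dots> \<le> (C * d ^ (2 ^ n) / a 0) / d ^ (2 ^ n)"
      using dp a0 by (intro divide_right_mono gr) auto
    also have "\<dots> = C / a 0" using dp by simp
    finally show False using n by simp
  qed
qed

definition lincomb :: "(('a::real_normed_vector \<Rightarrow>\<^sub>L 'b::real_normed_vector) \<times> 'a) list \<Rightarrow> 'b" where
  "lincomb l = (\<Sum>(Z, h)\<leftarrow>l. blinfun_apply Z h)"

definition act :: "('z \<Rightarrow> 'w) \<Rightarrow> ('z \<times> 'a) list \<Rightarrow> ('w \<times> 'a) list" where
  "act t l = map (\<lambda>(Z, h). (t Z, h)) l"

lemma lincomb_simps [simp]:
  "lincomb [] = 0" "lincomb ((Z, h) # l) = Z h + lincomb l" "lincomb (l @ l') = lincomb l + lincomb l'"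
  by (simp_all add: lincomb_def)

lemma act_simps [simp]:
  "act t [] = []" "act t ((Z, h) # l) = (t Z, h) # act t l" "act t (l @ l') = act t l @ act t l'"
  by (simp_all add: act_def)

lemma act_comp: "act t (act s l) = act (t \<circ> s) l"
  by (induction l) auto

lemma set_act: "set l \<subseteq> E \<times> UNIV \<Longrightarrow> (\<And>Z. Z \<in> E \<Longrightarrow> t Z \<in> E') \<Longrightarrow> set (act t l) \<subseteq> E' \<times> UNIV"
  by (induction l) auto

lemma lincomb_act_scale: "lincomb (act t (map (\<lambda>(Z, h). (Z, r *\<^sub>R h)) l)) = r *\<^sub>R lincomb (act t l)"
  by (induction l) (auto simp: blf_simps scaleR_add_right)

lemma act_id: "act (\<lambda>Z. Z) l = l"
  by (induction l) auto

lemma lincomb_scale: "lincomb (map (\<lambda>(Z, h). (Z, r *\<^sub>R h)) l) = r *\<^sub>R lincomb l"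
  using lincomb_act_scale [of "\<lambda>Z. Z"] by (simp add: act_id)

lemma inner_lincomb_act:
  fixes t s :: "('a::real_normed_vector \<Rightarrow>\<^sub>L 'b::real_inner) \<Rightarrow> 'a \<Rightarrow>\<^sub>L 'b"
  assumes ad: "\<And>Z W h k. Z \<in> E \<Longrightarrow> W \<in> E \<Longrightarrow> inner (t Z h) (blinfun_apply W k) = inner (blinfun_apply Z h) (s W k)"
    and l: "set l \<subseteq> E \<times> UNIV" and l': "set l' \<subseteq> E \<times> UNIV"
  shows "inner (lincomb (act t l)) (lincomb l') = inner (lincomb l) (lincomb (act s l'))"
proof -
  have "inner (lincomb (act t l)) (W k) = inner (lincomb l) (s W k)" if "W \<in> E" for W k
    using l by (induction l) (auto simp: inner_add_left ad that)
  then show ?thesis using l' by (induction l') (auto simp: inner_add_right)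
qed

text \<open>An operator with an adjoint on a set of maps \<open>Z\<close> is bounded on the vectors \<open>\<Sum> Z\<^sub>i h\<^sub>i\<close>
  with the bound that it has on the maps; a priori one only knows the weaker estimate by
  \<open>\<Sum> \<parallel>Z\<^sub>i\<parallel> \<parallel>h\<^sub>i\<parallel>\<close>, which the powers of \<open>st\<close> improve.\<close>

lemma norm_lincomb_act_le:
  fixes t s :: "('a::real_normed_vector \<Rightarrow>\<^sub>L 'b::real_inner) \<Rightarrow> 'a \<Rightarrow>\<^sub>L 'b"
  assumes E: "\<And>Z. Z \<in> E \<Longrightarrow> t Z \<in> E" "\<And>Z. Z \<in> E \<Longrightarrow> s Z \<in> E"
    and ad: "\<And>Z W h k. Z \<in> E \<Longrightarrow> W \<in> E \<Longrightarrow> inner (t Z h) (blinfun_apply W k) = inner (blinfun_apply Z h) (s W k)"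
    and bt: "\<And>Z. Z \<in> E \<Longrightarrow> norm (t Z) \<le> c * norm Z" and bs: "\<And>Z. Z \<in> E \<Longrightarrow> norm (s Z) \<le> c' * norm Z"
    and c: "0 \<le> c" "0 \<le> c'" and l: "set l \<subseteq> E \<times> UNIV"
  shows "(norm (lincomb (act t l)))\<^sup>2 \<le> c * c' * (norm (lincomb l))\<^sup>2"
proof -
  define B where "B = s \<circ> t"
  have BE: "(B ^^ k) Z \<in> E" if "Z \<in> E" for Z k
    by (induction k) (auto simp: B_def that E)
  have Bad: "inner (B Z h) (blinfun_apply W k) = inner (blinfun_apply Z h) (B W k)" if "Z \<in> E" "W \<in> E" for Z W h k
    using ad [OF that(1) E(1) [OF that(2)], of h k] ad [OF that(2) E(1) [OF that(1)], of k h]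
    by (simp add: B_def inner_commute)
  have Bkad: "inner ((B ^^ n) Z h) (blinfun_apply W k) = inner (blinfun_apply Z h) ((B ^^ n) W k)"
    if "Z \<in> E" "W \<in> E" for Z W h k n
    using that
  proof (induction n arbitrary: W k)
    case (Suc n)
    have "B W \<in> E" using BE [OF Suc.prems(2), of 1] by simp
    then show ?case using Suc Bad [OF BE [OF Suc.prems(1)] Suc.prems(2), of n h k]
      by (simp add: funpow_swap1)
  qed simp
  define a where "a = (\<lambda>k. norm (lincomb (act (B ^^ k) l)))"
  have ip: "inner (lincomb (act (B ^^ m) l)) (lincomb (act (B ^^ n) l))
      = inner (lincomb l) (lincomb (act (B ^^ (m + n)) l))" for m n
    using inner_lincomb_act [OF Bkad l set_act [OF l BE]]
    by (simp add: act_comp funpow_add)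
  have Bn: "norm ((B ^^ k) Z) \<le> (c * c') ^ k * norm Z" if "Z \<in> E" for Z k
  proof (induction k)
    case (Suc k)
    have "norm ((B ^^ Suc k) Z) \<le> c' * (c * norm ((B ^^ k) Z))"
      using order_trans [OF bs [OF E(1) [OF BE [OF that]]] mult_left_mono [OF bt [OF BE [OF that]] c(2)]]
      by (simp add: B_def)
    also have "\<dots> \<le> c' * (c * ((c * c') ^ k * norm Z))" by (intro mult_left_mono Suc c)
    finally show ?case by (simp add: ac_simps)
  qed simp
  have gr: "a k \<le> (\<Sum>(Z, h)\<leftarrow>l. norm Z * norm h) * (c * c') ^ k" for k
    unfolding a_def using l
  proof (induction l)
    case (Cons p l)
    obtain Z h where p: "p = (Z, h)" by fastforce
    then have "Z \<in> E" using Cons.prems by auto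
    have "norm ((B ^^ k) Z h + lincomb (act (B ^^ k) l)) \<le> norm ((B ^^ k) Z) * norm h + norm (lincomb (act (B ^^ k) l))"
      by (rule order_trans [OF norm_triangle_ineq]) (intro add_right_mono norm_blinfun)
    also have "\<dots> \<le> ((c * c') ^ k * norm Z) * norm h + (\<Sum>(Z, h)\<leftarrow>l. norm Z * norm h) * (c * c') ^ k"
      using Cons by (intro add_mono mult_right_mono Bn \<open>Z \<in> E\<close>) auto
    finally show ?case by (simp add: p algebra_simps)
  qed simp
  have "(a k)\<^sup>2 \<le> a 0 * a (2 * k)" for k
  proof -
    have "(a k)\<^sup>2 = inner (lincomb l) (lincomb (act (B ^^ (2 * k)) l))"
      unfolding a_def power2_norm_eq_inner ip by (simp add: mult_2)
    also have "\<dots> \<le> norm (lincomb l) * a (2 * k)" unfolding a_def by (rule norm_cauchy_schwarz)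
    finally show ?thesis by (simp add: a_def act_id id_def)
  qed
  from growth_bound [OF _ this gr] c have a1: "a 1 \<le> c * c' * a 0" by (simp add: a_def)
  have a0: "a 0 = norm (lincomb l)" by (simp add: a_def act_id id_def)
  have "(norm (lincomb (act t l)))\<^sup>2 = inner (lincomb l) (lincomb (act B l))"
    using inner_lincomb_act [OF ad l set_act [OF l E(1)]]
    by (simp add: power2_norm_eq_inner act_comp B_def)
  also have "\<dots> \<le> norm (lincomb l) * a 1" unfolding a_def by (simp add: norm_cauchy_schwarz)
  also have "\<dots> \<le> norm (lincomb l) * (c * c' * norm (lincomb l))"
    using a1 a0 by (intro mult_left_mono) auto
  finally show ?thesis by (simp add: power2_eq_square ac_simps)
qed

lemma span_subset_lincomb:
  "span {blinfun_apply Z h | Z h. Z \<in> E} \<subseteq> {lincomb l | l. set l \<subseteq> E \<times> UNIV}"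
proof (rule span_minimal)
  show "{blinfun_apply Z h | Z h. Z \<in> E} \<subseteq> {lincomb l | l. set l \<subseteq> E \<times> UNIV}"
  proof clarify
    fix Z :: "'b \<Rightarrow>\<^sub>L 'a" and h assume "Z \<in> E"
    then show "\<exists>l. blinfun_apply Z h = lincomb l \<and> set l \<subseteq> E \<times> UNIV"
      by (intro exI [of _ "[(Z, h)]"]) simp
  qed
  show "subspace {lincomb l | l. set l \<subseteq> E \<times> (UNIV :: 'b set)}"
    unfolding subspace_def
  proof (intro conjI ballI allI)
    show "0 \<in> {lincomb l | l. set l \<subseteq> E \<times> (UNIV :: 'b set)}" by (intro CollectI exI [of _ "[]"]) simp
    fix x y assume "x \<in> {lincomb l | l. set l \<subseteq> E \<times> (UNIV :: 'b set)}" "y \<in> {lincomb l | l. set l \<subseteq> E \<times> (UNIV :: 'b set)}"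
    then obtain l l' where l: "x = lincomb l" "y = lincomb l'" "set l \<subseteq> E \<times> UNIV" "set l' \<subseteq> E \<times> UNIV" by blast
    then show "x + y \<in> {lincomb l | l. set l \<subseteq> E \<times> (UNIV :: 'b set)}"
      by (intro CollectI exI [of _ "l @ l'"]) simp
  next
    fix x and c :: real assume "x \<in> {lincomb l | l. set l \<subseteq> E \<times> (UNIV :: 'b set)}"
    then obtain l where l: "x = lincomb l" "set l \<subseteq> E \<times> UNIV" by blast
    then show "c *\<^sub>R x \<in> {lincomb l | l. set l \<subseteq> E \<times> (UNIV :: 'b set)}"
      by (intro CollectI exI [of _ "map (\<lambda>(Z, h). (Z, c *\<^sub>R h)) l"]) (auto simp: lincomb_scale)
  qed
qed

text \<open>A vector \<open>\<xi>\<close> of the direct sum is viewed as the operator \<open>Z\<close> from \<open>H\<close> to \<open>l\<^sup>2(I; H)\<close> with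
  coordinates \<open>\<xi> i\<close>; then \<open>\<langle>\<xi>, \<eta>\<rangle> = Z\<^sup>*W\<close>, and the norm convergence of \<open>\<Sum>\<^sub>i \<xi>\<^sub>i\<^sup>*\<xi>\<^sub>i\<close> becomes
  the norm convergence of the truncations of \<open>Z\<close>.\<close>

locale module_family =
  fixes I :: "'i set" and Y :: "'i \<Rightarrow> 'h::complex_hilbert bop set"
  assumes fibre_subspace: "i \<in> I \<Longrightarrow> linear_subspace bounded_ops (Y i)"
    and fibre_closed: "i \<in> I \<Longrightarrow> closed (Y i)"
begin

lemma fibre:
  assumes "i \<in> I"
  shows fibre_clin: "y \<in> Y i \<Longrightarrow> clin y" and fibre_zero: "0 \<in> Y i"
    and fibre_add: "y \<in> Y i \<Longrightarrow> y' \<in> Y i \<Longrightarrow> y + y' \<in> Y i"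
    and fibre_scale: "y \<in> Y i \<Longrightarrow> scale_op c y \<in> Y i"
  using fibre_subspace [OF assms]
  by (auto simp: linear_subspace_def bounded_ops_def clinear_ops_iff_clin)

lemma fibre_scaleR: "i \<in> I \<Longrightarrow> y \<in> Y i \<Longrightarrow> r *\<^sub>R y \<in> Y i"
  using fibre_scale [of i y "complex_of_real r"] by (simp add: scale_op_eq cscale_of_real)

definition vecs :: "('h \<Rightarrow>\<^sub>L ('i, 'h) ell2) set" where
  "vecs = {Z. (\<forall>i\<in>I. prj i o\<^sub>L Z \<in> Y i) \<and> (\<forall>i. i \<notin> I \<longrightarrow> prj i o\<^sub>L Z = 0) \<and>
    ((\<lambda>F. trunc F o\<^sub>L Z) \<longlongrightarrow> Z) (finite_subsets_at_top UNIV)}"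

definition fam :: "('h \<Rightarrow>\<^sub>L ('i, 'h) ell2) \<Rightarrow> 'i \<Rightarrow> 'h bop" where
  "fam Z = (\<lambda>i. prj i o\<^sub>L Z)"

definition vec :: "('i \<Rightarrow> 'h bop) \<Rightarrow> 'h \<Rightarrow>\<^sub>L ('i, 'h) ell2" where
  "vec \<xi> = (THE Z. fam Z = \<xi>)"

lemma fam_apply: "fam Z i h = coord (Z h) i"
  by (simp add: fam_def)

lemma fam_inject: "fam Z = fam W \<longleftrightarrow> Z = W"
  by (metis (no_types, lifting) blinfun_eqI ell2_eqI fam_apply)

lemma vec_fam [simp]: "vec (fam Z) = Z"
  unfolding vec_def by (rule the_equality) (auto simp: fam_inject)

lemma vecs_clin: "Z \<in> vecs \<Longrightarrow> clin Z"
proof -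
  assume Z: "Z \<in> vecs"
  have "clin (prj i o\<^sub>L Z)" for i
    using Z fibre_clin [of i] by (cases "i \<in> I") (auto simp: vecs_def)
  then have "coord (Z (c *\<^sub>C h)) i = c *\<^sub>C coord (Z h) i" for c h i
    by (simp add: clin_def)
  then show ?thesis unfolding clin_def by (auto intro!: ell2_eqI simp: coord_scaleC)
qed

lemma vecs_zero: "0 \<in> vecs"
  by (simp add: vecs_def comp.zero_right fibre_zero)

lemma vecs_add: "Z \<in> vecs \<Longrightarrow> W \<in> vecs \<Longrightarrow> Z + W \<in> vecs"
  by (auto simp: vecs_def comp.add_right intro: fibre_add tendsto_add)

lemma vecs_scaleR: "Z \<in> vecs \<Longrightarrow> r *\<^sub>R Z \<in> vecs"
  by (auto simp: vecs_def comp.scaleR_right intro: fibre_scaleR tendsto_scaleR)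

lemma subspace_vecs: "subspace vecs"
  by (simp add: subspace_def vecs_zero vecs_add vecs_scaleR)

lemma vecs_scale: "Z \<in> vecs \<Longrightarrow> cscale c o\<^sub>L Z \<in> vecs"
proof -
  assume Z: "Z \<in> vecs"
  have pc: "prj i o\<^sub>L (cscale c o\<^sub>L Z) = scale_op c (prj i o\<^sub>L Z)" for i
    by (rule blinfun_eqI) (simp add: scale_op_eq coord_scaleC)
  have "trunc F o\<^sub>L (cscale c o\<^sub>L Z) = cscale c o\<^sub>L (trunc F o\<^sub>L Z)" for F
    by (metis adjoint_pair_clin adjoint_pair_trunc blinfun_compose_assoc cscale_commute)
  moreover have "((\<lambda>F. cscale c o\<^sub>L (trunc F o\<^sub>L Z)) \<longlongrightarrow> cscale c o\<^sub>L Z) (finite_subsets_at_top UNIV)"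
    using Z by (intro comp.tendsto tendsto_const) (simp add: vecs_def)
  ultimately show ?thesis using Z
    by (auto simp: vecs_def pc intro: fibre_scale) (simp add: scale_op_eq comp.zero_right)
qed

lemma closed_vecs: "closed vecs"
  unfolding closed_sequential_limits
proof (intro allI impI)
  fix W Z assume *: "(\<forall>n. W n \<in> vecs) \<and> W \<longlonglongrightarrow> Z"
  then have W: "W n \<in> vecs" for n by blast
  have lim: "W \<longlonglongrightarrow> Z" using * by blast
  have limc: "(\<lambda>n. prj i o\<^sub>L W n) \<longlonglongrightarrow> (prj i o\<^sub>L Z)" for i
    by (intro comp.tendsto tendsto_const lim)
  have "prj i o\<^sub>L Z \<in> Y i" if "i \<in> I" for i
    using closed_sequentially [OF fibre_closed [OF that] _ limc] W that by (auto simp: vecs_def)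
  moreover have "prj i o\<^sub>L Z = 0" if "i \<notin> I" for i
  proof -
    have "prj i o\<^sub>L W n = 0" for n using W [of n] that by (simp add: vecs_def)
    then show ?thesis using limc [of i] by (simp add: LIMSEQ_const_iff)
  qed
  moreover have "((\<lambda>F. trunc F o\<^sub>L Z) \<longlongrightarrow> Z) (finite_subsets_at_top UNIV)"
    unfolding tendsto_iff
  proof (intro allI impI)
    fix e :: real assume "0 < e"
    then have "0 < e / 3" by simp
    then obtain n where n: "dist (W n) Z < e / 3"
      using lim unfolding tendsto_iff eventually_sequentially by blast
    have "eventually (\<lambda>F. dist (trunc F o\<^sub>L W n) (W n) < e / 3) (finite_subsets_at_top UNIV)"
    proof -
      have "((\<lambda>F. trunc F o\<^sub>L W n) \<longlongrightarrow> W n) (finite_subsets_at_top UNIV)"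
        using W [of n] by (simp add: vecs_def)
      from this [unfolded tendsto_iff, rule_format, OF \<open>0 < e / 3\<close>] show ?thesis .
    qed
    moreover have "eventually (\<lambda>F. finite F) (finite_subsets_at_top UNIV)"
      by (rule eventually_finite_subsets_at_top_weakI)
    ultimately show "eventually (\<lambda>F. dist (trunc F o\<^sub>L Z) Z < e) (finite_subsets_at_top UNIV)"
    proof eventually_elim
      case (elim F)
      have "norm (trunc F o\<^sub>L (Z - W n)) \<le> 1 * norm (Z - W n)"
        by (rule order_trans [OF norm_blinfun_compose]) (intro mult_right_mono norm_trunc_le elim norm_ge_zero)
      then have "dist (trunc F o\<^sub>L Z) (trunc F o\<^sub>L W n) < e / 3"
        using n by (simp add: dist_norm comp.diff_right norm_minus_commute)
      moreover have "dist (trunc F o\<^sub>L Z) Z \<le> dist (trunc F o\<^sub>L Z) (trunc F o\<^sub>L W n)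
          + dist (trunc F o\<^sub>L W n) (W n) + dist (W n) Z"
        using dist_triangle [of "trunc F o\<^sub>L Z" Z "trunc F o\<^sub>L W n"]
          dist_triangle [of "trunc F o\<^sub>L W n" Z "W n"] by linarith
      ultimately show ?case using elim n by simp
    qed
  qed
  ultimately show "Z \<in> vecs" by (simp add: vecs_def)
qed

lemma eps_in_vecs: "i \<in> I \<Longrightarrow> y \<in> Y i \<Longrightarrow> eps i o\<^sub>L y \<in> vecs"
proof -
  assume i: "i \<in> I" and y: "y \<in> Y i"
  have p: "prj j o\<^sub>L (eps i o\<^sub>L y) = (if j = i then y else 0)" for j
    by (rule blinfun_eqI) auto
  have "eventually (\<lambda>F. trunc F o\<^sub>L (eps i o\<^sub>L y) = eps i o\<^sub>L y) (finite_subsets_at_top UNIV)"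
    unfolding eventually_finite_subsets_at_top
  proof (intro exI [of _ "{i}"] conjI allI impI)
    fix F assume "finite F \<and> {i} \<subseteq> F \<and> F \<subseteq> UNIV"
    then show "trunc F o\<^sub>L (eps i o\<^sub>L y) = eps i o\<^sub>L y"
      by (intro blinfun_eqI ell2_eqI) (auto simp: coord_trunc)
  qed auto
  then have "((\<lambda>F. trunc F o\<^sub>L (eps i o\<^sub>L y)) \<longlongrightarrow> eps i o\<^sub>L y) (finite_subsets_at_top UNIV)"
    by (rule tendsto_eventually)
  then show ?thesis using i y by (auto simp: vecs_def p fibre_zero)
qed

lemma vecs_induct:
  assumes Z: "Z \<in> vecs" and sub: "subspace V" and cl: "closed V"
    and gen: "\<And>i y. i \<in> I \<Longrightarrow> y \<in> Y i \<Longrightarrow> eps i o\<^sub>L y \<in> V"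
  shows "Z \<in> V"
proof -
  have lim: "((\<lambda>F. trunc F o\<^sub>L Z) \<longlongrightarrow> Z) (finite_subsets_at_top UNIV)" using Z by (simp add: vecs_def)
  have "eps i o\<^sub>L prj i o\<^sub>L Z \<in> V" for i
    unfolding blinfun_compose_assoc
    using Z gen [of i "prj i o\<^sub>L Z"] subspace_0 [OF sub]
    by (cases "i \<in> I") (auto simp: vecs_def comp.zero_right)
  then have "trunc F o\<^sub>L Z \<in> V" for F
    by (simp add: trunc_def comp.sum_left subspace_sum [OF sub])
  then show ?thesis by (intro Lim_in_closed_set [OF cl _ finite_subsets_at_top_neq_bot lim]) simp
qed

lemma has_sum_gram:
  assumes Z: "clin Z" and W: "W \<in> vecs"
  shows "((\<lambda>i. adj (fam Z i) o\<^sub>L fam W i) has_sum (hadj Z o\<^sub>L W)) UNIV"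
proof -
  have "adj (fam Z i) = hadj Z o\<^sub>L eps i" for i
    unfolding fam_def by (intro adj_eqI adjoint_pair_comp adjoint_pair_prj adjoint_pair_hadj Z)
  then have "(\<Sum>i\<in>F. adj (fam Z i) o\<^sub>L fam W i) = hadj Z o\<^sub>L (trunc F o\<^sub>L W)" for F
    by (simp add: fam_def trunc_def comp.sum_left comp.sum_right blinfun_compose_assoc)
  then have eq: "sum (\<lambda>i. adj (fam Z i) o\<^sub>L fam W i) = (\<lambda>F. hadj Z o\<^sub>L (trunc F o\<^sub>L W))"
    by (rule ext)
  have "((\<lambda>F. hadj Z o\<^sub>L (trunc F o\<^sub>L W)) \<longlongrightarrow> hadj Z o\<^sub>L W) (finite_subsets_at_top UNIV)"
    using W by (intro comp.tendsto tendsto_const) (simp add: vecs_def)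
  then show ?thesis unfolding has_sum_def eq .
qed

lemma has_sum_gram_I:
  assumes Z: "clin Z" and W: "W \<in> vecs"
  shows "((\<lambda>i. adj (fam Z i) o\<^sub>L fam W i) has_sum (hadj Z o\<^sub>L W)) I"
proof -
  have "((\<lambda>i. adj (fam Z i) o\<^sub>L fam W i) has_sum (hadj Z o\<^sub>L W)) I
      \<longleftrightarrow> ((\<lambda>i. adj (fam Z i) o\<^sub>L fam W i) has_sum (hadj Z o\<^sub>L W)) UNIV"
    by (rule has_sum_cong_neutral) (use W in \<open>auto simp: vecs_def fam_def comp.zero_right\<close>)
  then show ?thesis using has_sum_gram [OF assms] by simp
qed

lemma fam_in_dsum: "Z \<in> vecs \<Longrightarrow> fam Z \<in> dsum I Y"
proof -
  assume Z: "Z \<in> vecs"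
  then have "(\<forall>i\<in>I. fam Z i \<in> Y i) \<and> (\<forall>i. i \<notin> I \<longrightarrow> fam Z i = 0)"
    by (simp add: vecs_def fam_def)
  then show ?thesis
    using has_sum_imp_summable [OF has_sum_gram_I [OF vecs_clin [OF Z] Z]] by (simp add: dsum_def)
qed

lemma mod_inner_fam:
  assumes "Z \<in> vecs" "W \<in> vecs"
  shows "mod_inner I (fam Z) (fam W) = hadj Z o\<^sub>L W"
  unfolding mod_inner_def by (rule infsumI [OF has_sum_gram_I [OF vecs_clin [OF assms(1)] assms(2)]])

lemma dsum_eq_fam:
  assumes \<xi>: "\<xi> \<in> dsum I Y"
  obtains Z where "Z \<in> vecs" "\<xi> = fam Z"
proof -
  have \<xi>Y: "\<xi> i \<in> Y i" if "i \<in> I" for i using \<xi> that by (simp add: dsum_def)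
  have \<xi>0: "\<xi> i = 0" if "i \<notin> I" for i using \<xi> that by (simp add: dsum_def)
  have cl: "clin (\<xi> i)" for i using \<xi>Y fibre_clin \<xi>0 by (cases "i \<in> I") auto
  define A where "A = (\<Sum>\<^sub>\<infinity>i\<in>I. adj (\<xi> i) o\<^sub>L \<xi> i)"
  have "((\<lambda>i. adj (\<xi> i) o\<^sub>L \<xi> i) has_sum A) I"
    unfolding A_def using \<xi> by (intro has_sum_infsum) (simp add: dsum_def)
  moreover have "((\<lambda>i. adj (\<xi> i) o\<^sub>L \<xi> i) has_sum A) I \<longleftrightarrow> ((\<lambda>i. adj (\<xi> i) o\<^sub>L \<xi> i) has_sum A) UNIV"
    by (rule has_sum_cong_neutral) (auto simp: \<xi>0 comp.zero_right)
  ultimately have A: "((\<lambda>i. adj (\<xi> i) o\<^sub>L \<xi> i) has_sum A) UNIV" by simp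
  have sq: "inner h ((adj (\<xi> i) o\<^sub>L \<xi> i) h) = (norm (\<xi> i h))\<^sup>2" for i h
    using adjoint_pairD [OF adjoint_pair_adj [OF cl [of i]]]
    by (simp add: inner_Re_cinner power2_norm_eq_inner)
  have bl: "bounded_linear (\<lambda>T. inner h (blinfun_apply T h))" for h :: 'h
    by (rule bounded_linear_compose [OF bounded_linear_inner_right blinfun.bounded_linear_left])
  have hs: "((\<lambda>i. (norm (\<xi> i h))\<^sup>2) has_sum inner h (A h)) UNIV" for h
    using has_sum_bounded_linear [OF bl A, of h] by (simp only: sq)
  have bd: "(\<Sum>i\<in>F. (norm (\<xi> i h))\<^sup>2) \<le> (sqrt (norm A) * norm h)\<^sup>2" if "finite F" for F h
  proof -
    have "(\<Sum>i\<in>F. (norm (\<xi> i h))\<^sup>2) \<le> inner h (A h)"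
      using finite_sum_le_infsum [OF has_sum_imp_summable [OF hs] that] infsumI [OF hs] by simp
    also have "\<dots> \<le> norm h * (norm A * norm h)"
      by (rule order_trans [OF norm_cauchy_schwarz]) (intro mult_left_mono norm_blinfun norm_ge_zero)
    finally show ?thesis by (simp add: power_mult_distrib power2_eq_square ac_simps)
  qed
  define Z where "Z = of_coords (\<lambda>h i. blinfun_apply (\<xi> i) h)"
  have co: "coord (Z h) i = \<xi> i h" for h i
    unfolding Z_def using cl by (intro of_coords [OF _ _ bd]) (auto simp: blf_simps clin_def)
  then have fam: "fam Z = \<xi>" by (auto simp: fun_eq_iff fam_def intro!: blinfun_eqI)
  have "((\<lambda>F. trunc F o\<^sub>L Z) \<longlongrightarrow> Z) (finite_subsets_at_top UNIV)"
  proof -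
    have est: "norm (Z - (trunc F o\<^sub>L Z)) \<le> sqrt (norm (A - (\<Sum>i\<in>F. adj (\<xi> i) o\<^sub>L \<xi> i)))"
      if F: "finite F" for F
    proof (rule norm_blinfun_bound)
      fix h
      let ?R = "A - (\<Sum>i\<in>F. adj (\<xi> i) o\<^sub>L \<xi> i)"
      have "(norm (Z h))\<^sup>2 = inner h (A h)"
        unfolding norm_ell2_sq co by (rule infsumI [OF hs])
      moreover have "inner h ((\<Sum>i\<in>F. adj (\<xi> i) o\<^sub>L \<xi> i) h) = (\<Sum>i\<in>F. (norm (\<xi> i h))\<^sup>2)"
        unfolding blinfun_apply_sum inner_sum_right sq ..
      ultimately have "(norm (Z h - trunc F (Z h)))\<^sup>2 = inner h (?R h)"
        by (simp add: norm_diff_trunc_sq [OF F] co blf_simps inner_diff_right)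
      also have "\<dots> \<le> norm h * (norm ?R * norm h)"
        by (rule order_trans [OF norm_cauchy_schwarz]) (intro mult_left_mono norm_blinfun norm_ge_zero)
      also have "\<dots> = (sqrt (norm ?R) * norm h)\<^sup>2" by (simp add: power_mult_distrib power2_eq_square ac_simps)
      finally have "norm (Z h - trunc F (Z h)) \<le> sqrt (norm ?R) * norm h" by (rule power2_le_imp_le) simp
      then show "norm ((Z - (trunc F o\<^sub>L Z)) h) \<le> sqrt (norm ?R) * norm h" by (simp add: blf_simps)
    qed simp
    have "((\<lambda>F. A - (\<Sum>i\<in>F. adj (\<xi> i) o\<^sub>L \<xi> i)) \<longlongrightarrow> A - A) (finite_subsets_at_top UNIV)"
      using A unfolding has_sum_def by (intro tendsto_diff tendsto_const)
    then have "((\<lambda>F. sqrt (norm (A - (\<Sum>i\<in>F. adj (\<xi> i) o\<^sub>L \<xi> i)))) \<longlongrightarrow> 0) (finite_subsets_at_top UNIV)"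
      using tendsto_real_sqrt [OF tendsto_norm] by fastforce
    then have "((\<lambda>F. Z - (trunc F o\<^sub>L Z)) \<longlongrightarrow> 0) (finite_subsets_at_top UNIV)"
      by (rule Lim_null_comparison [rotated]) (auto intro!: eventually_finite_subsets_at_top_weakI est)
    from tendsto_diff [OF tendsto_const [of Z] this] show ?thesis by simp
  qed
  then have "Z \<in> vecs" using \<xi>Y \<xi>0 fam unfolding vecs_def fam_def by auto
  then show thesis using that fam by blast
qed

lemma dsum_iff: "\<xi> \<in> dsum I Y \<longleftrightarrow> (\<exists>Z\<in>vecs. \<xi> = fam Z)"
  by (metis dsum_eq_fam fam_in_dsum)

lemma norm_sum_mod_inner:
  fixes n :: nat
  assumes "\<And>j. j < n \<Longrightarrow> Z j \<in> vecs"
  shows "norm (\<Sum>j<n. mod_inner I (fam (Z j)) (fam (Z j))) = (norm (\<Sum>j<n. eps j o\<^sub>L Z j))\<^sup>2"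
proof (rule norm_gram)
  fix h k
  have "cinner h ((\<Sum>j<n. mod_inner I (fam (Z j)) (fam (Z j))) k) = (\<Sum>j<n. cinner (Z j h) (Z j k))"
    unfolding blinfun_apply_sum cinner.sum_right
    using assms by (intro sum.cong) (auto simp: mod_inner_fam adjoint_pairD [OF adjoint_pair_hadj [OF vecs_clin]])
  also have "\<dots> = cinner ((\<Sum>j<n. eps j o\<^sub>L Z j) h) ((\<Sum>j<n. eps j o\<^sub>L Z j) k)"
    unfolding blinfun_apply_sum cinner.sum_left blinfun_apply_blinfun_compose cinner_eps
    by (intro sum.cong) (auto simp: finite_support_ell2)
  finally show "cinner h ((\<Sum>j<n. mod_inner I (fam (Z j)) (fam (Z j))) k)
      = cinner ((\<Sum>j<n. eps j o\<^sub>L Z j) h) ((\<Sum>j<n. eps j o\<^sub>L Z j) k)" .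
qed

text \<open>A mapping \<open>T\<close> of the direct sum, transported to \<open>vecs\<close>.\<close>

definition hat :: "('i, 'h) mod_op \<Rightarrow> ('h \<Rightarrow>\<^sub>L ('i, 'h) ell2) \<Rightarrow> 'h \<Rightarrow>\<^sub>L ('i, 'h) ell2" where
  "hat T Z = vec (T (fam Z))"

lemma hat:
  assumes "T \<in> dsum I Y \<rightarrow>\<^sub>E dsum I Y" "Z \<in> vecs"
  shows hat_in: "hat T Z \<in> vecs" and fam_hat: "fam (hat T Z) = T (fam Z)"
proof -
  obtain W where W: "W \<in> vecs" "T (fam Z) = fam W"
    using dsum_eq_fam [OF PiE_mem [OF assms(1) fam_in_dsum [OF assms(2)]]] by metis
  then show "hat T Z \<in> vecs" "fam (hat T Z) = T (fam Z)" by (simp_all add: hat_def)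
qed

lemma is_mod_adjoint_cinner:
  assumes TS: "is_mod_adjoint I Y T S" and "Z \<in> vecs" "W \<in> vecs"
  shows "cinner (hat T Z h) (W k) = cinner (Z h) (hat S W k)"
proof -
  have T: "T \<in> dsum I Y \<rightarrow>\<^sub>E dsum I Y" and S: "S \<in> dsum I Y \<rightarrow>\<^sub>E dsum I Y"
    using TS unfolding is_mod_adjoint_def by blast+
  have "mod_inner I (fam (hat T Z)) (fam W) = mod_inner I (fam Z) (fam (hat S W))"
    using TS assms fam_in_dsum by (simp add: is_mod_adjoint_def fam_hat [OF T] fam_hat [OF S])
  then have "hadj (hat T Z) o\<^sub>L W = hadj Z o\<^sub>L hat S W"
    using assms by (simp add: mod_inner_fam hat_in [OF T] hat_in [OF S])
  then have "cinner h (hadj (hat T Z) (W k)) = cinner h (hadj Z (hat S W k))"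
    by (metis blinfun_apply_blinfun_compose)
  then show ?thesis
    using assms by (simp add: adjoint_pairD [OF adjoint_pair_hadj [OF vecs_clin], symmetric] hat_in [OF T])
qed

lemma is_mod_adjointI:
  assumes T: "T \<in> dsum I Y \<rightarrow>\<^sub>E dsum I Y" and S: "S \<in> dsum I Y \<rightarrow>\<^sub>E dsum I Y"
    and eq: "\<And>Z W h k. Z \<in> vecs \<Longrightarrow> W \<in> vecs \<Longrightarrow> cinner (hat T Z h) (W k) = cinner (Z h) (hat S W k)"
  shows "is_mod_adjoint I Y T S"
  unfolding is_mod_adjoint_def
proof (intro conjI T S ballI)
  fix \<xi> \<eta> assume "\<xi> \<in> dsum I Y" "\<eta> \<in> dsum I Y"
  then obtain Z W where Z: "Z \<in> vecs" "\<xi> = fam Z" and W: "W \<in> vecs" "\<eta> = fam W"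
    using dsum_eq_fam by metis
  have "hadj (hat T Z) o\<^sub>L W = hadj Z o\<^sub>L hat S W"
    by (rule blinfun_eqI, rule cinner_ext')
      (simp add: adjoint_pairD [OF adjoint_pair_hadj [OF vecs_clin], symmetric] hat_in [OF T] Z W eq)
  then show "mod_inner I (T \<xi>) \<eta> = mod_inner I \<xi> (S \<eta>)"
    by (simp add: Z W flip: fam_hat [OF T] fam_hat [OF S])
      (simp add: mod_inner_fam hat_in [OF T] hat_in [OF S] Z W)
qed

lemma vecs_eqI:
  assumes "Z \<in> vecs" "Z' \<in> vecs"
    and eq: "\<And>W h k. W \<in> vecs \<Longrightarrow> cinner (blinfun_apply Z h) (W k) = cinner (blinfun_apply Z' h) (W k)"
  shows "Z = Z'"
proof (rule blinfun_eqI)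
  fix h
  have "Z - Z' \<in> vecs" using assms subspace_diff [OF subspace_vecs] by blast
  then have "cinner (Z h) ((Z - Z') h) = cinner (Z' h) ((Z - Z') h)" by (rule eq)
  then have "cinner (Z h - Z' h) ((Z - Z') h) = 0" by (simp add: cinner.diff_left)
  then have "cinner (Z h - Z' h) (Z h - Z' h) = 0" by (simp add: blf_simps)
  then show "Z h = Z' h" by (simp add: cinner_self)
qed

lemma hat_bounded:
  assumes TS: "is_mod_adjoint I Y T S"
  obtains C where "0 \<le> C" "\<And>Z. Z \<in> vecs \<Longrightarrow> norm (hat T Z) \<le> C * norm Z"
proof -
  have T: "T \<in> dsum I Y \<rightarrow>\<^sub>E dsum I Y" and S: "S \<in> dsum I Y \<rightarrow>\<^sub>E dsum I Y"
    using TS unfolding is_mod_adjoint_def by blast+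
  let ?J = "{Z \<in> vecs. norm Z \<le> 1}"
  define \<phi> :: "('h \<Rightarrow>\<^sub>L ('i, 'h) ell2) \<Rightarrow> ('h \<Rightarrow>\<^sub>L ('i, 'h) ell2) \<Rightarrow>\<^sub>L 'h bop"
    where "\<phi> = (\<lambda>Z. Blinfun (\<lambda>W. hadj (hat T Z) o\<^sub>L W))"
  have \<phi>: "blinfun_apply (\<phi> Z) W = hadj (hat T Z) o\<^sub>L W" for Z W
    unfolding \<phi>_def by (subst bounded_linear_Blinfun_apply) (rule comp.bounded_linear_right, rule refl)
  have ad: "hadj (hat T Z) o\<^sub>L W = hadj Z o\<^sub>L hat S W" if "Z \<in> vecs" "W \<in> vecs" for Z W
    by (rule blinfun_eqI, rule cinner_ext')
      (simp add: adjoint_pairD [OF adjoint_pair_hadj [OF vecs_clin], symmetric] hat_in [OF T] that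
        is_mod_adjoint_cinner [OF TS])
  have "\<exists>C. \<forall>Z\<in>?J. norm (\<phi> Z W) \<le> C" if W: "W \<in> vecs" for W
  proof (intro exI ballI)
    fix Z assume Z: "Z \<in> ?J"
    have "norm (\<phi> Z W) \<le> norm (hadj Z) * norm (hat S W)"
      using Z W by (simp add: \<phi> ad norm_blinfun_compose)
    also have "\<dots> \<le> 1 * norm (hat S W)"
      using Z by (intro mult_right_mono) (auto simp: norm_adjoint_pair [OF adjoint_pair_hadj [OF vecs_clin]])
    finally show "norm (\<phi> Z W) \<le> 1 * norm (hat S W)" .
  qed
  then obtain C where C: "0 \<le> C" "\<And>Z W. Z \<in> ?J \<Longrightarrow> W \<in> vecs \<Longrightarrow> norm (\<phi> Z W) \<le> C * norm W"
    by (rule uniform_boundedness [OF subspace_vecs closed_vecs]) blast+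
  have unit: "norm (hat T Z) \<le> C" if Z: "Z \<in> vecs" "norm Z \<le> 1" for Z
  proof (cases "hat T Z = 0")
    case False
    have "norm (hat T Z) * norm (hat T Z) = norm (\<phi> Z (hat T Z))"
      using norm_adjoint_pair_comp [OF adjoint_pair_hadj [OF vecs_clin [OF hat_in [OF T Z(1)]]]]
      by (simp add: \<phi> power2_eq_square)
    also have "\<dots> \<le> C * norm (hat T Z)" by (rule C) (use Z hat_in [OF T] in auto)
    finally show ?thesis using False by simp
  qed (simp add: C)
  show thesis
  proof (rule that [OF C(1)])
    fix Z assume Z: "Z \<in> vecs"
    have scl: "hat T (r *\<^sub>R Z) = r *\<^sub>R hat T Z" for r
      by (rule vecs_eqI) (simp_all add: hat_in [OF T] Z vecs_scaleR is_mod_adjoint_cinner [OF TS] blf_simps cinner_simps)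
    show "norm (hat T Z) \<le> C * norm Z"
    proof (cases "Z = 0")
      case False
      then have "norm (hat T (inverse (norm Z) *\<^sub>R Z)) \<le> C"
        by (intro unit vecs_scaleR Z) simp
      then show ?thesis using False by (simp add: scl field_simps)
    next
      case True
      then show ?thesis using scl [of 0] by simp
    qed
  qed
qed

end

lemma in_closure_span: "x \<in> G \<Longrightarrow> x \<in> closure (span G)"
  by (meson closure_subset span_base subsetD)

definition col_op ::
  "nat \<Rightarrow> (nat \<Rightarrow> 'a::complex_hilbert \<Rightarrow>\<^sub>L 'b::complex_hilbert) \<Rightarrow> 'a \<Rightarrow>\<^sub>L (nat, 'b) ell2" where
  "col_op n Z = (\<Sum>j<n. eps j o\<^sub>L Z j)"

lemma matop_col_op:
  fixes Z :: "nat \<Rightarrow> 'a::complex_hilbert \<Rightarrow>\<^sub>L 'b::complex_hilbert"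
  shows "matop {..<n} M o\<^sub>L col_op n Z = col_op n (\<lambda>i. \<Sum>j<n. M i j o\<^sub>L Z j)"
proof (rule blinfun_eqI, rule ell2_eqI)
  fix h :: 'a and i
  have co: "coord (col_op n W h) j = (if j < n then W j h else 0)" for W :: "nat \<Rightarrow> 'a \<Rightarrow>\<^sub>L 'b" and j
    unfolding col_op_def blinfun_apply_sum by (simp add: finite_support_ell2)
  show "coord ((matop {..<n} M o\<^sub>L col_op n Z) h) i = coord (col_op n (\<lambda>i. \<Sum>j<n. M i j o\<^sub>L Z j) h) i"
    by (simp add: coord_matop co blinfun_apply_sum)
qed

context module_family
begin

text \<open>The orthogonal complement of the vectors \<open>Z h\<close>, on which the operators representing
  adjointable maps are zero.\<close>

definition null :: "('i, 'h) ell2 set" where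
  "null = {v. \<forall>Z\<in>vecs. \<forall>h. cinner (blinfun_apply Z h) v = 0}"

lemma subspace_null: "subspace null"
  by (simp add: subspace_def null_def cinner_simps)

lemma vecs_null_total:
  "closure (span ({blinfun_apply Z h | Z h. Z \<in> vecs} \<union> null)) = UNIV"
proof -
  let ?V = "span {blinfun_apply Z h | Z h. Z \<in> vecs}"
  let ?C = "closure (span ({blinfun_apply Z h | Z h. Z \<in> vecs} \<union> null))"
  have sub: "subspace ?C" by (intro subspace_closure_normed) simp
  have "x \<in> ?C" for x
  proof -
    obtain p where p: "p \<in> closure ?V" and orth: "\<And>v. v \<in> closure ?V \<Longrightarrow> inner (x - p) v = 0"
      using orthogonal_projection_exists [OF subspace_closure_normed [OF subspace_span] closed_closure]
      by blast
    have "cinner (Z h) (x - p) = 0" if Z: "Z \<in> vecs" for Z h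
    proof -
      have m: "Z k \<in> closure ?V" for k
        by (rule in_closure_span) (use Z in blast)
      have "\<i> *\<^sub>C Z h = Z (\<i> *\<^sub>C h)" using vecs_clin [OF Z] by (simp add: clin_def)
      then show ?thesis
        using orth [OF m [of h]] orth [OF m [of "\<i> *\<^sub>C h"]] by (simp add: cinner_eq inner_commute complex_eq_iff)
    qed
    then have "x - p \<in> null" by (simp add: null_def)
    then have "x - p \<in> ?C" by (intro in_closure_span UnI2)
    moreover have "p \<in> ?C" using p closure_mono [OF span_mono [OF Un_upper1]] by blast
    ultimately have "(x - p) + p \<in> ?C" by (rule subspace_add [OF sub])
    then show "x \<in> ?C" by simp
  qed
  then show ?thesis by blast
qed

lemma operator_eqI:
  assumes "\<And>Z. Z \<in> vecs \<Longrightarrow> R o\<^sub>L Z = R' o\<^sub>L Z" and "\<And>v. v \<in> null \<Longrightarrow> blinfun_apply R v = R' v"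
  shows "R = R'"
proof (rule blinfun_eq_on_dense [OF vecs_null_total])
  fix x assume "x \<in> {blinfun_apply Z h | Z h. Z \<in> vecs} \<union> null"
  then show "R x = R' x"
  proof
    assume "x \<in> {blinfun_apply Z h | Z h. Z \<in> vecs}"
    then obtain Z h where x: "x = blinfun_apply Z h" and Z: "Z \<in> vecs" by blast
    show ?thesis
      unfolding x using arg_cong [OF assms(1) [OF Z], of "\<lambda>T. blinfun_apply T h"] by simp
  qed (rule assms(2))
qed

lemma adjointable_iff: "T \<in> carrier (adjointable_ops I Y) \<longleftrightarrow> (\<exists>S. is_mod_adjoint I Y T S)"
  by (simp add: adjointable_ops_def)

lemma is_mod_adjoint_sym: "is_mod_adjoint I Y T S \<Longrightarrow> is_mod_adjoint I Y S T"
proof (rule is_mod_adjointI)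
  assume TS: "is_mod_adjoint I Y T S"
  then show "S \<in> dsum I Y \<rightarrow>\<^sub>E dsum I Y" "T \<in> dsum I Y \<rightarrow>\<^sub>E dsum I Y"
    unfolding is_mod_adjoint_def by blast+
  show "cinner (hat S Z h) (W k) = cinner (Z h) (hat T W k)" if "Z \<in> vecs" "W \<in> vecs" for Z W h k
  proof -
    have "cinner (hat S Z h) (W k) = cnj (cinner (W k) (hat S Z h))" by (rule cinner_commute)
    also have "\<dots> = cnj (cinner (hat T W k) (Z h))" by (simp add: is_mod_adjoint_cinner [OF TS that(2,1)])
    also have "\<dots> = cinner (Z h) (hat T W k)" by (rule cinner_commute [symmetric])
    finally show ?thesis .
  qed
qed

text \<open>The operator on \<open>l\<^sup>2(I; H)\<close> that represents an adjointable map.\<close>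

definition rep :: "('i, 'h) mod_op \<Rightarrow> ('i, 'h) ell2 bop" where
  "rep T = (SOME R. (\<forall>Z\<in>vecs. R o\<^sub>L Z = hat T Z) \<and> (\<forall>v\<in>null. R v = 0))"

lemma rep:
  assumes T: "T \<in> carrier (adjointable_ops I Y)"
  shows rep_comp: "Z \<in> vecs \<Longrightarrow> rep T o\<^sub>L Z = hat T Z" and rep_null: "v \<in> null \<Longrightarrow> rep T v = 0"
proof -
  obtain S where TS: "is_mod_adjoint I Y T S" using T by (auto simp: adjointable_iff)
  note ST = is_mod_adjoint_sym [OF TS]
  have Tf: "T \<in> dsum I Y \<rightarrow>\<^sub>E dsum I Y" and Sf: "S \<in> dsum I Y \<rightarrow>\<^sub>E dsum I Y"
    using TS unfolding is_mod_adjoint_def by blast+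
  obtain C where C: "0 \<le> C" "\<And>Z. Z \<in> vecs \<Longrightarrow> norm (hat T Z) \<le> C * norm Z" using hat_bounded [OF TS] by metis
  obtain C' where C': "0 \<le> C'" "\<And>Z. Z \<in> vecs \<Longrightarrow> norm (hat S Z) \<le> C' * norm Z" using hat_bounded [OF ST] by metis
  have iad: "inner (hat T Z h) (W k) = inner (Z h) (hat S W k)" if "Z \<in> vecs" "W \<in> vecs" for Z W h k
    by (simp add: inner_Re_cinner is_mod_adjoint_cinner [OF TS that])
  define D where "D = {(lincomb l + v, lincomb (act (hat T) l)) | l v. set l \<subseteq> vecs \<times> UNIV \<and> v \<in> null}"
  have DI: "(lincomb l + v, lincomb (act (hat T) l)) \<in> D" if "set l \<subseteq> vecs \<times> UNIV" "v \<in> null" for l v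
    using that by (auto simp: D_def)
  have D: "subspace D" unfolding subspace_def
  proof (intro conjI ballI allI)
    show "0 \<in> D" using DI [of "[]" 0] subspace_0 [OF subspace_null] by (simp add: zero_prod_def)
    fix p q assume "p \<in> D" "q \<in> D"
    then obtain l v l' v' where
      "p = (lincomb l + v, lincomb (act (hat T) l))" "set l \<subseteq> vecs \<times> UNIV" "v \<in> null"
      "q = (lincomb l' + v', lincomb (act (hat T) l'))" "set l' \<subseteq> vecs \<times> UNIV" "v' \<in> null"
      by (auto simp: D_def)
    then show "p + q \<in> D"
      using DI [of "l @ l'" "v + v'"] subspace_add [OF subspace_null] by (simp add: algebra_simps)
  next
    fix p and r :: real assume "p \<in> D"
    then obtain l v where p: "p = (lincomb l + v, lincomb (act (hat T) l))" "set l \<subseteq> vecs \<times> UNIV" "v \<in> null"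
      by (auto simp: D_def)
    have "set (map (\<lambda>(Z, h). (Z, r *\<^sub>R h)) l) \<subseteq> vecs \<times> UNIV" using p(2) by auto
    from DI [OF this, of "r *\<^sub>R v"] show "r *\<^sub>R p \<in> D"
      using p subspace_scale [OF subspace_null]
      by (simp add: lincomb_scale lincomb_act_scale scaleR_add_right)
  qed
  have bd: "norm y \<le> sqrt (C * C') * norm x" if xy: "(x, y) \<in> D" for x y
  proof -
    obtain l v where l: "x = lincomb l + v" "y = lincomb (act (hat T) l)" "set l \<subseteq> vecs \<times> UNIV" "v \<in> null"
      using xy by (auto simp: D_def)
    have "inner (blinfun_apply Z h) v = 0" if "Z \<in> vecs" for Z h
      using \<open>v \<in> null\<close> that by (simp add: null_def inner_Re_cinner)
    then have "inner (lincomb l) v = 0"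
      using l(3) by (induction l) (auto simp: inner_add_left)
    then have "(norm x)\<^sup>2 = (norm (lincomb l))\<^sup>2 + (norm v)\<^sup>2"
      by (simp add: l power2_norm_eq_inner inner_add_left inner_add_right inner_commute)
    then have le: "(norm (lincomb l))\<^sup>2 \<le> (norm x)\<^sup>2" by simp
    have "(norm y)\<^sup>2 \<le> C * C' * (norm (lincomb l))\<^sup>2"
      unfolding l(2) by (rule norm_lincomb_act_le [where E = vecs and s = "hat S"])
        (use C C' l(3) iad in \<open>auto simp: hat_in [OF Tf] hat_in [OF Sf]\<close>)
    also have "\<dots> \<le> C * C' * (norm x)\<^sup>2" using le C C' by (intro mult_left_mono) auto
    also have "\<dots> = (sqrt (C * C') * norm x)\<^sup>2" using C C' by (simp add: power_mult_distrib)
    finally show ?thesis by (rule power2_le_imp_le) (use C C' in simp)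
  qed
  have "fst ` D = {x. \<exists>y. (x, y) \<in> D}" by force
  have "{blinfun_apply Z h | Z h. Z \<in> vecs} \<union> null \<subseteq> fst ` D"
  proof
    fix x assume "x \<in> {blinfun_apply Z h | Z h. Z \<in> vecs} \<union> null"
    then show "x \<in> fst ` D"
    proof
      assume "x \<in> {blinfun_apply Z h | Z h. Z \<in> vecs}"
      then obtain Z h where "x = blinfun_apply Z h" "Z \<in> vecs" by blast
      then show ?thesis using DI [of "[(Z, h)]" 0] subspace_0 [OF subspace_null] by (force simp: image_iff)
    next
      assume "x \<in> null"
      then show ?thesis using DI [of "[]" x] by (force simp: image_iff)
    qed
  qed
  moreover have "subspace (fst ` D)" by (rule linear_subspace_image [OF linear_fst D])
  ultimately have "span ({blinfun_apply Z h | Z h. Z \<in> vecs} \<union> null) \<subseteq> fst ` D" by (rule span_minimal)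
  then have dense: "closure (fst ` D) = UNIV" using closure_mono vecs_null_total by blast
  obtain R where R: "\<And>x y. (x, y) \<in> D \<Longrightarrow> blinfun_apply R x = y"
    by (rule bounded_relation_extension_blinfun [OF D bd _ dense]) (use C C' in auto)
  have "R o\<^sub>L Z = hat T Z" if "Z \<in> vecs" for Z
  proof (rule blinfun_eqI)
    fix h show "(R o\<^sub>L Z) h = hat T Z h"
      using R [OF DI [of "[(Z, h)]" 0]] that subspace_0 [OF subspace_null] by simp
  qed
  moreover have "R v = 0" if "v \<in> null" for v
    using R [OF DI [of "[]" v]] that by simp
  ultimately have "(\<forall>Z\<in>vecs. R o\<^sub>L Z = hat T Z) \<and> (\<forall>v\<in>null. R v = 0)" by blast
  then have "(\<forall>Z\<in>vecs. rep T o\<^sub>L Z = hat T Z) \<and> (\<forall>v\<in>null. rep T v = 0)"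
    unfolding rep_def by (rule someI)
  then show "Z \<in> vecs \<Longrightarrow> rep T o\<^sub>L Z = hat T Z" "v \<in> null \<Longrightarrow> rep T v = 0" by blast+
qed

lemma rep_apply: "T \<in> carrier (adjointable_ops I Y) \<Longrightarrow> Z \<in> vecs \<Longrightarrow> rep T (Z h) = hat T Z h"
  by (metis rep_comp blinfun_apply_blinfun_compose)

lemma is_mod_adjoint_hat_in: "is_mod_adjoint I Y T S \<Longrightarrow> Z \<in> vecs \<Longrightarrow> hat T Z \<in> vecs"
  by (rule hat_in) (simp_all add: is_mod_adjoint_def)

lemma adjoint_pair_rep:
  assumes TS: "is_mod_adjoint I Y T S"
  shows "adjoint_pair (rep T) (rep S)"
proof (rule adjoint_pair_if_on_dense [OF vecs_null_total vecs_null_total])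
  note ST = is_mod_adjoint_sym [OF TS]
  have T: "T \<in> carrier (adjointable_ops I Y)" and S: "S \<in> carrier (adjointable_ops I Y)"
    using TS ST by (auto simp: adjointable_iff)
  fix x y assume x: "x \<in> {blinfun_apply Z h | Z h. Z \<in> vecs} \<union> null" and y: "y \<in> {blinfun_apply Z h | Z h. Z \<in> vecs} \<union> null"
  show "cinner (rep T x) y = cinner x (rep S y)"
  proof (cases "x \<in> null")
    case True
    have c0: "cinner x (W k) = 0" if "W \<in> vecs" for W k
      using True that cinner_commute [of x "W k"] by (simp add: null_def)
    then show ?thesis using y is_mod_adjoint_hat_in [OF ST] True
      by (auto simp: c0 rep_null [OF T] rep_null [OF S] rep_apply [OF S] cinner_simps)
  next
    case False
    then obtain Z h where Z: "x = blinfun_apply Z h" "Z \<in> vecs" using x by blast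
    show ?thesis
    proof (cases "y \<in> null")
      case True
      then show ?thesis using Z is_mod_adjoint_hat_in [OF TS]
        by (auto simp: rep_null [OF S] rep_apply [OF T] cinner_simps null_def)
    next
      case False
      then obtain W k where "y = blinfun_apply W k" "W \<in> vecs" using y by blast
      then show ?thesis using Z is_mod_adjoint_cinner [OF TS]
        by (simp add: rep_apply [OF T] rep_apply [OF S])
    qed
  qed
qed

text \<open>The C*-algebra of operators that arise in this way, and the inverse of \<open>rep\<close>.\<close>

definition represented_pair :: "('i, 'h) ell2 bop \<Rightarrow> ('i, 'h) ell2 bop \<Rightarrow> bool" where
  "represented_pair R R' \<longleftrightarrow> adjoint_pair R R' \<and>
    (\<forall>Z\<in>vecs. R o\<^sub>L Z \<in> vecs \<and> R' o\<^sub>L Z \<in> vecs) \<and> (\<forall>v\<in>null. R v = 0 \<and> R' v = 0)"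

definition represented :: "('i, 'h) ell2 bop set" where
  "represented = {R. \<exists>R'. represented_pair R R'}"

definition sigma :: "('i, 'h) ell2 bop \<Rightarrow> ('i, 'h) mod_op" where
  "sigma R = (\<lambda>\<xi>\<in>dsum I Y. fam (R o\<^sub>L vec \<xi>))"

lemma sigma_fam: "Z \<in> vecs \<Longrightarrow> sigma R (fam Z) = fam (R o\<^sub>L Z)"
  by (simp add: sigma_def fam_in_dsum)

lemma hat_sigma: "Z \<in> vecs \<Longrightarrow> hat (sigma R) Z = R o\<^sub>L Z"
  by (simp add: hat_def sigma_fam)

lemma mod_op_eqI:
  assumes "T \<in> extensional (dsum I Y)" "T' \<in> extensional (dsum I Y)"
    and "\<And>Z. Z \<in> vecs \<Longrightarrow> T (fam Z) = T' (fam Z)"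
  shows "T = T'"
  by (rule extensionalityI [OF assms(1,2)]) (metis assms(3) dsum_eq_fam)

lemma sigma_adjoint:
  assumes "adjoint_pair R R'" and "\<And>Z. Z \<in> vecs \<Longrightarrow> R o\<^sub>L Z \<in> vecs" "\<And>Z. Z \<in> vecs \<Longrightarrow> R' o\<^sub>L Z \<in> vecs"
  shows "is_mod_adjoint I Y (sigma R) (sigma R')"
proof (rule is_mod_adjointI)
  have "sigma Q \<in> dsum I Y \<rightarrow>\<^sub>E dsum I Y" if "\<And>Z. Z \<in> vecs \<Longrightarrow> Q o\<^sub>L Z \<in> vecs" for Q
    unfolding sigma_def
  proof (rule restrict_PiE_iff [THEN iffD2], intro ballI)
    fix \<xi> assume "\<xi> \<in> dsum I Y"
    then obtain Z where "Z \<in> vecs" "\<xi> = fam Z" by (rule dsum_eq_fam)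
    then show "fam (Q o\<^sub>L vec \<xi>) \<in> dsum I Y" using that by (simp add: fam_in_dsum)
  qed
  then show "sigma R \<in> dsum I Y \<rightarrow>\<^sub>E dsum I Y" "sigma R' \<in> dsum I Y \<rightarrow>\<^sub>E dsum I Y" using assms by blast+
  show "cinner (hat (sigma R) Z h) (W k) = cinner (Z h) (hat (sigma R') W k)" if "Z \<in> vecs" "W \<in> vecs" for Z W h k
    by (simp add: hat_sigma that adjoint_pairD [OF assms(1)])
qed

lemma represented_pair_sigma: "represented_pair R R' \<Longrightarrow> is_mod_adjoint I Y (sigma R) (sigma R')"
  by (rule sigma_adjoint) (auto simp: represented_pair_def)

lemma represented_pair_rep: "is_mod_adjoint I Y T S \<Longrightarrow> represented_pair (rep T) (rep S)"
proof -
  assume TS: "is_mod_adjoint I Y T S"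
  note ST = is_mod_adjoint_sym [OF TS]
  have T: "T \<in> carrier (adjointable_ops I Y)" and S: "S \<in> carrier (adjointable_ops I Y)"
    using TS ST by (auto simp: adjointable_iff)
  show ?thesis unfolding represented_pair_def
    using adjoint_pair_rep [OF TS] is_mod_adjoint_hat_in [OF TS] is_mod_adjoint_hat_in [OF ST]
    by (simp add: rep_comp [OF T] rep_comp [OF S] rep_null [OF T] rep_null [OF S])
qed

lemma is_mod_adjoint_extensional: "is_mod_adjoint I Y T S \<Longrightarrow> T \<in> extensional (dsum I Y)"
  unfolding is_mod_adjoint_def by (simp add: PiE_def)

lemma sigma_extensional: "sigma R \<in> extensional (dsum I Y)"
  by (simp add: sigma_def)

lemma sigma_rep: "T \<in> carrier (adjointable_ops I Y) \<Longrightarrow> sigma (rep T) = T"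
proof -
  assume T: "T \<in> carrier (adjointable_ops I Y)"
  then obtain S where TS: "is_mod_adjoint I Y T S" by (auto simp: adjointable_iff)
  have Tf: "T \<in> dsum I Y \<rightarrow>\<^sub>E dsum I Y" using TS unfolding is_mod_adjoint_def by blast
  show ?thesis
    by (rule mod_op_eqI [OF sigma_extensional is_mod_adjoint_extensional [OF TS]])
      (simp add: sigma_fam rep_comp [OF T] fam_hat [OF Tf])
qed

lemma represented_carrier: "R \<in> represented \<Longrightarrow> sigma R \<in> carrier (adjointable_ops I Y)"
  by (auto simp: represented_def adjointable_iff dest: represented_pair_sigma)

lemma rep_sigma: "R \<in> represented \<Longrightarrow> rep (sigma R) = R"
proof -
  assume R: "R \<in> represented"
  show ?thesis
  proof (rule operator_eqI)
    show "rep (sigma R) o\<^sub>L Z = R o\<^sub>L Z" if "Z \<in> vecs" for Z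
      by (simp add: rep_comp [OF represented_carrier [OF R]] that hat_sigma)
    show "rep (sigma R) v = R v" if "v \<in> null" for v
      using R that by (auto simp: rep_null [OF represented_carrier [OF R]] represented_def represented_pair_def)
  qed
qed

lemma rep_in_represented: "T \<in> carrier (adjointable_ops I Y) \<Longrightarrow> rep T \<in> represented"
  by (auto simp: represented_def adjointable_iff dest: represented_pair_rep)

lemma rep_image: "rep ` carrier (adjointable_ops I Y) = represented"
proof
  show "rep ` carrier (adjointable_ops I Y) \<subseteq> represented" by (rule image_subsetI) (rule rep_in_represented)
  show "represented \<subseteq> rep ` carrier (adjointable_ops I Y)"
  proof
    fix R assume R: "R \<in> represented"
    show "R \<in> rep ` carrier (adjointable_ops I Y)"
      using rep_sigma [OF R] represented_carrier [OF R] by (simp add: image_iff) metis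
  qed
qed

lemma represented_iff_adj: "R \<in> represented \<longleftrightarrow> clin R \<and> represented_pair R (adj R)"
proof
  assume "R \<in> represented"
  then obtain R' where R': "represented_pair R R'" by (auto simp: represented_def)
  then have a: "adjoint_pair R R'" by (simp add: represented_pair_def)
  show "clin R \<and> represented_pair R (adj R)"
    using R' adj_eqI [OF a] adjoint_pair_clin [OF a] by simp
qed (auto simp: represented_def)

lemma represented_pairD:
  assumes "represented_pair R R'"
  shows "adjoint_pair R R'" "Z \<in> vecs \<Longrightarrow> R o\<^sub>L Z \<in> vecs" "Z \<in> vecs \<Longrightarrow> R' o\<^sub>L Z \<in> vecs"
    "v \<in> null \<Longrightarrow> R v = 0" "v \<in> null \<Longrightarrow> R' v = 0"
  using assms by (auto simp: represented_pair_def)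

lemma represented_pair_sym: "represented_pair R R' \<Longrightarrow> represented_pair R' R"
  unfolding represented_pair_def using adjoint_pair_sym by blast

lemma represented_pair_add:
  "represented_pair R R' \<Longrightarrow> represented_pair Q Q' \<Longrightarrow> represented_pair (R + Q) (R' + Q')"
  unfolding represented_pair_def by (auto simp: comp.add_left blf_simps intro: adjoint_pair_add vecs_add)

lemma represented_pair_comp:
  "represented_pair R R' \<Longrightarrow> represented_pair Q Q' \<Longrightarrow> represented_pair (R o\<^sub>L Q) (Q' o\<^sub>L R')"
  unfolding represented_pair_def by (auto simp: blinfun_compose_assoc blf_simps intro: adjoint_pair_comp)

lemma represented_pair_zero: "represented_pair 0 0"
  by (simp add: represented_pair_def adjoint_pair_zero comp.zero_left vecs_zero)

lemma represented_pair_scale: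
  "represented_pair R R' \<Longrightarrow> represented_pair (scale_op c R) (scale_op (cnj c) R')"
proof -
  assume R: "represented_pair R R'"
  have "R' o\<^sub>L cscale (cnj c) = scale_op (cnj c) R'"
    unfolding scale_op_eq by (rule cscale_commute [OF adjoint_pair_clin2 [OF represented_pairD(1) [OF R]]])
  then have "adjoint_pair (scale_op c R) (scale_op (cnj c) R')"
    using adjoint_pair_comp [OF adjoint_pair_cscale represented_pairD(1) [OF R], of c] by (simp add: scale_op_eq)
  then show ?thesis using R unfolding represented_pair_def
    by (auto simp: scale_op_eq blinfun_compose_assoc intro: vecs_scale)
qed

lemma concrete_cstar_represented: "concrete_cstar represented"
proof
  show "closed represented" unfolding closed_sequential_limits
  proof (intro allI impI)
    fix Q R assume *: "(\<forall>n. Q n \<in> represented) \<and> Q \<longlonglongrightarrow> R"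
    then have Q: "represented_pair (Q n) (adj (Q n))" "clin (Q n)" for n by (auto simp: represented_iff_adj)
    have lim: "Q \<longlonglongrightarrow> R" using * by blast
    have R: "clin R" using closed_sequentially [OF closed_clin] Q lim by auto
    have "norm (adj (Q n) - adj R) = norm (Q n - R)" for n
      using norm_adj [of "Q n - R"] Q R by (simp add: adj_diff clin_diff)
    then have lim': "(\<lambda>n. adj (Q n)) \<longlonglongrightarrow> adj R"
      using lim by (simp add: tendsto_iff dist_norm)
    have v: "S o\<^sub>L Z \<in> vecs" if "P \<longlonglongrightarrow> S" "\<And>n. P n o\<^sub>L Z \<in> vecs" for P :: "nat \<Rightarrow> ('i, 'h) ell2 bop" and S Z
    proof -
      have "(\<lambda>n. P n o\<^sub>L Z) \<longlonglongrightarrow> (S o\<^sub>L Z)" by (intro comp.tendsto that(1) tendsto_const)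
      from closed_sequentially [OF closed_vecs _ this] show ?thesis using that(2) by simp
    qed
    have z: "S v = 0" if "P \<longlonglongrightarrow> S" "\<And>n. P n v = 0" for P :: "nat \<Rightarrow> ('i, 'h) ell2 bop" and S v
      using blinfun.tendsto [OF that(1) tendsto_const [of v]] that(2) by (simp add: LIMSEQ_const_iff)
    have "represented_pair R (adj R)" unfolding represented_pair_def
      using v [OF lim] v [OF lim'] z [OF lim] z [OF lim'] Q(1) adjoint_pair_adj [OF R]
      by (auto simp: represented_pair_def)
    then show "R \<in> represented" by (auto simp: represented_def)
  qed
  show "0 \<in> represented" using represented_pair_zero by (auto simp: represented_def)
  fix a assume a: "a \<in> represented"
  then obtain a' where a': "represented_pair a a'" by (auto simp: represented_def)
  show "clin a" using a by (simp add: represented_iff_adj)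
  show "adj a \<in> represented"
    using represented_pair_sym [OF a'] adj_eqI [OF represented_pairD(1) [OF a']] by (auto simp: represented_def)
  show "scale_op c a \<in> represented" for c
    using represented_pair_scale [OF a'] by (auto simp: represented_def)
  fix b assume "b \<in> represented"
  then obtain b' where b': "represented_pair b b'" by (auto simp: represented_def)
  show "a + b \<in> represented" using represented_pair_add [OF a' b'] by (auto simp: represented_def)
  show "a o\<^sub>L b \<in> represented" using represented_pair_comp [OF a' b'] by (auto simp: represented_def)
qed

lemma adjointable_ops_eq:
  assumes T: "T \<in> carrier (adjointable_ops I Y)" and S: "S \<in> carrier (adjointable_ops I Y)"
  shows "T \<oplus>\<^bsub>adjointable_ops I Y\<^esub> S = sigma (rep T + rep S)"
    and "T \<otimes>\<^bsub>adjointable_ops I Y\<^esub> S = sigma (rep T o\<^sub>L rep S)"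
    and "c \<odot>\<^bsub>adjointable_ops I Y\<^esub> T = sigma (scale_op c (rep T))"
    and "star (adjointable_ops I Y) T = sigma (adj (rep T))"
proof -
  obtain T' S' where TT: "is_mod_adjoint I Y T T'" and SS: "is_mod_adjoint I Y S S'"
    using T S by (auto simp: adjointable_iff)
  have Tf: "T \<in> dsum I Y \<rightarrow>\<^sub>E dsum I Y" and Sf: "S \<in> dsum I Y \<rightarrow>\<^sub>E dsum I Y"
    using TT SS unfolding is_mod_adjoint_def by blast+
  have Tr: "T (fam Z) = fam (rep T o\<^sub>L Z)" and Sr: "S (fam Z) = fam (rep S o\<^sub>L Z)" if "Z \<in> vecs" for Z
    using that by (simp_all add: rep_comp [OF T] rep_comp [OF S] fam_hat [OF Tf] fam_hat [OF Sf])
  show "T \<oplus>\<^bsub>adjointable_ops I Y\<^esub> S = sigma (rep T + rep S)"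
    by (rule mod_op_eqI [OF _ sigma_extensional])
      (simp_all add: adjointable_ops_def fam_in_dsum Tr Sr sigma_fam, simp add: fam_def comp.add_left comp.add_right)
  show "c \<odot>\<^bsub>adjointable_ops I Y\<^esub> T = sigma (scale_op c (rep T))"
  proof (rule mod_op_eqI [OF _ sigma_extensional])
    show "c \<odot>\<^bsub>adjointable_ops I Y\<^esub> T \<in> extensional (dsum I Y)" by (simp add: adjointable_ops_def)
    fix Z assume Z: "Z \<in> vecs"
    have "scale_op c (fam (rep T o\<^sub>L Z) i) = fam (scale_op c (rep T) o\<^sub>L Z) i" for i
      by (rule blinfun_eqI) (simp add: fam_def scale_op_eq coord_scaleC)
    then show "(c \<odot>\<^bsub>adjointable_ops I Y\<^esub> T) (fam Z) = sigma (scale_op c (rep T)) (fam Z)"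
      using Z by (simp add: adjointable_ops_def fam_in_dsum Tr sigma_fam)
  qed
  show "T \<otimes>\<^bsub>adjointable_ops I Y\<^esub> S = sigma (rep T o\<^sub>L rep S)"
  proof (rule mod_op_eqI [OF _ sigma_extensional])
    show "T \<otimes>\<^bsub>adjointable_ops I Y\<^esub> S \<in> extensional (dsum I Y)" by (simp add: adjointable_ops_def)
    fix Z assume Z: "Z \<in> vecs"
    have "rep S o\<^sub>L Z \<in> vecs" using represented_pairD(2) [OF represented_pair_rep [OF SS]] Z by blast
    then show "(T \<otimes>\<^bsub>adjointable_ops I Y\<^esub> S) (fam Z) = sigma (rep T o\<^sub>L rep S) (fam Z)"
      using Z by (simp add: adjointable_ops_def fam_in_dsum Sr Tr compose_def sigma_fam blinfun_compose_assoc)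
  qed
  have "U = sigma (adj (rep T))" if "is_mod_adjoint I Y T U" for U
  proof -
    have "U \<in> carrier (adjointable_ops I Y)"
      using is_mod_adjoint_sym [OF that] by (auto simp: adjointable_iff)
    then show ?thesis
      using adj_eqI [OF adjoint_pair_rep [OF that]] sigma_rep by simp
  qed
  then show "star (adjointable_ops I Y) T = sigma (adj (rep T))"
    using TT by (auto simp: adjointable_ops_def intro: the_equality)
qed

lemma adjointable_zero: "\<zero>\<^bsub>adjointable_ops I Y\<^esub> = sigma 0"
  by (rule mod_op_eqI [OF _ sigma_extensional])
    (simp_all add: adjointable_ops_def fam_in_dsum sigma_fam, simp add: fam_def comp.zero_left comp.zero_right)

lemma rep_ops:
  assumes T: "T \<in> carrier (adjointable_ops I Y)" and S: "S \<in> carrier (adjointable_ops I Y)"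
  shows "rep (T \<oplus>\<^bsub>adjointable_ops I Y\<^esub> S) = rep T + rep S"
    and "rep (T \<otimes>\<^bsub>adjointable_ops I Y\<^esub> S) = rep T o\<^sub>L rep S"
    and "rep (c \<odot>\<^bsub>adjointable_ops I Y\<^esub> T) = scale_op c (rep T)"
    and "rep (star (adjointable_ops I Y) T) = adj (rep T)"
proof -
  interpret concrete_cstar represented by (rule concrete_cstar_represented)
  note r = rep_in_represented [OF T] rep_in_represented [OF S]
  show "rep (T \<oplus>\<^bsub>adjointable_ops I Y\<^esub> S) = rep T + rep S"
    "rep (T \<otimes>\<^bsub>adjointable_ops I Y\<^esub> S) = rep T o\<^sub>L rep S"
    "rep (c \<odot>\<^bsub>adjointable_ops I Y\<^esub> T) = scale_op c (rep T)"
    "rep (star (adjointable_ops I Y) T) = adj (rep T)"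
    unfolding adjointable_ops_eq [OF T S]
    by (rule rep_sigma, simp add: r add_B mult_B scale_B adj_B)+
qed

text \<open>It suffices to estimate a matrix on columns of elements of \<open>vecs\<close>: on the linear combinations of
  their values one has the same estimate, and on the complement the matrix is zero.\<close>

lemma norm_matop_rep_le:
  assumes M: "\<And>i j. i < n \<Longrightarrow> j < n \<Longrightarrow> M i j \<in> carrier (adjointable_ops I Y)" and c0: "0 \<le> c"
    and est: "\<And>Z. (\<And>j. j < n \<Longrightarrow> Z j \<in> vecs) \<Longrightarrow>
      norm (matop {..<n} (\<lambda>i j. rep (M i j)) o\<^sub>L col_op n Z) \<le> c * norm (col_op n Z)"
  shows "norm (matop {..<n} (\<lambda>i j. rep (M i j))) \<le> c"
proof -
  let ?R = "matop {..<n} (\<lambda>i j. rep (M i j))"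
  define E where "E = {col_op n Z | Z. \<forall>j<n. Z j \<in> vecs}"
  have ad: "represented_pair (rep (M i j)) (adj (rep (M i j)))" if "i < n" "j < n" for i j
    using rep_in_represented [OF M [OF that]] by (simp add: represented_iff_adj)
  define R' where "R' = matop {..<n} (\<lambda>i j. adj (rep (M j i)))"
  have RR: "adjoint_pair ?R R'" unfolding R'_def
    by (rule adjoint_pair_matop) (use ad represented_pairD(1) in auto)
  have ER: "?R o\<^sub>L W \<in> E" "R' o\<^sub>L W \<in> E" if W: "W \<in> E" for W
  proof -
    obtain Z where Z: "W = col_op n Z" "\<And>j. j < n \<Longrightarrow> Z j \<in> vecs" using W by (auto simp: E_def)
    have "(\<Sum>j<n. rep (M i j) o\<^sub>L Z j) \<in> vecs" "(\<Sum>j<n. adj (rep (M j i)) o\<^sub>L Z j) \<in> vecs" if "i < n" for i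
      using that by (auto intro!: subspace_sum [OF subspace_vecs] represented_pairD(2,3) [OF ad] Z)
    then show "?R o\<^sub>L W \<in> E" "R' o\<^sub>L W \<in> E" unfolding Z R'_def matop_col_op E_def by blast+
  qed
  have bR: "norm (?R o\<^sub>L W) \<le> c * norm W" if W: "W \<in> E" for W
    using that est by (auto simp: E_def)
  have Ecl: "clin W" if "W \<in> E" for W
    using that by (auto simp: E_def col_op_def intro!: clin_sum clin_comp vecs_clin)
  have bR': "norm (R' o\<^sub>L W) \<le> c * norm W" if W: "W \<in> E" for W
  proof (cases "R' o\<^sub>L W = 0")
    case False
    note aW = adjoint_pair_hadj [OF Ecl [OF W]]
    have "adjoint_pair (R' o\<^sub>L W) (hadj W o\<^sub>L ?R)" by (rule adjoint_pair_comp [OF adjoint_pair_sym [OF RR] aW])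
    from norm_adjoint_pair_comp [OF this]
    have "norm (R' o\<^sub>L W) * norm (R' o\<^sub>L W) = norm (hadj W o\<^sub>L (?R o\<^sub>L (R' o\<^sub>L W)))"
      by (simp add: power2_eq_square blinfun_compose_assoc)
    also have "\<dots> \<le> norm (hadj W) * norm (?R o\<^sub>L (R' o\<^sub>L W))" by (rule norm_blinfun_compose)
    also have "\<dots> \<le> norm W * (c * norm (R' o\<^sub>L W))"
      using bR [OF ER(2) [OF W]] by (simp add: norm_adjoint_pair [OF aW] mult_left_mono)
    finally show ?thesis using False by (simp add: mult.commute)
  qed (simp add: c0)
  have lin: "norm (?R z) \<le> c * norm z" if "z \<in> span {blinfun_apply W h | W h. W \<in> E}" for z
  proof -
    obtain l where l: "z = lincomb l" "set l \<subseteq> E \<times> UNIV"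
      using span_subset_lincomb [of E] \<open>z \<in> span _\<close> by blast
    have act: "lincomb (act (\<lambda>W. Q o\<^sub>L W) l) = Q (lincomb l)" for Q :: "(nat, ('i, 'h) ell2) ell2 bop"
      by (induction l) (auto simp: blf_simps)
    have "(norm (lincomb (act (\<lambda>W. ?R o\<^sub>L W) l)))\<^sup>2 \<le> c * c * (norm (lincomb l))\<^sup>2"
      by (rule norm_lincomb_act_le [where s = "\<lambda>W. R' o\<^sub>L W" and E = E])
        (use ER bR bR' c0 l(2) in \<open>auto simp: inner_Re_cinner adjoint_pairD [OF RR]\<close>)
    then have "(norm (?R z))\<^sup>2 \<le> (c * norm z)\<^sup>2" by (simp add: act l(1) power_mult_distrib power2_eq_square ac_simps)
    then show ?thesis by (rule power2_le_imp_le) (simp add: c0)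
  qed
  let ?V = "closure (span {blinfun_apply W h | W h. W \<in> E})"
  have "closed {z. norm (?R z) \<le> c * norm z}"
    by (intro closed_Collect_le continuous_intros linear_continuous_on blinfun.bounded_linear_right)
  then have lin': "norm (?R z) \<le> c * norm z" if "z \<in> ?V" for z
    using closure_minimal [of "span {blinfun_apply W h | W h. W \<in> E}" "{z. norm (?R z) \<le> c * norm z}"] lin that by blast
  show "norm ?R \<le> c"
  proof (rule norm_blinfun_bound [OF c0])
    fix x
    obtain p where p: "p \<in> ?V" and orth: "\<And>v. v \<in> ?V \<Longrightarrow> inner (x - p) v = 0"
      using orthogonal_projection_exists [OF subspace_closure_normed [OF subspace_span] closed_closure]
      by blast
    have "coord (x - p) j \<in> null" if j: "j < n" for j
      unfolding null_def
    proof (intro CollectI ballI allI)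
      fix Z h assume Z: "Z \<in> vecs"
      have "col_op n (\<lambda>i. if i = j then Z else 0) = (\<Sum>i<n. if i = j then eps i o\<^sub>L Z else 0)"
        unfolding col_op_def by (intro sum.cong) (auto simp: comp.zero_right)
      then have "eps j o\<^sub>L Z = col_op n (\<lambda>i. if i = j then Z else 0)" using j by (simp add: sum.delta)
      then have "eps j o\<^sub>L Z \<in> E" unfolding E_def using Z vecs_zero by auto
      then have "(eps j o\<^sub>L Z) k \<in> ?V" for k by (intro in_closure_span) blast
      then have o: "inner (x - p) (eps j (Z k)) = 0" for k using orth by simp
      have "\<i> *\<^sub>C eps j (Z h) = eps j (Z (\<i> *\<^sub>C h))"
        using vecs_clin [OF Z] by (simp add: clin_def, rule_tac ell2_eqI) (simp add: coord_scaleC)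
      then have "cinner (eps j (Z h)) (x - p) = 0"
        using o [of h] o [of "\<i> *\<^sub>C h"] by (simp add: cinner_eq inner_commute complex_eq_iff)
      then show "cinner (Z h) (coord (x - p) j) = 0" by (simp add: cinner_eps)
    qed
    then have "?R (x - p) = 0"
      using represented_pairD(4) [OF ad] by (intro ell2_eqI) (simp add: coord_matop coord_zero)
    then have "?R x = ?R p" by (simp add: blf_simps)
    then have "norm (?R x) \<le> c * norm p" using lin' [OF p] by simp
    also have "\<dots> \<le> c * norm x"
    proof (rule mult_left_mono [OF _ c0])
      have "(norm x)\<^sup>2 = (norm (x - p))\<^sup>2 + (norm p)\<^sup>2"
        using orth [OF p] by (simp add: power2_norm_eq_inner inner_diff_left inner_diff_right inner_commute)
      then have "(norm p)\<^sup>2 \<le> (norm x)\<^sup>2" by simp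
      then show "norm p \<le> norm x" by simp
    qed
    finally show "norm (?R x) \<le> c * norm x" .
  qed
qed

text \<open>The norm of a matrix of adjointable maps is that of the matrix of representing operators.\<close>

lemma mat_norm_adjointable:
  assumes M: "\<And>i j. i < n \<Longrightarrow> j < n \<Longrightarrow> M i j \<in> carrier (adjointable_ops I Y)"
  shows "mat_norm (adjointable_ops I Y) n M = norm (matop {..<n} (\<lambda>i j. rep (M i j)))"
proof -
  let ?R = "matop {..<n} (\<lambda>i j. rep (M i j))"
  define E where "E = {col_op n Z | Z. \<forall>j<n. Z j \<in> vecs}"
  let ?S = "{norm (?R o\<^sub>L W) | W. W \<in> E \<and> norm W \<le> 1}"
  have ad: "represented_pair (rep (M i j)) (adj (rep (M i j)))" if "i < n" "j < n" for i j
    using rep_in_represented [OF M [OF that]] by (simp add: represented_iff_adj)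
  have set_eq: "{sqrt (norm (\<Sum>i<n. mod_inner I
        (\<lambda>s. \<Sum>j<n. M i j (\<xi> j) s) (\<lambda>s. \<Sum>j<n. M i j (\<xi> j) s))) | \<xi>.
      (\<forall>j<n. \<xi> j \<in> dsum I Y) \<and> norm (\<Sum>j<n. mod_inner I (\<xi> j) (\<xi> j)) \<le> 1} = ?S" (is "?L = _")
  proof -
    have val: "sqrt (norm (\<Sum>i<n. mod_inner I (\<lambda>s. \<Sum>j<n. M i j (\<xi> j) s) (\<lambda>s. \<Sum>j<n. M i j (\<xi> j) s)))
          = norm (?R o\<^sub>L col_op n Z)"
      "norm (\<Sum>j<n. mod_inner I (\<xi> j) (\<xi> j)) = (norm (col_op n Z))\<^sup>2"
      if Z: "\<forall>j<n. Z j \<in> vecs \<and> \<xi> j = fam (Z j)" for \<xi> Z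
    proof -
      have mv: "rep (M i j) o\<^sub>L Z j \<in> vecs" if "i < n" "j < n" for i j
        using represented_pairD(2) [OF ad] Z that by blast
      have "M i j (\<xi> j) = fam (rep (M i j) o\<^sub>L Z j)" if "i < n" "j < n" for i j
        using Z that sigma_fam sigma_rep [OF M [OF that]] by metis
      then have "(\<lambda>s. \<Sum>j<n. M i j (\<xi> j) s) = fam (\<Sum>j<n. rep (M i j) o\<^sub>L Z j)" if "i < n" for i
        using that by (auto simp: fam_def comp.sum_right fun_eq_iff intro!: sum.cong)
      then have "(\<Sum>i<n. mod_inner I (\<lambda>s. \<Sum>j<n. M i j (\<xi> j) s) (\<lambda>s. \<Sum>j<n. M i j (\<xi> j) s))
          = (\<Sum>i<n. mod_inner I (fam (\<Sum>j<n. rep (M i j) o\<^sub>L Z j)) (fam (\<Sum>j<n. rep (M i j) o\<^sub>L Z j)))"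
        by (intro sum.cong) auto
      moreover have "(\<Sum>j<n. rep (M i j) o\<^sub>L Z j) \<in> vecs" if "i < n" for i
        using mv that by (auto intro!: subspace_sum [OF subspace_vecs])
      ultimately show "sqrt (norm (\<Sum>i<n. mod_inner I (\<lambda>s. \<Sum>j<n. M i j (\<xi> j) s) (\<lambda>s. \<Sum>j<n. M i j (\<xi> j) s)))
          = norm (?R o\<^sub>L col_op n Z)"
        by (simp add: norm_sum_mod_inner matop_col_op) (simp add: col_op_def)
      have "(\<Sum>j<n. mod_inner I (\<xi> j) (\<xi> j)) = (\<Sum>j<n. mod_inner I (fam (Z j)) (fam (Z j)))"
        using Z by (intro sum.cong) auto
      then show "norm (\<Sum>j<n. mod_inner I (\<xi> j) (\<xi> j)) = (norm (col_op n Z))\<^sup>2"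
        using Z by (simp add: norm_sum_mod_inner col_op_def)
    qed
    show ?thesis
    proof (intro subset_antisym subsetI)
      fix s assume "s \<in> ?L"
      then obtain \<xi> where \<xi>: "\<forall>j<n. \<xi> j \<in> dsum I Y" "norm (\<Sum>j<n. mod_inner I (\<xi> j) (\<xi> j)) \<le> 1"
        and s: "s = sqrt (norm (\<Sum>i<n. mod_inner I (\<lambda>s. \<Sum>j<n. M i j (\<xi> j) s) (\<lambda>s. \<Sum>j<n. M i j (\<xi> j) s)))"
        by blast
      have "\<forall>j. \<exists>Z. j < n \<longrightarrow> Z \<in> vecs \<and> \<xi> j = fam Z" using \<xi>(1) dsum_eq_fam by metis
      then obtain Z where Z: "\<forall>j<n. Z j \<in> vecs \<and> \<xi> j = fam (Z j)" by metis
      have "col_op n Z \<in> E" using Z by (auto simp: E_def)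
      moreover have "norm (col_op n Z) \<le> 1" using \<xi>(2) val(2) [OF Z] by (simp add: abs_square_le_1)
      ultimately show "s \<in> ?S" using s val(1) [OF Z] by blast
    next
      fix s assume "s \<in> ?S"
      then obtain Z where Z: "\<forall>j<n. Z j \<in> vecs" "norm (col_op n Z) \<le> 1" "s = norm (?R o\<^sub>L col_op n Z)"
        by (auto simp: E_def)
      have v: "\<forall>j<n. Z j \<in> vecs \<and> fam (Z j) = fam (Z j)" using Z by simp
      show "s \<in> ?L"
        using Z val(1) [OF v] val(2) [OF v] fam_in_dsum
        by (intro CollectI exI [of _ "\<lambda>j. fam (Z j)"]) (simp add: abs_square_le_1)
    qed
  qed
  have zero: "0 \<in> ?S"
    by (intro CollectI exI [of _ "col_op n (\<lambda>_. 0)"])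
      (auto simp: E_def vecs_zero col_op_def comp.zero_right intro: exI [of _ "\<lambda>_. 0"])
  have le: "s \<le> norm ?R" if "s \<in> ?S" for s
  proof -
    obtain W :: "'h \<Rightarrow>\<^sub>L (nat, ('i, 'h) ell2) ell2" where W: "s = norm (?R o\<^sub>L W)" "norm W \<le> 1" using \<open>s \<in> ?S\<close> by auto
    have "s \<le> norm ?R * norm W" unfolding W(1) by (rule norm_blinfun_compose)
    also have "\<dots> \<le> norm ?R * 1" by (intro mult_left_mono W norm_ge_zero)
    finally show ?thesis by simp
  qed
  define c where "c = Sup ?S"
  have bdd: "bdd_above ?S" using le by (rule bdd_aboveI)
  have c0: "0 \<le> c" unfolding c_def using zero bdd by (rule cSup_upper)
  have ES: "r *\<^sub>R W \<in> E" if W: "W \<in> E" for r W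
  proof -
    obtain Z where Z: "W = col_op n Z" "\<And>j. j < n \<Longrightarrow> Z j \<in> vecs" using W by (auto simp: E_def)
    then show ?thesis
      unfolding E_def by (intro CollectI exI [of _ "\<lambda>j. r *\<^sub>R Z j"])
        (auto simp: col_op_def comp.scaleR_right scaleR_sum_right vecs_scaleR)
  qed
  have bR: "norm (?R o\<^sub>L W) \<le> c * norm W" if W: "W \<in> E" for W
  proof (cases "W = 0")
    case False
    have "norm (?R o\<^sub>L (inverse (norm W) *\<^sub>R W)) \<in> ?S"
      using ES [OF W] False by (intro CollectI exI [of _ "inverse (norm W) *\<^sub>R W"]) simp
    then have "norm (?R o\<^sub>L (inverse (norm W) *\<^sub>R W)) \<le> c" unfolding c_def using bdd by (rule cSup_upper)
    then show ?thesis using False by (simp add: comp.scaleR_right field_simps)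
  qed (simp add: comp.zero_right)
  have "norm ?R \<le> c"
    by (rule norm_matop_rep_le [OF M c0]) (use bR E_def in auto)
  moreover have "c \<le> norm ?R" unfolding c_def using zero le by (intro cSup_least) auto
  ultimately have "Sup ?S = norm ?R" by (simp add: c_def)
  then show ?thesis unfolding set_eq [symmetric] by (simp add: adjointable_ops_def)
qed

end

section \<open>Operator algebras with a faithful representation\<close>

lemma norm_matop_one: "norm (matop {..<1::nat} (\<lambda>_ _. A)) = norm (A :: 'k::complex_hilbert bop)"
proof (rule order_antisym)
  have m: "matop {..<1::nat} (\<lambda>_ _. A) = eps 0 o\<^sub>L A o\<^sub>L prj 0" by (simp add: matop_def)
  have "norm (eps (0::nat) o\<^sub>L A o\<^sub>L prj (0::nat)) \<le> (norm (eps (0::nat) :: 'k \<Rightarrow>\<^sub>L _) * norm A) * norm (prj (0::nat) :: _ \<Rightarrow>\<^sub>L 'k)"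
    by (rule order_trans [OF norm_blinfun_compose mult_right_mono [OF norm_blinfun_compose norm_ge_zero]])
  also have "\<dots> \<le> (1 * norm A) * 1" by (intro mult_mono norm_eps_le norm_prj_le) auto
  finally show "norm (matop {..<1::nat} (\<lambda>_ _. A)) \<le> norm A" unfolding m by simp
  have "prj 0 o\<^sub>L matop {..<1::nat} (\<lambda>_ _. A) o\<^sub>L eps 0 = A" by (rule matop_entry) auto
  then have "norm A = norm (prj 0 o\<^sub>L matop {..<1::nat} (\<lambda>_ _. A) o\<^sub>L eps 0)" by simp
  also have "\<dots> \<le> (norm (prj (0::nat) :: _ \<Rightarrow>\<^sub>L 'k) * norm (matop {..<1::nat} (\<lambda>_ _. A))) * norm (eps (0::nat) :: 'k \<Rightarrow>\<^sub>L _)"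
    by (rule order_trans [OF norm_blinfun_compose mult_right_mono [OF norm_blinfun_compose norm_ge_zero]])
  also have "\<dots> \<le> (1 * norm (matop {..<1::nat} (\<lambda>_ _. A))) * 1"
    by (intro mult_mono norm_eps_le norm_prj_le) auto
  finally show "norm A \<le> norm (matop {..<1::nat} (\<lambda>_ _. A))" by simp
qed

lemma scale_op_minus_one: "scale_op (- 1) T = - T"
  using cscale_of_real [of "- 1" T] by (simp add: scale_op_eq)

lemma bounded_linear_scale_op: "bounded_linear (scale_op c)"
  unfolding scale_op_eq by (rule comp.bounded_linear_right)

lemma closure_preserved:
  assumes f: "bounded_linear f" and S: "\<And>x. x \<in> S \<Longrightarrow> f x \<in> closure T" and x: "x \<in> closure S"
  shows "f x \<in> closure T"
proof -
  have "closure S \<subseteq> {x. f x \<in> closure T}"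
    using S by (intro closure_minimal closed_vimage_blinfun f closed_closure) auto
  then show ?thesis using x by blast
qed

locale represented_algebra =
  fixes R :: "'a op_alg" (structure) and \<rho> :: "'a \<Rightarrow> 'k::complex_hilbert bop"
  assumes rep_cstar: "concrete_cstar (\<rho> ` carrier R)" and rep_inj: "inj_on \<rho> (carrier R)"
    and zero_closed: "\<zero> \<in> carrier R" and rep_zero: "\<rho> \<zero> = 0"
    and add_closed: "a \<in> carrier R \<Longrightarrow> b \<in> carrier R \<Longrightarrow> a \<oplus> b \<in> carrier R"
    and rep_add: "a \<in> carrier R \<Longrightarrow> b \<in> carrier R \<Longrightarrow> \<rho> (a \<oplus> b) = \<rho> a + \<rho> b"
    and mult_closed: "a \<in> carrier R \<Longrightarrow> b \<in> carrier R \<Longrightarrow> a \<otimes> b \<in> carrier R"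
    and rep_mult: "a \<in> carrier R \<Longrightarrow> b \<in> carrier R \<Longrightarrow> \<rho> (a \<otimes> b) = \<rho> a o\<^sub>L \<rho> b"
    and smult_closed: "a \<in> carrier R \<Longrightarrow> c \<odot>\<^bsub>R\<^esub> a \<in> carrier R"
    and rep_smult: "a \<in> carrier R \<Longrightarrow> \<rho> (c \<odot>\<^bsub>R\<^esub> a) = scale_op c (\<rho> a)"
    and star_closed: "a \<in> carrier R \<Longrightarrow> star R a \<in> carrier R"
    and rep_star: "a \<in> carrier R \<Longrightarrow> \<rho> (star R a) = adj (\<rho> a)"
    and rep_mat_norm: "(\<And>i j. i < n \<Longrightarrow> j < n \<Longrightarrow> M i j \<in> carrier R) \<Longrightarrow>
      mat_norm R n M = norm (matop {..<n} (\<lambda>i j. \<rho> (M i j)))"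
begin

lemma clin_rep: "a \<in> carrier R \<Longrightarrow> clin (\<rho> a)"
  using concrete_cstar.clin_B [OF rep_cstar] by blast

lemma mat_norm_one: "a \<in> carrier R \<Longrightarrow> mat_norm R 1 (\<lambda>_ _. a) = norm (\<rho> a)"
  using rep_mat_norm [of 1 "\<lambda>_ _. a"] norm_matop_one by simp

lemma op_dist_eq: "a \<in> carrier R \<Longrightarrow> b \<in> carrier R \<Longrightarrow> op_dist R a b = norm (\<rho> a - \<rho> b)"
  by (simp add: op_dist_def mat_norm_one add_closed smult_closed rep_add rep_smult scale_op_minus_one
      del: One_nat_def)

lemma norm_closure_eq: "B \<subseteq> carrier R \<Longrightarrow> norm_closure R B = {a \<in> carrier R. \<rho> a \<in> closure (\<rho> ` B)}"
  unfolding norm_closure_def closure_approachable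
  by (auto simp: op_dist_eq subset_iff dist_norm norm_minus_commute)

lemma norm_closure_superset: "B \<subseteq> carrier R \<Longrightarrow> B \<subseteq> norm_closure R B"
  unfolding norm_closure_eq using closure_subset by blast

lemma norm_closure_subset: "norm_closure R B \<subseteq> carrier R"
  by (auto simp: norm_closure_def)

lemma norm_closure_mono: "B \<subseteq> C \<Longrightarrow> norm_closure R B \<subseteq> norm_closure R C"
  unfolding norm_closure_def by blast

lemma norm_closure_idem: "B \<subseteq> carrier R \<Longrightarrow> norm_closure R (norm_closure R B) = norm_closure R B"
proof (rule subset_antisym)
  assume B: "B \<subseteq> carrier R"
  have "\<rho> ` norm_closure R B \<subseteq> closure (\<rho> ` B)" by (auto simp: norm_closure_eq [OF B])
  then have "closure (\<rho> ` norm_closure R B) \<subseteq> closure (\<rho> ` B)" by (intro closure_minimal) auto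
  then show "norm_closure R (norm_closure R B) \<subseteq> norm_closure R B"
    using norm_closure_eq [OF norm_closure_subset [of B]] norm_closure_eq [OF B] by auto
qed (rule norm_closure_superset [OF norm_closure_subset])

lemma linear_subspace_carrier: "linear_subspace R (carrier R)"
  by (simp add: linear_subspace_def zero_closed add_closed smult_closed)

lemma cstar_subalgebra_carrier: "cstar_subalgebra R (carrier R)"
  using norm_closure_superset [of "carrier R"] norm_closure_subset [of "carrier R"]
  by (auto simp: cstar_subalgebra_def closed_subalgebra_def linear_subspace_carrier mult_closed star_closed)

lemma linear_subspaceD:
  assumes "linear_subspace R B"
  shows "B \<subseteq> carrier R" "\<zero> \<in> B" "a \<in> B \<Longrightarrow> b \<in> B \<Longrightarrow> a \<oplus> b \<in> B" "a \<in> B \<Longrightarrow> c \<odot>\<^bsub>R\<^esub> a \<in> B"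
  using assms by (auto simp: linear_subspace_def)

lemma rep_scaleR: "a \<in> carrier R \<Longrightarrow> \<rho> (complex_of_real r \<odot>\<^bsub>R\<^esub> a) = r *\<^sub>R \<rho> a"
  by (simp add: rep_smult scale_op_eq cscale_of_real)

lemma subspace_image: "linear_subspace R B \<Longrightarrow> subspace (\<rho> ` B)"
proof -
  assume B: "linear_subspace R B"
  note D = linear_subspaceD [OF B]
  show ?thesis unfolding subspace_def
  proof (intro conjI ballI allI)
    show "0 \<in> \<rho> ` B" using D(2) rep_zero by force
    show "x + y \<in> \<rho> ` B" if xy: "x \<in> \<rho> ` B" "y \<in> \<rho> ` B" for x y
    proof -
      obtain a b where "x = \<rho> a" "y = \<rho> b" "a \<in> B" "b \<in> B" using xy by blast
      then show ?thesis using D(1,3) rep_add [of a b] by (metis image_eqI subsetD)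
    qed
    show "r *\<^sub>R x \<in> \<rho> ` B" if x: "x \<in> \<rho> ` B" for r x
    proof -
      obtain a where "x = \<rho> a" "a \<in> B" using x by blast
      then show ?thesis using D(1,4) rep_scaleR [of a r] by (metis image_eqI subsetD)
    qed
  qed
qed

lemma linear_subspace_norm_closure:
  assumes B: "linear_subspace R B"
  shows "linear_subspace R (norm_closure R B)"
proof -
  note D = linear_subspaceD [OF B]
  note sub = subspace_closure_normed [OF subspace_image [OF B]]
  have "scale_op c x \<in> closure (\<rho> ` B)" if x: "x \<in> closure (\<rho> ` B)" for c x
  proof (rule closure_preserved [OF bounded_linear_scale_op _ x])
    fix y assume "y \<in> \<rho> ` B"
    then obtain a where a: "y = \<rho> a" "a \<in> B" by blast
    then have "scale_op c y = \<rho> (c \<odot>\<^bsub>R\<^esub> a)" using D(1) rep_smult by auto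
    then show "scale_op c y \<in> closure (\<rho> ` B)" using D(4) a closure_subset by blast
  qed
  then show ?thesis
    unfolding linear_subspace_def norm_closure_eq [OF D(1)]
    using sub by (auto simp: zero_closed rep_zero add_closed rep_add smult_closed rep_smult
        subspace_0 subspace_add)
qed

lemma closed_subalgebra_norm_closure:
  assumes B: "linear_subspace R B" and mult: "\<And>a b. a \<in> B \<Longrightarrow> b \<in> B \<Longrightarrow> a \<otimes> b \<in> B"
  shows "closed_subalgebra R (norm_closure R B)"
proof -
  note D = linear_subspaceD [OF B]
  have m1: "x o\<^sub>L y \<in> closure (\<rho> ` B)" if x: "x \<in> \<rho> ` B" and y: "y \<in> closure (\<rho> ` B)" for x y
  proof (rule closure_preserved [OF comp.bounded_linear_right _ y])
    fix z assume "z \<in> \<rho> ` B"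
    then obtain a b where "x = \<rho> a" "a \<in> B" "z = \<rho> b" "b \<in> B" using x by blast
    then have "x o\<^sub>L z = \<rho> (a \<otimes> b)" "a \<otimes> b \<in> B"
      using D(1) rep_mult [of a b] mult by (auto simp: subset_iff)
    then have "x o\<^sub>L z \<in> \<rho> ` B" by simp
    then show "x o\<^sub>L z \<in> closure (\<rho> ` B)" by (rule subsetD [OF closure_subset])
  qed
  have "x o\<^sub>L y \<in> closure (\<rho> ` B)" if x: "x \<in> closure (\<rho> ` B)" and y: "y \<in> closure (\<rho> ` B)" for x y
    by (rule closure_preserved [OF comp.bounded_linear_left _ x]) (rule m1 [OF _ y])
  then have "a \<otimes> b \<in> norm_closure R B" if "a \<in> norm_closure R B" "b \<in> norm_closure R B" for a b
    using that by (auto simp: norm_closure_eq [OF D(1)] mult_closed rep_mult)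
  then show ?thesis
    by (simp add: closed_subalgebra_def linear_subspace_norm_closure [OF B] norm_closure_idem [OF D(1)])
qed

definition lin_span :: "'a set \<Rightarrow> 'a set" where
  "lin_span F = \<Inter>{B. linear_subspace R B \<and> F \<subseteq> B}"

lemma closed_span_eq: "closed_span R F = norm_closure R (lin_span F)"
  by (simp add: closed_span_def lin_span_def)

lemma lin_span:
  assumes F: "F \<subseteq> carrier R"
  shows linear_subspace_lin_span: "linear_subspace R (lin_span F)" and lin_span_superset: "F \<subseteq> lin_span F"
    and lin_span_minimal: "linear_subspace R B \<Longrightarrow> F \<subseteq> B \<Longrightarrow> lin_span F \<subseteq> B"
proof -
  have "lin_span F \<subseteq> carrier R" using linear_subspace_carrier F by (auto simp: lin_span_def)
  then show "linear_subspace R (lin_span F)"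
    unfolding linear_subspace_def lin_span_def by (auto simp: linear_subspace_def)
qed (auto simp: lin_span_def)

lemma linear_subspace_closed_span: "F \<subseteq> carrier R \<Longrightarrow> linear_subspace R (closed_span R F)"
  unfolding closed_span_eq by (intro linear_subspace_norm_closure linear_subspace_lin_span)

lemma closed_span_superset: "F \<subseteq> carrier R \<Longrightarrow> F \<subseteq> closed_span R F"
  unfolding closed_span_eq
  using lin_span_superset norm_closure_superset linear_subspaceD(1) [OF linear_subspace_lin_span] by blast

lemma norm_closure_closed_span: "F \<subseteq> carrier R \<Longrightarrow> norm_closure R (closed_span R F) = closed_span R F"
  unfolding closed_span_eq by (rule norm_closure_idem [OF linear_subspaceD(1) [OF linear_subspace_lin_span]])

lemma closed_span_minimal:
  assumes "linear_subspace R B" "norm_closure R B = B" "F \<subseteq> B"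
  shows "closed_span R F \<subseteq> B"
proof -
  have "F \<subseteq> carrier R" using assms linear_subspaceD(1) by blast
  then have "lin_span F \<subseteq> B" using lin_span_minimal assms by blast
  then show ?thesis unfolding closed_span_eq using norm_closure_mono assms(2) by blast
qed

lemma closed_span_induct [consumes 2, case_names zero base add smult closed]:
  assumes F: "F \<subseteq> carrier R" and a: "a \<in> closed_span R F"
    and zero: "Q \<zero>" and base: "\<And>a. a \<in> F \<Longrightarrow> Q a"
    and add: "\<And>a b. a \<in> lin_span F \<Longrightarrow> b \<in> lin_span F \<Longrightarrow> Q a \<Longrightarrow> Q b \<Longrightarrow> Q (a \<oplus> b)"
    and smult: "\<And>a c. a \<in> lin_span F \<Longrightarrow> Q a \<Longrightarrow> Q (c \<odot>\<^bsub>R\<^esub> a)"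
    and closed: "\<And>a. a \<in> closed_span R F \<Longrightarrow>
      (\<And>e. 0 < e \<Longrightarrow> \<exists>b\<in>lin_span F. Q b \<and> norm (\<rho> a - \<rho> b) < e) \<Longrightarrow> Q a"
  shows "Q a"
proof -
  note L = linear_subspaceD [OF linear_subspace_lin_span [OF F]]
  have "linear_subspace R {x \<in> lin_span F. Q x}"
    unfolding linear_subspace_def using L zero add smult by auto
  then have Q: "Q x" if "x \<in> lin_span F" for x
    using lin_span_minimal [OF F, of "{x \<in> lin_span F. Q x}"] lin_span_superset [OF F] base that by blast
  show ?thesis
  proof (rule closed [OF a])
    fix e :: real assume "0 < e"
    then obtain b where "b \<in> lin_span F" "op_dist R a b < e" "a \<in> carrier R"
      using a by (auto simp: closed_span_eq norm_closure_def)
    then show "\<exists>b\<in>lin_span F. Q b \<and> norm (\<rho> a - \<rho> b) < e"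
      using Q L(1) by (auto simp: op_dist_eq subset_iff)
  qed
qed

lemma lin_span_subset_closed_span: "F \<subseteq> carrier R \<Longrightarrow> lin_span F \<subseteq> closed_span R F"
  unfolding closed_span_eq by (rule norm_closure_superset [OF linear_subspaceD(1) [OF linear_subspace_lin_span]])

lemma closed_subalgebraD:
  assumes "closed_subalgebra R B"
  shows "linear_subspace R B" "norm_closure R B = B" "a \<in> B \<Longrightarrow> b \<in> B \<Longrightarrow> a \<otimes> b \<in> B"
    "a \<in> carrier R \<Longrightarrow> \<rho> a \<in> closure (\<rho> ` B) \<Longrightarrow> a \<in> B"
proof -
  show *: "linear_subspace R B" "norm_closure R B = B" using assms by (auto simp: closed_subalgebra_def)
  show "a \<in> B \<Longrightarrow> b \<in> B \<Longrightarrow> a \<otimes> b \<in> B" using assms by (auto simp: closed_subalgebra_def)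
  show "a \<in> carrier R \<Longrightarrow> \<rho> a \<in> closure (\<rho> ` B) \<Longrightarrow> a \<in> B"
    using *(2) norm_closure_eq [OF linear_subspaceD(1) [OF *(1)]] by blast
qed

text \<open>The closed span of a multiplicative set is an algebra.\<close>

lemma alg_gen_eq_closed_span:
  assumes F: "F \<subseteq> carrier R" and mult: "\<And>a b. a \<in> F \<Longrightarrow> b \<in> F \<Longrightarrow> a \<otimes> b \<in> F"
  shows "alg_gen R F = closed_span R F" and "closed_subalgebra R (closed_span R F)"
proof -
  note L = linear_subspaceD [OF linear_subspace_lin_span [OF F]]
  note D = inj_onD [OF rep_inj]
  have eqs1: "(a \<oplus> b) \<otimes> d = a \<otimes> d \<oplus> b \<otimes> d" "d \<otimes> (a \<oplus> b) = d \<otimes> a \<oplus> d \<otimes> b"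
    if "a \<in> carrier R" "b \<in> carrier R" "d \<in> carrier R" for a b d
    using that by (auto intro!: D simp: rep_add rep_mult add_closed mult_closed comp.add_left comp.add_right)
  have eqs2: "(c \<odot>\<^bsub>R\<^esub> a) \<otimes> d = c \<odot>\<^bsub>R\<^esub> (a \<otimes> d)" "d \<otimes> (c \<odot>\<^bsub>R\<^esub> a) = c \<odot>\<^bsub>R\<^esub> (d \<otimes> a)"
    if m: "a \<in> carrier R" "d \<in> carrier R" for a d c
  proof -
    have "\<rho> d o\<^sub>L (cscale c o\<^sub>L \<rho> a) = cscale c o\<^sub>L (\<rho> d o\<^sub>L \<rho> a)"
      using cscale_commute [OF clin_rep [OF m(2)]] by (metis blinfun_compose_assoc)
    then show "(c \<odot>\<^bsub>R\<^esub> a) \<otimes> d = c \<odot>\<^bsub>R\<^esub> (a \<otimes> d)" "d \<otimes> (c \<odot>\<^bsub>R\<^esub> a) = c \<odot>\<^bsub>R\<^esub> (d \<otimes> a)"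
      by (auto intro!: D simp: m rep_mult rep_smult mult_closed smult_closed scale_op_eq blinfun_compose_assoc)
  qed
  have eqs3: "\<zero> \<otimes> d = \<zero>" "d \<otimes> \<zero> = \<zero>" if "d \<in> carrier R" for d
    using that by (auto intro!: D simp: rep_mult rep_zero mult_closed zero_closed comp.zero_left comp.zero_right)
  note eqs = eqs1 eqs2 eqs3
  have c: "x \<in> carrier R" if "x \<in> lin_span F" for x using that L(1) by blast
  have cF: "x \<in> carrier R" if "x \<in> F" for x using that F by blast
  have m1: "x \<otimes> d \<in> lin_span F" if x: "x \<in> lin_span F" and d: "d \<in> F" for x d
  proof -
    have "linear_subspace R {x \<in> lin_span F. x \<otimes> d \<in> lin_span F}"
      unfolding linear_subspace_def using L d by (auto simp: eqs c cF)
    then show ?thesis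
      using lin_span_minimal [OF F, of "{x \<in> lin_span F. x \<otimes> d \<in> lin_span F}"]
        lin_span_superset [OF F] mult d x by blast
  qed
  have m2: "x \<otimes> y \<in> lin_span F" if x: "x \<in> lin_span F" and y: "y \<in> lin_span F" for x y
  proof -
    have "linear_subspace R {y \<in> lin_span F. x \<otimes> y \<in> lin_span F}"
      unfolding linear_subspace_def using L x by (auto simp: eqs c)
    then show ?thesis
      using lin_span_minimal [OF F, of "{y \<in> lin_span F. x \<otimes> y \<in> lin_span F}"]
        lin_span_superset [OF F] m1 x y by blast
  qed
  show cs: "closed_subalgebra R (closed_span R F)"
    unfolding closed_span_eq by (rule closed_subalgebra_norm_closure [OF linear_subspace_lin_span [OF F] m2])
  show "alg_gen R F = closed_span R F"
  proof (rule subset_antisym)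
    show "alg_gen R F \<subseteq> closed_span R F"
      using cs closed_span_superset [OF F] by (auto simp: alg_gen_def)
    show "closed_span R F \<subseteq> alg_gen R F"
      unfolding alg_gen_def using closed_span_minimal closed_subalgebraD(1,2) by (intro Inter_greatest) auto
  qed
qed

lemma cstar_gen:
  assumes F: "F \<subseteq> carrier R"
  shows cstar_subalgebra_cstar_gen: "cstar_subalgebra R (cstar_gen R F)" and cstar_gen_superset: "F \<subseteq> cstar_gen R F"
    and cstar_gen_minimal: "cstar_subalgebra R B \<Longrightarrow> F \<subseteq> B \<Longrightarrow> cstar_gen R F \<subseteq> B"
proof -
  show min: "cstar_subalgebra R B \<Longrightarrow> F \<subseteq> B \<Longrightarrow> cstar_gen R F \<subseteq> B" for B
    by (auto simp: cstar_gen_def)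
  have sub: "cstar_gen R F \<subseteq> carrier R" by (rule min [OF cstar_subalgebra_carrier F])
  have "norm_closure R (cstar_gen R F) \<subseteq> B" if "cstar_subalgebra R B" "F \<subseteq> B" for B
    using norm_closure_mono [OF min [OF that]] that by (simp add: cstar_subalgebra_def closed_subalgebra_def)
  then have "norm_closure R (cstar_gen R F) \<subseteq> cstar_gen R F" unfolding cstar_gen_def by blast
  then have "norm_closure R (cstar_gen R F) = cstar_gen R F"
    using norm_closure_superset [OF sub] by (rule subset_antisym)
  moreover have "linear_subspace R (cstar_gen R F)"
    using sub unfolding linear_subspace_def cstar_gen_def
    by (auto simp: cstar_subalgebra_def closed_subalgebra_def linear_subspace_def)
  ultimately show "cstar_subalgebra R (cstar_gen R F)"
    unfolding cstar_subalgebra_def closed_subalgebra_def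
    by (auto simp: cstar_gen_def cstar_subalgebra_def closed_subalgebra_def)
  show "F \<subseteq> cstar_gen R F" by (auto simp: cstar_gen_def)
qed

lemma concrete_cstar_image:
  assumes B: "cstar_subalgebra R B"
  shows "concrete_cstar (\<rho> ` B)"
proof -
  have cs: "closed_subalgebra R B" and st: "\<And>a. a \<in> B \<Longrightarrow> star R a \<in> B"
    using B by (auto simp: cstar_subalgebra_def)
  note D = closed_subalgebraD [OF cs] linear_subspaceD [OF closed_subalgebraD(1) [OF cs]]
  have c: "a \<in> carrier R" if "a \<in> B" for a using that D(5) by blast
  interpret full: concrete_cstar "\<rho> ` carrier R" by (rule rep_cstar)
  show ?thesis
  proof
    have "closure (\<rho> ` B) \<subseteq> \<rho> ` B"
    proof
      fix x assume x: "x \<in> closure (\<rho> ` B)"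
      have "closure (\<rho> ` B) \<subseteq> \<rho> ` carrier R"
        using D(5) by (intro closure_minimal full.closed_B) auto
      then obtain a where "x = \<rho> a" "a \<in> carrier R" using x by blast
      then show "x \<in> \<rho> ` B" using D(4) x by blast
    qed
    then show "closed (\<rho> ` B)" using closure_subset_eq by blast
    show "0 \<in> \<rho> ` B" using subspace_0 [OF subspace_image [OF D(1)]] .
    fix x assume "x \<in> \<rho> ` B"
    then obtain a where a: "x = \<rho> a" "a \<in> B" by blast
    show "clin x" using a c clin_rep by simp
    show "scale_op k x \<in> \<rho> ` B" for k
      using a c D(8) rep_smult [of a k] by (metis image_eqI)
    show "adj x \<in> \<rho> ` B" using a c st rep_star [of a] by (metis image_eqI)
    fix y assume "y \<in> \<rho> ` B"
    then obtain b where b: "y = \<rho> b" "b \<in> B" by blast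
    show "x + y \<in> \<rho> ` B" using a b c D(7) rep_add [of a b] by (metis image_eqI)
    show "x o\<^sub>L y \<in> \<rho> ` B" using a b c D(3) rep_mult [of a b] by (metis image_eqI)
  qed
qed

definition unrep :: "'k bop \<Rightarrow> 'a" where
  "unrep = inv_into (carrier R) \<rho>"

lemma unrep_rep [simp]: "a \<in> carrier R \<Longrightarrow> unrep (\<rho> a) = a"
  by (simp add: unrep_def inv_into_f_f [OF rep_inj])

lemma star_rep_star_hom:
  assumes B: "cstar_subalgebra R B" and f: "star_hom R bounded_ops B f"
  shows "star_rep (\<rho> ` B) (f \<circ> unrep)"
proof -
  have cs: "closed_subalgebra R B" and st: "\<And>a. a \<in> B \<Longrightarrow> star R a \<in> B"
    using B by (auto simp: cstar_subalgebra_def)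
  note D = linear_subspaceD [OF closed_subalgebraD(1) [OF cs]] closed_subalgebraD(3) [OF cs]
  have c: "a \<in> carrier R" if "a \<in> B" for a using that D(1) by blast
  interpret concrete_cstar "\<rho> ` B" by (rule concrete_cstar_image [OF B])
  show ?thesis
  proof
    fix x assume "x \<in> \<rho> ` B"
    then obtain a where a: "x = \<rho> a" "a \<in> B" by blast
    show "clin ((f \<circ> unrep) x)" using f a c
      by (auto simp: star_hom_def alg_hom_def bounded_ops_def clinear_ops_iff_clin)
    show "(f \<circ> unrep) (scale_op k x) = scale_op k ((f \<circ> unrep) x)" for k
      using f a c by (simp add: star_hom_def alg_hom_def bounded_ops_def smult_closed flip: rep_smult)
    show "(f \<circ> unrep) (adj x) = adj ((f \<circ> unrep) x)"
      using f a c by (simp add: star_hom_def alg_hom_def bounded_ops_def star_closed flip: rep_star)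
    fix y assume "y \<in> \<rho> ` B"
    then obtain b where b: "y = \<rho> b" "b \<in> B" by blast
    show "(f \<circ> unrep) (x + y) = (f \<circ> unrep) x + (f \<circ> unrep) y"
      using f a b c by (simp add: star_hom_def alg_hom_def bounded_ops_def add_closed flip: rep_add)
    show "(f \<circ> unrep) (x o\<^sub>L y) = (f \<circ> unrep) x o\<^sub>L (f \<circ> unrep) y"
      using f a b c by (simp add: star_hom_def alg_hom_def bounded_ops_def mult_closed flip: rep_mult)
  qed
qed

lemma star_hom_completely_contractive:
  assumes B: "cstar_subalgebra R B" and f: "star_hom R bounded_ops B f"
    and M: "\<And>i j. i < n \<Longrightarrow> j < n \<Longrightarrow> M i j \<in> B"
  shows "norm (matop {..<n} (\<lambda>i j. f (M i j))) \<le> mat_norm R n M"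
proof -
  interpret star_rep "\<rho> ` B" "f \<circ> unrep" by (rule star_rep_star_hom [OF B f])
  have c: "M i j \<in> carrier R" if "i < n" "j < n" for i j
    using M [OF that] B by (auto simp: cstar_subalgebra_def closed_subalgebra_def linear_subspace_def)
  have "matop {..<n} (\<lambda>i j. f (M i j)) = matop {..<n} (\<lambda>i j. (f \<circ> unrep) (\<rho> (M i j)))"
    by (rule matop_cong) (simp add: c)
  also have "norm \<dots> \<le> norm (matop {..<n} (\<lambda>i j. \<rho> (M i j)))"
    by (rule rep_completely_contractive) (auto intro: M)
  finally show ?thesis using rep_mat_norm [of n M] c by simp
qed

end

lemma (in module_family) represented_algebra_adjointable:
  "represented_algebra (adjointable_ops I Y) rep"
proof -
  interpret concrete_cstar represented by (rule concrete_cstar_represented)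
  note r = rep_in_represented
  show ?thesis
  proof (rule represented_algebra.intro)
    show "concrete_cstar (rep ` carrier (adjointable_ops I Y))"
      unfolding rep_image by (rule concrete_cstar_represented)
    show "inj_on rep (carrier (adjointable_ops I Y))"
      by (rule inj_on_inverseI [where g = sigma]) (rule sigma_rep)
    show "\<zero>\<^bsub>adjointable_ops I Y\<^esub> \<in> carrier (adjointable_ops I Y)"
      unfolding adjointable_zero by (rule represented_carrier [OF zero_B])
    show "rep \<zero>\<^bsub>adjointable_ops I Y\<^esub> = 0"
      unfolding adjointable_zero by (rule rep_sigma [OF zero_B])
  next
    fix a b c assume a: "a \<in> carrier (adjointable_ops I Y)"
    show "c \<odot>\<^bsub>adjointable_ops I Y\<^esub> a \<in> carrier (adjointable_ops I Y)"
      unfolding adjointable_ops_eq [OF a a] by (intro represented_carrier scale_B r a)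
    show "star (adjointable_ops I Y) a \<in> carrier (adjointable_ops I Y)"
      unfolding adjointable_ops_eq [OF a a] by (intro represented_carrier adj_B r a)
    show "rep (c \<odot>\<^bsub>adjointable_ops I Y\<^esub> a) = scale_op c (rep a)"
      "rep (star (adjointable_ops I Y) a) = adj (rep a)" by (rule rep_ops [OF a a])+
    assume b: "b \<in> carrier (adjointable_ops I Y)"
    show "a \<oplus>\<^bsub>adjointable_ops I Y\<^esub> b \<in> carrier (adjointable_ops I Y)"
      "a \<otimes>\<^bsub>adjointable_ops I Y\<^esub> b \<in> carrier (adjointable_ops I Y)"
      unfolding adjointable_ops_eq [OF a b] by (intro represented_carrier add_B mult_B r a b)+
    show "rep (a \<oplus>\<^bsub>adjointable_ops I Y\<^esub> b) = rep a + rep b"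
      "rep (a \<otimes>\<^bsub>adjointable_ops I Y\<^esub> b) = rep a o\<^sub>L rep b" by (rule rep_ops [OF a b])+
  qed (rule mat_norm_adjointable)
qed

lemma represented_algebra_bounded_ops:
  "represented_algebra (bounded_ops :: 'k::complex_hilbert bop op_alg) (\<lambda>T. T)"
proof -
  have c: "carrier (bounded_ops :: 'k bop op_alg) = {T. clin T}"
    by (auto simp: bounded_ops_def clinear_ops_iff_clin)
  show ?thesis
    by unfold_locales
      (auto simp: c closed_clin concrete_cstar_clin mat_norm_bounded_ops, auto simp: bounded_ops_def)
qed

section \<open>Coordinate changes and block diagonal operators\<close>

lemma cinner_eps_right: "cinner x (eps i k) = cinner (coord x i) k"
  using cinner_commute [of x "eps i k"] cinner_commute [of "coord x i" k] by (simp add: cinner_eps)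

lemma eps_dense:
  "closure (span {eps j k | j k. True}) = (UNIV :: ('j, 'k::complex_hilbert) ell2 set)"
proof -
  have "x \<in> closure (span {eps j k | j k. True})" for x :: "('j, 'k) ell2"
    by (rule closed_subspace_ell2_UNIV) (auto intro!: subspace_closure_normed in_closure_span)
  then show ?thesis by blast
qed

lemma adjoint_pair_on_eps:
  assumes "\<And>i k j l. cinner (coord (blinfun_apply S (eps i k)) j) l = cinner k (coord (blinfun_apply T (eps j l)) i)"
  shows "adjoint_pair S T"
  by (rule adjoint_pair_if_on_dense [OF eps_dense eps_dense])
    (auto simp: cinner_eps cinner_eps_right assms)

text \<open>Partial composition with a coordinate map.\<close>

definition pull :: "'b set \<Rightarrow> ('b \<Rightarrow> 'a) \<Rightarrow> ('a, 'k::complex_hilbert) ell2 \<Rightarrow>\<^sub>L ('b, 'k) ell2" where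
  "pull A f = of_coords (\<lambda>x i. if i \<in> A then coord x (f i) else 0)"

lemma pull:
  fixes f :: "'b \<Rightarrow> 'a" and x :: "('a, 'k::complex_hilbert) ell2"
  assumes f: "inj_on f A"
  shows coord_pull: "coord (pull A f x) i = (if i \<in> A then coord x (f i) else 0)"
    and clin_pull: "clin (pull A f :: ('a, 'k) ell2 \<Rightarrow>\<^sub>L ('b, 'k) ell2)"
    and norm_pull_le: "norm (pull A f :: ('a, 'k) ell2 \<Rightarrow>\<^sub>L ('b, 'k) ell2) \<le> 1"
proof -
  have bd: "(\<Sum>i\<in>F. (norm (if i \<in> A then coord x (f i) else 0))\<^sup>2) \<le> (1 * norm x)\<^sup>2"
    if "finite F" for F and x :: "('a, 'k) ell2"
  proof -
    have "(\<Sum>i\<in>F. (norm (if i \<in> A then coord x (f i) else 0))\<^sup>2) = (\<Sum>i\<in>F \<inter> A. (norm (coord x (f i)))\<^sup>2)"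
      using that by (simp add: sum.inter_restrict) (rule sum.cong, auto)
    also have "\<dots> = (\<Sum>j\<in>f ` (F \<inter> A). (norm (coord x j))\<^sup>2)"
      using f by (intro sum.reindex_cong [symmetric, where l = f]) (auto intro: inj_on_subset)
    also have "\<dots> \<le> (norm x)\<^sup>2" using that by (intro finite_sum_le_norm_sq) simp
    finally show ?thesis by simp
  qed
  show "coord (pull A f x) i = (if i \<in> A then coord x (f i) else 0)"
    unfolding pull_def by (rule of_coords(1) [OF _ _ bd]) (simp_all add: coord_add coord_scaleC)
  show "clin (pull A f :: ('a, 'k) ell2 \<Rightarrow>\<^sub>L ('b, 'k) ell2)"
    unfolding pull_def by (rule of_coords(2) [OF _ _ bd]) (simp_all add: coord_add coord_scaleC)
  show "norm (pull A f :: ('a, 'k) ell2 \<Rightarrow>\<^sub>L ('b, 'k) ell2) \<le> 1"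
    unfolding pull_def by (rule of_coords(3) [OF _ _ bd]) (simp_all add: coord_add coord_scaleC)
qed

lemma adjoint_pair_pull:
  fixes f :: "'b \<Rightarrow> 'a"
  assumes f: "inj_on f A"
  shows "adjoint_pair (pull A f :: ('a, 'c::complex_hilbert) ell2 \<Rightarrow>\<^sub>L _) (pull (f ` A) (inv_into A f))"
proof (rule adjoint_pair_on_eps)
  fix a b and k l :: 'c
  have "b \<in> A \<and> f b = a \<longleftrightarrow> a \<in> f ` A \<and> inv_into A f a = b"
    using f by (auto simp: inv_into_f_f f_inv_into_f inv_into_into)
  then show "cinner (coord (pull A f (eps a k)) b) l = cinner k (coord (pull (f ` A) (inv_into A f) (eps b l)) a)"
    by (auto simp: coord_pull [OF f] coord_pull [OF inj_on_inv_into [OF subset_refl]] cinner_simps)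
qed

lemma pull_tensor_vec: "inj_on f A \<Longrightarrow> pull A f (tensor_vec k x) = tensor_vec k (pull A f x)"
  by (rule ell2_eqI) (simp add: coord_pull)

text \<open>The rows of a family indexed by pairs, with respect to a bijective pairing.\<close>

lemma rows_sq_sum_le:
  fixes g :: "'p \<Rightarrow> 'q \<Rightarrow> 'c" and x :: "('c, 'k::complex_hilbert) ell2"
  assumes g: "\<And>p q p' q'. g p q = g p' q' \<longleftrightarrow> p = p' \<and> q = q'" and F: "finite F"
  shows "(\<Sum>p\<in>F. (norm (pull UNIV (g p) x))\<^sup>2) \<le> (norm x)\<^sup>2"
proof -
  have inj: "inj_on (g p) UNIV" for p by (auto simp: inj_on_def g)
  have inj': "inj_on (inv_into UNIV (g p)) (range (g p))" for p by (rule inj_on_inv_into) simp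
  define y where "y = (\<Sum>p\<in>F. pull (range (g p)) (inv_into UNIV (g p)) (pull UNIV (g p) x))"
  have co: "coord (pull (range (g p)) (inv_into UNIV (g p)) (pull UNIV (g p) x)) c = (if c \<in> range (g p) then coord x c else 0)"
    for p c by (auto simp: coord_pull [OF inj] coord_pull [OF inj'] inv_into_f_f [OF inj])
  have "norm (coord y c) \<le> norm (coord x c)" for c
  proof (cases "\<exists>p\<in>F. c \<in> range (g p)")
    case True
    then obtain p where p: "p \<in> F" "c \<in> range (g p)" by blast
    have "coord y c = (\<Sum>p'\<in>F. if p' = p then coord x c else 0)"
      unfolding y_def coord_sum co using p by (intro sum.cong) (auto simp: g)
    then show ?thesis using p F by (simp add: sum.delta)
  next
    case False
    then have "coord y c = 0" unfolding y_def coord_sum co by (intro sum.neutral) auto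
    then show ?thesis by simp
  qed
  then have ny: "norm y \<le> norm x" by (rule ell2_norm_le_if_coord_le)
  have "inner (pull (range (g p)) (inv_into UNIV (g p)) (pull UNIV (g p) x)) x = (norm (pull UNIV (g p) x))\<^sup>2" for p
    using adjoint_pairD [OF adjoint_pair_sym [OF adjoint_pair_pull [OF inj [of p]]], of "pull UNIV (g p) x" x]
    by (simp add: inner_Re_cinner power2_norm_eq_inner)
  then have "(\<Sum>p\<in>F. (norm (pull UNIV (g p) x))\<^sup>2) = inner y x" by (simp add: y_def inner_sum_left)
  also have "\<dots> \<le> norm y * norm x" by (rule norm_cauchy_schwarz)
  also have "\<dots> \<le> norm x * norm x" using ny by (intro mult_right_mono) auto
  finally show ?thesis by (simp add: power2_eq_square)
qed

definition row :: "'p \<Rightarrow> ('p \<times> 'q, 'k::complex_hilbert) ell2 \<Rightarrow>\<^sub>L ('q, 'k) ell2" where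
  "row p = pull UNIV (Pair p)"

lemma coord_row [simp]: "coord (row p x) q = coord x (p, q)"
  unfolding row_def by (subst coord_pull) (auto simp: inj_on_def)

lemma row_eps: "row p (eps (p', q) h) = (if p = p' then eps q h else 0)"
  by (rule ell2_eqI) (auto simp: coord_zero)

definition blockdiag ::
  "('p \<Rightarrow> ('q, 'k::complex_hilbert) ell2 bop) \<Rightarrow> ('p \<times> 'q, 'k) ell2 bop" where
  "blockdiag D = of_coords (\<lambda>x (p, q). coord (D p (row p x)) q)"

lemma sum_sq_le_sum_norm_sq:
  fixes z :: "'p \<Rightarrow> ('q, 'k::complex_hilbert) ell2"
  assumes "finite F"
  shows "(\<Sum>(p, q)\<in>F. (norm (coord (z p) q))\<^sup>2) \<le> (\<Sum>p\<in>fst ` F. (norm (z p))\<^sup>2)"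
proof -
  have "F \<subseteq> fst ` F \<times> snd ` F" by force
  then have "(\<Sum>(p, q)\<in>F. (norm (coord (z p) q))\<^sup>2) \<le> (\<Sum>(p, q)\<in>fst ` F \<times> snd ` F. (norm (coord (z p) q))\<^sup>2)"
    using assms by (intro sum_mono2) auto
  also have "\<dots> = (\<Sum>p\<in>fst ` F. \<Sum>q\<in>snd ` F. (norm (coord (z p) q))\<^sup>2)"
    by (simp add: sum.cartesian_product)
  also have "\<dots> \<le> (\<Sum>p\<in>fst ` F. (norm (z p))\<^sup>2)"
    using assms by (intro sum_mono finite_sum_le_norm_sq) auto
  finally show ?thesis .
qed

lemma blockdiag:
  fixes D :: "'a \<Rightarrow> ('b, 'c::complex_hilbert) ell2 bop"
  assumes D: "\<And>p. clin (D p)" "\<And>p. norm (D p) \<le> 1"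
  shows coord_blockdiag: "coord (blockdiag D x) (p, q) = coord (D p (row p x)) q"
    and clin_blockdiag: "clin (blockdiag D)"
proof -
  have bd: "(\<Sum>c\<in>F. (norm (case c of (p, q) \<Rightarrow> coord (D p (row p x)) q))\<^sup>2) \<le> (1 * norm x)\<^sup>2"
    if F: "finite F" for F and x :: "('a \<times> 'b, 'c) ell2"
  proof -
    have "(\<Sum>c\<in>F. (norm (case c of (p, q) \<Rightarrow> coord (D p (row p x)) q))\<^sup>2)
        = (\<Sum>(p, q)\<in>F. (norm (coord (D p (row p x)) q))\<^sup>2)"
      by (intro sum.cong) auto
    also have "\<dots> \<le> (\<Sum>p\<in>fst ` F. (norm (D p (row p x)))\<^sup>2)" by (rule sum_sq_le_sum_norm_sq [OF F])
    also have "\<dots> \<le> (\<Sum>p\<in>fst ` F. (norm (row p x))\<^sup>2)"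
    proof (intro sum_mono power_mono norm_ge_zero)
      show "norm (D p (row p x)) \<le> norm (row p x)" for p
        using order_trans [OF norm_blinfun mult_right_mono [OF D(2) norm_ge_zero]] by simp
    qed
    also have "\<dots> \<le> (norm x)\<^sup>2" unfolding row_def using F by (intro rows_sq_sum_le) auto
    finally show ?thesis by simp
  qed
  have lin: "clin (row p :: ('a \<times> 'b, 'c) ell2 \<Rightarrow>\<^sub>L _)" for p
    unfolding row_def by (rule clin_pull) (simp add: inj_on_def)
  have "coord (blockdiag D x) c = (case c of (p, q) \<Rightarrow> coord (D p (row p x)) q)" for x c
    unfolding blockdiag_def
    by (rule of_coords(1) [OF _ _ bd]) (use D lin in \<open>auto simp: blf_simps clin_def coord_add coord_scaleC\<close>)
  then show "coord (blockdiag D x) (p, q) = coord (D p (row p x)) q" by simp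
  show "clin (blockdiag D)"
    unfolding blockdiag_def
    by (rule of_coords(2) [OF _ _ bd]) (use D lin in \<open>auto simp: blf_simps clin_def coord_add coord_scaleC\<close>)
qed

lemma row_blockdiag:
  assumes D: "\<And>p. clin (D p)" "\<And>p. norm (D p) \<le> 1"
  shows "row p (blockdiag D x) = D p (row p x)"
  by (rule ell2_eqI) (simp add: coord_blockdiag [OF D])

lemma pair_ell2_eqI: "(\<And>p. row p x = row p y) \<Longrightarrow> x = y"
  by (rule ell2_eqI) (metis coord_row surj_pair)

lemma adjoint_pair_blockdiag:
  fixes D E :: "'a \<Rightarrow> ('b, 'c::complex_hilbert) ell2 bop"
  assumes DE: "\<And>p. adjoint_pair (D p) (E p)" and D: "\<And>p. norm (D p) \<le> 1"
  shows "adjoint_pair (blockdiag D) (blockdiag E)"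
proof (rule adjoint_pair_on_eps)
  fix i j :: "'a \<times> 'b" and k l :: 'c
  obtain p q p' q' where ij: "i = (p, q)" "j = (p', q')" by fastforce
  have cD: "clin (D p)" and cE: "clin (E p)" and nE: "norm (E p) \<le> 1" for p
    using adjoint_pair_clin [OF DE] adjoint_pair_clin2 [OF DE] norm_adjoint_pair [OF DE, of p] D [of p] by auto
  have "cinner (coord (D p (eps q k)) q') l = cinner k (coord (E p (eps q' l)) q)"
    using adjoint_pairD [OF DE, of p "eps q k" "eps q' l"] by (simp add: cinner_eps cinner_eps_right)
  then show "cinner (coord (blockdiag D (eps i k)) j) l = cinner k (coord (blockdiag E (eps j l)) i)"
    by (auto simp: ij coord_blockdiag [OF cD D] coord_blockdiag [OF cE nE] row_eps blf_simps coord_zero cinner_simps)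
qed

text \<open>Identification of \<open>l\<^sup>2(J; l\<^sup>2(I; H))\<close> with \<open>l\<^sup>2(I \<times> J; H)\<close>.\<close>

definition flat :: "('j, ('i, 'h::complex_hilbert) ell2) ell2 \<Rightarrow>\<^sub>L ('i \<times> 'j, 'h) ell2" where
  "flat = of_coords (\<lambda>x (i, j). coord (coord x j) i)"

definition unflat :: "('i \<times> 'j, 'h::complex_hilbert) ell2 \<Rightarrow>\<^sub>L ('j, ('i, 'h) ell2) ell2" where
  "unflat = of_coords (\<lambda>y j. pull UNIV (\<lambda>i. (i, j)) y)"

lemma coord_flat [simp]:
  fixes x :: "('c, ('a, 'b::complex_hilbert) ell2) ell2"
  shows "coord (flat x) (i, j) = coord (coord x j) i"
proof -
  have bd: "(\<Sum>c\<in>F. (norm (case c of (i, j) \<Rightarrow> coord (coord x j) i))\<^sup>2) \<le> (1 * norm x)\<^sup>2"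
    if F: "finite F" for F and x :: "('c, ('a, 'b) ell2) ell2"
  proof -
    have "(\<Sum>c\<in>F. (norm (case c of (i, j) \<Rightarrow> coord (coord x j) i))\<^sup>2)
        = (\<Sum>(j, i)\<in>prod.swap ` F. (norm (coord (coord x j) i))\<^sup>2)"
      by (subst sum.reindex) (auto intro!: sum.cong inj_onI)
    also have "\<dots> \<le> (\<Sum>j\<in>fst ` prod.swap ` F. (norm (coord x j))\<^sup>2)"
      using F by (intro sum_sq_le_sum_norm_sq) simp
    also have "\<dots> \<le> (norm x)\<^sup>2" using F by (intro finite_sum_le_norm_sq) simp
    finally show ?thesis by simp
  qed
  have "coord (flat x) c = (case c of (i, j) \<Rightarrow> coord (coord x j) i)" for c
    unfolding flat_def by (rule of_coords(1) [OF _ _ bd]) (auto simp: coord_add coord_scaleC)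
  then show ?thesis by simp
qed

lemma coord_unflat:
  fixes y :: "('b \<times> 'a, 'c::complex_hilbert) ell2"
  shows "coord (unflat y) j = pull UNIV (\<lambda>i. (i, j)) y"
proof -
  have bd: "(\<Sum>j\<in>F. (norm (pull UNIV (\<lambda>i. (i, j)) y))\<^sup>2) \<le> (1 * norm y)\<^sup>2"
    if F: "finite F" for F and y :: "('b \<times> 'a, 'c) ell2"
    unfolding mult_1 by (rule rows_sq_sum_le [OF _ F]) auto
  have "clin (pull UNIV (\<lambda>i. (i, j)) :: ('b \<times> 'a, 'c) ell2 \<Rightarrow>\<^sub>L _)" for j
    by (rule clin_pull) (simp add: inj_on_def)
  then show ?thesis
    unfolding unflat_def by (intro of_coords(1) [OF _ _ bd]) (auto simp: blf_simps clin_def)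
qed

lemma coord_coord_unflat [simp]: "coord (coord (unflat y) j) i = coord y (i, j)"
  unfolding coord_unflat by (subst coord_pull) (auto simp: inj_on_def)

lemma flat_unflat [simp]: "flat (unflat y) = y" and unflat_flat [simp]: "unflat (flat x) = x"
  by (rule ell2_eqI, force) (rule ell2_eqI, rule ell2_eqI, simp)

lemma adjoint_pair_flat:
  "adjoint_pair (flat :: ('a, ('b, 'c::complex_hilbert) ell2) ell2 \<Rightarrow>\<^sub>L _) unflat"
proof (rule adjoint_pair_if_on_dense [OF eps_dense eps_dense])
  fix x :: "('a, ('b, 'c) ell2) ell2" and y :: "('b \<times> 'a, 'c) ell2"
  assume "x \<in> {eps j k | j k. True}" "y \<in> {eps j k | j k. True}"
  then obtain j z i j' h where x: "x = eps j z" and y: "y = eps (i, j') h" by auto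
  have "coord (unflat y) j = (if j = j' then eps i h else 0)"
    by (rule ell2_eqI) (auto simp: y coord_zero)
  then show "cinner (flat x) y = cinner x (unflat y)"
    by (auto simp: x y cinner_eps cinner_eps_right cinner_simps coord_zero)
qed

lemma norm_flat_le: "norm (flat :: ('a, ('b, 'c::complex_hilbert) ell2) ell2 \<Rightarrow>\<^sub>L _) \<le> 1"
  and norm_unflat_le: "norm (unflat :: _ \<Rightarrow>\<^sub>L ('a, ('b, 'c::complex_hilbert) ell2) ell2) \<le> 1"
proof -
  have "(norm (flat x))\<^sup>2 = (norm x)\<^sup>2" for x :: "('a, ('b, 'c) ell2) ell2"
    using adjoint_pairD [OF adjoint_pair_flat, of x "flat x"] by (simp add: power2_norm_eq_inner inner_Re_cinner)
  then have "norm (flat x) = norm x" for x :: "('a, ('b, 'c) ell2) ell2" by (simp add: power2_eq_iff_nonneg)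
  then show f: "norm (flat :: ('a, ('b, 'c) ell2) ell2 \<Rightarrow>\<^sub>L _) \<le> 1" by (intro norm_blinfun_bound) auto
  show "norm (unflat :: _ \<Rightarrow>\<^sub>L ('a, ('b, 'c) ell2) ell2) \<le> 1"
    using norm_adjoint_pair [OF adjoint_pair_flat [where ?'a = 'a and ?'b = 'b and ?'c = 'c]] f by simp
qed

lemma unitary_norm_le:
  "adjoint_pair U V \<Longrightarrow> V o\<^sub>L U = id_blinfun \<Longrightarrow> norm U \<le> 1"
proof (rule norm_blinfun_bound)
  fix x assume UV: "adjoint_pair U V" "V o\<^sub>L U = id_blinfun"
  have "V (U x) = x" using arg_cong [OF UV(2), of "\<lambda>T. blinfun_apply T x"] by simp
  then have "(norm (U x))\<^sup>2 = (norm x)\<^sup>2"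
    using adjoint_pairD [OF UV(1), of x "U x"] by (simp add: power2_norm_eq_inner inner_Re_cinner)
  then show "norm (U x) \<le> 1 * norm x" by (simp add: power2_eq_iff_nonneg)
qed simp

section \<open>The universal representation of a group\<close>

lemma slice_eq: "slice \<pi> x = row \<pi> x"
proof -
  have "coord (row \<pi> x) = (\<lambda>i. coord x (\<pi>, i))" by (rule ext) simp
  then show ?thesis unfolding slice_def by (metis coord_inverse)
qed

definition univ_component ::
  "('g, 'z) monoid_scheme \<Rightarrow> 'g \<Rightarrow> ('g \<Rightarrow> ('g \<times> nat) l2 bop) \<Rightarrow> ('g \<times> nat) l2 bop" where
  "univ_component G g \<pi> = (if \<pi> \<in> unitary_reps G then \<pi> g else id_blinfun)"

context group
begin

lemma univ_component:
  assumes g: "g \<in> carrier G"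
  shows "adjoint_pair (univ_component G g \<pi>) (adj (univ_component G g \<pi>))"
    and "adj (univ_component G g \<pi>) o\<^sub>L univ_component G g \<pi> = id_blinfun"
    and "univ_component G g \<pi> o\<^sub>L adj (univ_component G g \<pi>) = id_blinfun"
proof -
  have "unitary_op (univ_component G g \<pi>)"
    using g by (auto simp: univ_component_def unitary_reps_def) (auto simp: unitary_op_def clinear_ops_iff_clin intro: blinfun_eqI)
  then show "adjoint_pair (univ_component G g \<pi>) (adj (univ_component G g \<pi>))"
    "adj (univ_component G g \<pi>) o\<^sub>L univ_component G g \<pi> = id_blinfun"
    "univ_component G g \<pi> o\<^sub>L adj (univ_component G g \<pi>) = id_blinfun"
    by (auto simp: unitary_op_def clinear_ops_iff_clin adjoint_pair_adj)
qed

lemma univ_component_norm: "g \<in> carrier G \<Longrightarrow> norm (univ_component G g \<pi>) \<le> 1"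
  by (rule unitary_norm_le) (rule univ_component, assumption)+

lemma univ_component_clin: "g \<in> carrier G \<Longrightarrow> clin (univ_component G g \<pi>)"
  by (rule adjoint_pair_clin) (rule univ_component)

lemma univ_unitary_eq:
  assumes g: "g \<in> carrier G"
  shows "univ_unitary G g = blockdiag (univ_component G g)"
  unfolding univ_unitary_def
proof (rule the_equality)
  note D = univ_component_clin [OF g] univ_component_norm [OF g]
  have sl: "slice \<pi> (blockdiag (univ_component G g) x)
      = (if \<pi> \<in> unitary_reps G then \<pi> g (slice \<pi> x) else slice \<pi> x)" for \<pi> x
    by (simp add: slice_eq row_blockdiag [OF D] univ_component_def)
  then show "blockdiag (univ_component G g) \<in> clinear_ops \<and> (\<forall>x \<pi>. slice \<pi> (blockdiag (univ_component G g) x)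
      = (if \<pi> \<in> unitary_reps G then \<pi> g (slice \<pi> x) else slice \<pi> x))"
    by (simp add: clinear_ops_iff_clin clin_blockdiag [OF D])
  fix U assume U: "U \<in> clinear_ops \<and> (\<forall>x \<pi>. slice \<pi> (U x) = (if \<pi> \<in> unitary_reps G then \<pi> g (slice \<pi> x) else slice \<pi> x))"
  then have eq: "slice \<pi> (U x) = slice \<pi> (blockdiag (univ_component G g) x)" for \<pi> x
    using sl by presburger
  show "U = blockdiag (univ_component G g)"
    by (rule blinfun_eqI, rule pair_ell2_eqI) (use eq in \<open>simp add: slice_eq\<close>)
qed

lemma row_univ_unitary:
  "g \<in> carrier G \<Longrightarrow> row \<pi> (univ_unitary G g x) = univ_component G g \<pi> (row \<pi> x)"
  by (simp add: univ_unitary_eq row_blockdiag univ_component_clin univ_component_norm)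

lemma univ_unitary_adjoint:
  assumes g: "g \<in> carrier G"
  obtains V where "adjoint_pair (univ_unitary G g) V" "V o\<^sub>L univ_unitary G g = id_blinfun"
    "univ_unitary G g o\<^sub>L V = id_blinfun"
proof -
  let ?E = "\<lambda>\<pi>. adj (univ_component G g \<pi>)"
  note u = univ_component [OF g]
  note D = univ_component_clin [OF g] univ_component_norm [OF g]
  have cE: "clin (?E \<pi>)" and nE: "norm (?E \<pi>) \<le> 1" for \<pi>
    using adjoint_pair_clin2 [OF u(1)] norm_adjoint_pair [OF u(1)] D(2) by auto
  have app: "univ_component G g \<pi> (?E \<pi> x) = x" "?E \<pi> (univ_component G g \<pi> x) = x" for \<pi> x
    using arg_cong [OF u(3), of "\<lambda>T. blinfun_apply T x" \<pi>] arg_cong [OF u(2), of "\<lambda>T. blinfun_apply T x" \<pi>]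
    by simp_all
  show thesis
  proof (rule that [of "blockdiag ?E"])
    show "adjoint_pair (univ_unitary G g) (blockdiag ?E)"
      unfolding univ_unitary_eq [OF g] by (rule adjoint_pair_blockdiag [OF u(1) D(2)])
    show "blockdiag ?E o\<^sub>L univ_unitary G g = id_blinfun" "univ_unitary G g o\<^sub>L blockdiag ?E = id_blinfun"
      unfolding univ_unitary_eq [OF g]
      by (rule blinfun_eqI, rule pair_ell2_eqI, simp add: row_blockdiag [OF D] row_blockdiag [OF cE nE] app)+
  qed
qed

lemma clin_univ_unitary: "g \<in> carrier G \<Longrightarrow> clin (univ_unitary G g)"
  by (metis univ_unitary_adjoint adjoint_pair_clin)

lemma univ_unitary_mult:
  assumes "g \<in> carrier G" "h \<in> carrier G"
  shows "univ_unitary G (g \<otimes> h) = univ_unitary G g o\<^sub>L univ_unitary G h"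
proof (rule blinfun_eqI, rule pair_ell2_eqI)
  fix x \<pi>
  have "univ_component G (g \<otimes> h) \<pi> = univ_component G g \<pi> o\<^sub>L univ_component G h \<pi>"
    using assms by (auto simp: univ_component_def unitary_reps_def intro: blinfun_eqI)
  then show "row \<pi> (univ_unitary G (g \<otimes> h) x) = row \<pi> ((univ_unitary G g o\<^sub>L univ_unitary G h) x)"
    using assms by (simp add: row_univ_unitary)
qed

text \<open>The regular representation, with multiplicity, is one of the components of the universal
  representation.\<close>

definition shift :: "'a \<Rightarrow> 'a \<times> nat \<Rightarrow> 'a \<times> nat" where
  "shift g = (\<lambda>(h, n). (if h \<in> carrier G then inv g \<otimes> h else h, n))"

definition regular :: "'a \<Rightarrow> ('a \<times> nat) l2 bop" where
  "regular g = pull UNIV (shift g)"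

lemma shift_mult: "g \<in> carrier G \<Longrightarrow> h \<in> carrier G \<Longrightarrow> shift h (shift g s) = shift (g \<otimes> h) s"
  by (cases s) (auto simp: shift_def inv_mult_group m_assoc)

lemma shift_one: "shift \<one> s = s"
  by (cases s) (auto simp: shift_def)

lemma inj_shift: "g \<in> carrier G \<Longrightarrow> inj_on (shift g) A"
  by (rule inj_on_inverseI [where g = "shift (inv g)"]) (simp add: shift_mult shift_one)

lemma coord_regular: "g \<in> carrier G \<Longrightarrow> coord (regular g x) s = coord x (shift g s)"
  by (simp add: regular_def coord_pull inj_shift)

lemma adjoint_pair_regular: "g \<in> carrier G \<Longrightarrow> adjoint_pair (regular g) (regular (inv g))"
proof (rule adjoint_pair_on_eps)
  fix i j and k l :: complex assume g: "g \<in> carrier G"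
  have "shift g j = i \<longleftrightarrow> shift (inv g) i = j"
    using g by (metis inv_closed inv_inv l_inv r_inv shift_mult shift_one)
  then show "cinner (coord (regular g (eps i k)) j) l = cinner k (coord (regular (inv g) (eps j l)) i)"
    using g by (auto simp: coord_regular cinner_simps)
qed

lemma regular_in_unitary_reps: "regular \<in> unitary_reps G"
proof -
  have "unitary_op (regular g)" if g: "g \<in> carrier G" for g
    unfolding unitary_op_def adj_eqI [OF adjoint_pair_regular [OF g]]
    using g adjoint_pair_clin [OF adjoint_pair_regular [OF g]]
    by (auto simp: clinear_ops_iff_clin coord_regular shift_mult shift_one intro!: blinfun_eqI ell2_eqI)
  moreover have "regular (g \<otimes> h) = regular g o\<^sub>L regular h" if "g \<in> carrier G" "h \<in> carrier G" for g h
    using that by (intro blinfun_eqI ell2_eqI) (simp add: coord_regular shift_mult)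
  ultimately show ?thesis by (simp add: unitary_reps_def)
qed

end

section \<open>Exterior tensor products with a Hilbert space\<close>

lemma orthogonal_to_dense:
  fixes v :: "'a::complex_hilbert"
  assumes dense: "closure (span G) = UNIV" and orth: "\<And>x. x \<in> G \<Longrightarrow> cinner x v = 0"
  shows "v = 0"
proof -
  have "subspace {x. cinner x v = 0}" by (auto simp: subspace_def cinner_simps)
  moreover have "closed {x. cinner x v = 0}"
    by (intro closed_Collect_eq continuous_on_const linear_continuous_on cinner.bounded_linear_left)
  ultimately have "closure (span G) \<subseteq> {x. cinner x v = 0}"
    using orth by (intro closure_minimal span_minimal) auto
  then have "cinner v v = 0" using dense by blast
  then show ?thesis by (simp add: cinner_self)
qed

locale module_tensor = base: module_family I Y + amp: module_family "I \<times> (UNIV :: 'j set)" "Y \<circ> fst"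
  for I :: "'i set" and Y :: "'i \<Rightarrow> 'h::complex_hilbert bop set" and J :: "'j itself"

lemma (in module_family) module_tensor: "module_tensor TYPE('j) I Y"
  by (intro module_tensor.intro module_family_axioms module_family.intro)
    (auto simp: fibre_subspace fibre_closed)

context module_tensor
begin

abbreviation (input) "ops \<equiv> adjointable_ops I Y"
abbreviation (input) "ops2 \<equiv> adjointable_ops (I \<times> (UNIV :: 'j set)) (Y \<circ> fst)"

definition tmap :: "('h \<Rightarrow>\<^sub>L ('i, 'h) ell2) \<Rightarrow> 'j l2 \<Rightarrow> 'h \<Rightarrow>\<^sub>L ('i \<times> 'j, 'h) ell2" where
  "tmap Z x = flat o\<^sub>L tvec x o\<^sub>L Z"

lemma coord_tmap: "coord (tmap Z x h) (i, j) = coord x j *\<^sub>C coord (Z h) i"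
  by (simp add: tmap_def coord_scaleC)

lemma fam_tmap: "amp.fam (tmap Z x) = mod_tensor_vec (base.fam Z) x"
proof
  fix c :: "'i \<times> 'j"
  obtain i j where "c = (i, j)" by fastforce
  then show "amp.fam (tmap Z x) c = mod_tensor_vec (base.fam Z) x c"
    by (intro blinfun_eqI) (simp add: amp.fam_apply coord_tmap mod_tensor_vec_def scale_op_apply base.fam_apply)
qed

lemma tmap_eps: "tmap (eps i o\<^sub>L y) (delta j) = eps (i, j) o\<^sub>L y"
  by (rule blinfun_eqI, rule ell2_eqI) (auto simp: coord_tmap coord_delta scaleC_one split: if_splits)

lemma tmap_in_vecs:
  assumes Z: "Z \<in> base.vecs"
  shows "tmap Z x \<in> amp.vecs"
proof -
  have 1: "tmap W (delta j) \<in> amp.vecs" if W: "W \<in> base.vecs" for W j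
  proof -
    have bl: "bounded_linear (\<lambda>W. tmap W (delta j))"
      unfolding tmap_def by (rule comp.bounded_linear_right)
    have "W \<in> {W. tmap W (delta j) \<in> amp.vecs}"
    proof (rule base.vecs_induct [OF W])
      show "subspace {W. tmap W (delta j) \<in> amp.vecs}"
        using linear_subspace_vimage [OF bounded_linear.linear [OF bl] amp.subspace_vecs] by (simp add: vimage_def)
      show "closed {W. tmap W (delta j) \<in> amp.vecs}" by (rule closed_vimage_blinfun [OF amp.closed_vecs bl])
      show "eps i o\<^sub>L y \<in> {W. tmap W (delta j) \<in> amp.vecs}" if "i \<in> I" "y \<in> Y i" for i y
        using amp.eps_in_vecs [of "(i, j)" y] that by (simp add: tmap_eps)
    qed
    then show ?thesis by simp
  qed
  have sc: "tmap Z (c *\<^sub>C x) = cscale c o\<^sub>L tmap Z x" for c x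
    by (rule blinfun_eqI, rule pair_ell2_eqI, rule ell2_eqI)
      (simp add: coord_tmap coord_scaleC scaleC_complex_def scaleC_scaleC)
  have bl: "bounded_linear (\<lambda>x. tmap Z x)"
  proof (rule bounded_linear_intro [where K = "norm Z"])
    show "tmap Z (x + y) = tmap Z x + tmap Z y" for x y
      by (rule blinfun_eqI, rule pair_ell2_eqI, rule ell2_eqI)
        (simp add: coord_tmap coord_add blf_simps scaleC_add_left)
    show "tmap Z (r *\<^sub>R x) = r *\<^sub>R tmap Z x" for r x
      using sc [of "complex_of_real r" x] by (simp add: scaleC_of_real cscale_of_real)
    show "norm (tmap Z x) \<le> norm x * norm Z" for x
    proof (rule norm_blinfun_bound)
      fix h
      have "norm (tmap Z x h) \<le> norm (tensor_vec (Z h) x)"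
        using order_trans [OF norm_blinfun [of flat "tensor_vec (Z h) x"] mult_right_mono [OF norm_flat_le norm_ge_zero]]
        by (simp add: tmap_def)
      also have "\<dots> \<le> (norm Z * norm h) * norm x"
        unfolding norm_tensor_vec by (intro mult_right_mono norm_blinfun) simp
      finally show "norm (tmap Z x h) \<le> norm x * norm Z * norm h" by (simp add: ac_simps)
    qed simp
  qed
  have "x \<in> {x. tmap Z x \<in> amp.vecs}"
  proof (rule closed_subspace_ell2_UNIV)
    show "subspace {x. tmap Z x \<in> amp.vecs}"
      using linear_subspace_vimage [OF bounded_linear.linear [OF bl] amp.subspace_vecs] by (simp add: vimage_def)
    show "closed {x. tmap Z x \<in> amp.vecs}" by (rule closed_vimage_blinfun [OF amp.closed_vecs bl])
    show "eps j c \<in> {x. tmap Z x \<in> amp.vecs}" for j c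
    proof -
      have "eps j c = c *\<^sub>C delta j"
        by (rule ell2_eqI) (simp add: coord_scaleC coord_delta scaleC_complex_def)
      then show ?thesis using amp.vecs_scale [OF 1 [OF Z], of c j] by (simp add: sc)
    qed
  qed
  then show ?thesis by simp
qed

lemma amp_vecs_induct:
  assumes W: "W \<in> amp.vecs" and "subspace V" "closed V"
    and gen: "\<And>i y j. i \<in> I \<Longrightarrow> y \<in> Y i \<Longrightarrow> tmap (eps i o\<^sub>L y) (delta j) \<in> V"
  shows "W \<in> V"
  by (rule amp.vecs_induct [OF assms(1-3)]) (auto simp: gen simp flip: tmap_eps)

text \<open>The operator \<open>Q \<otimes> b\<close>, moved to the index set of the tensor
  product module.\<close>

definition op2 :: "('i, 'h) ell2 bop \<Rightarrow> 'j l2 bop \<Rightarrow> ('i \<times> 'j, 'h) ell2 bop" where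
  "op2 Q b = flat o\<^sub>L op_tensor Q b o\<^sub>L unflat"

lemma op2_tmap: "clin Q \<Longrightarrow> clin b \<Longrightarrow> op2 Q b o\<^sub>L tmap Z x = tmap (Q o\<^sub>L Z) (b x)"
  by (rule blinfun_eqI) (simp add: op2_def tmap_def op_tensor_apply)

lemma adjoint_pair_op2: "adjoint_pair Q Q' \<Longrightarrow> adjoint_pair b b' \<Longrightarrow> adjoint_pair (op2 Q b) (op2 Q' b')"
  using adjoint_pair_comp [OF adjoint_pair_flat adjoint_pair_comp [OF adjoint_pair_op_tensor adjoint_pair_sym [OF adjoint_pair_flat]]]
  unfolding op2_def blinfun_compose_assoc by blast

lemma vecs_if_on_generators:
  assumes gen: "\<And>i y j. i \<in> I \<Longrightarrow> y \<in> Y i \<Longrightarrow> U o\<^sub>L tmap (eps i o\<^sub>L y) (delta j) \<in> amp.vecs"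
    and W: "W \<in> amp.vecs"
  shows "U o\<^sub>L W \<in> amp.vecs"
proof -
  have "W \<in> {W. U o\<^sub>L W \<in> amp.vecs}"
  proof (rule amp_vecs_induct [OF W])
    show "subspace {W. U o\<^sub>L W \<in> amp.vecs}"
      using linear_subspace_vimage [OF bounded_linear.linear [OF comp.bounded_linear_right] amp.subspace_vecs]
      by (simp add: vimage_def)
    show "closed {W. U o\<^sub>L W \<in> amp.vecs}" by (rule closed_vimage_blinfun [OF amp.closed_vecs comp.bounded_linear_right])
  qed (use gen in auto)
  then show ?thesis by simp
qed

lemma eq_on_vecs_if_on_generators:
  assumes gen: "\<And>i y j. i \<in> I \<Longrightarrow> y \<in> Y i \<Longrightarrow> U o\<^sub>L tmap (eps i o\<^sub>L y) (delta j) = U' o\<^sub>L tmap (eps i o\<^sub>L y) (delta j)"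
    and W: "W \<in> amp.vecs"
  shows "U o\<^sub>L W = U' o\<^sub>L W"
proof -
  have "W \<in> {W. U o\<^sub>L W = U' o\<^sub>L W}"
  proof (rule amp_vecs_induct [OF W])
    show "subspace {W. U o\<^sub>L W = U' o\<^sub>L W}"
      by (auto simp: subspace_def comp.zero_right comp.add_right comp.scaleR_right)
    show "closed {W. U o\<^sub>L W = U' o\<^sub>L W}"
      by (intro closed_Collect_eq linear_continuous_on comp.bounded_linear_right)
  qed (use gen in auto)
  then show ?thesis by simp
qed

lemma op2_null:
  assumes QQ: "base.represented_pair Q Q'" and bb: "adjoint_pair b b'" and v: "v \<in> amp.null"
  shows "op2 Q b v = 0"
proof -
  note aQ = base.represented_pairD(1) [OF QQ]
  have c: "clin Q'" "clin b'" using adjoint_pair_clin2 [OF aQ] adjoint_pair_clin2 [OF bb] by auto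
  have orth: "cinner (flat (tensor_vec (Q' k) (b' x))) v = 0" for k x
  proof -
    define A where "A = flat o\<^sub>L tvec (b' x) o\<^sub>L Q'"
    have clA: "clin A" unfolding A_def using c(1) adjoint_pair_clin [OF adjoint_pair_flat] by blast
    have "hadj A v = 0"
    proof (rule orthogonal_to_dense [OF base.vecs_null_total])
      fix k assume "k \<in> {blinfun_apply Z h | Z h. Z \<in> base.vecs} \<union> base.null"
      then have "cinner (A k) v = 0"
      proof
        assume "k \<in> {blinfun_apply Z h | Z h. Z \<in> base.vecs}"
        then obtain Z h where k: "k = blinfun_apply Z h" and Z: "Z \<in> base.vecs" by blast
        have "A k = tmap (Q' o\<^sub>L Z) (b' x) h" by (simp add: A_def k tmap_def)
        then show ?thesis
          using v tmap_in_vecs [OF base.represented_pairD(3) [OF QQ Z]] by (simp add: amp.null_def)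
      next
        assume "k \<in> base.null"
        then show ?thesis using base.represented_pairD(5) [OF QQ] by (simp add: A_def blf_simps cinner_simps)
      qed
      then show "cinner k (hadj A v) = 0" by (simp add: adjoint_pairD [OF adjoint_pair_hadj [OF clA]])
    qed
    then have "cinner (A k) v = 0" by (simp add: adjoint_pairD [OF adjoint_pair_hadj [OF clA]] cinner_simps)
    then show ?thesis by (simp add: A_def)
  qed
  have ap: "adjoint_pair (op_tensor Q' b') (op_tensor Q b)"
    by (rule adjoint_pair_op_tensor [OF adjoint_pair_sym [OF aQ] adjoint_pair_sym [OF bb]])
  have "op_tensor Q b (unflat v) = 0"
  proof (rule orthogonal_to_dense [OF tensor_vecs_dense])
    fix z :: "('j, ('i, 'h) ell2) ell2" assume "z \<in> tensor_vecs"
    then obtain k x where z: "z = tensor_vec k x" by blast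
    show "cinner z (op_tensor Q b (unflat v)) = 0"
      using orth [of k x] by (simp add: z op_tensor_apply [OF c] adjoint_pairD [OF adjoint_pair_flat]
          flip: adjoint_pairD [OF ap])
  qed
  then show ?thesis by (simp add: op2_def blf_simps)
qed

lemma represented_pair_op2:
  assumes QQ: "base.represented_pair Q Q'" and bb: "adjoint_pair b b'"
  shows "amp.represented_pair (op2 Q b) (op2 Q' b')"
proof -
  note aQ = base.represented_pairD(1) [OF QQ]
  note cl = adjoint_pair_clin [OF aQ] adjoint_pair_clin2 [OF aQ] adjoint_pair_clin [OF bb] adjoint_pair_clin2 [OF bb]
  have st: "op2 R d o\<^sub>L W \<in> amp.vecs"
    if "clin R" "clin d" "\<And>Z. Z \<in> base.vecs \<Longrightarrow> R o\<^sub>L Z \<in> base.vecs" "W \<in> amp.vecs" for R d W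
    by (rule vecs_if_on_generators [OF _ that(4)]) (simp add: op2_tmap that tmap_in_vecs base.eps_in_vecs)
  show ?thesis unfolding amp.represented_pair_def
    using adjoint_pair_op2 [OF aQ bb] op2_null [OF QQ bb]
      op2_null [OF base.represented_pair_sym [OF QQ] adjoint_pair_sym [OF bb]]
      st [OF cl(1,3) base.represented_pairD(2) [OF QQ]] st [OF cl(2,4) base.represented_pairD(3) [OF QQ]]
    by blast
qed

text \<open>The exterior tensor product of adjointable maps, and the operator that represents it.\<close>

lemma mod_op_tensor:
  assumes T: "T \<in> carrier ops" and b: "clin b"
  shows mod_op_tensor_carrier: "mod_op_tensor I Y T b \<in> carrier ops2"
    and rep_mod_op_tensor: "amp.rep (mod_op_tensor I Y T b) = op2 (base.rep T) b"
proof -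
  have cT: "clin (base.rep T)" and QQ: "base.represented_pair (base.rep T) (adj (base.rep T))"
    using base.rep_in_represented [OF T] by (auto simp: base.represented_iff_adj)
  have rp: "amp.represented_pair (op2 (base.rep T) b) (op2 (adj (base.rep T)) (adj b))"
    by (rule represented_pair_op2 [OF QQ adjoint_pair_adj [OF b]])
  then have r: "op2 (base.rep T) b \<in> amp.represented" by (auto simp: amp.represented_def)
  obtain T' where TT: "is_mod_adjoint I Y T T'" using T by (auto simp: base.adjointable_iff)
  then have Tf: "T \<in> dsum I Y \<rightarrow>\<^sub>E dsum I Y" unfolding is_mod_adjoint_def by blast
  have Tfam: "T (base.fam Z) = base.fam (base.rep T o\<^sub>L Z)" if "Z \<in> base.vecs" for Z
    using that by (simp add: base.rep_comp [OF T] base.fam_hat [OF Tf])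
  have "mod_op_tensor I Y T b = amp.sigma (op2 (base.rep T) b)"
    unfolding mod_op_tensor_def
  proof (rule the_equality)
    have "amp.sigma (op2 (base.rep T) b) (mod_tensor_vec \<xi> x) = mod_tensor_vec (T \<xi>) (b x)"
      if \<xi>: "\<xi> \<in> dsum I Y" for \<xi> x
    proof -
      obtain Z where Z: "Z \<in> base.vecs" "\<xi> = base.fam Z" using base.dsum_eq_fam [OF \<xi>] by metis
      show ?thesis
        by (simp add: Z Tfam amp.sigma_fam tmap_in_vecs op2_tmap [OF cT b] flip: fam_tmap)
    qed
    then show "amp.sigma (op2 (base.rep T) b) \<in> carrier ops2 \<and>
        (\<forall>\<xi>\<in>dsum I Y. \<forall>x. amp.sigma (op2 (base.rep T) b) (mod_tensor_vec \<xi> x) = mod_tensor_vec (T \<xi>) (b x))"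
      using amp.represented_carrier [OF r] by blast
    fix S assume "S \<in> carrier ops2 \<and> (\<forall>\<xi>\<in>dsum I Y. \<forall>x. S (mod_tensor_vec \<xi> x) = mod_tensor_vec (T \<xi>) (b x))"
    then have S: "S \<in> carrier ops2" and Seq: "\<And>\<xi> x. \<xi> \<in> dsum I Y \<Longrightarrow> S (mod_tensor_vec \<xi> x) = mod_tensor_vec (T \<xi>) (b x)"
      by auto
    obtain S' where SS: "is_mod_adjoint (I \<times> UNIV) (Y \<circ> fst) S S'" using S by (auto simp: amp.adjointable_iff)
    then have Sf: "S \<in> dsum (I \<times> UNIV) (Y \<circ> fst) \<rightarrow>\<^sub>E dsum (I \<times> UNIV) (Y \<circ> fst)"
      unfolding is_mod_adjoint_def by blast
    have on: "amp.rep S o\<^sub>L tmap Z x = op2 (base.rep T) b o\<^sub>L tmap Z x" if Z: "Z \<in> base.vecs" for Z x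
    proof -
      have "amp.fam (amp.rep S o\<^sub>L tmap Z x) = S (amp.fam (tmap Z x))"
        by (simp add: amp.rep_comp [OF S] tmap_in_vecs Z amp.fam_hat [OF Sf])
      also have "\<dots> = amp.fam (op2 (base.rep T) b o\<^sub>L tmap Z x)"
        by (simp add: fam_tmap Seq base.fam_in_dsum Z Tfam op2_tmap [OF cT b])
      finally show ?thesis by (simp add: amp.fam_inject)
    qed
    have "amp.rep S = op2 (base.rep T) b"
    proof (rule amp.operator_eqI)
      show "amp.rep S o\<^sub>L W = op2 (base.rep T) b o\<^sub>L W" if "W \<in> amp.vecs" for W
        by (rule eq_on_vecs_if_on_generators [OF _ that]) (simp add: on base.eps_in_vecs)
      show "amp.rep S v = op2 (base.rep T) b v" if "v \<in> amp.null" for v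
        using amp.rep_null [OF S that] amp.represented_pairD(4) [OF rp that] by simp
    qed
    then show "S = amp.sigma (op2 (base.rep T) b)" using amp.sigma_rep [OF S] by simp
  qed
  then show "mod_op_tensor I Y T b \<in> carrier ops2" "amp.rep (mod_op_tensor I Y T b) = op2 (base.rep T) b"
    using amp.represented_carrier [OF r] amp.rep_sigma [OF r] by simp_all
qed

end

text \<open>Conjugation of the amplification \<open>T \<otimes> 1\<close> by the unitary \<open>\<xi> \<otimes> x \<mapsto> \<xi> \<otimes> u\<^sub>i x\<close>, for \<open>\<xi>\<close> in the \<open>i\<close>-th
  summand.\<close>

locale module_twist = module_tensor I Y J
  for I :: "'i set" and Y :: "'i \<Rightarrow> 'h::complex_hilbert bop set" and J :: "'j itself" +
  fixes u u' :: "'i \<Rightarrow> 'j l2 bop"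
  assumes u_adjoint: "adjoint_pair (u i) (u' i)"
    and u_left: "u' i o\<^sub>L u i = id_blinfun" and u_right: "u i o\<^sub>L u' i = id_blinfun"
begin

definition block :: "('i \<Rightarrow> 'j l2 bop) \<Rightarrow> ('i \<times> 'j, 'h) ell2 bop" where
  "block w = blockdiag (\<lambda>i. op_tensor id_blinfun (w i))"

lemma block:
  assumes ad: "\<And>i. adjoint_pair (w i) (w' i)" and inv: "\<And>i. w' i o\<^sub>L w i = id_blinfun"
  shows adjoint_pair_block: "adjoint_pair (block w) (block w')"
    and block_inverse: "block w' o\<^sub>L block w = id_blinfun"
    and block_generator: "block w o\<^sub>L tmap (eps i o\<^sub>L y) x = tmap (eps i o\<^sub>L y) (w i x)"
    and row_block: "row i (block w z) = op_tensor id_blinfun (w i) (row i z)"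
proof -
  have c: "clin (w i)" "clin (w' i)" for i using adjoint_pair_clin [OF ad] adjoint_pair_clin2 [OF ad] by auto
  have nw: "norm (w i) \<le> 1" "norm (w' i) \<le> 1" for i
    using unitary_norm_le [OF ad inv] norm_adjoint_pair [OF ad, of i] by auto
  have ot: "adjoint_pair (op_tensor id_blinfun (w i)) (op_tensor id_blinfun (w' i))" for i
    by (rule adjoint_pair_op_tensor [OF adjoint_pair_id ad])
  have ni: "norm (id_blinfun :: 'h bop) \<le> 1" by (rule norm_blinfun_bound) auto
  have no: "norm (op_tensor (id_blinfun :: 'h bop) (w i)) \<le> 1" "norm (op_tensor (id_blinfun :: 'h bop) (w' i)) \<le> 1" for i
    using order_trans [OF norm_op_tensor_le [OF clin_id c(1)] mult_le_one [OF ni norm_ge_zero nw(1)]]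
      order_trans [OF norm_op_tensor_le [OF clin_id c(2)] mult_le_one [OF ni norm_ge_zero nw(2)]] by auto
  show ab: "adjoint_pair (block w) (block w')"
    unfolding block_def by (rule adjoint_pair_blockdiag [OF ot no(1)])
  have co: "clin (op_tensor (id_blinfun :: 'h bop) (w i))" "clin (op_tensor (id_blinfun :: 'h bop) (w' i))" for i
    by (simp_all add: clin_op_tensor c)
  have rw: "row i (block w z) = op_tensor id_blinfun (w i) (row i z)"
    "row i (block w' z) = op_tensor id_blinfun (w' i) (row i z)" for i z
    unfolding block_def by (rule row_blockdiag [OF co(1) no(1)], rule row_blockdiag [OF co(2) no(2)])
  show "row i (block w z) = op_tensor id_blinfun (w i) (row i z)" by (rule rw)
  have "op_tensor (id_blinfun :: 'h bop) (w' i) o\<^sub>L op_tensor id_blinfun (w i) = id_blinfun" for i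
  proof -
    have "(id_blinfun :: 'h bop) o\<^sub>L id_blinfun = id_blinfun" by (rule blinfun_eqI) simp
    then show ?thesis by (simp add: op_tensor_mult c inv op_tensor_id)
  qed
  then have "op_tensor (id_blinfun :: 'h bop) (w' i) (op_tensor id_blinfun (w i) z) = z" for i z
    by (metis blinfun_apply_blinfun_compose blinfun_apply_id_blinfun)
  then show "block w' o\<^sub>L block w = id_blinfun"
    by (intro blinfun_eqI, intro pair_ell2_eqI) (simp add: rw)
  show "block w o\<^sub>L tmap (eps i o\<^sub>L y) x = tmap (eps i o\<^sub>L y) (w i x)"
  proof (rule blinfun_eqI, rule pair_ell2_eqI)
    fix h p
    have r: "row p (tmap (eps i o\<^sub>L y) x' h) = (if p = i then tensor_vec (y h) x' else 0)" for x'
      by (rule ell2_eqI) (auto simp: coord_tmap coord_zero)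
    show "row p ((block w o\<^sub>L tmap (eps i o\<^sub>L y) x) h) = row p (tmap (eps i o\<^sub>L y) (w i x) h)"
      by (simp add: rw r op_tensor_apply c blf_simps)
  qed
qed

lemma block_vecs:
  assumes ad: "\<And>i. adjoint_pair (w i) (w' i)" and inv: "\<And>i. w' i o\<^sub>L w i = id_blinfun"
    and W: "W \<in> amp.vecs"
  shows "block w o\<^sub>L W \<in> amp.vecs"
  by (rule vecs_if_on_generators [OF _ W])
    (simp add: block_generator [OF ad inv] tmap_in_vecs base.eps_in_vecs)

lemma block_null:
  assumes ad: "\<And>i. adjoint_pair (w i) (w' i)" and inv: "\<And>i. w' i o\<^sub>L w i = id_blinfun" "\<And>i. w i o\<^sub>L w' i = id_blinfun"
    and v: "v \<in> amp.null"
  shows "block w v \<in> amp.null"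
  unfolding amp.null_def
proof (intro CollectI ballI allI)
  fix Z h assume "Z \<in> amp.vecs"
  then have "block w' o\<^sub>L Z \<in> amp.vecs"
    by (rule block_vecs [where w = w' and w' = w, OF adjoint_pair_sym [OF ad] inv(2)])
  then have "cinner ((block w' o\<^sub>L Z) h) v = 0" using v unfolding amp.null_def by blast
  then show "cinner (Z h) (block w v) = 0"
    by (simp add: adjoint_pairD [OF adjoint_pair_sym [OF adjoint_pair_block [OF ad inv(1)]]])
qed

definition twist_op :: "('i, 'h) ell2 bop \<Rightarrow> ('i \<times> 'j, 'h) ell2 bop" where
  "twist_op Q = block u o\<^sub>L op2 Q id_blinfun o\<^sub>L block u'"

text \<open>Conjugation by the diagonal unitary of \<open>T \<otimes> 1\<close>.\<close>

definition twist :: "('i, 'h) mod_op \<Rightarrow> ('i \<times> 'j, 'h) mod_op" where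
  "twist T = amp.sigma (twist_op (base.rep T))"

lemma blocks:
  "adjoint_pair (block u) (block u')" "block u' o\<^sub>L block u = id_blinfun" "block u o\<^sub>L block u' = id_blinfun"
  by (rule adjoint_pair_block [OF u_adjoint u_left] block_inverse [OF u_adjoint u_left]
      block_inverse [OF adjoint_pair_sym [OF u_adjoint] u_right])+

lemma block_cancel: "block u' (block u z) = z"
  using arg_cong [OF blocks(2), of "\<lambda>T. blinfun_apply T z"] by simp

lemma represented_pair_twist:
  assumes QQ: "base.represented_pair Q Q'"
  shows "amp.represented_pair (twist_op Q) (twist_op Q')"
proof -
  have oo: "amp.represented_pair (op2 Q id_blinfun) (op2 Q' id_blinfun)"
    by (rule represented_pair_op2 [OF QQ adjoint_pair_id])
  have ap: "adjoint_pair (twist_op Q) (twist_op Q')"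
    using adjoint_pair_comp [OF blocks(1) adjoint_pair_comp [OF amp.represented_pairD(1) [OF oo] adjoint_pair_sym [OF blocks(1)]]]
    by (simp add: twist_op_def blinfun_compose_assoc)
  have u'v: "block u' o\<^sub>L Z \<in> amp.vecs" if "Z \<in> amp.vecs" for Z
    by (rule block_vecs [OF adjoint_pair_sym [OF u_adjoint] u_right that])
  have uv: "block u o\<^sub>L Z \<in> amp.vecs" if "Z \<in> amp.vecs" for Z
    by (rule block_vecs [OF u_adjoint u_left that])
  have n: "block u' v \<in> amp.null" if "v \<in> amp.null" for v
    by (rule block_null [OF adjoint_pair_sym [OF u_adjoint] u_right u_left that])
  show ?thesis
    unfolding amp.represented_pair_def
  proof (intro conjI ap ballI)
    fix Z assume Z: "Z \<in> amp.vecs"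
    show "twist_op Q o\<^sub>L Z \<in> amp.vecs" "twist_op Q' o\<^sub>L Z \<in> amp.vecs"
      unfolding twist_op_def blinfun_compose_assoc
      by (intro uv amp.represented_pairD(2) [OF oo] u'v Z, intro uv amp.represented_pairD(3) [OF oo] u'v Z)
  next
    fix v assume v: "v \<in> amp.null"
    show "twist_op Q v = 0" "twist_op Q' v = 0"
      using amp.represented_pairD(4,5) [OF oo n [OF v]] by (simp_all add: twist_op_def blf_simps)
  qed
qed

lemma twist:
  assumes T: "T \<in> carrier ops"
  shows twist_carrier: "twist T \<in> carrier ops2" and rep_twist: "amp.rep (twist T) = twist_op (base.rep T)"
proof -
  have "base.represented_pair (base.rep T) (adj (base.rep T))"
    using base.rep_in_represented [OF T] by (simp add: base.represented_iff_adj)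
  then have r: "twist_op (base.rep T) \<in> amp.represented"
    using represented_pair_twist by (auto simp: amp.represented_def)
  show "twist T \<in> carrier ops2" "amp.rep (twist T) = twist_op (base.rep T)"
    unfolding twist_def using amp.represented_carrier [OF r] amp.rep_sigma [OF r] by auto
qed

lemma twist_op_star_rep: "star_rep {T. clin T} twist_op"
proof -
  interpret concrete_cstar "{T :: ('i, 'h) ell2 bop. clin T}" by (rule concrete_cstar_clin)
  have cb: "clin (block u)" "clin (block u')" using adjoint_pair_clin [OF blocks(1)] adjoint_pair_clin2 [OF blocks(1)] by auto
  have cf: "clin (flat :: ('j, ('i, 'h) ell2) ell2 \<Rightarrow>\<^sub>L _)" "clin (unflat :: _ \<Rightarrow>\<^sub>L ('j, ('i, 'h) ell2) ell2)"
    using adjoint_pair_clin [OF adjoint_pair_flat] adjoint_pair_clin2 [OF adjoint_pair_flat] by auto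
  have ii: "(id_blinfun :: 'j l2 bop) o\<^sub>L id_blinfun = id_blinfun" by (rule blinfun_eqI) simp
  have tw: "twist_op a z = block u (flat (op_tensor a id_blinfun (unflat (block u' z))))" for a z
    by (simp add: twist_op_def op2_def)
  show ?thesis
  proof
    fix a b :: "('i, 'h) ell2 bop" and c assume "a \<in> {T. clin T}"
    then have a: "clin a" by simp
    show "clin (twist_op a)"
      unfolding twist_op_def op2_def by (intro clin_comp cb cf clin_op_tensor a clin_id)
    have "op_tensor (scale_op c a) (id_blinfun :: 'j l2 bop) = scale_op c (op_tensor a id_blinfun)"
      by (simp add: op_tensor_scale_left a)
    then show "twist_op (scale_op c a) = scale_op c (twist_op a)"
      by (intro blinfun_eqI) (use cb cf in \<open>simp add: tw scale_op_apply clin_def\<close>)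
    have "adjoint_pair (twist_op a) (twist_op (adj a))"
      using adjoint_pair_comp [OF blocks(1) adjoint_pair_comp [OF adjoint_pair_op2 [OF adjoint_pair_adj [OF a] adjoint_pair_id] adjoint_pair_sym [OF blocks(1)]]]
      by (simp add: twist_op_def blinfun_compose_assoc)
    then show "twist_op (adj a) = adj (twist_op a)" by (rule adj_eqI [symmetric])
    assume "b \<in> {T. clin T}"
    then have b: "clin b" by simp
    show "twist_op (a + b) = twist_op a + twist_op b"
      by (rule blinfun_eqI) (simp add: tw op_tensor_add_left a b blf_simps)
    show "twist_op (a o\<^sub>L b) = twist_op a o\<^sub>L twist_op b"
    proof (rule blinfun_eqI)
      fix z
      have "op_tensor (a o\<^sub>L b) (id_blinfun :: 'j l2 bop) = op_tensor a id_blinfun o\<^sub>L op_tensor b id_blinfun"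
        by (simp add: op_tensor_mult a b ii)
      then show "twist_op (a o\<^sub>L b) z = (twist_op a o\<^sub>L twist_op b) z" by (simp add: tw block_cancel)
    qed
  qed
qed

text \<open>The twist is a *-homomorphism, hence completely contractive, and is undone by undoing
  the conjugation and compressing to one coordinate of the tensor factor.\<close>

lemma mat_norm_twist:
  assumes M: "\<And>i j. i < n \<Longrightarrow> j < n \<Longrightarrow> M i j \<in> carrier ops"
  shows "mat_norm ops2 n (\<lambda>i j. twist (M i j)) = mat_norm ops n M"
proof -
  interpret star_rep "{T :: ('i, 'h) ell2 bop. clin T}" twist_op by (rule twist_op_star_rep)
  have cl: "clin (base.rep (M i j))" if "i < n" "j < n" for i j
    using base.rep_in_represented [OF M [OF that]] by (simp add: base.represented_iff_adj)
  let ?N = "matop {..<n} (\<lambda>i j. base.rep (M i j))"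
  let ?N2 = "matop {..<n} (\<lambda>i j. twist_op (base.rep (M i j)))"
  have "norm ?N2 \<le> norm ?N" by (rule rep_completely_contractive) (auto simp: cl)
  moreover have "norm ?N \<le> norm ?N2"
  proof -
    define A where "A = prj (undefined :: 'j) o\<^sub>L unflat o\<^sub>L block u'"
    define B where "B = block u o\<^sub>L flat o\<^sub>L eps (undefined :: 'j)"
    have clb: "clin (block u)" "clin (block u')" using adjoint_pair_clin [OF blocks(1)] adjoint_pair_clin2 [OF blocks(1)] by auto
    have cA: "clin A" "clin B" unfolding A_def B_def
      using clb adjoint_pair_clin [OF adjoint_pair_flat] adjoint_pair_clin2 [OF adjoint_pair_flat] by blast+
    have nb: "norm (block u) \<le> 1" "norm (block u') \<le> 1"
      using unitary_norm_le [OF blocks(1,2)] norm_adjoint_pair [OF blocks(1)] by auto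
    have nA: "norm A \<le> 1" "norm B \<le> 1" unfolding A_def B_def
      by (rule order_trans [OF norm_blinfun_compose mult_le_one [OF order_trans [OF norm_blinfun_compose mult_le_one]]],
          auto simp: norm_prj_le norm_eps_le norm_flat_le norm_unflat_le nb)+
    have "A o\<^sub>L twist_op (base.rep (M i j)) o\<^sub>L B = base.rep (M i j)" if "i < n" "j < n" for i j
    proof (rule blinfun_eqI)
      fix z :: "('i, 'h) ell2"
      have "eps undefined z = tensor_vec z (delta (undefined :: 'j))" by simp
      then show "(A o\<^sub>L twist_op (base.rep (M i j)) o\<^sub>L B) z = base.rep (M i j) z"
        using op_tensor_apply [OF cl [OF that] clin_id, of z "delta (undefined :: 'j)"]
        by (simp add: A_def B_def twist_op_def op2_def block_cancel)
    qed
    then have "?N = matop {..<n} (\<lambda>i j. A o\<^sub>L twist_op (base.rep (M i j)) o\<^sub>L B)"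
      by (intro matop_cong) auto
    also have "norm \<dots> \<le> norm ?N2" by (intro matop_sandwich_le cA nA) simp
    finally show ?thesis .
  qed
  ultimately have "norm ?N2 = norm ?N" by simp
  moreover have "mat_norm ops n M = norm ?N" by (rule base.mat_norm_adjointable [OF M])
  moreover have "mat_norm ops2 n (\<lambda>i j. twist (M i j)) = norm (matop {..<n} (\<lambda>i j. amp.rep (twist (M i j))))"
    by (rule amp.mat_norm_adjointable) (simp add: twist_carrier M)
  moreover have "matop {..<n} (\<lambda>i j. amp.rep (twist (M i j))) = ?N2"
    by (rule matop_cong) (simp add: rep_twist M)
  ultimately show ?thesis by simp
qed

end

section \<open>Creation operators on the Fock module\<close>

context represented_algebra
begin

lemma closed_image_closed_span:
  assumes F: "F \<subseteq> carrier R"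
  shows "closed (\<rho> ` closed_span R F)" and "subspace (\<rho> ` closed_span R F)"
proof -
  interpret concrete_cstar "\<rho> ` carrier R" by (rule rep_cstar)
  note sp = linear_subspace_closed_span [OF F]
  show "subspace (\<rho> ` closed_span R F)" by (rule subspace_image [OF sp])
  note sub = linear_subspaceD(1) [OF sp]
  have "closure (\<rho> ` closed_span R F) \<subseteq> \<rho> ` carrier R"
    using sub by (intro closure_minimal closed_B image_mono)
  then have "closure (\<rho> ` closed_span R F) \<subseteq> \<rho> ` norm_closure R (closed_span R F)"
    unfolding norm_closure_eq [OF sub] by blast
  then show "closed (\<rho> ` closed_span R F)"
    unfolding norm_closure_closed_span [OF F] by (metis closure_subset closure_closed subset_antisym closed_closure)
qed

text \<open>Linear continuous maps are determined by a generating set.  This one induction serves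
  both to prove that maps agree (with \<open>V = {0}\<close>) and that they take values in a
  closed subspace.\<close>

lemma closed_span_maps_into:
  fixes f :: "'a \<Rightarrow> 'v::real_normed_vector"
  assumes F: "F \<subseteq> carrier R" and V: "subspace V" "closed V" and a: "a \<in> closed_span R F"
    and base: "\<And>a. a \<in> F \<Longrightarrow> f a \<in> V"
    and add: "\<And>a b. a \<in> closed_span R F \<Longrightarrow> b \<in> closed_span R F \<Longrightarrow> f (a \<oplus> b) = f a + f b"
    and smult: "\<And>a c. a \<in> closed_span R F \<Longrightarrow> f a \<in> V \<Longrightarrow> f (c \<odot>\<^bsub>R\<^esub> a) \<in> V"
    and bound: "\<And>a. a \<in> closed_span R F \<Longrightarrow> norm (f a) \<le> K * norm (\<rho> a)"
  shows "f a \<in> V"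
  using F a
proof (induction rule: closed_span_induct)
  note sp = linear_subspaceD [OF linear_subspace_closed_span [OF F]]
  case zero
  have "norm (f \<zero>) \<le> 0" using bound [OF sp(2)] by (simp add: rep_zero)
  then show ?case using subspace_0 [OF V(1)] by simp
next
  case (add a b)
  then have "f (a \<oplus> b) = f a + f b" using lin_span_subset_closed_span [OF F] by (intro assms(6)) auto
  then show ?case using add(3,4) by (simp add: subspace_add [OF V(1)])
next
  case (smult a c)
  then show ?case using lin_span_subset_closed_span [OF F] by (intro assms(7)) auto
next
  note sp = linear_subspaceD [OF linear_subspace_closed_span [OF F]]
  case (closed a)
  have "\<exists>v\<in>V. dist v (f a) < e" if e: "0 < e" for e
  proof -
    have K: "0 < \<bar>K\<bar> + 1" by simp
    obtain b where b: "b \<in> lin_span F" "f b \<in> V" "norm (\<rho> a - \<rho> b) < e / (\<bar>K\<bar> + 1)"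
      using closed(2) [OF divide_pos_pos [OF e K]] by blast
    have bs: "b \<in> closed_span R F" using b(1) lin_span_subset_closed_span [OF F] by blast
    let ?d = "a \<oplus> ((- 1) \<odot>\<^bsub>R\<^esub> b)"
    have ds: "?d \<in> closed_span R F" by (rule sp(3) [OF closed(1) sp(4) [OF bs]])
    have c: "a \<in> carrier R" "b \<in> carrier R" "?d \<in> carrier R" using sp(1) closed(1) bs ds by auto
    have rd: "\<rho> ?d = \<rho> a - \<rho> b"
      using c by (simp add: rep_add smult_closed rep_smult scale_op_minus_one)
    have "\<rho> (?d \<oplus> b) = \<rho> a" using c by (simp add: rep_add rd)
    then have "?d \<oplus> b = a" using rep_inj c by (simp add: inj_on_eq_iff add_closed)
    then have "f a = f ?d + f b" using assms(6) [OF ds bs] by simp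
    then have "dist (f b) (f a) \<le> K * norm (\<rho> a - \<rho> b)"
      using bound [OF ds] by (simp add: dist_norm rd norm_minus_commute)
    also have "\<dots> \<le> (\<bar>K\<bar> + 1) * norm (\<rho> a - \<rho> b)" by (intro mult_right_mono) auto
    also have "\<dots> < e" using b(3) K by (simp add: pos_less_divide_eq mult.commute)
    finally show ?thesis using b(2) by blast
  qed
  then have "f a \<in> closure V" unfolding closure_approachable by blast
  then show ?case using V(2) by simp
qed (use base in auto)

end

locale subsemigroup = group G for G :: "('g, 'z) monoid_scheme" (structure) +
  fixes P :: "'g set"
  assumes submonoid_P: "submonoid P G"
begin

lemma in_carrier: "p \<in> P \<Longrightarrow> p \<in> carrier G"
  by (rule submonoid.mem_carrier [OF submonoid_P])

lemma one_P: "\<one> \<in> P"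
  by (rule submonoid.one_closed [OF submonoid_P])

lemma mult_P: "p \<in> P \<Longrightarrow> q \<in> P \<Longrightarrow> p \<otimes> q \<in> P"
  by (rule submonoid.m_closed [OF submonoid_P])

lemma inv_mult_cancel: "p \<in> P \<Longrightarrow> r \<in> P \<Longrightarrow> inv p \<otimes> (p \<otimes> r) = r"
  by (simp add: in_carrier flip: m_assoc)

abbreviation translates :: "'g \<Rightarrow> 'g set" where "translates p \<equiv> (\<lambda>r. p \<otimes> r) ` P"

lemma translates_iff: "p \<in> P \<Longrightarrow> s \<in> carrier G \<Longrightarrow> s \<in> translates p \<longleftrightarrow> inv p \<otimes> s \<in> P"
  by (auto simp: inv_mult_cancel image_iff) (metis in_carrier inv_closed m_assoc r_inv l_one)

lemma translates_one: "translates \<one> = P"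
  by (force simp: in_carrier image_iff)

lemma inj_translate: "p \<in> P \<Longrightarrow> inj_on (\<lambda>s. inv p \<otimes> s) (translates p)"
  by (auto simp: inj_on_def inv_mult_cancel)

text \<open>The creation operator without regard to the module: it is defined for operators on any
  Hilbert space, so that it also describes \<open>c p \<xi> \<otimes> V p\<close> on \<open>K
  \<otimes> l\<^sup>2(P)\<close>.\<close>

definition cre :: "'g \<Rightarrow> 'k::complex_hilbert bop \<Rightarrow> ('g, 'k) ell2 bop" where
  "cre p \<xi> = diagop (\<lambda>_. \<xi>) o\<^sub>L pull (translates p) (\<lambda>s. inv p \<otimes> s)"

text \<open>With \<open>adj \<xi>\<close> in place of \<open>\<xi>\<close> this is the adjoint of
  the creation operator.\<close>

definition ann :: "'g \<Rightarrow> 'k::complex_hilbert bop \<Rightarrow> ('g, 'k) ell2 bop" where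
  "ann p \<xi> = diagop (\<lambda>_. \<xi>) o\<^sub>L pull P (\<lambda>r. p \<otimes> r)"

lemma coord_cre: "p \<in> P \<Longrightarrow> clin \<xi> \<Longrightarrow>
    coord (cre p \<xi> x) s = (if s \<in> translates p then \<xi> (coord x (inv p \<otimes> s)) else 0)"
  by (simp add: cre_def coord_diagop [where C = "norm \<xi>"] coord_pull inj_translate blf_simps)

lemma coord_ann: "p \<in> P \<Longrightarrow> clin \<xi> \<Longrightarrow> coord (ann p \<xi> x) r = (if r \<in> P then \<xi> (coord x (p \<otimes> r)) else 0)"
  by (subst ann_def) (simp add: coord_diagop [where C = "norm \<xi>"] coord_pull inj_on_def in_carrier blf_simps)

lemma clin_cre: "p \<in> P \<Longrightarrow> clin \<xi> \<Longrightarrow> clin (cre p \<xi>)"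
  unfolding cre_def by (intro clin_comp clin_diagop [where C = "norm \<xi>"] clin_pull inj_translate) auto

lemma adjoint_pair_cre:
  assumes p: "p \<in> P" and \<xi>: "clin \<xi>"
  shows "adjoint_pair (cre p \<xi>) (ann p (adj \<xi>))"
proof (rule adjoint_pair_on_eps)
  fix i j k l
  have e: "j \<in> translates p \<and> inv p \<otimes> j = i \<longleftrightarrow> i \<in> P \<and> p \<otimes> i = j"
    using p by (auto simp: inv_mult_cancel)
  have "coord (cre p \<xi> (eps i k)) j = (if j \<in> translates p \<and> inv p \<otimes> j = i then \<xi> k else 0)"
    using p \<xi> by (simp add: coord_cre blf_simps)
  moreover have "coord (ann p (adj \<xi>) (eps j l)) i = (if i \<in> P \<and> p \<otimes> i = j then adj \<xi> l else 0)"
    using p \<xi> by (simp add: coord_ann clin_adj blf_simps)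
  ultimately show "cinner (coord (cre p \<xi> (eps i k)) j) l = cinner k (coord (ann p (adj \<xi>) (eps j l)) i)"
    using adjoint_pairD [OF adjoint_pair_adj [OF \<xi>]] by (simp add: e cinner_simps)
qed

lemma cre_mult:
  assumes p: "p \<in> P" "q \<in> P" and c: "clin \<xi>" "clin \<eta>"
  shows "cre p \<xi> o\<^sub>L cre q \<eta> = cre (p \<otimes> q) (\<xi> o\<^sub>L \<eta>)"
proof (rule blinfun_eqI, rule ell2_eqI)
  fix x s
  have "s \<in> translates (p \<otimes> q) \<longleftrightarrow> s \<in> translates p \<and> inv p \<otimes> s \<in> translates q"
    using p by (auto simp: inv_mult_cancel m_assoc in_carrier mult_P image_iff)
  moreover have "inv q \<otimes> (inv p \<otimes> s) = inv (p \<otimes> q) \<otimes> s" if "s \<in> translates p"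
    using that p by (auto simp: inv_mult_group m_assoc in_carrier)
  ultimately show "coord ((cre p \<xi> o\<^sub>L cre q \<eta>) x) s = coord (cre (p \<otimes> q) (\<xi> o\<^sub>L \<eta>) x) s"
    using p c by (simp add: coord_cre clin_comp mult_P blf_simps)
qed

lemma ann_cre:
  assumes p: "p \<in> P" and c: "clin \<xi>" "clin \<eta>"
  shows "ann p \<xi> o\<^sub>L cre p \<eta> = cre \<one> (\<xi> o\<^sub>L \<eta>)"
  by (rule blinfun_eqI, rule ell2_eqI)
    (use p c in \<open>auto simp: coord_cre coord_ann clin_comp translates_one inv_mult_cancel one_P in_carrier\<close>)

lemma ann_one: "clin \<xi> \<Longrightarrow> ann \<one> \<xi> = cre \<one> \<xi>"
  by (rule blinfun_eqI, rule ell2_eqI)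
    (auto simp: coord_cre coord_ann translates_one one_P in_carrier)

lemma cre_eps:
  assumes p: "p \<in> P" "r \<in> P" and c: "clin \<xi>"
  shows "cre p \<xi> o\<^sub>L (eps r o\<^sub>L y) = eps (p \<otimes> r) o\<^sub>L (\<xi> o\<^sub>L y)"
proof (rule blinfun_eqI, rule ell2_eqI)
  fix h s
  have "s \<in> translates p \<and> inv p \<otimes> s = r \<longleftrightarrow> s = p \<otimes> r" using p by (auto simp: inv_mult_cancel)
  then show "coord ((cre p \<xi> o\<^sub>L (eps r o\<^sub>L y)) h) s = coord ((eps (p \<otimes> r) o\<^sub>L (\<xi> o\<^sub>L y)) h) s"
    using p c by (auto simp: coord_cre blf_simps)
qed

lemma ann_eps:
  assumes p: "p \<in> P" and c: "clin \<xi>"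
  shows "ann p \<xi> o\<^sub>L (eps s o\<^sub>L y) = (if s \<in> translates p then eps (inv p \<otimes> s) o\<^sub>L (\<xi> o\<^sub>L y) else 0)"
proof (rule blinfun_eqI, rule ell2_eqI)
  fix h r
  have "s \<in> translates p \<and> inv p \<otimes> s = r \<longleftrightarrow> r \<in> P \<and> s = p \<otimes> r" using p by (auto simp: inv_mult_cancel)
  then show "coord ((ann p \<xi> o\<^sub>L (eps s o\<^sub>L y)) h) r
      = coord ((if s \<in> translates p then eps (inv p \<otimes> s) o\<^sub>L (\<xi> o\<^sub>L y) else 0) h) r"
    using p c by (auto simp: coord_ann blf_simps coord_zero)
qed

abbreviation vp :: "'g \<Rightarrow> 'g l2 bop" where "vp p \<equiv> cre p id_blinfun"

lemma op_tensor_vp: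
  assumes p: "p \<in> P" and \<xi>: "clin \<xi>"
  shows "op_tensor \<xi> (vp p) = cre p \<xi>"
proof (rule op_tensor_eqI [OF _ \<xi> clin_cre [OF p clin_id]], rule ell2_eqI)
  have "\<xi> (c *\<^sub>C k) = c *\<^sub>C \<xi> k" for c k using \<xi> by (simp add: clin_def)
  then show "coord (cre p \<xi> (tensor_vec k x)) j = coord (tensor_vec (\<xi> k) (vp p x)) j" for k x j
    by (simp add: coord_cre p \<xi> clin_id scaleC_zero_left)
qed

lemma semigroup_isometry_eq:
  assumes p: "p \<in> P"
  shows "semigroup_isometry (G\<lparr>carrier := P\<rparr>) p = vp p"
proof -
  have ed: "eps j c = c *\<^sub>C delta j" for j :: 'g and c :: complex
    by (rule ell2_eqI) (simp add: coord_scaleC coord_delta scaleC_complex_def)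
  have d: "vp p (delta s) = (if s \<in> P then delta (p \<otimes> s) else 0)" for s
  proof (rule ell2_eqI)
    fix t
    have "t \<in> translates p \<and> inv p \<otimes> t = s \<longleftrightarrow> s \<in> P \<and> t = p \<otimes> s" using p by (auto simp: inv_mult_cancel)
    then show "coord (vp p (delta s)) t = coord (if s \<in> P then delta (p \<otimes> s) else 0) t"
      using p by (auto simp: coord_cre clin_id coord_delta coord_zero)
  qed
  have "(THE V. V \<in> clinear_ops \<and> (\<forall>s\<in>P. V (delta s) = delta (p \<otimes> s)) \<and> (\<forall>s. s \<notin> P \<longrightarrow> V (delta s) = 0)) = vp p"
  proof (rule the_equality)
    have cl: "clin (vp p)" by (rule clin_cre [OF p clin_id])
    show "vp p \<in> clinear_ops \<and> (\<forall>s\<in>P. vp p (delta s) = delta (p \<otimes> s)) \<and> (\<forall>s. s \<notin> P \<longrightarrow> vp p (delta s) = 0)"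
      using p by (simp add: d clinear_ops_iff_clin clin_cre clin_id)
    fix V :: "'g l2 bop"
    assume V: "V \<in> clinear_ops \<and> (\<forall>s\<in>P. V (delta s) = delta (p \<otimes> s)) \<and> (\<forall>s. s \<notin> P \<longrightarrow> V (delta s) = 0)"
    show "V = vp p"
    proof (rule ell2_blinfun_eqI)
      fix j and c :: complex
      have "V (delta j) = vp p (delta j)" using V by (simp add: d)
      then show "V (eps j c) = vp p (eps j c)"
        using V cl unfolding ed clinear_ops_iff_clin clin_def by simp
    qed
  qed
  then show ?thesis by (simp add: semigroup_isometry_def)
qed

end

locale fock_system = subsemigroup G P for G :: "('g, 'z) monoid_scheme" (structure) and P +
  fixes X :: "'g \<Rightarrow> 'h::complex_hilbert bop set"
  assumes product_system: "product_system (G\<lparr>carrier := P\<rparr>) X"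
begin

abbreviation S where "S \<equiv> G\<lparr>carrier := P\<rparr>"

lemma fibre_mult:
  assumes "p \<in> P" "q \<in> P" "\<xi> \<in> X p" "\<eta> \<in> X q"
  shows "\<xi> o\<^sub>L \<eta> \<in> X (p \<otimes> q)"
  using product_system.mult_fibre [OF product_system, of p q \<xi> \<eta>] assms by simp

lemma fibre_adj_mult:
  assumes "p \<in> P" "q \<in> P" "\<xi> \<in> X p" "\<eta> \<in> X (p \<otimes> q)"
  shows "adj \<xi> o\<^sub>L \<eta> \<in> X q"
  using product_system.adj_mult_fibre [OF product_system, of p q \<xi> \<eta>] assms by simp

lemma unit_fibre: "cstar_subalgebra bounded_ops (X \<one>)"
  using product_system.unit_fibre [OF product_system] by simp

sublocale module_family P X
  by (rule module_family.intro) (use product_system.closed_subspace [OF product_system] in auto)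

lemma fibre_gram: "p \<in> P \<Longrightarrow> \<xi> \<in> X p \<Longrightarrow> \<eta> \<in> X p \<Longrightarrow> adj \<xi> o\<^sub>L \<eta> \<in> X \<one>"
  using fibre_adj_mult [of p \<one> \<xi> \<eta>] by (simp add: one_P in_carrier)

lemma vecs_invariantI:
  assumes gen: "\<And>i y. i \<in> P \<Longrightarrow> y \<in> X i \<Longrightarrow> A o\<^sub>L (eps i o\<^sub>L y) \<in> vecs" and Z: "Z \<in> vecs"
  shows "A o\<^sub>L Z \<in> vecs"
proof -
  have bl: "bounded_linear (\<lambda>Z :: 'h \<Rightarrow>\<^sub>L ('g, 'h) ell2. A o\<^sub>L Z)" by (rule comp.bounded_linear_right)
  have "Z \<in> {Z. A o\<^sub>L Z \<in> vecs}"
  proof (rule vecs_induct [OF Z])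
    show "subspace {Z. A o\<^sub>L Z \<in> vecs}"
      using linear_subspace_vimage [OF bounded_linear.linear [OF bl] subspace_vecs] by (simp add: vimage_def)
    show "closed {Z. A o\<^sub>L Z \<in> vecs}" by (rule closed_vimage_blinfun [OF closed_vecs bl])
  qed (use gen in auto)
  then show ?thesis by simp
qed

lemma cre_vecs:
  assumes p: "p \<in> P" and \<xi>: "\<xi> \<in> X p" and Z: "Z \<in> vecs"
  shows "cre p \<xi> o\<^sub>L Z \<in> vecs" and "ann p (adj \<xi>) o\<^sub>L Z \<in> vecs"
proof -
  have c: "clin \<xi>" using p \<xi> by (rule fibre_clin)
  show "cre p \<xi> o\<^sub>L Z \<in> vecs"
    by (rule vecs_invariantI [OF _ Z]) (simp add: cre_eps p c eps_in_vecs mult_P fibre_mult \<xi>)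
  show "ann p (adj \<xi>) o\<^sub>L Z \<in> vecs"
  proof (rule vecs_invariantI [OF _ Z])
    fix s y assume s: "s \<in> P" "y \<in> X s"
    show "ann p (adj \<xi>) o\<^sub>L (eps s o\<^sub>L y) \<in> vecs"
    proof (cases "s \<in> translates p")
      case True
      then obtain r where r: "r \<in> P" "s = p \<otimes> r" by blast
      then have "adj \<xi> o\<^sub>L y \<in> X r" using fibre_adj_mult [OF p r(1) \<xi>] s(2) by simp
      then show ?thesis using p c r by (simp add: ann_eps clin_adj inv_mult_cancel eps_in_vecs)
    next
      case False
      then show ?thesis using p c by (simp add: ann_eps clin_adj vecs_zero)
    qed
  qed
qed

abbreviation "ops \<equiv> adjointable_ops P X"

lemma fock_ops_eq: "fock_ops S X = ops"
  by (simp add: fock_ops_def)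

lemma fam_cre:
  assumes p: "p \<in> P" and \<xi>: "clin \<xi>"
  shows "fam (cre p \<xi> o\<^sub>L Z) s = (if s \<in> translates p then \<xi> o\<^sub>L fam Z (inv p \<otimes> s) else 0)"
  by (rule blinfun_eqI) (simp add: fam_apply coord_cre p \<xi>)

text \<open>The creation operator on the module is induced by an operator on \<open>l\<^sup>2(G;
  H)\<close> which need not vanish on the vectors orthogonal to the module, so that it can differ
  from the faithful representative.\<close>

lemma creation_eq:
  assumes p: "p \<in> P" and \<xi>: "\<xi> \<in> X p"
  shows "creation S X p \<xi> = sigma (cre p \<xi>)"
proof (rule mod_op_eqI)
  show "creation S X p \<xi> \<in> extensional (dsum P X)" by (simp add: creation_def)
  show "sigma (cre p \<xi>) \<in> extensional (dsum P X)" by (rule sigma_extensional)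
  fix Z assume Z: "Z \<in> vecs"
  have "creation S X p \<xi> (fam Z) s = fam (cre p \<xi> o\<^sub>L Z) s" for s
  proof (cases "s \<in> translates p")
    case True
    then obtain r where r: "r \<in> P" "s = p \<otimes> r" by blast
    have "(THE r'. r' \<in> P \<and> p \<otimes> r = p \<otimes> r') = r"
      by (rule the_equality) (use p r in_carrier in auto)
    then show ?thesis
      using p r fam_in_dsum [OF Z] fibre_clin [OF p \<xi>]
      by (auto simp: creation_def fam_cre inv_mult_cancel)
  next
    case False
    then show ?thesis
      using p fam_in_dsum [OF Z] fibre_clin [OF p \<xi>] by (auto simp: creation_def fam_cre image_iff)
  qed
  then show "creation S X p \<xi> (fam Z) = sigma (cre p \<xi>) (fam Z)" by (simp add: sigma_fam Z fun_eq_iff)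
qed

lemma creation_adjoint:
  assumes p: "p \<in> P" and \<xi>: "\<xi> \<in> X p"
  shows "is_mod_adjoint P X (creation S X p \<xi>) (sigma (ann p (adj \<xi>)))"
  unfolding creation_eq [OF assms]
  by (rule sigma_adjoint [OF adjoint_pair_cre [OF p fibre_clin [OF p \<xi>]] cre_vecs [OF p \<xi>]])

lemma creation:
  assumes p: "p \<in> P" and \<xi>: "\<xi> \<in> X p"
  shows creation_carrier: "creation S X p \<xi> \<in> carrier ops"
    and hat_creation: "Z \<in> vecs \<Longrightarrow> hat (creation S X p \<xi>) Z = cre p \<xi> o\<^sub>L Z"
  using creation_adjoint [OF assms] by (auto simp: adjointable_iff creation_eq [OF assms] hat_sigma)

lemma ops_eqI:
  assumes T: "T \<in> carrier ops" "T' \<in> carrier ops" and eq: "\<And>Z. Z \<in> vecs \<Longrightarrow> hat T Z = hat T' Z"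
  shows "T = T'"
proof -
  have "rep T = rep T'"
    by (rule operator_eqI) (simp_all add: rep_comp rep_null T eq)
  then have "sigma (rep T) = sigma (rep T')" by (rule arg_cong)
  then show ?thesis unfolding sigma_rep [OF T(1)] sigma_rep [OF T(2)] .
qed

sublocale ops: represented_algebra ops rep by (rule represented_algebra_adjointable)

lemma hat_ops:
  assumes T: "T \<in> carrier ops" and T': "T' \<in> carrier ops" and Z: "Z \<in> vecs"
  shows "hat (T \<oplus>\<^bsub>ops\<^esub> T') Z = hat T Z + hat T' Z"
    and "hat (T \<otimes>\<^bsub>ops\<^esub> T') Z = hat T (hat T' Z)"
proof -
  have T'Z: "hat T' Z \<in> vecs" using T' Z is_mod_adjoint_hat_in by (auto simp: adjointable_iff)
  have "hat (T \<oplus>\<^bsub>ops\<^esub> T') Z = (rep T + rep T') o\<^sub>L Z" "hat (T \<otimes>\<^bsub>ops\<^esub> T') Z = rep T o\<^sub>L (rep T' o\<^sub>L Z)"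
    using rep_comp [OF ops.add_closed [OF T T'] Z] rep_comp [OF ops.mult_closed [OF T T'] Z] T T'
    by (simp_all add: rep_ops blinfun_compose_assoc)
  then show "hat (T \<oplus>\<^bsub>ops\<^esub> T') Z = hat T Z + hat T' Z" "hat (T \<otimes>\<^bsub>ops\<^esub> T') Z = hat T (hat T' Z)"
    by (simp_all add: rep_comp T T' Z T'Z comp.add_left)
qed

lemma hat_smult:
  assumes T: "T \<in> carrier ops" and Z: "Z \<in> vecs"
  shows "hat (c \<odot>\<^bsub>ops\<^esub> T) Z = cscale c o\<^sub>L hat T Z"
  using rep_comp [OF ops.smult_closed [OF T] Z, of c] rep_comp [OF T Z]
  by (simp add: ops.rep_smult T scale_op_eq blinfun_compose_assoc)

lemma creation_mult:
  assumes p: "p \<in> P" "q \<in> P" and \<xi>: "\<xi> \<in> X p" and \<eta>: "\<eta> \<in> X q"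
  shows "creation S X p \<xi> \<otimes>\<^bsub>ops\<^esub> creation S X q \<eta> = creation S X (p \<otimes> q) (\<xi> o\<^sub>L \<eta>)"
proof (rule ops_eqI)
  note c = creation_carrier [OF p(1) \<xi>] creation_carrier [OF p(2) \<eta>]
  have pq: "p \<otimes> q \<in> P" "\<xi> o\<^sub>L \<eta> \<in> X (p \<otimes> q)" using p \<xi> \<eta> by (auto intro: mult_P fibre_mult)
  show "creation S X p \<xi> \<otimes>\<^bsub>ops\<^esub> creation S X q \<eta> \<in> carrier ops" by (rule ops.mult_closed [OF c])
  show "creation S X (p \<otimes> q) (\<xi> o\<^sub>L \<eta>) \<in> carrier ops" by (rule creation_carrier [OF pq])
  fix Z assume Z: "Z \<in> vecs"
  show "hat (creation S X p \<xi> \<otimes>\<^bsub>ops\<^esub> creation S X q \<eta>) Z = hat (creation S X (p \<otimes> q) (\<xi> o\<^sub>L \<eta>)) Z"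
    using cre_mult [OF p fibre_clin [OF p(1) \<xi>] fibre_clin [OF p(2) \<eta>]]
    by (simp add: hat_ops c Z hat_creation p \<xi> \<eta> pq cre_vecs(1) flip: blinfun_compose_assoc)
qed

lemma cre_linear:
  assumes "p \<in> P" "clin \<xi>" "clin \<eta>"
  shows "cre p (\<xi> + \<eta>) = cre p \<xi> + cre p \<eta>" "cre p (scale_op c \<xi>) = cscale c o\<^sub>L cre p \<xi>"
  by (rule blinfun_eqI, rule ell2_eqI, use assms in \<open>simp add: coord_cre clin_add coord_add blf_simps\<close>)
    (rule blinfun_eqI, rule ell2_eqI, use assms in \<open>simp add: coord_cre clin_comp coord_scaleC scale_op_eq blf_simps\<close>)

lemma creation_linear:
  assumes p: "p \<in> P" and \<xi>: "\<xi> \<in> X p" and \<eta>: "\<eta> \<in> X p"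
  shows "creation S X p (\<xi> + \<eta>) = creation S X p \<xi> \<oplus>\<^bsub>ops\<^esub> creation S X p \<eta>"
    and "creation S X p (scale_op c \<xi>) = c \<odot>\<^bsub>ops\<^esub> creation S X p \<xi>"
  by (rule ops_eqI; simp add: creation_carrier fibre_add fibre_scale ops.add_closed ops.smult_closed hat_ops hat_smult hat_creation
      cre_linear [OF p fibre_clin [OF p \<xi>] fibre_clin [OF p \<eta>]] p \<xi> \<eta> comp.add_left blinfun_compose_assoc)+

lemma star_creation:
  assumes p: "p \<in> P" and \<xi>: "\<xi> \<in> X p"
  shows "star ops (creation S X p \<xi>) = sigma (ann p (adj \<xi>))"
proof -
  note c = creation_carrier [OF assms]
  have 1: "adj (rep (creation S X p \<xi>)) = rep (sigma (ann p (adj \<xi>)))"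
    using adjoint_pair_rep [OF creation_adjoint [OF assms]] by (rule adj_eqI)
  have 2: "sigma (ann p (adj \<xi>)) \<in> carrier ops"
    unfolding adjointable_iff using is_mod_adjoint_sym [OF creation_adjoint [OF assms]] by (rule exI [where x = "creation S X p \<xi>"])
  show ?thesis unfolding adjointable_ops_eq(4) [OF c c] 1 by (rule sigma_rep [OF 2])
qed

text \<open>This is the only relation between creation operators and their adjoints that the norm
  estimate needs: it moves the inner product of \<open>X p\<close> into the coefficient
  algebra.\<close>

lemma star_creation_mult:
  assumes p: "p \<in> P" and \<xi>: "\<xi> \<in> X p" and \<eta>: "\<eta> \<in> X p"
  shows "star ops (creation S X p \<xi>) \<otimes>\<^bsub>ops\<^esub> creation S X p \<eta> = creation S X \<one> (adj \<xi> o\<^sub>L \<eta>)"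
proof (rule ops_eqI)
  have g: "adj \<xi> o\<^sub>L \<eta> \<in> X \<one>" by (rule fibre_gram [OF assms])
  note c = ops.star_closed [OF creation_carrier [OF p \<xi>]] creation_carrier [OF p \<eta>]
  show "star ops (creation S X p \<xi>) \<otimes>\<^bsub>ops\<^esub> creation S X p \<eta> \<in> carrier ops" by (rule ops.mult_closed [OF c])
  show "creation S X \<one> (adj \<xi> o\<^sub>L \<eta>) \<in> carrier ops" by (rule creation_carrier [OF one_P g])
  fix Z assume Z: "Z \<in> vecs"
  show "hat (star ops (creation S X p \<xi>) \<otimes>\<^bsub>ops\<^esub> creation S X p \<eta>) Z = hat (creation S X \<one> (adj \<xi> o\<^sub>L \<eta>)) Z"
    using ann_cre [OF p clin_adj [OF fibre_clin [OF p \<xi>]] fibre_clin [OF p \<eta>]]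
    unfolding hat_ops(2) [OF c Z]
    unfolding star_creation [OF p \<xi>] hat_creation [OF p \<eta> Z] hat_creation [OF one_P g Z]
      hat_sigma [OF cre_vecs(1) [OF p \<eta> Z]]
    by (simp flip: blinfun_compose_assoc)
qed

lemma star_creation_one:
  assumes a: "a \<in> X \<one>"
  shows "star ops (creation S X \<one> a) = creation S X \<one> (adj a)"
proof -
  have "adj a \<in> X \<one>" using unit_fibre a by (auto simp: cstar_subalgebra_def bounded_ops_def)
  then show ?thesis
    by (simp add: star_creation [OF one_P a] creation_eq [OF one_P] ann_one clin_adj fibre_clin [OF one_P a])
qed

definition creations :: "('g, 'h) mod_op set" where
  "creations = {creation S X p \<xi> | p \<xi>. p \<in> P \<and> \<xi> \<in> X p}"

lemma creations_subset: "creations \<subseteq> carrier ops"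
  by (auto simp: creations_def creation_carrier)

text \<open>The creation operators are closed under multiplication, so the algebra that they
  generate is their closed linear span.\<close>

lemma toeplitz_plus_eq: "toeplitz_plus S X = closed_span ops creations"
  and closed_subalgebra_toeplitz_plus: "closed_subalgebra ops (toeplitz_plus S X)"
proof -
  have m: "a \<otimes>\<^bsub>ops\<^esub> b \<in> creations" if ab: "a \<in> creations" "b \<in> creations" for a b
  proof -
    obtain p \<xi> q \<eta> where "a = creation S X p \<xi>" "b = creation S X q \<eta>" "p \<in> P" "q \<in> P" "\<xi> \<in> X p" "\<eta> \<in> X q"
      using ab by (auto simp: creations_def)
    then have "a \<otimes>\<^bsub>ops\<^esub> b = creation S X (p \<otimes> q) (\<xi> o\<^sub>L \<eta>)" "p \<otimes> q \<in> P" "\<xi> o\<^sub>L \<eta> \<in> X (p \<otimes> q)"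
      using creation_mult [of p q \<xi> \<eta>] mult_P [of p q] fibre_mult [of p q \<xi> \<eta>] by auto
    then show ?thesis unfolding creations_def by blast
  qed
  have e: "toeplitz_plus S X = alg_gen ops creations" by (simp add: toeplitz_plus_def fock_ops_eq creations_def)
  show 1: "toeplitz_plus S X = closed_span ops creations"
    unfolding e by (rule ops.alg_gen_eq_closed_span(1) [OF creations_subset m])
  show "closed_subalgebra ops (toeplitz_plus S X)"
    unfolding 1 by (rule ops.alg_gen_eq_closed_span(2) [OF creations_subset m])
qed

lemma toeplitz_eq: "toeplitz S X = cstar_gen ops creations"
  by (simp add: toeplitz_def fock_ops_eq creations_def)

lemma cstar_subalgebra_toeplitz: "cstar_subalgebra ops (toeplitz S X)"
  unfolding toeplitz_eq by (rule ops.cstar_subalgebra_cstar_gen [OF creations_subset])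

lemma toeplitz_plus_subset: "toeplitz_plus S X \<subseteq> toeplitz S X"
  unfolding toeplitz_plus_def alg_gen_def
  using cstar_subalgebra_toeplitz ops.cstar_gen_superset [OF creations_subset]
  by (auto simp: cstar_subalgebra_def fock_ops_eq toeplitz_eq creations_def)

lemma creation_in_toeplitz_plus: "p \<in> P \<Longrightarrow> \<xi> \<in> X p \<Longrightarrow> creation S X p \<xi> \<in> toeplitz_plus S X"
  unfolding toeplitz_plus_eq using ops.closed_span_superset [OF creations_subset] by (auto simp: creations_def)

lemma toeplitz_carrier: "toeplitz S X \<subseteq> carrier ops"
  using ops.linear_subspaceD(1) cstar_subalgebra_toeplitz by (simp add: cstar_subalgebra_def closed_subalgebra_def)

end

section \<open>The Fock space of a representation\<close>

locale fock_representation = fock_system G P X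
  for G :: "('g, 'z) monoid_scheme" (structure) and P and X :: "'g \<Rightarrow> 'h::complex_hilbert bop set" +
  fixes \<Psi> :: "('g, 'h) mod_op \<Rightarrow> 'k::complex_hilbert bop"
  assumes star_hom_Psi: "star_hom ops bounded_ops (toeplitz S X) \<Psi>"
    and inj_Psi: "inj_on \<Psi> (creation S X \<one> ` X \<one>)"
begin

lemma Psi:
  assumes "T \<in> toeplitz S X" "T' \<in> toeplitz S X"
  shows Psi_clin: "clin (\<Psi> T)" and Psi_add: "\<Psi> (T \<oplus>\<^bsub>ops\<^esub> T') = \<Psi> T + \<Psi> T'"
    and Psi_mult: "\<Psi> (T \<otimes>\<^bsub>ops\<^esub> T') = \<Psi> T o\<^sub>L \<Psi> T'"
    and Psi_smult: "\<Psi> (c \<odot>\<^bsub>ops\<^esub> T) = scale_op c (\<Psi> T)"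
    and Psi_star: "\<Psi> (star ops T) = adj (\<Psi> T)"
  using star_hom_Psi assms
  by (auto simp: star_hom_def alg_hom_def bounded_ops_def image_subset_iff clinear_ops_iff_clin)

abbreviation c where "c p \<xi> \<equiv> \<Psi> (creation S X p \<xi>)"

lemma creation_in_toeplitz: "p \<in> P \<Longrightarrow> \<xi> \<in> X p \<Longrightarrow> creation S X p \<xi> \<in> toeplitz S X"
  using creation_in_toeplitz_plus toeplitz_plus_subset by blast

lemma star_in_toeplitz: "T \<in> toeplitz S X \<Longrightarrow> star ops T \<in> toeplitz S X"
  using cstar_subalgebra_toeplitz by (simp add: cstar_subalgebra_def)

lemma c_clin: "p \<in> P \<Longrightarrow> \<xi> \<in> X p \<Longrightarrow> clin (c p \<xi>)"
  using Psi_clin creation_in_toeplitz by blast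

lemma c_mult: "p \<in> P \<Longrightarrow> q \<in> P \<Longrightarrow> \<xi> \<in> X p \<Longrightarrow> \<eta> \<in> X q \<Longrightarrow> c p \<xi> o\<^sub>L c q \<eta> = c (p \<otimes> q) (\<xi> o\<^sub>L \<eta>)"
  using Psi_mult [OF creation_in_toeplitz creation_in_toeplitz, of p \<xi> q \<eta>] creation_mult [of p q \<xi> \<eta>] by simp

lemma c_add: "p \<in> P \<Longrightarrow> \<xi> \<in> X p \<Longrightarrow> \<eta> \<in> X p \<Longrightarrow> c p (\<xi> + \<eta>) = c p \<xi> + c p \<eta>"
  using Psi_add [OF creation_in_toeplitz creation_in_toeplitz, of p \<xi> p \<eta>] creation_linear(1) [of p \<xi> \<eta>] by simp

lemma c_scale: "p \<in> P \<Longrightarrow> \<xi> \<in> X p \<Longrightarrow> c p (scale_op a \<xi>) = scale_op a (c p \<xi>)"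
  using Psi_smult [OF creation_in_toeplitz creation_in_toeplitz, of p \<xi> p \<xi>] creation_linear(2) [of p \<xi> \<xi>] by simp

lemma c_zero: "p \<in> P \<Longrightarrow> c p 0 = 0"
  using c_add [of p 0 0] fibre_zero [of p] by simp

lemma c_gram: "p \<in> P \<Longrightarrow> \<xi> \<in> X p \<Longrightarrow> \<eta> \<in> X p \<Longrightarrow> adj (c p \<xi>) o\<^sub>L c p \<eta> = c \<one> (adj \<xi> o\<^sub>L \<eta>)"
  using Psi_mult [OF star_in_toeplitz creation_in_toeplitz, OF creation_in_toeplitz, of p \<xi> p \<eta>] star_creation_mult [of p \<xi> \<eta>]
    Psi_star [OF creation_in_toeplitz creation_in_toeplitz, of p \<xi> p \<xi>] by simp

lemma cinner_c:
  assumes "p \<in> P" "\<xi> \<in> X p" "\<eta> \<in> X p"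
  shows "cinner (c p \<xi> k) (c p \<eta> k') = cinner k (c \<one> (adj \<xi> o\<^sub>L \<eta>) k')"
  using adjoint_pairD [OF adjoint_pair_adj [OF c_clin [OF assms(1,2)]], of k "c p \<eta> k'"]
  by (simp flip: c_gram [OF assms])

lemma concrete_cstar_unit: "concrete_cstar (X \<one>)"
  using represented_algebra.concrete_cstar_image [OF represented_algebra_bounded_ops unit_fibre] by simp

sublocale unit: star_rep "X \<one>" "c \<one>"
proof (intro star_rep.intro concrete_cstar_unit star_rep_axioms.intro)
  fix a b z assume a: "a \<in> X \<one>"
  show "clin (c \<one> a)" by (rule c_clin [OF one_P a])
  show "c \<one> (scale_op z a) = scale_op z (c \<one> a)" by (rule c_scale [OF one_P a])
  show "c \<one> (adj a) = adj (c \<one> a)"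
    using Psi_star [OF creation_in_toeplitz creation_in_toeplitz, OF one_P a one_P a] by (simp add: star_creation_one a)
  assume b: "b \<in> X \<one>"
  show "c \<one> (a + b) = c \<one> a + c \<one> b" by (rule c_add [OF one_P a b])
  show "c \<one> (a o\<^sub>L b) = c \<one> a o\<^sub>L c \<one> b" using c_mult [OF one_P one_P a b] by simp
qed

text \<open>The creation operators of degree one represent the coefficient algebra faithfully,
  which is seen by applying them to the vector of \<open>a\<^sup>*\<close>: \<open>a a\<^sup>* =
  0\<close> forces \<open>a = 0\<close>.  Injective *-representations are isometric.\<close>

lemma norm_unit:
  assumes a: "a \<in> X \<one>"
  shows "norm (c \<one> a) = norm a"
proof (rule unit.rep_isometric [OF _ a])
  fix a assume a: "a \<in> X \<one>" and 0: "c \<one> a = 0"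
  have z: "0 \<in> X \<one>" by (rule unit.zero_B)
  have a': "adj a \<in> X \<one>" by (rule unit.adj_B [OF a])
  have cl: "clin a" by (rule unit.clin_B [OF a])
  have "creation S X \<one> a = creation S X \<one> 0"
    using inj_onD [OF inj_Psi, of "creation S X \<one> a" "creation S X \<one> 0"] a z 0 c_zero [OF one_P] by simp
  moreover have "eps \<one> o\<^sub>L adj a \<in> vecs" by (rule eps_in_vecs [OF one_P a'])
  ultimately have "cre \<one> a o\<^sub>L (eps \<one> o\<^sub>L adj a) = cre \<one> 0 o\<^sub>L (eps \<one> o\<^sub>L adj a)"
    using hat_creation [OF one_P a] hat_creation [OF one_P z] by metis
  then have e: "eps \<one> o\<^sub>L (a o\<^sub>L adj a) = eps \<one> o\<^sub>L (0 o\<^sub>L adj a)"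
    unfolding cre_eps [OF one_P one_P cl] cre_eps [OF one_P one_P clin_zero] by simp
  have "(a o\<^sub>L adj a) h = 0" for h
    using arg_cong [OF e, of "\<lambda>T. coord (blinfun_apply T h) \<one>"] by (simp add: coord_zero)
  then have "a o\<^sub>L adj a = 0" by (intro blinfun_eqI) simp
  moreover have "norm (a o\<^sub>L adj a) = (norm (adj a))\<^sup>2"
    by (rule norm_gram) (simp add: adjoint_pairD [OF adjoint_pair_sym [OF adjoint_pair_adj [OF cl]]])
  ultimately show "a = 0" by (simp add: norm_adj cl)
qed

text \<open>The interior tensor product of the Fock module with \<open>K\<close>, in concrete
  form: \<open>U Z k\<close> is the image of \<open>Z \<otimes> k\<close> in \<open>K \<otimes>
  l\<^sup>2(P)\<close>.\<close>

definition U :: "('h \<Rightarrow>\<^sub>L ('g, 'h) ell2) \<Rightarrow> 'k \<Rightarrow>\<^sub>L ('g, 'k) ell2" where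
  "U Z = of_coords (\<lambda>k r. if r \<in> P then c r (fam Z r) k else 0)"

lemma fam_in_fibre: "Z \<in> vecs \<Longrightarrow> r \<in> P \<Longrightarrow> fam Z r \<in> X r"
  and fam_outside: "Z \<in> vecs \<Longrightarrow> r \<notin> P \<Longrightarrow> fam Z r = 0"
  by (auto simp: vecs_def fam_def)

text \<open>Finite partial sums of the inner product are bounded by the whole, which makes the
  coordinates in the definition of \<open>U\<close> square summable.\<close>

lemma partial_gram_le:
  assumes Z: "Z \<in> vecs" and F: "finite F" "F \<subseteq> P"
  shows "norm (\<Sum>r\<in>F. adj (fam Z r) o\<^sub>L fam Z r) \<le> (norm Z)\<^sup>2"
proof (rule norm_selfadjoint_le)
  let ?A = "\<Sum>r\<in>F. adj (fam Z r) o\<^sub>L fam Z r"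
  have ad: "adjoint_pair (fam Z r) (adj (fam Z r))" if "r \<in> F" for r
    using that F(2) Z fam_in_fibre fibre_clin by (intro adjoint_pair_adj) blast
  show "adjoint_pair ?A ?A"
    by (rule adjoint_pair_sum) (rule adjoint_pair_comp [OF adjoint_pair_sym [OF ad] ad])
  fix h
  have "inner (?A h) h = (\<Sum>r\<in>F. (norm (coord (Z h) r))\<^sup>2)"
    unfolding blinfun_apply_sum inner_sum_left
  proof (rule sum.cong [OF refl])
    fix r assume "r \<in> F"
    then show "inner ((adj (fam Z r) o\<^sub>L fam Z r) h) h = (norm (coord (Z h) r))\<^sup>2"
      using adjoint_pairD [OF adjoint_pair_sym [OF ad], of r "fam Z r h" h]
      by (simp add: inner_Re_cinner cinner_self fam_apply)
  qed
  also have "\<dots> \<le> (norm (Z h))\<^sup>2" by (rule finite_sum_le_norm_sq [OF F(1)])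
  also have "\<dots> \<le> (norm Z * norm h)\<^sup>2" by (intro power_mono norm_blinfun) simp
  finally have "inner (?A h) h \<le> (norm Z)\<^sup>2 * (norm h)\<^sup>2" by (simp add: power_mult_distrib)
  moreover have "0 \<le> inner (?A h) h"
    unfolding \<open>inner (?A h) h = (\<Sum>r\<in>F. (norm (coord (Z h) r))\<^sup>2)\<close> by (simp add: sum_nonneg)
  ultimately show "\<bar>inner (?A h) h\<bar> \<le> (norm Z)\<^sup>2 * (norm h)\<^sup>2" by simp
qed simp

lemma U:
  assumes Z: "Z \<in> vecs"
  shows coord_U: "coord (U Z k) r = (if r \<in> P then c r (fam Z r) k else 0)"
    and clin_U: "clin (U Z)"
proof -
  have add: "(if r \<in> P then c r (fam Z r) (k + k') else 0)
      = (if r \<in> P then c r (fam Z r) k else 0) + (if r \<in> P then c r (fam Z r) k' else 0)" for k k' r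
    by (simp add: blf_simps)
  have sc: "(if r \<in> P then c r (fam Z r) (a *\<^sub>C k) else 0) = a *\<^sub>C (if r \<in> P then c r (fam Z r) k else 0)" for k a r
    using c_clin [OF _ fam_in_fibre [OF Z], of r] by (simp add: clin_def scaleC_zero_right)
  have bd: "(\<Sum>r\<in>F. (norm (if r \<in> P then c r (fam Z r) k else 0))\<^sup>2) \<le> (norm Z * norm k)\<^sup>2"
    if F: "finite F" for F k
  proof -
    let ?A = "\<Sum>r\<in>F \<inter> P. adj (fam Z r) o\<^sub>L fam Z r"
    have g: "adj (fam Z r) o\<^sub>L fam Z r \<in> X \<one>" if "r \<in> F \<inter> P" for r
      using that fam_in_fibre [OF Z] by (intro fibre_gram) auto
    have A: "?A \<in> X \<one>" by (rule unit.sum_B) (rule g)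
    have rs: "c \<one> ?A = (\<Sum>r\<in>F \<inter> P. c \<one> (adj (fam Z r) o\<^sub>L fam Z r))"
      by (rule unit.rep_sum) (rule g)
    have "(\<Sum>r\<in>F. (norm (if r \<in> P then c r (fam Z r) k else 0))\<^sup>2) = (\<Sum>r\<in>F \<inter> P. (norm (c r (fam Z r) k))\<^sup>2)"
      using F by (simp add: sum.inter_restrict) (rule sum.cong, auto)
    also have "\<dots> = (\<Sum>r\<in>F \<inter> P. inner k (c \<one> (adj (fam Z r) o\<^sub>L fam Z r) k))"
    proof (rule sum.cong [OF refl])
      fix r assume "r \<in> F \<inter> P"
      then show "(norm (c r (fam Z r) k))\<^sup>2 = inner k (c \<one> (adj (fam Z r) o\<^sub>L fam Z r) k)"
        using cinner_c [of r "fam Z r" "fam Z r" k k] fam_in_fibre [OF Z]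
        by (simp add: power2_norm_eq_inner inner_Re_cinner)
    qed
    also have "\<dots> = inner k (c \<one> ?A k)"
      unfolding rs blinfun_apply_sum inner_sum_right ..
    also have "\<dots> \<le> norm k * (norm (c \<one> ?A) * norm k)"
      by (intro order_trans [OF norm_cauchy_schwarz] mult_left_mono norm_blinfun) simp
    also have "\<dots> \<le> norm k * ((norm Z)\<^sup>2 * norm k)"
      unfolding norm_unit [OF A] using F by (intro mult_left_mono mult_right_mono partial_gram_le Z) auto
    finally show ?thesis by (simp add: power2_eq_square ac_simps)
  qed
  show "coord (U Z k) r = (if r \<in> P then c r (fam Z r) k else 0)"
    unfolding U_def by (rule of_coords(1) [OF add sc bd norm_ge_zero])
  show "clin (U Z)" unfolding U_def by (rule of_coords(2) [OF add sc bd norm_ge_zero])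
qed

lemma gram_in_unit:
  assumes Z: "Z \<in> vecs" and W: "W \<in> vecs"
  shows "adj (fam Z r) o\<^sub>L fam W r \<in> X \<one>" and "hadj Z o\<^sub>L W \<in> X \<one>"
proof -
  show g: "adj (fam Z r) o\<^sub>L fam W r \<in> X \<one>" for r
    using fibre_gram fam_in_fibre Z W fam_outside [OF W] unit.zero_B by (cases "r \<in> P") auto
  have "((\<lambda>F. \<Sum>r\<in>F. adj (fam Z r) o\<^sub>L fam W r) \<longlongrightarrow> hadj Z o\<^sub>L W) (finite_subsets_at_top UNIV)"
    using has_sum_gram [OF vecs_clin [OF Z] W] by (simp add: has_sum_def)
  then show "hadj Z o\<^sub>L W \<in> X \<one>"
    by (rule Lim_in_closed_set [OF unit.closed_B _ finite_subsets_at_top_neq_bot, rotated])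
      (intro always_eventually allI unit.sum_B g)
qed

lemma unit_has_sum:
  assumes f: "\<And>i. f i \<in> X \<one>" and a: "a \<in> X \<one>" and s: "(f has_sum a) A"
  shows "((\<lambda>i. c \<one> (f i)) has_sum c \<one> a) A"
proof -
  have "((\<lambda>F. \<Sum>i\<in>F. f i) \<longlongrightarrow> a) (finite_subsets_at_top A)" using s by (simp add: has_sum_def)
  then have "((\<lambda>F. norm ((\<Sum>i\<in>F. f i) - a)) \<longlongrightarrow> 0) (finite_subsets_at_top A)"
    by (simp add: LIM_zero_iff tendsto_norm_zero_iff)
  moreover have "norm ((\<Sum>i\<in>F. c \<one> (f i)) - c \<one> a) = norm ((\<Sum>i\<in>F. f i) - a)" for F
  proof -
    have "(\<Sum>i\<in>F. f i) \<in> X \<one>" by (rule unit.sum_B) (rule f)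
    then show ?thesis using norm_unit [of "(\<Sum>i\<in>F. f i) - a"] a by (simp add: unit.rep_diff unit.rep_sum f unit.diff_B)
  qed
  ultimately have "((\<lambda>F. norm ((\<Sum>i\<in>F. c \<one> (f i)) - c \<one> a)) \<longlongrightarrow> 0) (finite_subsets_at_top A)" by simp
  then show ?thesis unfolding has_sum_def by (simp add: LIM_zero_iff tendsto_norm_zero_iff)
qed

text \<open>Each coordinate contributes the image of \<open>(Z r)\<^sup>* (W r)\<close> under the
  representation of the coefficient algebra.  The sum of these converges in norm, and the
  representation is isometric, so it can be pulled out.\<close>

lemma U_gram:
  assumes Z: "Z \<in> vecs" and W: "W \<in> vecs"
  shows "cinner (U Z k) (U W k') = cinner k (c \<one> (hadj Z o\<^sub>L W) k')"
proof -
  have "((\<lambda>r. c \<one> (adj (fam Z r) o\<^sub>L fam W r)) has_sum c \<one> (hadj Z o\<^sub>L W)) UNIV"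
    by (rule unit_has_sum [OF gram_in_unit(1) [OF Z W] gram_in_unit(2) [OF Z W] has_sum_gram [OF vecs_clin [OF Z] W]])
  moreover have "bounded_linear (\<lambda>T. cinner k (blinfun_apply T k'))"
    by (rule bounded_linear_compose [OF cinner.bounded_linear_right blinfun.bounded_linear_left])
  ultimately have "((\<lambda>r. cinner k (c \<one> (adj (fam Z r) o\<^sub>L fam W r) k')) has_sum cinner k (c \<one> (hadj Z o\<^sub>L W) k')) UNIV"
    by (rule has_sum_bounded_linear [rotated])
  moreover have "cinner k (c \<one> (adj (fam Z r) o\<^sub>L fam W r) k') = cinner (coord (U Z k) r) (coord (U W k') r)" for r
    using cinner_c [of r "fam Z r" "fam W r" k k'] fam_in_fibre Z W
    by (cases "r \<in> P") (auto simp: coord_U fam_outside c_zero one_P cinner_simps)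
  ultimately show ?thesis by (simp add: cinner_ell2_def infsumI)
qed

text \<open>The square of the norm of a column is the norm of a sum of inner products in the
  coefficient algebra, where the representation is isometric.\<close>

lemma norm_col_U:
  assumes Z: "\<And>i. i < n \<Longrightarrow> Z i \<in> vecs"
  shows "norm (col_op n (\<lambda>i. U (Z i))) = norm (col_op n Z)"
proof -
  have col: "cinner (col_op n V h) (col_op n V k) = (\<Sum>i<n. cinner (V i h) (V i k))"
    for V :: "nat \<Rightarrow> 'x::complex_hilbert \<Rightarrow>\<^sub>L 'y::complex_hilbert" and h k
    unfolding col_op_def blinfun_apply_sum cinner.sum_left blinfun_apply_blinfun_compose cinner_eps
    by (intro sum.cong) (auto simp: finite_support_ell2)
  have g: "hadj (Z i) o\<^sub>L Z i \<in> X \<one>" if "i \<in> {..<n}" for i using that Z by (intro gram_in_unit) auto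
  let ?A = "\<Sum>i<n. hadj (Z i) o\<^sub>L Z i"
  have rs: "c \<one> ?A = (\<Sum>i<n. c \<one> (hadj (Z i) o\<^sub>L Z i))" by (rule unit.rep_sum) (rule g)
  have "norm ?A = (norm (col_op n Z))\<^sup>2"
  proof (rule norm_gram)
    fix h k
    show "cinner h (?A k) = cinner (col_op n Z h) (col_op n Z k)"
      unfolding col blinfun_apply_sum cinner.sum_right
      using Z by (intro sum.cong) (auto simp: adjoint_pairD [OF adjoint_pair_hadj [OF vecs_clin]])
  qed
  moreover have "norm (c \<one> ?A) = (norm (col_op n (\<lambda>i. U (Z i))))\<^sup>2"
  proof (rule norm_gram)
    fix h k
    show "cinner h (c \<one> ?A k) = cinner (col_op n (\<lambda>i. U (Z i)) h) (col_op n (\<lambda>i. U (Z i)) k)"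
      unfolding col rs blinfun_apply_sum cinner.sum_right
      using Z by (intro sum.cong) (auto simp: U_gram)
  qed
  moreover have "norm (c \<one> ?A) = norm ?A" by (intro norm_unit unit.sum_B g)
  ultimately show ?thesis by (simp add: power2_eq_iff_nonneg)
qed

lemma norm_U:
  assumes Z: "Z \<in> vecs"
  shows "norm (U Z) = norm Z"
proof -
  have "norm (c \<one> (hadj Z o\<^sub>L Z)) = (norm (U Z))\<^sup>2"
    by (rule norm_gram) (simp add: U_gram Z)
  moreover have "norm (hadj Z o\<^sub>L Z) = (norm Z)\<^sup>2"
    by (rule norm_gram) (simp add: adjoint_pairD [OF adjoint_pair_hadj [OF vecs_clin [OF Z]]])
  ultimately show ?thesis using norm_unit [OF gram_in_unit(2) [OF Z Z]] by (simp add: power2_eq_iff_nonneg)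
qed

lemma U_linear:
  assumes Z: "Z \<in> vecs"
  shows "W \<in> vecs \<Longrightarrow> U (Z + W) = U Z + U W" and "U (cscale a o\<^sub>L Z) = cscale a o\<^sub>L U Z"
proof -
  have f: "fam (Z + W) r = fam Z r + fam W r" "fam (cscale a o\<^sub>L Z) r = scale_op a (fam Z r)" for r W
    by (rule blinfun_eqI, simp add: fam_apply coord_add blf_simps scale_op_apply coord_scaleC)+
  show "U (cscale a o\<^sub>L Z) = cscale a o\<^sub>L U Z"
    by (rule blinfun_eqI, rule ell2_eqI)
      (simp add: coord_U Z vecs_scale f c_scale fam_in_fibre scale_op_apply coord_scaleC scaleC_zero_right)
  assume W: "W \<in> vecs"
  show "U (Z + W) = U Z + U W"
    by (rule blinfun_eqI, rule ell2_eqI)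
      (simp add: coord_U Z W vecs_add f c_add fam_in_fibre blf_simps coord_add)
qed

lemma U_sum:
  assumes "\<And>i. i \<in> F \<Longrightarrow> Z i \<in> vecs"
  shows "U (\<Sum>i\<in>F. Z i) = (\<Sum>i\<in>F. U (Z i))"
proof -
  have "U 0 = 0" using norm_U [OF vecs_zero] by simp
  then show ?thesis using assms
    by (induction F rule: infinite_finite_induct)
      (auto simp: U_linear(1) subspace_sum [OF subspace_vecs])
qed

text \<open>Multiplicativity \<open>c p \<xi> c r \<eta> = c (p r) (\<xi> \<eta>)\<close>, read
  coordinate by coordinate.\<close>

lemma cre_U:
  assumes p: "p \<in> P" and \<xi>: "\<xi> \<in> X p" and Z: "Z \<in> vecs"
  shows "cre p (c p \<xi>) o\<^sub>L U Z = U (cre p \<xi> o\<^sub>L Z)"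
proof (rule blinfun_eqI, rule ell2_eqI)
  fix k s
  show "coord ((cre p (c p \<xi>) o\<^sub>L U Z) k) s = coord (U (cre p \<xi> o\<^sub>L Z) k) s"
  proof (cases "s \<in> translates p")
    case True
    then obtain r where r: "r \<in> P" "s = p \<otimes> r" by blast
    have "c p \<xi> (c r (fam Z r) k) = c (p \<otimes> r) (\<xi> o\<^sub>L fam Z r) k"
      by (simp flip: c_mult [OF p r(1) \<xi> fam_in_fibre [OF Z r(1)]])
    then show ?thesis
      using True r p by (simp add: coord_cre c_clin \<xi> coord_U Z cre_vecs fam_cre fibre_clin [OF p \<xi>] inv_mult_cancel mult_P)
  next
    case False
    then show ?thesis
      using p by (simp add: coord_cre c_clin \<xi> coord_U Z cre_vecs fam_cre fibre_clin [OF p \<xi>] c_zero)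
  qed
qed

end

section \<open>Compression to the regular component\<close>

context subsemigroup
begin

text \<open>The inclusion of \<open>K \<otimes> l\<^sup>2(P)\<close> in \<open>K\<close> tensored
  with the universal representation, at the regular component and multiplicity index zero.\<close>

definition zk :: "('g, 'k::complex_hilbert) ell2 \<Rightarrow>\<^sub>L ('g univ_index, 'k) ell2" where
  "zk = pull ((\<lambda>s. (regular, s, 0)) ` P) (\<lambda>i. fst (snd i))"

definition zk' :: "('g univ_index, 'k::complex_hilbert) ell2 \<Rightarrow>\<^sub>L ('g, 'k) ell2" where
  "zk' = pull P (\<lambda>s. (regular, s, 0))"

lemma coord_zk: "coord (zk x) (\<pi>, s, n) = (if \<pi> = regular \<and> n = 0 \<and> s \<in> P then coord x s else 0)"
  unfolding zk_def by (subst coord_pull) (auto simp: inj_on_def)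

lemma coord_zk': "coord (zk' y) s = (if s \<in> P then coord y (regular, s, 0) else 0)"
  unfolding zk'_def by (subst coord_pull) (auto simp: inj_on_def)

lemma zk:
  shows clin_zk: "clin (zk :: ('g, 'k::complex_hilbert) ell2 \<Rightarrow>\<^sub>L _)"
    and norm_zk_le: "norm (zk :: ('g, 'k) ell2 \<Rightarrow>\<^sub>L _) \<le> 1"
    and clin_zk': "clin (zk' :: _ \<Rightarrow>\<^sub>L ('g, 'k) ell2)"
    and norm_zk'_le: "norm (zk' :: _ \<Rightarrow>\<^sub>L ('g, 'k) ell2) \<le> 1"
  unfolding zk_def zk'_def by (rule clin_pull norm_pull_le; auto simp: inj_on_def)+

text \<open>The range of the inclusion is invariant under \<open>P\<close>, because
  \<open>P\<close> is closed under left translation by its elements.  It is not invariant under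
  inverses, which is why only the nonselfadjoint algebra can be treated this way.\<close>

lemma univ_unitary_zk:
  assumes p: "p \<in> P"
  shows "univ_unitary G p o\<^sub>L zk = zk o\<^sub>L vp p"
proof (rule blinfun_eqI, rule pair_ell2_eqI)
  fix x :: "'g l2" and \<pi> :: "'g \<Rightarrow> ('g \<times> nat) l2 bop"
  note pc = in_carrier [OF p]
  have r0: "row \<pi> (zk y) = 0" if "\<pi> \<noteq> regular" for y :: "'g l2"
  proof (rule ell2_eqI)
    fix sn show "coord (row \<pi> (zk y)) sn = coord 0 sn" using that by (cases sn) (simp add: coord_zk coord_zero)
  qed
  show "row \<pi> ((univ_unitary G p o\<^sub>L zk) x) = row \<pi> ((zk o\<^sub>L vp p) x)"
  proof (cases "\<pi> = regular")
    case False
    then show ?thesis using r0 pc by (simp add: row_univ_unitary blf_simps)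
  next
    case True
    have c: "univ_component G p \<pi> = regular p"
      using True regular_in_unitary_reps by (simp add: univ_component_def)
    have "row \<pi> ((univ_unitary G p o\<^sub>L zk) x) = regular p (row \<pi> (zk x))"
      using pc by (simp add: row_univ_unitary c)
    moreover have "regular p (row \<pi> (zk x)) = row \<pi> (zk (vp p x))"
    proof (rule ell2_eqI)
      fix sn :: "'g \<times> nat"
      obtain s n where sn: "sn = (s, n)" by fastforce
      have "s \<in> P" if "s \<in> translates p" using that p mult_P by blast
      then show "coord (regular p (row \<pi> (zk x))) sn = coord (row \<pi> (zk (vp p x))) sn"
        using pc p True translates_iff [OF p, of s] in_carrier [of s]
        by (cases "s \<in> carrier G") (auto simp: sn coord_regular shift_def coord_zk coord_cre clin_id)
    qed
    ultimately show ?thesis by simp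
  qed
qed

lemma zk_tensor_vec: "zk (tensor_vec k x) = tensor_vec k (zk x)"
  unfolding zk_def by (rule pull_tensor_vec) (auto simp: inj_on_def)

lemma op_tensor_zk:
  assumes p: "p \<in> P" and a: "clin a"
  shows "op_tensor a (univ_unitary G p) o\<^sub>L zk = zk o\<^sub>L cre p a"
proof (rule tensor_blinfun_eqI)
  fix k x
  have "univ_unitary G p (zk x) = zk (vp p x)"
    using arg_cong [OF univ_unitary_zk [OF p], of "\<lambda>T. blinfun_apply T x"] by simp
  moreover have "cre p a (tensor_vec k x) = tensor_vec (a k) (vp p x)"
    using op_tensor_apply [OF a clin_cre [OF p clin_id], of k x] by (simp add: op_tensor_vp p a)
  ultimately show "(op_tensor a (univ_unitary G p) o\<^sub>L zk) (tensor_vec k x) = (zk o\<^sub>L cre p a) (tensor_vec k x)"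
    using op_tensor_apply [OF a clin_univ_unitary [OF in_carrier [OF p]]] by (simp add: zk_tensor_vec)
qed

lemma zk'_zk_cre:
  assumes p: "p \<in> P" and a: "clin a"
  shows "zk' o\<^sub>L (zk o\<^sub>L cre p a) = cre p a"
proof (rule blinfun_eqI, rule ell2_eqI)
  fix x s
  have "s \<in> P" if "s \<in> translates p" using that p mult_P by blast
  then show "coord ((zk' o\<^sub>L (zk o\<^sub>L cre p a)) x) s = coord (cre p a x) s"
    using p a by (auto simp: coord_zk coord_zk' coord_cre)
qed

end

locale equivariant_representation = fock_representation G P X \<Psi>
  for G :: "('g, 'z) monoid_scheme" (structure) and P and X :: "'g \<Rightarrow> 'h::complex_hilbert bop set"
    and \<Psi> :: "('g, 'h) mod_op \<Rightarrow> 'k::complex_hilbert bop" +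
  fixes \<delta>\<^sub>\<Psi> :: "'k bop \<Rightarrow> ('g univ_index, 'k) ell2 bop"
  assumes equivariant: "equivariant G S X \<Psi> \<delta>\<^sub>\<Psi>"
begin

lemma hilbert_ctx_simps [simp]:
  "alg hilbert_ctx = bounded_ops" "tens hilbert_ctx = bounded_ops" "elem hilbert_ctx = op_tensor"
  by (simp_all add: hilbert_ctx_def)

lemma cosystem_Psi: "cstar_cosystem G hilbert_ctx (\<Psi> ` toeplitz S X) \<delta>\<^sub>\<Psi>"
  using equivariant by (simp add: equivariant_def)

lemma cstar_image: "cstar_subalgebra bounded_ops (\<Psi> ` toeplitz S X)"
  and star_hom_delta: "star_hom bounded_ops bounded_ops (\<Psi> ` toeplitz S X) \<delta>\<^sub>\<Psi>"
  using cosystem_Psi by (simp_all add: cstar_cosystem_def)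

definition D where "D T = \<delta>\<^sub>\<Psi> (\<Psi> T)"

lemma D:
  assumes "T \<in> toeplitz S X" "T' \<in> toeplitz S X"
  shows D_clin: "clin (D T)" and D_add: "D (T \<oplus>\<^bsub>ops\<^esub> T') = D T + D T'"
    and D_mult: "D (T \<otimes>\<^bsub>ops\<^esub> T') = D T o\<^sub>L D T'"
    and D_smult: "D (a \<odot>\<^bsub>ops\<^esub> T) = scale_op a (D T)"
  using star_hom_delta assms unfolding D_def Psi_add [OF assms] Psi_mult [OF assms] Psi_smult [OF assms]
  by (auto simp: star_hom_def alg_hom_def bounded_ops_def image_subset_iff clinear_ops_iff_clin)

lemma D_creation: "p \<in> P \<Longrightarrow> \<xi> \<in> X p \<Longrightarrow> D (creation S X p \<xi>) = op_tensor (c p \<xi>) (univ_unitary G p)"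
  using equivariant by (simp add: equivariant_def D_def)

lemma norm_D_le_Psi:
  fixes n :: nat
  assumes M: "\<And>i j. i < n \<Longrightarrow> j < n \<Longrightarrow> M i j \<in> toeplitz S X"
  shows "norm (matop {..<n} (\<lambda>i j. D (M i j))) \<le> norm (matop {..<n} (\<lambda>i j. \<Psi> (M i j)))"
  using represented_algebra.star_hom_completely_contractive [OF represented_algebra_bounded_ops cstar_image star_hom_delta,
      of n "\<lambda>i j. \<Psi> (M i j)"] M
  by (simp add: D_def mat_norm_bounded_ops)

lemma norm_Psi_le:
  fixes n :: nat
  assumes M: "\<And>i j. i < n \<Longrightarrow> j < n \<Longrightarrow> M i j \<in> toeplitz S X"
  shows "norm (matop {..<n} (\<lambda>i j. \<Psi> (M i j))) \<le> mat_norm ops n M"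
  by (rule ops.star_hom_completely_contractive [OF cstar_subalgebra_toeplitz star_hom_Psi M])

lemma norm_D_le: "T \<in> toeplitz S X \<Longrightarrow> norm (D T) \<le> norm (rep T)"
  using norm_D_le_Psi [of 1 "\<lambda>_ _. T"] norm_Psi_le [of 1 "\<lambda>_ _. T"] ops.mat_norm_one [of T] toeplitz_carrier
  by (auto simp: norm_matop_one simp del: One_nat_def)

text \<open>A compression of the coaction.  On the whole Toeplitz algebra it is merely completely
  contractive and linear.\<close>

definition Phi :: "('g, 'h) mod_op \<Rightarrow> ('g, 'k) ell2 bop" where
  "Phi T = zk' o\<^sub>L D T o\<^sub>L zk"

lemma plus_in_toeplitz: "T \<in> toeplitz_plus S X \<Longrightarrow> T \<in> toeplitz S X"
  using toeplitz_plus_subset by blast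

lemma Phi:
  assumes T: "T \<in> toeplitz S X" "T' \<in> toeplitz S X"
  shows Phi_clin: "clin (Phi T)" and Phi_add: "Phi (T \<oplus>\<^bsub>ops\<^esub> T') = Phi T + Phi T'"
    and Phi_smult: "Phi (a \<odot>\<^bsub>ops\<^esub> T) = scale_op a (Phi T)" and norm_Phi_le: "norm (Phi T) \<le> norm (rep T)"
proof -
  show "clin (Phi T)" unfolding Phi_def by (intro clin_comp clin_zk clin_zk' D_clin [OF T])
  show "Phi (T \<oplus>\<^bsub>ops\<^esub> T') = Phi T + Phi T'"
    by (rule blinfun_eqI) (simp add: Phi_def D_add T blf_simps)
  have "zk' (a *\<^sub>C y) = a *\<^sub>C zk' y" for y :: "('g univ_index, 'k) ell2"
    using clin_zk' unfolding clin_def by blast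
  then show "Phi (a \<odot>\<^bsub>ops\<^esub> T) = scale_op a (Phi T)"
    by (intro blinfun_eqI) (simp add: Phi_def D_smult [OF T] scale_op_apply)
  have "norm (Phi T) \<le> (1 * norm (D T)) * 1"
    unfolding Phi_def
    by (intro order_trans [OF norm_blinfun_compose] mult_mono norm_zk_le norm_zk'_le mult_nonneg_nonneg) auto
  then show "norm (Phi T) \<le> norm (rep T)" using norm_D_le [OF T(1)] by simp
qed

lemma Phi_creation: "p \<in> P \<Longrightarrow> \<xi> \<in> X p \<Longrightarrow> Phi (creation S X p \<xi>) = cre p (c p \<xi>)"
  by (simp add: Phi_def D_creation op_tensor_zk c_clin zk'_zk_cre blinfun_compose_assoc)

lemma toeplitz_plus_maps_into:
  fixes f :: "('g, 'h) mod_op \<Rightarrow> 'v::real_normed_vector"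
  assumes T: "T \<in> toeplitz_plus S X" and V: "subspace V" "closed V"
    and base: "\<And>p \<xi>. p \<in> P \<Longrightarrow> \<xi> \<in> X p \<Longrightarrow> f (creation S X p \<xi>) \<in> V"
    and add: "\<And>a b. a \<in> toeplitz_plus S X \<Longrightarrow> b \<in> toeplitz_plus S X \<Longrightarrow> f (a \<oplus>\<^bsub>ops\<^esub> b) = f a + f b"
    and smult: "\<And>a z. a \<in> toeplitz_plus S X \<Longrightarrow> f a \<in> V \<Longrightarrow> f (z \<odot>\<^bsub>ops\<^esub> a) \<in> V"
    and bound: "\<And>a. a \<in> toeplitz_plus S X \<Longrightarrow> norm (f a) \<le> K * norm (rep a)"
  shows "f T \<in> V"
proof (rule ops.closed_span_maps_into [OF creations_subset V, where K = K and f = f and a = T, folded toeplitz_plus_eq])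
  show "f a \<in> V" if "a \<in> creations" for a using that base by (auto simp: creations_def)
qed (fact T add smult bound)+

text \<open>The invariance of the subspace under the generators passes to their closed
  span.\<close>

lemma D_zk:
  assumes T: "T \<in> toeplitz_plus S X"
  shows "D T o\<^sub>L zk = zk o\<^sub>L Phi T"
proof -
  have "(D T o\<^sub>L zk) - (zk o\<^sub>L Phi T) \<in> {0}"
  proof (rule toeplitz_plus_maps_into [OF T, where K = 2 and f = "\<lambda>T. (D T o\<^sub>L zk) - (zk o\<^sub>L Phi T)"])
    show "(D (creation S X p \<xi>) o\<^sub>L zk) - (zk o\<^sub>L Phi (creation S X p \<xi>)) \<in> {0}" if "p \<in> P" "\<xi> \<in> X p" for p \<xi>
      using that by (simp add: D_creation Phi_creation op_tensor_zk c_clin)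
    fix a assume "a \<in> toeplitz_plus S X"
    then have a: "a \<in> toeplitz S X" by (rule plus_in_toeplitz)
    have "norm (D a o\<^sub>L (zk :: ('g, 'k) ell2 \<Rightarrow>\<^sub>L _)) \<le> norm (D a) * 1"
      by (intro order_trans [OF norm_blinfun_compose] mult_mono norm_zk_le) auto
    moreover have "norm (zk o\<^sub>L Phi a) \<le> 1 * norm (Phi a)"
      by (intro order_trans [OF norm_blinfun_compose] mult_mono norm_zk_le) auto
    ultimately show "norm ((D a o\<^sub>L zk) - (zk o\<^sub>L Phi a)) \<le> 2 * norm (rep a)"
      using norm_triangle_ineq4 [of "D a o\<^sub>L zk" "zk o\<^sub>L Phi a"] norm_D_le [OF a] norm_Phi_le [OF a a] by linarith
    show "(D (z \<odot>\<^bsub>ops\<^esub> a) o\<^sub>L zk) - (zk o\<^sub>L Phi (z \<odot>\<^bsub>ops\<^esub> a)) \<in> {0}" if "(D a o\<^sub>L zk) - (zk o\<^sub>L Phi a) \<in> {0}" for z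
    proof -
      have e: "D a o\<^sub>L zk = zk o\<^sub>L Phi a" using that by simp
      have "D a (zk x) = zk (Phi a x)" for x using arg_cong [OF e, of "\<lambda>T. blinfun_apply T x"] by simp
      moreover have "zk (z *\<^sub>C y) = z *\<^sub>C zk y" for y :: "('g, 'k) ell2" using clin_zk unfolding clin_def by blast
      ultimately have "D (z \<odot>\<^bsub>ops\<^esub> a) o\<^sub>L zk = zk o\<^sub>L Phi (z \<odot>\<^bsub>ops\<^esub> a)"
        by (intro blinfun_eqI) (simp add: D_smult [OF a a] Phi_smult [OF a a] scale_op_apply)
      then show ?thesis by simp
    qed
    fix b assume "b \<in> toeplitz_plus S X"
    then have b: "b \<in> toeplitz S X" by (rule plus_in_toeplitz)
    show "(D (a \<oplus>\<^bsub>ops\<^esub> b) o\<^sub>L zk) - (zk o\<^sub>L Phi (a \<oplus>\<^bsub>ops\<^esub> b)) = (D a o\<^sub>L zk) - (zk o\<^sub>L Phi a) + ((D b o\<^sub>L zk) - (zk o\<^sub>L Phi b))"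
      by (simp add: D_add a b Phi_add comp.add_left comp.add_right)
  qed (auto simp: subspace_def)
  then show ?thesis by simp
qed

lemma Phi_mult:
  assumes "T \<in> toeplitz_plus S X" "T' \<in> toeplitz_plus S X"
  shows "Phi (T \<otimes>\<^bsub>ops\<^esub> T') = Phi T o\<^sub>L Phi T'"
proof -
  have "Phi (T \<otimes>\<^bsub>ops\<^esub> T') = zk' o\<^sub>L (D T o\<^sub>L (D T' o\<^sub>L zk))"
    unfolding Phi_def D_mult [OF plus_in_toeplitz [OF assms(1)] plus_in_toeplitz [OF assms(2)]] blinfun_compose_assoc ..
  also have "\<dots> = Phi T o\<^sub>L Phi T'"
    unfolding D_zk [OF assms(2)] unfolding Phi_def [of T] blinfun_compose_assoc ..
  finally show ?thesis .
qed

lemma hat_vecs: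
  assumes T: "T \<in> carrier ops" and Z: "Z \<in> vecs"
  shows "hat T Z \<in> vecs"
proof -
  obtain T' where "is_mod_adjoint P X T T'" using T unfolding adjointable_iff ..
  then show ?thesis using Z by (rule is_mod_adjoint_hat_in)
qed

text \<open>Both sides are continuous and linear in \<open>T\<close>, and agree on creation
  operators.\<close>

lemma Phi_U:
  assumes T: "T \<in> toeplitz_plus S X" and Z: "Z \<in> vecs"
  shows "Phi T o\<^sub>L U Z = U (hat T Z)"
proof -
  have hv: "hat a Z \<in> vecs" if "a \<in> toeplitz S X" for a
    using hat_vecs [OF _ Z] that toeplitz_carrier by blast
  have "(Phi T o\<^sub>L U Z) - U (hat T Z) \<in> {0}"
  proof (rule toeplitz_plus_maps_into [OF T, where K = "2 * norm Z" and f = "\<lambda>T. (Phi T o\<^sub>L U Z) - U (hat T Z)"])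
    show "(Phi (creation S X p \<xi>) o\<^sub>L U Z) - U (hat (creation S X p \<xi>) Z) \<in> {0}" if "p \<in> P" "\<xi> \<in> X p" for p \<xi>
      using that by (simp add: Phi_creation hat_creation Z cre_U)
    fix a assume "a \<in> toeplitz_plus S X"
    then have a: "a \<in> toeplitz S X" by (rule plus_in_toeplitz)
    then have ac: "a \<in> carrier ops" using toeplitz_carrier by blast
    have "norm (Phi a o\<^sub>L U Z) \<le> norm (rep a) * norm Z"
      using order_trans [OF norm_blinfun_compose [of "Phi a" "U Z"] mult_right_mono [OF norm_Phi_le [OF a a] norm_ge_zero]]
      by (simp add: norm_U [OF Z])
    moreover have "norm (U (hat a Z)) \<le> norm (rep a) * norm Z"
      using norm_blinfun_compose [of "rep a" Z] by (simp add: norm_U hv a rep_comp [OF ac Z])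
    ultimately show "norm ((Phi a o\<^sub>L U Z) - U (hat a Z)) \<le> 2 * norm Z * norm (rep a)"
    proof -
      have "2 * norm Z * norm (rep a) = norm (rep a) * norm Z + norm (rep a) * norm Z" by simp
      moreover assume "norm (Phi a o\<^sub>L U Z) \<le> norm (rep a) * norm Z" "norm (U (hat a Z)) \<le> norm (rep a) * norm Z"
      ultimately show ?thesis using norm_triangle_ineq4 [of "Phi a o\<^sub>L U Z" "U (hat a Z)"] by linarith
    qed
    show "(Phi (z \<odot>\<^bsub>ops\<^esub> a) o\<^sub>L U Z) - U (hat (z \<odot>\<^bsub>ops\<^esub> a) Z) \<in> {0}" if "(Phi a o\<^sub>L U Z) - U (hat a Z) \<in> {0}" for z
      using that by (simp add: Phi_smult [OF a a] hat_smult ac Z U_linear(2) hv a scale_op_eq blinfun_compose_assoc)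
    fix b assume "b \<in> toeplitz_plus S X"
    then have b: "b \<in> toeplitz S X" by (rule plus_in_toeplitz)
    then have bc: "b \<in> carrier ops" using toeplitz_carrier by blast
    show "(Phi (a \<oplus>\<^bsub>ops\<^esub> b) o\<^sub>L U Z) - U (hat (a \<oplus>\<^bsub>ops\<^esub> b) Z)
        = (Phi a o\<^sub>L U Z) - U (hat a Z) + ((Phi b o\<^sub>L U Z) - U (hat b Z))"
      by (simp add: Phi_add a b hat_ops(1) ac bc Z U_linear(1) hv comp.add_left)
  qed (auto simp: subspace_def)
  then show ?thesis by simp
qed

text \<open>The matrix norm of adjointable operators is computed on columns of module elements,
  \<open>U\<close> preserves the norms of such columns, and it intertwines \<open>T\<close> with
  \<open>Phi T\<close>.\<close>

lemma norm_le_Phi: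
  fixes n :: nat
  assumes M: "\<And>i j. i < n \<Longrightarrow> j < n \<Longrightarrow> M i j \<in> toeplitz_plus S X"
  shows "mat_norm ops n M \<le> norm (matop {..<n} (\<lambda>i j. Phi (M i j)))"
proof -
  have Mc: "M i j \<in> carrier ops" if "i < n" "j < n" for i j
    using M [OF that] plus_in_toeplitz toeplitz_carrier by blast
  have "norm (matop {..<n} (\<lambda>i j. rep (M i j))) \<le> norm (matop {..<n} (\<lambda>i j. Phi (M i j)))"
  proof (rule norm_matop_rep_le [OF Mc norm_ge_zero])
    fix Z assume Z: "\<And>j. j < n \<Longrightarrow> Z j \<in> vecs"
    have h: "hat (M i j) (Z j) \<in> vecs" if "i < n" "j < n" for i j
      by (rule hat_vecs [OF Mc [OF that] Z [OF that(2)]])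
    let ?W = "\<lambda>i. \<Sum>j<n. hat (M i j) (Z j)"
    have "matop {..<n} (\<lambda>i j. rep (M i j)) o\<^sub>L col_op n Z = col_op n ?W"
      unfolding matop_col_op unfolding col_op_def using Mc Z by (intro sum.cong) (auto simp: rep_comp)
    moreover have "U (?W i) = (\<Sum>j<n. U (hat (M i j) (Z j)))" if "i < n" for i
      by (rule U_sum) (use h that in auto)
    then have "matop {..<n} (\<lambda>i j. Phi (M i j)) o\<^sub>L col_op n (\<lambda>i. U (Z i)) = col_op n (\<lambda>i. U (?W i))"
      unfolding matop_col_op unfolding col_op_def using M Z by (intro sum.cong) (auto simp: Phi_U)
    moreover have "norm (col_op n (\<lambda>i. U (?W i))) = norm (col_op n ?W)"
      using h by (intro norm_col_U subspace_sum [OF subspace_vecs]) auto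
    ultimately show "norm (matop {..<n} (\<lambda>i j. rep (M i j)) o\<^sub>L col_op n Z)
        \<le> norm (matop {..<n} (\<lambda>i j. Phi (M i j))) * norm (col_op n Z)"
      using norm_blinfun_compose [of "matop {..<n} (\<lambda>i j. Phi (M i j))" "col_op n (\<lambda>i. U (Z i))"]
      by (simp add: norm_col_U Z)
  qed
  then show ?thesis using mat_norm_adjointable [OF Mc] by simp
qed

lemma norm_Phi_le_D:
  fixes n :: nat
  assumes M: "\<And>i j. i < n \<Longrightarrow> j < n \<Longrightarrow> M i j \<in> toeplitz S X"
  shows "norm (matop {..<n} (\<lambda>i j. Phi (M i j))) \<le> norm (matop {..<n} (\<lambda>i j. D (M i j)))"
  unfolding Phi_def by (rule matop_sandwich_le) (auto simp: clin_zk clin_zk' norm_zk_le norm_zk'_le)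

text \<open>The four norms form a closed cycle of inequalities, through \<open>Phi\<close>,
  \<open>\<delta>\<^sub>\<Psi> \<circ> \<Psi>\<close> and \<open>\<Psi>\<close>.\<close>

lemma completely_isometric:
  shows "completely_isometric ops bounded_ops (toeplitz_plus S X) Phi"
    and "completely_isometric ops bounded_ops (toeplitz_plus S X) \<Psi>"
  unfolding completely_isometric_def mat_norm_bounded_ops
proof (safe)
  fix n :: nat and M
  assume "\<forall>i<n. \<forall>j<n. M i j \<in> toeplitz_plus S X"
  then have M: "\<And>i j. i < n \<Longrightarrow> j < n \<Longrightarrow> M i j \<in> toeplitz_plus S X" by blast
  then have M': "\<And>i j. i < n \<Longrightarrow> j < n \<Longrightarrow> M i j \<in> toeplitz S X" by (simp add: plus_in_toeplitz)
  note le = norm_le_Phi [of n M, OF M] norm_Phi_le_D [of n M, OF M'] norm_D_le_Psi [of n M, OF M'] norm_Psi_le [of n M, OF M']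
  show "norm (matop {..<n} (\<lambda>i j. Phi (M i j))) = mat_norm ops n M" using le by linarith
  show "norm (matop {..<n} (\<lambda>i j. \<Psi> (M i j))) = mat_norm ops n M" using le by linarith
qed

lemma alg_hom_Phi: "alg_hom ops bounded_ops (toeplitz_plus S X) Phi"
  unfolding alg_hom_def
proof (intro conjI ballI allI image_subsetI)
  fix a b z assume a: "a \<in> toeplitz_plus S X"
  note a' = plus_in_toeplitz [OF a]
  show "Phi a \<in> carrier bounded_ops"
    using Phi_clin [OF a' a'] by (simp add: bounded_ops_def clinear_ops_iff_clin)
  show "Phi (z \<odot>\<^bsub>ops\<^esub> a) = z \<odot>\<^bsub>bounded_ops\<^esub> Phi a"
    using Phi_smult [OF a' a'] by (simp add: bounded_ops_def)
  assume b: "b \<in> toeplitz_plus S X"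
  show "Phi (a \<oplus>\<^bsub>ops\<^esub> b) = Phi a \<oplus>\<^bsub>bounded_ops\<^esub> Phi b"
    using Phi_add [OF a' plus_in_toeplitz [OF b]] by (simp add: bounded_ops_def)
  show "Phi (a \<otimes>\<^bsub>ops\<^esub> b) = Phi a \<otimes>\<^bsub>bounded_ops\<^esub> Phi b"
    using Phi_mult [OF a b] by (simp add: bounded_ops_def)
qed

lemma clin_semigroup_cstar: "b \<in> semigroup_cstar S \<Longrightarrow> clin b"
  and semigroup_isometry_in: "p \<in> P \<Longrightarrow> semigroup_isometry S p \<in> semigroup_cstar S"
proof -
  interpret R: represented_algebra "bounded_ops :: 'g l2 bop op_alg" "\<lambda>T. T" by (rule represented_algebra_bounded_ops)
  have F: "semigroup_isometry S ` P \<subseteq> carrier bounded_ops"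
    by (auto simp: semigroup_isometry_eq bounded_ops_def clinear_ops_iff_clin clin_cre clin_id)
  show "clin b" if "b \<in> semigroup_cstar S"
  proof -
    have "b \<in> carrier bounded_ops"
      using that R.cstar_gen_minimal [OF F R.cstar_subalgebra_carrier F] by (auto simp: semigroup_cstar_def)
    then show ?thesis by (simp add: bounded_ops_def clinear_ops_iff_clin)
  qed
  show "semigroup_isometry S p \<in> semigroup_cstar S" if "p \<in> P"
    using that R.cstar_gen_superset [OF F] by (auto simp: semigroup_cstar_def)
qed

lemma Phi_value: "p \<in> P \<Longrightarrow> \<xi> \<in> X p \<Longrightarrow> Phi (creation S X p \<xi>) = op_tensor (c p \<xi>) (semigroup_isometry S p)"
  by (simp add: Phi_creation semigroup_isometry_eq op_tensor_vp c_clin)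

lemma Phi_range: "Phi ` toeplitz_plus S X \<subseteq> spatial_tensor hilbert_ctx (\<Psi> ` toeplitz S X) (semigroup_cstar S)"
proof safe
  interpret R: represented_algebra "bounded_ops :: ('g, 'k) ell2 bop op_alg" "\<lambda>T. T" by (rule represented_algebra_bounded_ops)
  let ?E = "{op_tensor a b | a b. a \<in> \<Psi> ` toeplitz S X \<and> b \<in> semigroup_cstar S}"
  have E: "?E \<subseteq> carrier bounded_ops"
    using Psi_clin by (auto simp: bounded_ops_def clinear_ops_iff_clin clin_op_tensor clin_semigroup_cstar)
  have e: "spatial_tensor hilbert_ctx (\<Psi> ` toeplitz S X) (semigroup_cstar S) = closed_span bounded_ops ?E"
    by (simp add: spatial_tensor_def)
  note sp = R.linear_subspaceD [OF R.linear_subspace_closed_span [OF E]]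
  fix T assume T: "T \<in> toeplitz_plus S X"
  show "Phi T \<in> spatial_tensor hilbert_ctx (\<Psi> ` toeplitz S X) (semigroup_cstar S)"
    unfolding e
  proof (rule toeplitz_plus_maps_into [OF T, where K = 1 and f = Phi])
    show "subspace (closed_span bounded_ops ?E)" "closed (closed_span bounded_ops ?E)"
      using R.closed_image_closed_span [OF E] by simp_all
    fix p \<xi> assume "p \<in> P" "\<xi> \<in> X p"
    then have "Phi (creation S X p \<xi>) \<in> ?E"
      using Phi_value semigroup_isometry_in creation_in_toeplitz by blast
    then show "Phi (creation S X p \<xi>) \<in> closed_span bounded_ops ?E" using R.closed_span_superset [OF E] by blast
  next
    fix a z assume a: "a \<in> toeplitz_plus S X"
    note a' = plus_in_toeplitz [OF a]
    show "norm (Phi a) \<le> 1 * norm (rep a)" using norm_Phi_le [OF a' a'] by simp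
    assume "Phi a \<in> closed_span bounded_ops ?E"
    from sp(4) [OF this, of z] show "Phi (z \<odot>\<^bsub>ops\<^esub> a) \<in> closed_span bounded_ops ?E"
      by (simp add: Phi_smult [OF a' a'] bounded_ops_def)
  qed (simp add: Phi_add plus_in_toeplitz)
qed

end

section \<open>The canonical coaction\<close>

context equivariant_representation
begin

text \<open>Outside \<open>P\<close> the module has no fibre; the identity keeps the family
  unitary.\<close>

definition uu :: "'g \<Rightarrow> 'g univ_index l2 bop" where
  "uu p = (if p \<in> P then univ_unitary G p else id_blinfun)"

lemma uu:
  shows "adjoint_pair (uu p) (adj (uu p))" "adj (uu p) o\<^sub>L uu p = id_blinfun" "uu p o\<^sub>L adj (uu p) = id_blinfun"
proof -
  have "adjoint_pair (uu p) (adj (uu p)) \<and> adj (uu p) o\<^sub>L uu p = id_blinfun \<and> uu p o\<^sub>L adj (uu p) = id_blinfun"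
  proof (cases "p \<in> P")
    case True
    obtain V where V: "adjoint_pair (univ_unitary G p) V" "V o\<^sub>L univ_unitary G p = id_blinfun"
      "univ_unitary G p o\<^sub>L V = id_blinfun"
      by (rule univ_unitary_adjoint [OF in_carrier [OF True]])
    then show ?thesis using True adj_eqI [OF V(1)] by (simp add: uu_def)
  next
    case False
    then show ?thesis using adj_eqI [OF adjoint_pair_id [where 'a = "'g univ_index l2"]]
      by (auto simp: uu_def adjoint_pair_id intro: blinfun_eqI)
  qed
  then show "adjoint_pair (uu p) (adj (uu p))" "adj (uu p) o\<^sub>L uu p = id_blinfun" "uu p o\<^sub>L adj (uu p) = id_blinfun"
    by auto
qed

sublocale tw: module_twist P X "TYPE('g univ_index)" uu "\<lambda>p. adj (uu p)"
  by (intro module_twist.intro module_tensor module_twist_axioms.intro uu)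

abbreviation "ops2 \<equiv> adjointable_ops (P \<times> (UNIV :: 'g univ_index set)) (X \<circ> fst)"

sublocale ops2: represented_algebra ops2 tw.amp.rep
  by (rule tw.amp.represented_algebra_adjointable)

text \<open>A creation operator of degree \<open>p\<close> maps the fibre at \<open>r\<close> to
  that at \<open>p r\<close>, so that conjugation contributes \<open>u (p r) (u r)\<^sup>* = u
  p\<close> on every fibre.\<close>

lemma twist_creation:
  assumes p: "p \<in> P" and \<xi>: "\<xi> \<in> X p"
  shows "tw.twist (creation S X p \<xi>) = mod_op_tensor P X (creation S X p \<xi>) (univ_unitary G p)"
proof -
  let ?T = "creation S X p \<xi>"
  note T = creation_carrier [OF p \<xi>]
  note cu = clin_univ_unitary [OF in_carrier [OF p]]
  have cT: "clin (rep ?T)" by (rule ops.clin_rep [OF T])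
  have cid: "clin (id_blinfun :: 'g univ_index l2 bop)" by (rule clin_id)
  note c1 = tw.twist_carrier [OF T] and c2 = tw.mod_op_tensor_carrier [OF T cu]
  have "tw.amp.rep (tw.twist ?T) = tw.amp.rep (mod_op_tensor P X ?T (univ_unitary G p))"
  proof (rule tw.amp.operator_eqI)
    fix v assume "v \<in> tw.amp.null"
    then show "tw.amp.rep (tw.twist ?T) v = tw.amp.rep (mod_op_tensor P X ?T (univ_unitary G p)) v"
      by (simp add: tw.amp.rep_null c1 c2)
  next
    fix W assume W: "W \<in> tw.amp.vecs"
    show "tw.amp.rep (tw.twist ?T) o\<^sub>L W = tw.amp.rep (mod_op_tensor P X ?T (univ_unitary G p)) o\<^sub>L W"
    proof (rule tw.eq_on_vecs_if_on_generators [OF _ W])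
      fix r y and j :: "'g univ_index" assume r: "r \<in> P" and y: "y \<in> X r"
      let ?x = "delta j" and ?x' = "adj (uu r) (delta j)"
      have Q: "rep ?T o\<^sub>L (eps r o\<^sub>L y) = eps (p \<otimes> r) o\<^sub>L (\<xi> o\<^sub>L y)"
        using rep_comp [OF T eps_in_vecs [OF r y]] hat_creation [OF p \<xi> eps_in_vecs [OF r y]]
          cre_eps [OF p r fibre_clin [OF p \<xi>]] by simp
      have "tw.twist_op (rep ?T) o\<^sub>L tw.tmap (eps r o\<^sub>L y) ?x
          = tw.block uu o\<^sub>L (tw.op2 (rep ?T) id_blinfun o\<^sub>L (tw.block (\<lambda>p. adj (uu p)) o\<^sub>L tw.tmap (eps r o\<^sub>L y) ?x))"
        unfolding tw.twist_op_def blinfun_compose_assoc ..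
      also have "\<dots> = tw.block uu o\<^sub>L (tw.op2 (rep ?T) id_blinfun o\<^sub>L tw.tmap (eps r o\<^sub>L y) ?x')"
        unfolding tw.block_generator [where w = "\<lambda>p. adj (uu p)" and w' = uu, OF adjoint_pair_sym [OF uu(1)] uu(3)] ..
      also have "\<dots> = tw.block uu o\<^sub>L tw.tmap (eps (p \<otimes> r) o\<^sub>L (\<xi> o\<^sub>L y)) ?x'"
        unfolding tw.op2_tmap [OF cT cid] Q by simp
      also have "\<dots> = tw.tmap (eps (p \<otimes> r) o\<^sub>L (\<xi> o\<^sub>L y)) (uu (p \<otimes> r) ?x')"
        by (rule tw.block_generator [where w = uu and w' = "\<lambda>p. adj (uu p)", OF uu(1) uu(2)])
      also have "uu (p \<otimes> r) ?x' = univ_unitary G p ((uu r o\<^sub>L adj (uu r)) ?x)"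
        using p r by (simp add: uu_def mult_P univ_unitary_mult in_carrier)
      also have "\<dots> = univ_unitary G p ?x" unfolding uu(3) by simp
      also have "tw.tmap (eps (p \<otimes> r) o\<^sub>L (\<xi> o\<^sub>L y)) (univ_unitary G p ?x)
          = tw.op2 (rep ?T) (univ_unitary G p) o\<^sub>L tw.tmap (eps r o\<^sub>L y) ?x"
        unfolding tw.op2_tmap [OF cT cu] Q ..
      finally show "tw.amp.rep (tw.twist ?T) o\<^sub>L tw.tmap (eps r o\<^sub>L y) ?x
          = tw.amp.rep (mod_op_tensor P X ?T (univ_unitary G p)) o\<^sub>L tw.tmap (eps r o\<^sub>L y) ?x"
        unfolding tw.rep_twist [OF T] tw.rep_mod_op_tensor [OF T cu] .
    qed
  qed
  then show ?thesis by (rule inj_onD [OF ops2.rep_inj _ c1 c2])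
qed

lemma fock_ctx_simps:
  "alg (fock_ctx S X :: (_, ('g \<times> 'g univ_index, 'h) mod_op, _) tensor_ctx) = ops"
  "tens (fock_ctx S X) = ops2"
  "elem (fock_ctx S X) = mod_op_tensor P X"
  by (simp_all add: fock_ctx_def module_ctx_def)

lemma clin_full: "b \<in> full_group_cstar G \<Longrightarrow> clin b"
  and univ_unitary_in_full: "g \<in> carrier G \<Longrightarrow> univ_unitary G g \<in> full_group_cstar G"
proof -
  interpret R: represented_algebra "bounded_ops :: 'g univ_index l2 bop op_alg" "\<lambda>T. T" by (rule represented_algebra_bounded_ops)
  have F: "univ_unitary G ` carrier G \<subseteq> carrier bounded_ops"
    by (auto simp: bounded_ops_def clinear_ops_iff_clin clin_univ_unitary)
  show "clin b" if "b \<in> full_group_cstar G"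
  proof -
    have "b \<in> carrier bounded_ops"
      using that R.cstar_gen_minimal [OF F R.cstar_subalgebra_carrier F] by (auto simp: full_group_cstar_def)
    then show ?thesis by (simp add: bounded_ops_def clinear_ops_iff_clin)
  qed
  show "univ_unitary G g \<in> full_group_cstar G" if "g \<in> carrier G"
    using that R.cstar_gen_superset [OF F] by (auto simp: full_group_cstar_def)
qed

lemma plus_carrier: "T \<in> toeplitz_plus S X \<Longrightarrow> T \<in> carrier ops"
  using plus_in_toeplitz toeplitz_carrier by blast

interpretation twist_op: star_rep "{T :: ('g, 'h) ell2 bop. clin T}" tw.twist_op
  by (rule tw.twist_op_star_rep)

lemma rep_twist_ops:
  assumes T: "T \<in> carrier ops" and T': "T' \<in> carrier ops"
  shows "tw.amp.rep (tw.twist (T \<oplus>\<^bsub>ops\<^esub> T')) = tw.amp.rep (tw.twist T) + tw.amp.rep (tw.twist T')"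
    and "tw.amp.rep (tw.twist (T \<otimes>\<^bsub>ops\<^esub> T')) = tw.amp.rep (tw.twist T) o\<^sub>L tw.amp.rep (tw.twist T')"
    and "tw.amp.rep (tw.twist (z \<odot>\<^bsub>ops\<^esub> T)) = scale_op z (tw.amp.rep (tw.twist T))"
    and "norm (tw.amp.rep (tw.twist T)) \<le> norm (rep T)"
  using ops.clin_rep [OF T] ops.clin_rep [OF T'] twist_op.rep_contractive [of "rep T"]
  by (simp_all add: tw.rep_twist T T' ops.add_closed ops.mult_closed ops.smult_closed ops.rep_add ops.rep_mult ops.rep_smult
      twist_op.rep_add twist_op.rep_mult twist_op.rep_scale)

lemma alg_hom_twist: "alg_hom ops ops2 (toeplitz_plus S X) tw.twist"
  unfolding alg_hom_def
proof (intro conjI ballI allI image_subsetI)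
  fix a b z assume a: "a \<in> toeplitz_plus S X"
  note ac = plus_carrier [OF a]
  note ta = tw.twist_carrier [OF ac]
  show "tw.twist a \<in> carrier ops2" by (rule ta)
  show "tw.twist (z \<odot>\<^bsub>ops\<^esub> a) = z \<odot>\<^bsub>ops2\<^esub> tw.twist a"
    by (rule inj_onD [OF ops2.rep_inj])
      (simp_all add: rep_twist_ops(3) [OF ac ac] ops2.rep_smult ta ops2.smult_closed tw.twist_carrier ops.smult_closed ac)
  assume b: "b \<in> toeplitz_plus S X"
  note bc = plus_carrier [OF b]
  note tb = tw.twist_carrier [OF bc]
  show "tw.twist (a \<oplus>\<^bsub>ops\<^esub> b) = tw.twist a \<oplus>\<^bsub>ops2\<^esub> tw.twist b"
    by (rule inj_onD [OF ops2.rep_inj])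
      (simp_all add: rep_twist_ops(1) [OF ac bc] ops2.rep_add ta tb ops2.add_closed tw.twist_carrier ops.add_closed ac bc)
  show "tw.twist (a \<otimes>\<^bsub>ops\<^esub> b) = tw.twist a \<otimes>\<^bsub>ops2\<^esub> tw.twist b"
    by (rule inj_onD [OF ops2.rep_inj])
      (simp_all add: rep_twist_ops(2) [OF ac bc] ops2.rep_mult ta tb ops2.mult_closed tw.twist_carrier ops.mult_closed ac bc)
qed

abbreviation "elems \<equiv> {mod_op_tensor P X a b | a b. a \<in> toeplitz_plus S X \<and> b \<in> full_group_cstar G}"

lemma elems_subset: "elems \<subseteq> carrier ops2"
  using tw.mod_op_tensor_carrier plus_carrier clin_full by blast

lemma spatial_tensor_eq:
  "spatial_tensor (fock_ctx S X) (toeplitz_plus S X) (full_group_cstar G) = closed_span ops2 elems"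
  by (simp add: spatial_tensor_def fock_ctx_simps)

text \<open>The representation of the spatial tensor product is a closed subspace containing the
  images of the creation operators.\<close>

lemma twist_in_spatial_tensor:
  assumes T: "T \<in> toeplitz_plus S X"
  shows "tw.twist T \<in> closed_span ops2 elems"
proof -
  let ?V = "tw.amp.rep ` closed_span ops2 elems"
  note sp = ops2.linear_subspaceD [OF ops2.linear_subspace_closed_span [OF elems_subset]]
  have "tw.amp.rep (tw.twist T) \<in> ?V"
  proof (rule toeplitz_plus_maps_into [OF T, where K = 1 and f = "\<lambda>T. tw.amp.rep (tw.twist T)"])
    show "subspace ?V" "closed ?V" by (rule ops2.closed_image_closed_span [OF elems_subset])+
    fix p \<xi> assume p: "p \<in> P" "\<xi> \<in> X p"
    then have "tw.twist (creation S X p \<xi>) \<in> elems"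
      using twist_creation [OF p] creation_in_toeplitz_plus [OF p] univ_unitary_in_full [OF in_carrier [OF p(1)]] by blast
    then show "tw.amp.rep (tw.twist (creation S X p \<xi>)) \<in> ?V"
      using ops2.closed_span_superset [OF elems_subset] by blast
  next
    fix a z assume a: "a \<in> toeplitz_plus S X"
    note ac = plus_carrier [OF a]
    show "norm (tw.amp.rep (tw.twist a)) \<le> 1 * norm (rep a)" using rep_twist_ops(4) [OF ac ac] by simp
    assume "tw.amp.rep (tw.twist a) \<in> ?V"
    then obtain t where t: "t \<in> closed_span ops2 elems" "tw.amp.rep (tw.twist a) = tw.amp.rep t" by blast
    have "tw.amp.rep (tw.twist (z \<odot>\<^bsub>ops\<^esub> a)) = tw.amp.rep (z \<odot>\<^bsub>ops2\<^esub> t)"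
      using t sp(1) by (simp add: rep_twist_ops(3) [OF ac ac] ops2.rep_smult subsetD)
    then show "tw.amp.rep (tw.twist (z \<odot>\<^bsub>ops\<^esub> a)) \<in> ?V" using sp(4) [OF t(1), of z] by blast
  next
    fix a b assume "a \<in> toeplitz_plus S X" "b \<in> toeplitz_plus S X"
    then show "tw.amp.rep (tw.twist (a \<oplus>\<^bsub>ops\<^esub> b)) = tw.amp.rep (tw.twist a) + tw.amp.rep (tw.twist b)"
      by (intro rep_twist_ops(1) plus_carrier)
  qed
  then obtain t where t: "t \<in> closed_span ops2 elems" "tw.amp.rep (tw.twist T) = tw.amp.rep t" by blast
  then have "tw.twist T = t"
    using sp(1) tw.twist_carrier [OF plus_carrier [OF T]] by (intro ops2.rep_inj [THEN inj_onD, OF t(2)]) auto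
  then show ?thesis using t(1) by simp
qed

text \<open>Every creation operator lies in one of the spectral subspaces.\<close>

lemma closed_span_spectral:
  "closed_span ops (\<Union>g\<in>carrier G. {a \<in> toeplitz_plus S X. tw.twist a = mod_op_tensor P X a (univ_unitary G g)})
    = toeplitz_plus S X" (is "closed_span ops ?A = _")
proof
  note sub = ops.closed_subalgebraD(1,2) [OF closed_subalgebra_toeplitz_plus]
  have A: "?A \<subseteq> carrier ops" using plus_carrier by blast
  show "closed_span ops ?A \<subseteq> toeplitz_plus S X" by (rule ops.closed_span_minimal [OF sub]) blast
  have "creations \<subseteq> ?A"
    using creation_in_toeplitz_plus twist_creation in_carrier unfolding creations_def by blast
  then have "closed_span ops creations \<subseteq> closed_span ops ?A"
    using ops.closed_span_superset [OF A]
    by (intro ops.closed_span_minimal ops.linear_subspace_closed_span ops.norm_closure_closed_span A) blast+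
  then show "toeplitz_plus S X \<subseteq> closed_span ops ?A" by (simp add: toeplitz_plus_eq)
qed

lemma cosystem_twist: "cosystem G (fock_ctx S X) (toeplitz_plus S X) tw.twist"
  unfolding cosystem_def coaction_axioms_def spatial_tensor_eq fock_ctx_simps
proof (intro conjI closed_subalgebra_toeplitz_plus alg_hom_twist closed_span_spectral image_subsetI twist_in_spatial_tensor)
  show "completely_isometric ops ops2 (toeplitz_plus S X) tw.twist"
    unfolding completely_isometric_def using tw.mat_norm_twist plus_carrier by blast
qed

section \<open>The C*-cover\<close>

lemma alg_hom_Psi: "alg_hom ops bounded_ops (toeplitz_plus S X) \<Psi>"
  using star_hom_Psi plus_in_toeplitz unfolding star_hom_def alg_hom_def by blast

lemma norm_Psi_le_one: "T \<in> toeplitz S X \<Longrightarrow> norm (\<Psi> T) \<le> norm (rep T)"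
  using norm_Psi_le [of 1 "\<lambda>_ _. T"] ops.mat_norm_one [of T] toeplitz_carrier
  by (auto simp: norm_matop_one simp del: One_nat_def)

text \<open>The elements of the Toeplitz algebra that are mapped into the generated C*-algebra
  form a C*-subalgebra containing the creation operators.\<close>

lemma cstar_gen_image: "cstar_gen bounded_ops (\<Psi> ` toeplitz_plus S X) = \<Psi> ` toeplitz S X"
proof
  interpret R: represented_algebra "bounded_ops :: 'k bop op_alg" "\<lambda>T. T" by (rule represented_algebra_bounded_ops)
  let ?C = "cstar_gen bounded_ops (\<Psi> ` toeplitz_plus S X)"
  have F: "\<Psi> ` toeplitz_plus S X \<subseteq> carrier bounded_ops"
    using alg_hom_Psi unfolding alg_hom_def by blast
  show "?C \<subseteq> \<Psi> ` toeplitz S X"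
    by (rule R.cstar_gen_minimal [OF F cstar_image]) (use toeplitz_plus_subset in blast)
  have C: "cstar_subalgebra bounded_ops ?C" by (rule R.cstar_subalgebra_cstar_gen [OF F])
  interpret C: concrete_cstar ?C using R.concrete_cstar_image [OF C] by simp
  have sub: "closed_subalgebra ops (toeplitz S X)" using cstar_subalgebra_toeplitz by (simp add: cstar_subalgebra_def)
  note t = ops.linear_subspaceD [OF ops.closed_subalgebraD(1) [OF sub]] ops.closed_subalgebraD(3,4) [OF sub]
  let ?B = "{T \<in> toeplitz S X. \<Psi> T \<in> ?C}"
  have Bc: "?B \<subseteq> carrier ops" using t(1) by blast
  have z: "\<Psi> \<zero>\<^bsub>ops\<^esub> = 0" using norm_Psi_le_one [OF t(2)] by (simp add: ops.rep_zero)
  have closed: "a \<in> ?B" if a: "a \<in> carrier ops" "rep a \<in> closure (rep ` ?B)" for a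
  proof -
    have aT: "a \<in> toeplitz S X"
      by (rule t(6) [OF a(1)]) (use a(2) closure_mono [of "rep ` ?B" "rep ` toeplitz S X"] in blast)
    have "\<exists>y\<in>?C. dist y (\<Psi> a) < e" if e: "0 < e" for e
    proof -
      obtain b where b: "b \<in> ?B" "dist (rep b) (rep a) < e" using a(2) e unfolding closure_approachable by blast
      let ?d = "b \<oplus>\<^bsub>ops\<^esub> ((- 1) \<odot>\<^bsub>ops\<^esub> a)"
      have bT: "b \<in> toeplitz S X" using b(1) by simp
      have d: "?d \<in> toeplitz S X" by (intro t(3) t(4) bT aT)
      have "\<Psi> ?d = \<Psi> b - \<Psi> a"
        by (simp add: Psi_add bT t(4) aT Psi_smult [OF aT aT] scale_op_minus_one)
      moreover have "rep ?d = rep b - rep a"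
        using t(1) bT aT by (simp add: ops.rep_add ops.rep_smult ops.smult_closed subsetD scale_op_minus_one)
      ultimately show ?thesis using norm_Psi_le_one [OF d] b
        by (intro bexI [of _ "\<Psi> b"]) (auto simp: dist_norm intro: le_less_trans)
    qed
    then have "\<Psi> a \<in> closure ?C" unfolding closure_approachable by blast
    then show ?thesis using aT C.closed_B by simp
  qed
  have "cstar_subalgebra ops ?B"
    unfolding cstar_subalgebra_def closed_subalgebra_def linear_subspace_def
  proof (intro conjI ballI allI)
    show "norm_closure ops ?B = ?B"
      using ops.norm_closure_superset [OF Bc] closed unfolding ops.norm_closure_eq [OF Bc] by blast
    show "?B \<subseteq> carrier ops" by (rule Bc)
    show "\<zero>\<^bsub>ops\<^esub> \<in> ?B" using t(2) C.zero_B by (simp add: z)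
  next
    fix a w assume "a \<in> ?B"
    then have a: "a \<in> toeplitz S X" "\<Psi> a \<in> ?C" by auto
    show "w \<odot>\<^bsub>ops\<^esub> a \<in> ?B" using t(4) [OF a(1)] C.scale_B [OF a(2)] by (simp add: Psi_smult [OF a(1) a(1)])
    show "star ops a \<in> ?B" using star_in_toeplitz [OF a(1)] C.adj_B [OF a(2)] by (simp add: Psi_star [OF a(1) a(1)])
    fix b assume "b \<in> ?B"
    then have b: "b \<in> toeplitz S X" "\<Psi> b \<in> ?C" by auto
    show "a \<oplus>\<^bsub>ops\<^esub> b \<in> ?B" using t(3) [OF a(1) b(1)] C.add_B [OF a(2) b(2)] by (simp add: Psi_add a b)
    show "a \<otimes>\<^bsub>ops\<^esub> b \<in> ?B" using t(5) [OF a(1) b(1)] C.mult_B [OF a(2) b(2)] by (simp add: Psi_mult a b)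
  qed
  moreover have "creations \<subseteq> ?B"
    using creation_in_toeplitz creation_in_toeplitz_plus R.cstar_gen_superset [OF F] unfolding creations_def by blast
  ultimately have "toeplitz S X \<subseteq> ?B"
    unfolding toeplitz_eq by (intro ops.cstar_gen_minimal creations_subset)
  then show "\<Psi> ` toeplitz S X \<subseteq> ?C" by blast
qed

lemma (in concrete_cstar) scale_span_tensors:
  assumes t: "t \<in> closure (span tensors)"
  shows "scale_op c t \<in> closure (span (tensors :: ('j, 'h) ell2 bop set))"
proof -
  have bl: "bounded_linear (scale_op c :: ('j, 'h) ell2 bop \<Rightarrow> _)" by (rule bounded_linear_scale_op)
  have "scale_op c x \<in> span (tensors :: ('j, 'h) ell2 bop set)" if "x \<in> span tensors" for x
    using that
  proof (induction rule: span_induct)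
    case base
    show ?case
      using linear_subspace_vimage [OF bounded_linear.linear [OF bl] subspace_span] by (simp add: vimage_def)
  next
    case (step x)
    then obtain a b where "x = op_tensor a b" "a \<in> B" "clin b" by (auto simp: tensors_def)
    then have "scale_op c x = op_tensor (scale_op c a) b" "scale_op c a \<in> B"
      using clin_B scale_B by (auto simp: op_tensor_scale_left)
    then show ?case using \<open>clin b\<close> by (intro span_base) (auto simp: tensors_def)
  qed
  then show ?thesis using closure_preserved [OF bl _ t] closure_subset by blast
qed

text \<open>\<open>\<Psi>\<close> factors through a concrete C*-algebra, where it extends to the
  spatial tensor product.  The exterior tensor product of the module is indexed by pairs, and
  \<open>flat\<close> and \<open>unflat\<close> translate between this and iterated
  \<open>l\<^sup>2\<close> spaces.\<close>

lemma tensor_id_exists: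
  obtains \<Theta> where
    "is_tensor_id (fock_ctx S X) hilbert_ctx (toeplitz_plus S X) (full_group_cstar G) \<Psi> \<Theta>"
    "\<And>T. T \<in> toeplitz_plus S X \<Longrightarrow> \<delta>\<^sub>\<Psi> (\<Psi> T) = \<Theta> (tw.twist T)"
proof -
  interpret rs: star_rep "rep ` toeplitz S X" "\<Psi> \<circ> ops.unrep"
    by (rule ops.star_rep_star_hom [OF cstar_subalgebra_toeplitz star_hom_Psi])
  let ?C = "closure (span (rs.tensors :: ('g univ_index, ('g, 'h) ell2) ell2 bop set))"
  obtain \<Theta>0 :: "('g univ_index, ('g, 'h) ell2) ell2 bop \<Rightarrow> ('g univ_index, 'k) ell2 bop" where
    \<Theta>0: "\<And>a b. a \<in> rep ` toeplitz S X \<Longrightarrow> clin b \<Longrightarrow> \<Theta>0 (op_tensor a b) = op_tensor ((\<Psi> \<circ> ops.unrep) a) b"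
    "\<And>t. t \<in> ?C \<Longrightarrow> norm (\<Theta>0 t) \<le> norm t" "\<And>t. t \<in> ?C \<Longrightarrow> clin (\<Theta>0 t)"
    "\<And>s t. s \<in> ?C \<Longrightarrow> t \<in> ?C \<Longrightarrow> \<Theta>0 (s + t) = \<Theta>0 s + \<Theta>0 t"
    "\<And>s t. s \<in> ?C \<Longrightarrow> t \<in> ?C \<Longrightarrow> \<Theta>0 (s o\<^sub>L t) = \<Theta>0 s o\<^sub>L \<Theta>0 t"
    "\<And>c t. t \<in> ?C \<Longrightarrow> \<Theta>0 (scale_op c t) = scale_op c (\<Theta>0 t)"
    by (rule rs.rep_tensor_identity_exists) (rule that, assumption+)
  define K where "K = closed_span ops2 elems"
  define cj :: "('g \<times> 'g univ_index, 'h) mod_op \<Rightarrow> ('g univ_index, ('g, 'h) ell2) ell2 bop"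
    where "cj t = unflat o\<^sub>L tw.amp.rep t o\<^sub>L flat" for t
  define \<Theta> where "\<Theta> t = \<Theta>0 (cj t)" for t
  note sp = ops2.linear_subspaceD [OF ops2.linear_subspace_closed_span [OF elems_subset], folded K_def]
  have Kc: "t \<in> carrier ops2" if "t \<in> K" for t using sp(1) that by blast
  have cuf: "unflat (z *\<^sub>C y) = z *\<^sub>C (unflat y :: ('g univ_index, ('g, 'h) ell2) ell2)" for z y
    using adjoint_pair_clin2 [OF adjoint_pair_flat] unfolding clin_def by blast
  have cj_add: "cj (s \<oplus>\<^bsub>ops2\<^esub> t) = cj s + cj t" and cj_mult: "cj (s \<otimes>\<^bsub>ops2\<^esub> t) = cj s o\<^sub>L cj t"
    and cj_smult: "cj (z \<odot>\<^bsub>ops2\<^esub> t) = scale_op z (cj t)"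
    if s: "s \<in> carrier ops2" and t: "t \<in> carrier ops2" for s t z
    by (rule blinfun_eqI, simp add: cj_def ops2.rep_add ops2.rep_mult ops2.rep_smult s t blf_simps scale_op_apply cuf)+
  have norm_cj: "norm (cj t) \<le> norm (tw.amp.rep t)" for t
  proof -
    have "norm (cj t) \<le> (1 * norm (tw.amp.rep t)) * 1"
      unfolding cj_def
      by (intro order_trans [OF norm_blinfun_compose] mult_mono norm_flat_le norm_unflat_le mult_nonneg_nonneg) auto
    then show ?thesis by simp
  qed
  have cj_elem: "cj (mod_op_tensor P X a b) = op_tensor (rep a) b" if "a \<in> carrier ops" "clin b" for a b
    by (rule blinfun_eqI) (simp add: cj_def tw.rep_mod_op_tensor that tw.op2_def)
  have cjK: "cj t \<in> ?C" if t: "t \<in> K" for t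
  proof (rule ops2.closed_span_maps_into [OF elems_subset _ _ t [unfolded K_def], where f = cj and V = ?C and K = 1, folded K_def])
    show "subspace ?C" by (rule subspace_closure_normed) simp
    show "closed ?C" by simp
    show "cj a \<in> ?C" if a: "a \<in> elems" for a
    proof -
      obtain a' b where ab: "a = mod_op_tensor P X a' b" "a' \<in> toeplitz_plus S X" "b \<in> full_group_cstar G"
        using a by blast
      then have "cj a = op_tensor (rep a') b" using cj_elem plus_carrier clin_full by simp
      then have "cj a \<in> rs.tensors" using ab plus_in_toeplitz clin_full unfolding rs.tensors_def by blast
      then show ?thesis by (rule in_closure_span)
    qed
    show "cj (a \<oplus>\<^bsub>ops2\<^esub> b) = cj a + cj b" if "a \<in> K" "b \<in> K" for a b using that Kc cj_add by blast
    show "cj (z \<odot>\<^bsub>ops2\<^esub> a) \<in> ?C" if "a \<in> K" "cj a \<in> ?C" for a z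
      using rs.scale_span_tensors [OF that(2)] cj_smult [OF Kc Kc, OF that(1) that(1)] by simp
    show "norm (cj a) \<le> 1 * norm (tw.amp.rep a)" for a using norm_cj by simp
  qed
  have \<Theta>_elem: "\<Theta> (mod_op_tensor P X a b) = op_tensor (\<Psi> a) b"
    if a: "a \<in> toeplitz_plus S X" and b: "b \<in> full_group_cstar G" for a b
    unfolding \<Theta>_def cj_elem [OF plus_carrier [OF a] clin_full [OF b]]
    using \<Theta>0(1) [OF _ clin_full [OF b], of "rep a"] plus_in_toeplitz [OF a] plus_carrier [OF a] by simp
  have \<Theta>_add: "\<Theta> (s \<oplus>\<^bsub>ops2\<^esub> t) = \<Theta> s + \<Theta> t" and \<Theta>_mult: "\<Theta> (s \<otimes>\<^bsub>ops2\<^esub> t) = \<Theta> s o\<^sub>L \<Theta> t"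
    and \<Theta>_smult: "\<Theta> (z \<odot>\<^bsub>ops2\<^esub> t) = scale_op z (\<Theta> t)" if "s \<in> K" "t \<in> K" for s t z
    unfolding \<Theta>_def cj_add [OF Kc [OF that(1)] Kc [OF that(2)]] cj_mult [OF Kc [OF that(1)] Kc [OF that(2)]]
      cj_smult [OF Kc [OF that(1)] Kc [OF that(2)]]
    by (rule \<Theta>0(4,5) [OF cjK [OF that(1)] cjK [OF that(2)]] \<Theta>0(6) [OF cjK [OF that(2)]])+
  have norm_\<Theta>: "norm (\<Theta> t) \<le> norm (tw.amp.rep t)" if "t \<in> K" for t
    unfolding \<Theta>_def using \<Theta>0(2) [OF cjK [OF that]] norm_cj [of t] by linarith
  show thesis
  proof (rule that)
    interpret R: represented_algebra "bounded_ops :: ('g univ_index, 'k) ell2 bop op_alg" "\<lambda>T. T"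
      by (rule represented_algebra_bounded_ops)
    have cl: "\<Theta> t \<in> carrier bounded_ops" if "t \<in> K" for t
      using \<Theta>0(3) [OF cjK [OF that]] by (simp add: \<Theta>_def bounded_ops_def clinear_ops_iff_clin)
    show "is_tensor_id (fock_ctx S X) hilbert_ctx (toeplitz_plus S X) (full_group_cstar G) \<Psi> \<Theta>"
      unfolding is_tensor_id_def spatial_tensor_eq fock_ctx_simps hilbert_ctx_simps K_def [symmetric] alg_hom_def
    proof (intro conjI exI [of _ 1] ballI allI image_subsetI)
      show "\<Theta> t \<in> carrier bounded_ops" if "t \<in> K" for t by (rule cl [OF that])
      show "\<Theta> (s \<oplus>\<^bsub>ops2\<^esub> t) = \<Theta> s \<oplus>\<^bsub>bounded_ops\<^esub> \<Theta> t" if "s \<in> K" "t \<in> K" for s t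
        using \<Theta>_add [OF that] by (simp add: bounded_ops_def)
      show "\<Theta> (s \<otimes>\<^bsub>ops2\<^esub> t) = \<Theta> s \<otimes>\<^bsub>bounded_ops\<^esub> \<Theta> t" if "s \<in> K" "t \<in> K" for s t
        using \<Theta>_mult [OF that] by (simp add: bounded_ops_def)
      show "\<Theta> (z \<odot>\<^bsub>ops2\<^esub> t) = z \<odot>\<^bsub>bounded_ops\<^esub> \<Theta> t" if "t \<in> K" for t z
        using \<Theta>_smult [OF that that] by (simp add: bounded_ops_def)
      show "mat_norm bounded_ops 1 (\<lambda>_ _. \<Theta> t) \<le> 1 * mat_norm ops2 1 (\<lambda>_ _. t)" if "t \<in> K" for t
        unfolding R.mat_norm_one [OF cl [OF that]] ops2.mat_norm_one [OF Kc [OF that]] using norm_\<Theta> [OF that] by simp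
      show "\<Theta> (mod_op_tensor P X a b) = op_tensor (\<Psi> a) b" if "a \<in> toeplitz_plus S X" "b \<in> full_group_cstar G" for a b
        by (rule \<Theta>_elem [OF that])
    qed
    fix T assume T: "T \<in> toeplitz_plus S X"
    have tK: "tw.twist a \<in> K" if "a \<in> toeplitz_plus S X" for a
      unfolding K_def by (rule twist_in_spatial_tensor [OF that])
    have hom: "tw.twist (a \<oplus>\<^bsub>ops\<^esub> b) = tw.twist a \<oplus>\<^bsub>ops2\<^esub> tw.twist b" "tw.twist (z \<odot>\<^bsub>ops\<^esub> a) = z \<odot>\<^bsub>ops2\<^esub> tw.twist a"
      if "a \<in> toeplitz_plus S X" "b \<in> toeplitz_plus S X" for a b z
      using alg_hom_twist that unfolding alg_hom_def by blast+
    have "D T - \<Theta> (tw.twist T) \<in> {0}"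
    proof (rule toeplitz_plus_maps_into [OF T, where K = 2 and f = "\<lambda>T. D T - \<Theta> (tw.twist T)"])
      show "D (creation S X p \<xi>) - \<Theta> (tw.twist (creation S X p \<xi>)) \<in> {0}" if p: "p \<in> P" "\<xi> \<in> X p" for p \<xi>
        using \<Theta>_elem [OF creation_in_toeplitz_plus [OF p] univ_unitary_in_full [OF in_carrier [OF p(1)]]]
        by (simp add: twist_creation [OF p] D_creation [OF p])
      fix a assume a: "a \<in> toeplitz_plus S X"
      note aT = plus_in_toeplitz [OF a] and ac = plus_carrier [OF a]
      show "norm (D a - \<Theta> (tw.twist a)) \<le> 2 * norm (rep a)"
        using norm_triangle_ineq4 [of "D a" "\<Theta> (tw.twist a)"] norm_D_le [OF aT] norm_\<Theta> [OF tK [OF a]]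
          rep_twist_ops(4) [OF ac ac] by linarith
      show "D (z \<odot>\<^bsub>ops\<^esub> a) - \<Theta> (tw.twist (z \<odot>\<^bsub>ops\<^esub> a)) \<in> {0}" if "D a - \<Theta> (tw.twist a) \<in> {0}" for z
        using that by (simp add: D_smult [OF aT aT] hom(2) [OF a a] \<Theta>_smult [OF tK [OF a] tK [OF a]])
      fix b assume b: "b \<in> toeplitz_plus S X"
      show "D (a \<oplus>\<^bsub>ops\<^esub> b) - \<Theta> (tw.twist (a \<oplus>\<^bsub>ops\<^esub> b)) = D a - \<Theta> (tw.twist a) + (D b - \<Theta> (tw.twist b))"
        by (simp add: D_add [OF aT plus_in_toeplitz [OF b]] hom(1) [OF a b] \<Theta>_add [OF tK [OF a] tK [OF b]])
    qed (auto simp: subspace_def)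
    then show "\<delta>\<^sub>\<Psi> (\<Psi> T) = \<Theta> (tw.twist T)" by (simp add: D_def)
  qed
qed

lemma cstar_cover_Psi:
  "cstar_cover G (fock_ctx S X) (toeplitz_plus S X) tw.twist hilbert_ctx (\<Psi> ` toeplitz S X) \<Psi> \<delta>\<^sub>\<Psi>"
proof -
  obtain \<Theta> where "is_tensor_id (fock_ctx S X) hilbert_ctx (toeplitz_plus S X) (full_group_cstar G) \<Psi> \<Theta>"
    "\<And>T. T \<in> toeplitz_plus S X \<Longrightarrow> \<delta>\<^sub>\<Psi> (\<Psi> T) = \<Theta> (tw.twist T)"
    by (rule tensor_id_exists) (rule that, assumption+)
  then have "\<exists>\<Theta>. is_tensor_id (fock_ctx S X) hilbert_ctx (toeplitz_plus S X) (full_group_cstar G) \<Psi> \<Theta> \<and>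
      (\<forall>a\<in>toeplitz_plus S X. \<delta>\<^sub>\<Psi> (\<Psi> a) = \<Theta> (tw.twist a))" by blast
  then show ?thesis
    using cosystem_twist alg_hom_Psi completely_isometric(2) cstar_gen_image cosystem_Psi
    unfolding cstar_cover_def fock_ctx_simps hilbert_ctx_simps by simp
qed

end

theorem proposition5p16:
  fixes G :: "('g, 'z) monoid_scheme" and P :: "'g set" and S :: "('g, 'z) monoid_scheme"
    and X :: "'g \<Rightarrow> 'h::complex_hilbert bop set"
    and \<Psi> :: "('g, 'h) mod_op \<Rightarrow> 'k::complex_hilbert bop"
    and \<delta>\<^sub>\<Psi> :: "'k bop \<Rightarrow> ('g univ_index, 'k) ell2 bop"
  assumes "group G" and "submonoid P G" and "S = G\<lparr>carrier := P\<rparr>"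
    and "product_system S X"
    and "star_hom (fock_ops S X) bounded_ops (toeplitz S X) \<Psi>"
    and "inj_on \<Psi> (creation S X \<one>\<^bsub>G\<^esub> ` X \<one>\<^bsub>G\<^esub>)"
    and "equivariant G S X \<Psi> \<delta>\<^sub>\<Psi>"
  shows
    "(\<exists>\<Phi>. alg_hom (fock_ops S X) bounded_ops (toeplitz_plus S X) \<Phi> \<and>
        \<Phi> ` toeplitz_plus S X \<subseteq> spatial_tensor hilbert_ctx (\<Psi> ` toeplitz S X) (semigroup_cstar S) \<and>
        completely_isometric (fock_ops S X) bounded_ops (toeplitz_plus S X) \<Phi> \<and>
        (\<forall>p\<in>P. \<forall>\<xi>\<in>X p.
          \<Phi> (creation S X p \<xi>) = op_tensor (\<Psi> (creation S X p \<xi>)) (semigroup_isometry S p))) \<and>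
     (\<exists>\<delta>. (\<forall>p\<in>P. \<forall>\<xi>\<in>X p. \<delta> (creation S X p \<xi>) =
            elem (fock_ctx S X) (creation S X p \<xi>) (univ_unitary G p)) \<and>
        cstar_cover G (fock_ctx S X) (toeplitz_plus S X) \<delta>
          hilbert_ctx (\<Psi> ` toeplitz S X) \<Psi> \<delta>\<^sub>\<Psi>)"
proof -
  interpret group G by (rule assms(1))
  have fs: "fock_system G P X"
    by (intro fock_system.intro subsemigroup.intro subsemigroup_axioms.intro fock_system_axioms.intro assms(1,2))
      (use assms(3,4) in simp)
  interpret F: fock_system G P X by (rule fs)
  interpret E: equivariant_representation G P X \<Psi> \<delta>\<^sub>\<Psi>
    by (intro equivariant_representation.intro fock_representation.intro fock_representation_axioms.intro
        equivariant_representation_axioms.intro fs)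
      (use assms(3,5-7) in \<open>simp_all add: F.fock_ops_eq\<close>)
  show ?thesis
    unfolding assms(3) F.fock_ops_eq
  proof (intro conjI exI [of _ E.Phi] exI [of _ E.tw.twist] ballI)
    show "E.Phi (creation F.S X p \<xi>) = op_tensor (\<Psi> (creation F.S X p \<xi>)) (semigroup_isometry F.S p)"
      if "p \<in> P" "\<xi> \<in> X p" for p \<xi>
      by (rule E.Phi_value [OF that])
    show "E.tw.twist (creation F.S X p \<xi>) = elem (fock_ctx F.S X) (creation F.S X p \<xi>) (univ_unitary G p)"
      if "p \<in> P" "\<xi> \<in> X p" for p \<xi>
      unfolding E.fock_ctx_simps by (rule E.twist_creation [OF that])
  qed (rule E.alg_hom_Phi E.Phi_range E.completely_isometric(1) E.cstar_cover_Psi)+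
qed

end
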